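(* Let $\Bbbk$ be a unital commutative ring, and let $\mathsf{X}$ be an $\mathsf{E}$-bicomodule that is weakly projective, i.e. such that for each $j\ge 0$ the $\Bbbk S_j$-module $\mathsf{X}[j]$ is projective. Then the Koszul complex $K^*(\mathsf{X})=\operatorname{Hom}(\mathsf{X},\mathsf{E}^!)$ (morphisms of species), with differential $$d(\varphi)=[\tau,\varphi]=\tau\frown\varphi-(-1)^{|\varphi|}\varphi\frown\tau ,$$ is a cochain complex computing the cohomology groups of $\mathsf{X}$: for every $p\ge 0$ there is an isomorphism $H^p(K^*(\mathsf{X}))\cong H^p(\mathsf{X},\mathsf{E})$. Moreover, for each $p\in\mathbb{N}_0$, $$K^p(\mathsf{X})=\operatorname{Hom}_{S_p}(\mathsf{X}[p],\operatorname{sgn}_p),$$ where $\operatorname{sgn}_p$ is the sign representation of $\Bbbk S_p$.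
   Context: A (linear) species is a functor from finite sets and bijections to $\Bbbk$-modules; $\mathsf{X}[n]$ denotes its value on $[n]=\{1,\ldots,n\}$, an $S_n$-module. The Cauchy product is $(\mathsf{X}\cdot\mathsf{Y})[I]=\bigoplus_{(S,T)}\mathsf{X}[S]\otimes\mathsf{Y}[T]$ over decompositions $(S,T)$ of $I$ (ordered tuples of disjoint, possibly empty, subsets with union $I$). The exponential species $\mathsf{E}$, $\mathsf{E}[I]=\Bbbk e_I$, is a coalgebra with coproduct $e_I\mapsto e_S\otimes e_T$. An $\mathsf{E}$-bicomodule is a species $\mathsf{X}$ with coactions $\lambda:\mathsf{X}\to\mathsf{E}\cdot\mathsf{X}$, $\rho:\mathsf{X}\to\mathsf{X}\cdot\mathsf{E}$, counital, coassociative and compatible. Write $\lambda(z)=\sum_{(S,T)}e_S\otimes z/\!/T$ and $\rho(z)=\sum_{(S,T)}z\backslash\!\backslash S\otimes e_T$ for $z\in\mathsf{X}[I]$. Cohomology: $C^n(\mathsf{X})=\operatorname{Hom}(\mathsf{X},\mathsf{E}^{\cdot n})$ (with $\mathsf{E}^{\cdot 0}$ the unit species). A cochain $\alpha$ is given by its coefficients $\alpha(F_1,\ldots,F_n)(z)\in\Bbbk$, for $(F_1,\ldots,F_n)$ a decomposition of $I$ and $z\in\mathsf{X}[I]$. The differential is $\delta=\sum_{i=0}^{n+1}(-1)^id^i$ with $(d^0\alpha)(F_0,\ldots,F_n)(z)=\alpha(F_1,\ldots,F_n)(z/\!/F_0^c)$; $(d^i\alpha)(F_0,\ldots,F_n)(z)=\alpha(F_0,\ldots,F_{i-1}\cup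 F_i,\ldots,F_n)(z)$ for $0<i<n+1$; $(d^{n+1}\alpha)(F_0,\ldots,F_n)(z)=\alpha(F_0,\ldots,F_{n-1})(z\backslash\!\backslash F_n^c)$. Here $F^c$ is the complement in $I$. $H^*(\mathsf{X},\mathsf{E})$ is the cohomology of this complex. The algebra $\mathsf{E}^!$ is the Koszul dual of $\mathsf{E}$: $\mathsf{E}^!=H^0(\Omega(\mathsf{E}))$, where $\Omega(\mathsf{E})[I]$ is free on compositions of $I$ (ordered tuples of disjoint nonempty sets with union $I$), with concatenation product and differential $d(F_1,\ldots,F_q)=\sum_i(-1)^i\sum_{(A,B)}(F_1,\ldots,A,B,\ldots,F_q)$, $(A,B)$ running over ordered pairs of disjoint nonempty sets with union $F_i$, a composition with $q$ blocks being in degree $q-|I|$. Thus $\mathsf{E}^![I]$ is the quotient of the free module on linear orders of $I$ by the relations $\ell+\ell'=0$ whenever $\ell'$ is obtained from $\ell$ by swapping two adjacent elements, with product $\mu$ induced by concatenation. $K^p(\mathsf{X})$ consists of the morphisms $\mathsf{X}\to\mathsf{E}^!$ that vanish on $\mathsf{X}[I]$ for $|I|\ne p$, and $|\varphi|=p$ for such $\varphi$. The map $\tau:\mathsf{E}\to\mathsf{E}^!$ sends $e_{\{i\}}$ to the class of the unique order on $\{i\}$ and is zero on $\mathsf{E}[I]$ with $|I|\neq1$. Finally $\tau\frown\varphi=\mu\circ(\tau\otimes\varphi)\circ\lambda$ and $\varphi\frown\tau=\mu\circ(\varphi\otimes\tau)\circ\rho$, without additional signs; that is, $\tau\frown\varphi$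 sends $z\in\mathsf X[I]$ to $\sum_{i\in I}\tau(e_{\{i\}})\,\varphi(z/\!/(I\setminus i))$. *)

theory Defs
  imports "HOL-Algebra.Module" "HOL-Algebra.AbelCoset" "HOL-Combinatorics.Permutations"
begin

section \<open>Modules\<close>

text \<open>The ring fields \<open>mult\<close> and \<open>one\<close> of a \<open>module\<close> record carry no meaning for a module and are
  left unspecified. Linear maps are extensional, so that two linear maps are equal iff they agree on
  the carrier.\<close>

definition lin_hom ::
  "('k, 'r) ring_scheme \<Rightarrow> ('k, 'a) module \<Rightarrow> ('k, 'b) module \<Rightarrow> ('a \<Rightarrow> 'b) set" where
  "lin_hom R M N = {f \<in> carrier M \<rightarrow>\<^sub>E carrier N.
     (\<forall>x\<in>carrier M. \<forall>y\<in>carrier M. f (x \<oplus>\<^bsub>M\<^esub> y) = f x \<oplus>\<^bsub>N\<^esub> f y) \<and>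
     (\<forall>c\<in>carrier R. \<forall>x\<in>carrier M. f (c \<odot>\<^bsub>M\<^esub> x) = c \<odot>\<^bsub>N\<^esub> f x)}"

definition lin_iso ::
  "('k, 'r) ring_scheme \<Rightarrow> ('k, 'a) module \<Rightarrow> ('k, 'b) module \<Rightarrow> ('a \<Rightarrow> 'b) set" where
  "lin_iso R M N = {f \<in> lin_hom R M N. bij_betw f (carrier M) (carrier N)}"

definition hom_module ::
  "('k, 'r) ring_scheme \<Rightarrow> ('k, 'a) module \<Rightarrow> ('k, 'b) module \<Rightarrow> ('k, 'a \<Rightarrow> 'b) module" where
  "hom_module R M N = \<lparr>carrier = lin_hom R M N, monoid.mult = undefined, monoid.one = undefined,
     ring.zero = (\<lambda>x\<in>carrier M. \<zero>\<^bsub>N\<^esub>),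
     ring.add = (\<lambda>f g. \<lambda>x\<in>carrier M. f x \<oplus>\<^bsub>N\<^esub> g x),
     module.smult = (\<lambda>c f. \<lambda>x\<in>carrier M. c \<odot>\<^bsub>N\<^esub> f x)\<rparr>"

definition regular_module :: "('k, 'r) ring_scheme \<Rightarrow> ('k, 'k) module" where
  "regular_module R = \<lparr>carrier = carrier R, monoid.mult = undefined, monoid.one = undefined,
     ring.zero = \<zero>\<^bsub>R\<^esub>,
     ring.add = (\<lambda>x y. x \<oplus>\<^bsub>R\<^esub> y),
     module.smult = (\<lambda>c x. c \<otimes>\<^bsub>R\<^esub> x)\<rparr>"

definition free_module :: "('k, 'r) ring_scheme \<Rightarrow> 'b set \<Rightarrow> ('k, 'b \<Rightarrow> 'k) module" where
  "free_module R B = \<lparr>carrier = {f. range f \<subseteq> carrier R \<and> finite {b. f b \<noteq> \<zero>\<^bsub>R\<^esub>} \<and>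
       {b. f b \<noteq> \<zero>\<^bsub>R\<^esub>} \<subseteq> B},
     monoid.mult = undefined, monoid.one = undefined,
     ring.zero = (\<lambda>b. \<zero>\<^bsub>R\<^esub>),
     ring.add = (\<lambda>f g b. f b \<oplus>\<^bsub>R\<^esub> g b),
     module.smult = (\<lambda>c f b. c \<otimes>\<^bsub>R\<^esub> f b)\<rparr>"

definition basis_vec :: "('k, 'r) ring_scheme \<Rightarrow> 'b \<Rightarrow> 'b \<Rightarrow> 'k" where
  "basis_vec R b = (\<lambda>c. if c = b then \<one>\<^bsub>R\<^esub> else \<zero>\<^bsub>R\<^esub>)"

text \<open>Linear extension, for a finite set \<open>B\<close>, of \<open>u\<close> from the basis \<open>B\<close> to the free module on \<open>B\<close>.\<close>

definition lin_ext :: "('k, 'a) module \<Rightarrow> 'b set \<Rightarrow> ('b \<Rightarrow> 'a) \<Rightarrow> ('b \<Rightarrow> 'k) \<Rightarrow> 'a" where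
  "lin_ext M B u f = (\<Oplus>\<^bsub>M\<^esub> b\<in>B. f b \<odot>\<^bsub>M\<^esub> u b)"

definition quot_module :: "('k, 'a) module \<Rightarrow> 'a set \<Rightarrow> ('k, 'a set) module" where
  "quot_module M N = \<lparr>carrier = a_rcosets\<^bsub>M\<^esub> N, monoid.mult = undefined, monoid.one = undefined,
     ring.zero = N,
     ring.add = (\<lambda>Y Z. Y <+>\<^bsub>M\<^esub> Z),
     module.smult = (\<lambda>c Y. \<Union>y\<in>Y. N +>\<^bsub>M\<^esub> (c \<odot>\<^bsub>M\<^esub> y))\<rparr>"

definition subquotient :: "('k, 'a) module \<Rightarrow> 'a set \<Rightarrow> 'a set \<Rightarrow> ('k, 'a set) module" where
  "subquotient M Z B = quot_module (M\<lparr>carrier := Z\<rparr>) B"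


section \<open>Cochain complexes\<close>

definition cochain_complex ::
  "('k, 'r) ring_scheme \<Rightarrow> (nat \<Rightarrow> ('k, 'a) module) \<Rightarrow> (nat \<Rightarrow> 'a \<Rightarrow> 'a) \<Rightarrow> bool" where
  "cochain_complex R C d \<longleftrightarrow>
     (\<forall>n. module R (C n)) \<and>
     (\<forall>n. d n \<in> lin_hom R (C n) (C (Suc n))) \<and>
     (\<forall>n. \<forall>x\<in>carrier (C n). d (Suc n) (d n x) = \<zero>\<^bsub>C (Suc (Suc n))\<^esub>)"

definition coboundaries ::
  "(nat \<Rightarrow> ('k, 'a) module) \<Rightarrow> (nat \<Rightarrow> 'a \<Rightarrow> 'a) \<Rightarrow> nat \<Rightarrow> 'a set" where
  "coboundaries C d n = (case n of 0 \<Rightarrow> {\<zero>\<^bsub>C 0\<^esub>} | Suc m \<Rightarrow> d m ` carrier (C m))"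

definition cohomology ::
  "(nat \<Rightarrow> ('k, 'a) module) \<Rightarrow> (nat \<Rightarrow> 'a \<Rightarrow> 'a) \<Rightarrow> nat \<Rightarrow> ('k, 'a set) module" where
  "cohomology C d n =
     subquotient (C n) {x \<in> carrier (C n). d n x = \<zero>\<^bsub>C (Suc n)\<^esub>} (coboundaries C d n)"


section \<open>Representations of the symmetric groups\<close>

text \<open>A module over the group ring of \<open>S\<^sub>j\<close> is given by a module \<open>M\<close> over the ground ring together
  with the action of the permutations of \<open>{1..j}\<close> on \<open>M\<close>; its homomorphisms are the equivariant linear
  maps.\<close>

definition rep_hom ::
  "('k, 'r) ring_scheme \<Rightarrow> nat \<Rightarrow> ('k, 'a) module \<Rightarrow> ((nat \<Rightarrow> nat) \<Rightarrow> 'a \<Rightarrow> 'a) \<Rightarrow>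
     ('k, 'b) module \<Rightarrow> ((nat \<Rightarrow> nat) \<Rightarrow> 'b \<Rightarrow> 'b) \<Rightarrow> ('k, 'a \<Rightarrow> 'b) module" where
  "rep_hom R j M a N b = (hom_module R M N)
     \<lparr>carrier := {f \<in> lin_hom R M N.
        \<forall>\<sigma>. \<sigma> permutes {1..j} \<longrightarrow> (\<forall>x\<in>carrier M. f (a \<sigma> x) = b \<sigma> (f x))}\<rparr>"

text \<open>The free module over the group ring of \<open>S\<^sub>j\<close> on the set \<open>B\<close>: it has the basis
  \<open>S\<^sub>j \<times> B\<close> over the ground ring, and \<open>\<sigma>\<close> maps \<open>(\<pi>, b)\<close> to \<open>(\<sigma> \<circ> \<pi>, b)\<close>.\<close>

definition free_rep ::
  "('k, 'r) ring_scheme \<Rightarrow> nat \<Rightarrow> 'b set \<Rightarrow> ('k, (nat \<Rightarrow> nat) \<times> 'b \<Rightarrow> 'k) module" where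
  "free_rep R j B = free_module R ({\<pi>. \<pi> permutes {1..j}} \<times> B)"

definition free_rep_act ::
  "(nat \<Rightarrow> nat) \<Rightarrow> ((nat \<Rightarrow> nat) \<times> 'b \<Rightarrow> 'k) \<Rightarrow> (nat \<Rightarrow> nat) \<times> 'b \<Rightarrow> 'k" where
  "free_rep_act \<sigma> f = (\<lambda>(\<pi>, b). f (inv_into UNIV \<sigma> \<circ> \<pi>, b))"

text \<open>Projective means: direct summand of a free module. Restricting the basis to a subset of the
  type of the elements of \<open>M\<close> loses nothing, since a projective \<open>M\<close> is a direct summand of the free
  module on its own underlying set.\<close>

definition projective_rep ::
  "('k, 'r) ring_scheme \<Rightarrow> nat \<Rightarrow> ('k, 'a) module \<Rightarrow> ((nat \<Rightarrow> nat) \<Rightarrow> 'a \<Rightarrow> 'a) \<Rightarrow> bool" where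
  "projective_rep R j M a \<longleftrightarrow> (\<exists>B :: 'a set.
     \<exists>\<iota>\<in>carrier (rep_hom R j M a (free_rep R j B) free_rep_act).
     \<exists>\<pi>\<in>carrier (rep_hom R j (free_rep R j B) free_rep_act M a).
       \<forall>x\<in>carrier M. \<pi> (\<iota> x) = x)"

definition sgn_act :: "('k, 'r) ring_scheme \<Rightarrow> (nat \<Rightarrow> nat) \<Rightarrow> 'k \<Rightarrow> 'k" where
  "sgn_act R \<sigma> c = [sign \<sigma>] \<cdot>\<^bsub>R\<^esub> c"


section \<open>Species\<close>

text \<open>Finite sets are modelled by the finite sets of natural numbers; they form a category with
  bijections that is equivalent to the one of all finite sets. The bijection \<open>I \<rightarrow> J\<close> given by a
  function \<open>\<sigma>\<close> injective on \<open>I\<close> has \<open>J = \<sigma> ` I\<close>, and \<open>sp_map X I \<sigma>\<close> is its image under the functor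
  \<open>X\<close>; it depends only on the restriction of \<open>\<sigma>\<close> to \<open>I\<close>.\<close>

record ('k, 'm) species =
  sp_val :: "nat set \<Rightarrow> ('k, 'm) module"
  sp_map :: "nat set \<Rightarrow> (nat \<Rightarrow> nat) \<Rightarrow> 'm \<Rightarrow> 'm"

locale species = R?: cring R
  for R :: "('k, 'r) ring_scheme" (structure) and X :: "('k, 'm) species" +
  assumes val_module: "finite I \<Longrightarrow> module R (sp_val X I)"
    and map_hom: "\<lbrakk>finite I; inj_on \<sigma> I\<rbrakk> \<Longrightarrow> sp_map X I \<sigma> \<in> lin_hom R (sp_val X I) (sp_val X (\<sigma> ` I))"
    and map_cong: "\<lbrakk>finite I; inj_on \<sigma> I; \<And>i. i \<in> I \<Longrightarrow> \<sigma> i = \<sigma>' i\<rbrakk> \<Longrightarrow> sp_map X I \<sigma> = sp_map X I \<sigma>'"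
    and map_id: "\<lbrakk>finite I; z \<in> carrier (sp_val X I)\<rbrakk> \<Longrightarrow> sp_map X I id z = z"
    and map_comp: "\<lbrakk>finite I; inj_on \<sigma> I; inj_on \<pi> (\<sigma> ` I); z \<in> carrier (sp_val X I)\<rbrakk> \<Longrightarrow>
      sp_map X I (\<pi> \<circ> \<sigma>) z = sp_map X (\<sigma> ` I) \<pi> (sp_map X I \<sigma> z)"

definition species_hom ::
  "('k, 'r) ring_scheme \<Rightarrow> ('k, 'm) species \<Rightarrow> ('k, 'n) species \<Rightarrow>
     ('k, nat set \<Rightarrow> 'm \<Rightarrow> 'n) module" where
  "species_hom R X Y = \<lparr>carrier = {f \<in> (\<Pi>\<^sub>E I\<in>{I. finite I}. lin_hom R (sp_val X I) (sp_val Y I)).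
       \<forall>I \<sigma>. finite I \<and> inj_on \<sigma> I \<longrightarrow>
         (\<forall>z\<in>carrier (sp_val X I). f (\<sigma> ` I) (sp_map X I \<sigma> z) = sp_map Y I \<sigma> (f I z))},
     monoid.mult = undefined, monoid.one = undefined,
     ring.zero = (\<lambda>I\<in>{I. finite I}. \<zero>\<^bsub>hom_module R (sp_val X I) (sp_val Y I)\<^esub>),
     ring.add = (\<lambda>f g. \<lambda>I\<in>{I. finite I}. f I \<oplus>\<^bsub>hom_module R (sp_val X I) (sp_val Y I)\<^esub> g I),
     module.smult = (\<lambda>c f. \<lambda>I\<in>{I. finite I}. c \<odot>\<^bsub>hom_module R (sp_val X I) (sp_val Y I)\<^esub> f I)\<rparr>"

definition weakly_projective :: "('k, 'r) ring_scheme \<Rightarrow> ('k, 'm) species \<Rightarrow> bool" where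
  "weakly_projective R X \<longleftrightarrow> (\<forall>j. projective_rep R j (sp_val X {1..j}) (sp_map X {1..j}))"


section \<open>The exponential species and its bicomodules\<close>

definition exp_species :: "('k, 'r) ring_scheme \<Rightarrow> ('k, nat set \<Rightarrow> 'k) species" where
  "exp_species R = \<lparr>sp_val = (\<lambda>I. free_module R {I}),
     sp_map = (\<lambda>I \<sigma>. \<lambda>f\<in>carrier (free_module R {I}).
       lin_ext (free_module R {\<sigma> ` I}) {I} (\<lambda>_. basis_vec R (\<sigma> ` I)) f)\<rparr>"

definition decomps2 :: "nat set \<Rightarrow> (nat set \<times> nat set) set" where
  "decomps2 I = {(S, T). S \<union> T = I \<and> S \<inter> T = {}}"

text \<open>The Cauchy products of \<open>X\<close> with the exponential species on the left and on the right. As \<open>E[S]\<close>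
  is free on \<open>e\<^sub>S\<close>, every element of \<open>E[S] \<otimes> X[T]\<close> is \<open>e\<^sub>S \<otimes> x\<close> for a unique \<open>x\<close>, and it
  is represented by this \<open>x\<close>; hence the summand of \<open>(E \<cdot> X)[I]\<close> at \<open>(S, T)\<close> is \<open>X[T]\<close>, and likewise that
  of \<open>(X \<cdot> E)[I]\<close> is \<open>X[S]\<close>. The argument \<open>s\<close> (\<open>snd\<close> or \<open>fst\<close>) selects the factor taken by \<open>X\<close>.\<close>

definition cauchy_exp ::
  "(nat set \<times> nat set \<Rightarrow> nat set) \<Rightarrow> ('k, 'm) species \<Rightarrow>
     ('k, nat set \<times> nat set \<Rightarrow> 'm) species" where
  "cauchy_exp s X =
     (let V = (\<lambda>I. \<lparr>carrier = (\<Pi>\<^sub>E D\<in>decomps2 I. carrier (sp_val X (s D))),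
           monoid.mult = undefined, monoid.one = undefined,
           ring.zero = (\<lambda>D\<in>decomps2 I. \<zero>\<^bsub>sp_val X (s D)\<^esub>),
           ring.add = (\<lambda>f g. \<lambda>D\<in>decomps2 I. f D \<oplus>\<^bsub>sp_val X (s D)\<^esub> g D),
           module.smult = (\<lambda>c f. \<lambda>D\<in>decomps2 I. c \<odot>\<^bsub>sp_val X (s D)\<^esub> f D)\<rparr>)
      in \<lparr>sp_val = V,
          sp_map = (\<lambda>I \<sigma>. \<lambda>f\<in>carrier (V I). \<lambda>(S', T')\<in>decomps2 (\<sigma> ` I).
            let D = ({i\<in>I. \<sigma> i \<in> S'}, {i\<in>I. \<sigma> i \<in> T'})
            in sp_map X (s D) \<sigma> (f D))\<rparr>)"

abbreviation exp_cauchy_left :: "('k, 'm) species \<Rightarrow> ('k, nat set \<times> nat set \<Rightarrow> 'm) species" where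
  "exp_cauchy_left X \<equiv> cauchy_exp snd X"

abbreviation exp_cauchy_right :: "('k, 'm) species \<Rightarrow> ('k, nat set \<times> nat set \<Rightarrow> 'm) species" where
  "exp_cauchy_right X \<equiv> cauchy_exp fst X"

text \<open>For \<open>z \<in> X[I]\<close> and \<open>T \<subseteq> I\<close>, these are \<open>z // T\<close> and, for \<open>S \<subseteq> I\<close>, the right-hand analogue
  (\<open>z\<close> double backslash \<open>S\<close>).\<close>

definition lquot ::
  "(nat set \<Rightarrow> 'm \<Rightarrow> nat set \<times> nat set \<Rightarrow> 'm) \<Rightarrow> nat set \<Rightarrow> 'm \<Rightarrow> nat set \<Rightarrow> 'm" where
  "lquot lam I z T = lam I z (I - T, T)"

definition rquot ::
  "(nat set \<Rightarrow> 'm \<Rightarrow> nat set \<times> nat set \<Rightarrow> 'm) \<Rightarrow> nat set \<Rightarrow> 'm \<Rightarrow> nat set \<Rightarrow> 'm" where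
  "rquot rho I z S = rho I z (S, I - S)"

text \<open>The coproduct of the exponential species sends \<open>e\<^sub>I\<close> to \<open>e\<^sub>S \<otimes> e\<^sub>T\<close>, and the counit sends the
  generator at the empty set to \<open>1\<close> and vanishes elsewhere. The component at
  \<open>(S, T, U)\<close> of \<open>(\<Delta> \<otimes> id) \<circ> \<lambda>\<close> at \<open>z\<close> is thus \<open>e\<^sub>S \<otimes> e\<^sub>T \<otimes> z // U\<close>, and
  that of \<open>(id \<otimes> \<lambda>) \<circ> \<lambda>\<close> is \<open>e\<^sub>S \<otimes> e\<^sub>T \<otimes> (z // (T \<union> U)) // U\<close>; similarly on the right, and for
  \<open>(\<lambda> \<otimes> id) \<circ> \<rho> = (id \<otimes> \<rho>) \<circ> \<lambda>\<close>.\<close>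

locale exp_bicomodule = species R X
  for R :: "('k, 'r) ring_scheme" (structure) and X :: "('k, 'm) species" +
  fixes lam rho :: "nat set \<Rightarrow> 'm \<Rightarrow> nat set \<times> nat set \<Rightarrow> 'm"
  assumes lam_hom: "lam \<in> carrier (species_hom R X (exp_cauchy_left X))"
    and rho_hom: "rho \<in> carrier (species_hom R X (exp_cauchy_right X))"
    and lam_counit: "\<lbrakk>finite I; z \<in> carrier (sp_val X I)\<rbrakk> \<Longrightarrow> lquot lam I z I = z"
    and rho_counit: "\<lbrakk>finite I; z \<in> carrier (sp_val X I)\<rbrakk> \<Longrightarrow> rquot rho I z I = z"
    and lam_coassoc: "\<lbrakk>finite I; z \<in> carrier (sp_val X I); S \<union> T \<union> U = I;
        S \<inter> T = {}; S \<inter> U = {}; T \<inter> U = {}\<rbrakk> \<Longrightarrow>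
      lquot lam I z U = lquot lam (T \<union> U) (lquot lam I z (T \<union> U)) U"
    and rho_coassoc: "\<lbrakk>finite I; z \<in> carrier (sp_val X I); S \<union> T \<union> U = I;
        S \<inter> T = {}; S \<inter> U = {}; T \<inter> U = {}\<rbrakk> \<Longrightarrow>
      rquot rho I z S = rquot rho (S \<union> T) (rquot rho I z (S \<union> T)) S"
    and compatible: "\<lbrakk>finite I; z \<in> carrier (sp_val X I); S \<union> T \<union> U = I;
        S \<inter> T = {}; S \<inter> U = {}; T \<inter> U = {}\<rbrakk> \<Longrightarrow>
      lquot lam (S \<union> T) (rquot rho I z (S \<union> T)) T = rquot rho (T \<union> U) (lquot lam I z (T \<union> U)) T"


section \<open>The complex computing the cohomology of a bicomodule\<close>

definition pairwise_disjoint :: "nat set list \<Rightarrow> bool" where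
  "pairwise_disjoint F \<longleftrightarrow> (\<forall>i j. i < j \<and> j < length F \<longrightarrow> F ! i \<inter> F ! j = {})"

definition decomps :: "nat \<Rightarrow> nat set \<Rightarrow> nat set list set" where
  "decomps n I = {F. length F = n \<and> pairwise_disjoint F \<and> \<Union> (set F) = I}"

text \<open>The \<open>n\<close>-th Cauchy power of the exponential species: the summand at a decomposition
  \<open>(F\<^sub>1, \<dots>, F\<^sub>n)\<close> is free on \<open>e\<^bsub>F\<^sub>1\<^esub> \<otimes> \<dots> \<otimes> e\<^bsub>F\<^sub>n\<^esub>\<close>, which is identified with the decomposition.
  For \<open>n = 0\<close> this is the unit species.\<close>

definition exp_power :: "('k, 'r) ring_scheme \<Rightarrow> nat \<Rightarrow> ('k, nat set list \<Rightarrow> 'k) species" where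
  "exp_power R n = \<lparr>sp_val = (\<lambda>I. free_module R (decomps n I)),
     sp_map = (\<lambda>I \<sigma>. \<lambda>f\<in>carrier (free_module R (decomps n I)).
       lin_ext (free_module R (decomps n (\<sigma> ` I))) (decomps n I)
         (\<lambda>F. basis_vec R (map (image \<sigma>) F)) f)\<rparr>"

definition cochains ::
  "('k, 'r) ring_scheme \<Rightarrow> ('k, 'm) species \<Rightarrow> nat \<Rightarrow>
     ('k, nat set \<Rightarrow> 'm \<Rightarrow> nat set list \<Rightarrow> 'k) module" where
  "cochains R X n = species_hom R X (exp_power R n)"

definition coeff ::
  "(nat set \<Rightarrow> 'm \<Rightarrow> nat set list \<Rightarrow> 'k) \<Rightarrow> nat set list \<Rightarrow> 'm \<Rightarrow> 'k" where
  "coeff \<alpha> F z = \<alpha> (\<Union> (set F)) z F"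

text \<open>The coefficient \<open>(d\<^sup>i \<alpha>)(F\<^sub>0, \<dots>, F\<^sub>n)(z)\<close>, where \<open>F\<close> has length \<open>n + 1\<close>.\<close>

definition coface ::
  "(nat set \<Rightarrow> 'm \<Rightarrow> nat set \<times> nat set \<Rightarrow> 'm) \<Rightarrow> (nat set \<Rightarrow> 'm \<Rightarrow> nat set \<times> nat set \<Rightarrow> 'm) \<Rightarrow>
     nat \<Rightarrow> (nat set \<Rightarrow> 'm \<Rightarrow> nat set list \<Rightarrow> 'k) \<Rightarrow> nat set list \<Rightarrow> 'm \<Rightarrow> 'k" where
  "coface lam rho i \<alpha> F z =
     (let I = \<Union> (set F) in
      if i = 0 then coeff \<alpha> (tl F) (lquot lam I z (I - hd F))
      else if i < length F then coeff \<alpha> (take (i - 1) F @ [F ! (i - 1) \<union> F ! i] @ drop (i + 1) F) z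
      else coeff \<alpha> (butlast F) (rquot rho I z (I - last F)))"

definition cochain_diff ::
  "('k, 'r) ring_scheme \<Rightarrow> ('k, 'm) species \<Rightarrow> (nat set \<Rightarrow> 'm \<Rightarrow> nat set \<times> nat set \<Rightarrow> 'm) \<Rightarrow>
     (nat set \<Rightarrow> 'm \<Rightarrow> nat set \<times> nat set \<Rightarrow> 'm) \<Rightarrow> nat \<Rightarrow>
     (nat set \<Rightarrow> 'm \<Rightarrow> nat set list \<Rightarrow> 'k) \<Rightarrow> nat set \<Rightarrow> 'm \<Rightarrow> nat set list \<Rightarrow> 'k" where
  "cochain_diff R X lam rho n = (\<lambda>\<alpha>\<in>carrier (cochains R X n).
     \<lambda>I\<in>{I. finite I}. \<lambda>z\<in>carrier (sp_val X I). \<lambda>F.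
       if F \<in> decomps (Suc n) I
       then \<Oplus>\<^bsub>R\<^esub> i\<in>{0..n+1}. [((-1 :: int) ^ i)] \<cdot>\<^bsub>R\<^esub> (coface lam rho i \<alpha> F z)
       else \<zero>\<^bsub>R\<^esub>)"


section \<open>The Koszul dual of the exponential species\<close>

definition compositions :: "nat set \<Rightarrow> nat set list set" where
  "compositions I = {F. pairwise_disjoint F \<and> {} \<notin> set F \<and> \<Union> (set F) = I}"

definition omega :: "('k, 'r) ring_scheme \<Rightarrow> nat set \<Rightarrow> int \<Rightarrow> ('k, nat set list \<Rightarrow> 'k) module" where
  "omega R I n = free_module R {F \<in> compositions I. int (length F) - int (card I) = n}"

definition omega_diff ::
  "('k, 'r) ring_scheme \<Rightarrow> nat set \<Rightarrow> (nat set list \<Rightarrow> 'k) \<Rightarrow> nat set list \<Rightarrow> 'k" where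
  "omega_diff R I =
     (let \<Omega> = free_module R (compositions I) in
      lin_ext \<Omega> (compositions I)
       (\<lambda>F. \<Oplus>\<^bsub>\<Omega>\<^esub> i\<in>{1..length F}. [((-1 :: int) ^ i)] \<cdot>\<^bsub>\<Omega>\<^esub>
         (\<Oplus>\<^bsub>\<Omega>\<^esub> D\<in>{(A, B) \<in> decomps2 (F ! (i - 1)). A \<noteq> {} \<and> B \<noteq> {}}.
           basis_vec R (take (i - 1) F @ [fst D, snd D] @ drop i F))))"

definition omega_cocycles :: "('k, 'r) ring_scheme \<Rightarrow> nat set \<Rightarrow> int \<Rightarrow> (nat set list \<Rightarrow> 'k) set" where
  "omega_cocycles R I n = {f \<in> carrier (omega R I n). omega_diff R I f = \<zero>\<^bsub>omega R I (n + 1)\<^esub>}"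

definition omega_coboundaries ::
  "('k, 'r) ring_scheme \<Rightarrow> nat set \<Rightarrow> int \<Rightarrow> (nat set list \<Rightarrow> 'k) set" where
  "omega_coboundaries R I n = omega_diff R I ` carrier (omega R I (n - 1))"

definition dual_class ::
  "('k, 'r) ring_scheme \<Rightarrow> nat set \<Rightarrow> (nat set list \<Rightarrow> 'k) \<Rightarrow> (nat set list \<Rightarrow> 'k) set" where
  "dual_class R I f = omega_coboundaries R I 0 +>\<^bsub>omega R I 0\<^esub> f"

text \<open>\<open>E\<^sup>! = H\<^sup>0(\<Omega>(E))\<close>; a bijection acts on classes by relabelling representatives.\<close>

definition exp_dual :: "('k, 'r) ring_scheme \<Rightarrow> ('k, (nat set list \<Rightarrow> 'k) set) species" where
  "exp_dual R =
     (let V = (\<lambda>I. subquotient (omega R I 0) (omega_cocycles R I 0) (omega_coboundaries R I 0))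
      in \<lparr>sp_val = V,
          sp_map = (\<lambda>I \<sigma>. \<lambda>\<xi>\<in>carrier (V I). \<Union>f\<in>\<xi>. dual_class R (\<sigma> ` I)
            (lin_ext (free_module R (compositions (\<sigma> ` I))) (compositions I)
              (\<lambda>F. basis_vec R (map (image \<sigma>) F)) f))\<rparr>)"

text \<open>The linear order \<open>i\<^sub>1 < \<dots> < i\<^sub>p\<close>, given by the list of its elements, is the composition into
  the singletons \<open>{i\<^sub>1}, \<dots>, {i\<^sub>p}\<close>.\<close>

definition lin_order_class :: "('k, 'r) ring_scheme \<Rightarrow> nat list \<Rightarrow> (nat set list \<Rightarrow> 'k) set" where
  "lin_order_class R w = dual_class R (set w) (basis_vec R (map (\<lambda>i. {i}) w))"

text \<open>The component \<open>E\<^sup>![S] \<otimes> E\<^sup>![T] \<rightarrow> E\<^sup>![S \<union> T]\<close> of the product, as a bilinear map.\<close>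

definition dual_mult ::
  "('k, 'r) ring_scheme \<Rightarrow> nat set \<Rightarrow> nat set \<Rightarrow> (nat set list \<Rightarrow> 'k) set \<Rightarrow>
     (nat set list \<Rightarrow> 'k) set \<Rightarrow> (nat set list \<Rightarrow> 'k) set" where
  "dual_mult R S T \<xi> \<eta> =
     (let \<Omega> = free_module R (compositions (S \<union> T)) in
      \<Union>f\<in>\<xi>. \<Union>g\<in>\<eta>. dual_class R (S \<union> T)
       (lin_ext \<Omega> (compositions S)
         (\<lambda>F. lin_ext \<Omega> (compositions T) (\<lambda>G. basis_vec R (F @ G)) g) f))"


section \<open>The Koszul complex\<close>

definition tau ::
  "('k, 'r) ring_scheme \<Rightarrow> nat set \<Rightarrow> (nat set \<Rightarrow> 'k) \<Rightarrow> (nat set list \<Rightarrow> 'k) set" where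
  "tau R = (\<lambda>I\<in>{I. finite I}. \<lambda>x\<in>carrier (sp_val (exp_species R) I).
     if card I = 1 then x I \<odot>\<^bsub>sp_val (exp_dual R) I\<^esub> lin_order_class R [the_elem I]
     else \<zero>\<^bsub>sp_val (exp_dual R) I\<^esub>)"

text \<open>\<open>\<mu> \<circ> (t \<otimes> \<phi>) \<circ> \<lambda>\<close> and \<open>\<mu> \<circ> (\<phi> \<otimes> t) \<circ> \<rho>\<close>, where the component of \<open>\<lambda>(z)\<close> at \<open>(S, T)\<close> is
  \<open>e\<^sub>S \<otimes> z // T\<close>.\<close>

definition cap_left ::
  "('k, 'r) ring_scheme \<Rightarrow> ('k, 'm) species \<Rightarrow> (nat set \<Rightarrow> 'm \<Rightarrow> nat set \<times> nat set \<Rightarrow> 'm) \<Rightarrow>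
     (nat set \<Rightarrow> (nat set \<Rightarrow> 'k) \<Rightarrow> (nat set list \<Rightarrow> 'k) set) \<Rightarrow>
     (nat set \<Rightarrow> 'm \<Rightarrow> (nat set list \<Rightarrow> 'k) set) \<Rightarrow> nat set \<Rightarrow> 'm \<Rightarrow> (nat set list \<Rightarrow> 'k) set" where
  "cap_left R X lam t \<phi> = (\<lambda>I\<in>{I. finite I}. \<lambda>z\<in>carrier (sp_val X I).
     \<Oplus>\<^bsub>sp_val (exp_dual R) I\<^esub> D\<in>decomps2 I. case D of (S, T) \<Rightarrow>
       dual_mult R S T (t S (basis_vec R S)) (\<phi> T (lquot lam I z T)))"

definition cap_right ::
  "('k, 'r) ring_scheme \<Rightarrow> ('k, 'm) species \<Rightarrow> (nat set \<Rightarrow> 'm \<Rightarrow> nat set \<times> nat set \<Rightarrow> 'm) \<Rightarrow>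
     (nat set \<Rightarrow> 'm \<Rightarrow> (nat set list \<Rightarrow> 'k) set) \<Rightarrow>
     (nat set \<Rightarrow> (nat set \<Rightarrow> 'k) \<Rightarrow> (nat set list \<Rightarrow> 'k) set) \<Rightarrow>
     nat set \<Rightarrow> 'm \<Rightarrow> (nat set list \<Rightarrow> 'k) set" where
  "cap_right R X rho \<phi> t = (\<lambda>I\<in>{I. finite I}. \<lambda>z\<in>carrier (sp_val X I).
     \<Oplus>\<^bsub>sp_val (exp_dual R) I\<^esub> D\<in>decomps2 I. case D of (S, T) \<Rightarrow>
       dual_mult R S T (\<phi> S (rquot rho I z S)) (t T (basis_vec R T)))"

definition koszul ::
  "('k, 'r) ring_scheme \<Rightarrow> ('k, 'm) species \<Rightarrow> nat \<Rightarrow>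
     ('k, nat set \<Rightarrow> 'm \<Rightarrow> (nat set list \<Rightarrow> 'k) set) module" where
  "koszul R X p = (species_hom R X (exp_dual R))
     \<lparr>carrier := {\<phi> \<in> carrier (species_hom R X (exp_dual R)).
        \<forall>I. finite I \<and> card I \<noteq> p \<longrightarrow>
          (\<forall>z\<in>carrier (sp_val X I). \<phi> I z = \<zero>\<^bsub>sp_val (exp_dual R) I\<^esub>)}\<rparr>"

definition koszul_diff ::
  "('k, 'r) ring_scheme \<Rightarrow> ('k, 'm) species \<Rightarrow> (nat set \<Rightarrow> 'm \<Rightarrow> nat set \<times> nat set \<Rightarrow> 'm) \<Rightarrow>
     (nat set \<Rightarrow> 'm \<Rightarrow> nat set \<times> nat set \<Rightarrow> 'm) \<Rightarrow> nat \<Rightarrow>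
     (nat set \<Rightarrow> 'm \<Rightarrow> (nat set list \<Rightarrow> 'k) set) \<Rightarrow> nat set \<Rightarrow> 'm \<Rightarrow> (nat set list \<Rightarrow> 'k) set" where
  "koszul_diff R X lam rho p = (\<lambda>\<phi>\<in>carrier (koszul R X p).
     cap_left R X lam (tau R) \<phi> \<ominus>\<^bsub>species_hom R X (exp_dual R)\<^esub>
       [((-1 :: int) ^ p)] \<cdot>\<^bsub>species_hom R X (exp_dual R)\<^esub> (cap_right R X rho \<phi> (tau R)))"

end

theory Submission
  imports Defs "HOL-Algebra.Free_Abelian_Groups"
begin

text \<open>Sending a cochain \<open>\<alpha>\<close> of degree \<open>n\<close> to the class in \<open>E\<^sup>!\<close> of its restriction to the linear
orders of the sets with \<open>n\<close> elements defines maps \<open>top_class n\<close> from \<open>C\<^sup>n(X)\<close> to \<open>K\<^sup>n(X)\<close>. They commute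
with the differentials (\<open>koszul_diff_top_class\<close>): the outer cofaces become the products with \<open>\<tau>\<close>, and the
interior cofaces add up to a coboundary of \<open>\<Omega>(E)\<close>, which is zero in \<open>E\<^sup>!\<close>. If \<open>X\<close> is weakly projective,
these maps are surjective (\<open>top_class_surjective\<close>) and their kernel is acyclic (\<open>kernel_acyclic\<close>), so
they induce isomorphisms in cohomology (\<open>cohomology_iso\<close>). As every element of \<open>K\<^sup>n(X)\<close> is the image of
a cochain, the Koszul complex inherits linearity and \<open>d \<circ> d = 0\<close> from the complex of cochains.

The kernel is handled by induction on the cardinality of the sets. Let \<open>\<gamma>\<close> be a cocycle that
vanishes on all sets with fewer than \<open>m\<close> elements, and let \<open>I\<close> have \<open>m\<close> elements. A coaction that
removes a nonempty block leads to a smaller set, where \<open>\<gamma>\<close> vanishes, and one that removes an empty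
block is the identity. So on \<open>I\<close> the coactions disappear (\<open>cochain_diff_local\<close>), and \<open>\<gamma>(z)\<close> is, for each
\<open>z\<close>, a cocycle of a complex that depends only on \<open>I\<close>. A decomposition of \<open>I\<close> into \<open>n\<close> blocks is a
function from \<open>I\<close> to \<open>{1..n}\<close>, that is, an \<open>n\<close>-simplex other than the base point of the smash power
indexed by \<open>I\<close> of the simplicial circle with one nondegenerate edge. The local complex is therefore
the reduced cochain complex of a sphere of dimension \<open>m\<close>, which has cohomology of rank one in degree
\<open>m\<close> and none elsewhere (\<open>local_exactness\<close>). Its top cohomology is detected by the evaluation
\<open>top_value\<close> on a fundamental cycle, and this evaluation also identifies \<open>E\<^sup>![I]\<close> with the ground ring
(\<open>coboundary_iff_top_value\<close>, \<open>lin_order_class_basis\<close>).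

Local exactness provides a primitive of \<open>\<gamma>(z)\<close> for each single \<open>z\<close>. Projectivity of \<open>X[m]\<close> makes the
choice linear and equivariant (\<open>projective_lifting\<close>), the result extends to a cochain supported on the
sets with \<open>m\<close> elements (\<open>cochain_extension\<close>), and correcting by it moves the induction to \<open>m + 1\<close>. The
same lifting yields the surjectivity of the comparison map. Finally, \<open>E\<^sup>![p]\<close> is free on the class
of the order \<open>1 < \<dots> < p\<close> and a transposition acts on it by \<open>- 1\<close> (\<open>exp_dual_map_order\<close>); this turns
\<open>K\<^sup>p(X)\<close> into the equivariant maps from \<open>X[p]\<close> to the sign representation.\<close>

section \<open>Alternating sums\<close>

abbreviation alt_sum :: "('k, 'r) ring_scheme => nat set => (nat => 'k) => 'k" where
 "alt_sum R S t \<equiv> \<Oplus>\<^bsub>R\<^esub> i\<in>S. [((-1 :: int) ^ i)] \<cdot>\<^bsub>R\<^esub> t i"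

text \<open>The terms with \<open>i < j\<close> cancel against those with \<open>j \<le> i\<close> by the simplicial identity.
 Formal integral combinations are used so that the cancellation holds in every module, including
 those with 2-torsion.\<close>

lemma sum_faces_square:
 fixes T :: "nat => nat => 'a \<Rightarrow>\<^sub>0 int"
 assumes "\<And>i j. i < j ==> j \<le> Suc N ==> T j i = T i (j - 1)"
 shows "(\<Sum>j\<in>{0..Suc N}. frag_cmul ((-1) ^ j) (\<Sum>i\<in>{0..N}. frag_cmul ((-1) ^ i) (T j i))) = 0"
proof -
 let ?g = "\<lambda>(j, i). frag_cmul ((-1) ^ (j + i)) (T j i)"
 let ?A = "{(j, i). i < j \<and> j \<le> Suc N}" and ?B = "{(j, i). j \<le> i \<and> i \<le> N}"
 have fin: "finite ?A" "finite ?B"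
  by (rule finite_subset[of _ "{..Suc N} \<times> {..Suc N}"]; auto)+
 have "(\<Sum>j\<in>{0..Suc N}. frag_cmul ((-1) ^ j) (\<Sum>i\<in>{0..N}. frag_cmul ((-1) ^ i) (T j i))) =
   (\<Sum>j\<in>{0..Suc N}. \<Sum>i\<in>{0..N}. ?g (j, i))"
  by (simp add: frag_cmul_sum power_add)
 also have "\<dots> = sum ?g ({0..Suc N} \<times> {0..N})"
  by (simp only: sum.cartesian_product split_def prod.collapse)
 also have "{0..Suc N} \<times> {0..N} = ?A \<union> ?B" by auto
 also have "sum ?g (?A \<union> ?B) = sum ?g ?A + sum ?g ?B"
  by (rule sum.union_disjoint[OF fin]) auto
 also have "sum ?g ?B = (\<Sum>(j, i)\<in>?A. ?g (i, j - 1))"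
  by (rule sum.reindex_bij_witness[of _ "\<lambda>(j, i). (i, j - 1)" "\<lambda>(j, i). (Suc i, j)"]) auto
 also have "\<dots> = (\<Sum>x\<in>?A. - ?g x)"
 proof (rule sum.cong[OF refl])
  fix x assume "x \<in> ?A"
  then obtain i l where x: "x = (Suc l, i)" "i < Suc l" "Suc l \<le> Suc N"
   by (cases x; cases "fst x") auto
  show "(case x of (j, i) => ?g (i, j - 1)) = - ?g x"
   using assms[OF x(2,3)] by (simp add: x(1) add.commute)
 qed
 finally show ?thesis by (simp add: sum_negf)
qed

text \<open>The bookkeeping of a prism operator: away from the two diagonals the terms of \<open>d \<circ> H\<close> and
 \<open>H \<circ> d\<close> cancel in pairs, and the diagonals telescope to the two ends of the prism.\<close>

lemma sum_prism:
 fixes A B :: "nat => nat => 'a \<Rightarrow>\<^sub>0 int"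
 assumes lower: "\<And>i k. i < k ==> k \<le> Suc N ==> A i k = B (k - 1) i"
  and upper: "\<And>i k. Suc k < i ==> i \<le> Suc (Suc N) ==> A i k = B k (i - 1)"
  and diagonal: "\<And>k. k \<le> N ==> A (Suc k) k = A (Suc k) (Suc k)"
 shows "(\<Sum>i\<in>{0..Suc N}. frag_cmul ((-1) ^ i) (\<Sum>k\<in>{0..N}. frag_cmul ((-1) ^ k) (B k i))) +
   (\<Sum>k\<in>{0..Suc N}. frag_cmul ((-1) ^ k) (\<Sum>i\<in>{0..Suc (Suc N)}. frag_cmul ((-1) ^ i) (A i k))) =
  A 0 0 - A (Suc (Suc N)) (Suc N)"
proof -
 let ?a = "\<lambda>(i, k). frag_cmul ((-1) ^ (i + k)) (A i k)"
 let ?b = "\<lambda>(k, i). frag_cmul ((-1) ^ (i + k)) (B k i)"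
 let ?L = "{(i, k). i < k \<and> k \<le> Suc N}" and ?U = "{(i, k). Suc k < i \<and> i \<le> Suc (Suc N)}"
 let ?D = "(\<lambda>k. (k, k)) ` {0..Suc N}" and ?E = "(\<lambda>k. (Suc k, k)) ` {0..Suc N}"
 let ?P = "{(k, i). k < i \<and> i \<le> Suc N}" and ?Q = "{(k, i). i \<le> k \<and> k \<le> N}"
 have fin: "finite ?L" "finite ?U" "finite ?P" "finite ?Q"
  by (rule finite_subset[of _ "{..Suc (Suc N)} \<times> {..Suc (Suc N)}"]; auto)+
 have "(\<Sum>k\<in>{0..Suc N}. frag_cmul ((-1) ^ k) (\<Sum>i\<in>{0..Suc (Suc N)}. frag_cmul ((-1) ^ i) (A i k))) =
   (\<Sum>k\<in>{0..Suc N}. \<Sum>i\<in>{0..Suc (Suc N)}. ?a (i, k))"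
  by (simp add: frag_cmul_sum power_add mult.commute del: sum.atLeast0_atMost_Suc sum.cl_ivl_Suc)
 also have "\<dots> = (\<Sum>i\<in>{0..Suc (Suc N)}. \<Sum>k\<in>{0..Suc N}. ?a (i, k))" by (rule sum.swap)
 also have "\<dots> = sum ?a ({0..Suc (Suc N)} \<times> {0..Suc N})"
  by (simp only: sum.cartesian_product split_def prod.collapse)
 also have "{0..Suc (Suc N)} \<times> {0..Suc N} = (?L \<union> ?U) \<union> (?D \<union> ?E)"
  by (auto simp: image_iff)
 also have "sum ?a ((?L \<union> ?U) \<union> (?D \<union> ?E)) = sum ?a ?L + sum ?a ?U + (sum ?a ?D + sum ?a ?E)"
 proof -
  have "sum ?a ((?L \<union> ?U) \<union> (?D \<union> ?E)) = sum ?a (?L \<union> ?U) + sum ?a (?D \<union> ?E)"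
   by (rule sum.union_disjoint) (auto intro: fin)
  moreover have "sum ?a (?L \<union> ?U) = sum ?a ?L + sum ?a ?U"
   by (rule sum.union_disjoint[OF fin(1,2)]) auto
  moreover have "sum ?a (?D \<union> ?E) = sum ?a ?D + sum ?a ?E"
   by (rule sum.union_disjoint) auto
  ultimately show ?thesis by simp
 qed
 also have "sum ?a ?D = (\<Sum>k\<in>{0..Suc N}. A k k)"
  by (subst sum.reindex) (auto simp: inj_on_def)
 also have "sum ?a ?E = (\<Sum>k\<in>{0..Suc N}. - A (Suc k) k)"
  by (subst sum.reindex) (auto simp: inj_on_def)
 also have "(\<Sum>k\<in>{0..Suc N}. A k k) + (\<Sum>k\<in>{0..Suc N}. - A (Suc k) k) = A 0 0 - A (Suc (Suc N)) (Suc N)"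
 proof -
  have "(\<Sum>k\<in>{0..Suc N}. A k k) = A 0 0 + (\<Sum>k\<in>{0..N}. A (Suc k) (Suc k))"
   by (simp add: sum.atLeast0_atMost_Suc_shift del: sum.atLeast0_atMost_Suc sum.cl_ivl_Suc)
  moreover have "(\<Sum>k\<in>{0..Suc N}. - A (Suc k) k) = - A (Suc (Suc N)) (Suc N) + (\<Sum>k\<in>{0..N}. - A (Suc k) (Suc k))"
   by (simp add: diagonal)
  ultimately show ?thesis by (simp add: sum_negf)
 qed
 also have "sum ?a ?L = (\<Sum>x\<in>?Q. - ?b x)"
 proof (rule sum.reindex_bij_witness[of _ "\<lambda>(k, i). (i, Suc k)" "\<lambda>(i, k). (k - 1, i)"])
  fix x assume "x \<in> ?L"
  then obtain i l where x: "x = (i, Suc l)" "i < Suc l" "Suc l \<le> Suc N"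
   by (cases x; cases "snd x") auto
  show "- ?b (case x of (i, k) => (k - 1, i)) = ?a x"
   using lower[OF x(2,3)] by (simp add: x(1))
 qed auto
 also have "sum ?a ?U = (\<Sum>x\<in>?P. - ?b x)"
 proof (rule sum.reindex_bij_witness[of _ "\<lambda>(k, i). (Suc i, k)" "\<lambda>(i, k). (k, i - 1)"])
  fix x assume "x \<in> ?U"
  then obtain k l where x: "x = (Suc l, k)" "Suc k < Suc l" "Suc l \<le> Suc (Suc N)"
   by (cases x; cases "fst x") auto
  show "- ?b (case x of (i, k) => (k, i - 1)) = ?a x"
   using upper[OF x(2,3)] by (simp add: x(1))
 qed auto
 finally have 1: "(\<Sum>k\<in>{0..Suc N}. frag_cmul ((-1) ^ k) (\<Sum>i\<in>{0..Suc (Suc N)}. frag_cmul ((-1) ^ i) (A i k))) =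
  (\<Sum>x\<in>?Q. - ?b x) + (\<Sum>x\<in>?P. - ?b x) + (A 0 0 - A (Suc (Suc N)) (Suc N))" .
 have "(\<Sum>i\<in>{0..Suc N}. frag_cmul ((-1) ^ i) (\<Sum>k\<in>{0..N}. frag_cmul ((-1) ^ k) (B k i))) =
   (\<Sum>i\<in>{0..Suc N}. \<Sum>k\<in>{0..N}. ?b (k, i))"
  by (simp add: frag_cmul_sum power_add)
 also have "\<dots> = (\<Sum>k\<in>{0..N}. \<Sum>i\<in>{0..Suc N}. ?b (k, i))" by (rule sum.swap)
 also have "\<dots> = sum ?b ({0..N} \<times> {0..Suc N})"
  by (simp only: sum.cartesian_product split_def prod.collapse)
 also have "{0..N} \<times> {0..Suc N} = ?Q \<union> ?P" by auto
 also have "sum ?b (?Q \<union> ?P) = sum ?b ?Q + sum ?b ?P"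
  by (rule sum.union_disjoint[OF fin(4,3)]) auto
 finally show ?thesis unfolding 1 by (simp add: sum_negf)
qed

context cring
begin

text \<open>Short names for the modules and classes over the fixed ring; \<open>unperm \<sigma>\<close> relabels the blocks
 of a decomposition by the inverse of \<open>\<sigma>\<close>.\<close>

abbreviation "fmod \<equiv> free_module R"
abbreviation "Ed \<equiv> sp_val (exp_dual R)"
abbreviation "cobd \<equiv> omega_coboundaries R"
abbreviation "dcl \<equiv> dual_class R"
abbreviation "loc \<equiv> lin_order_class R"
abbreviation "bas \<equiv> basis_vec R"
abbreviation "unperm \<sigma> \<equiv> map (image (inv_into UNIV \<sigma>))"

lemma signed_multiple: "x \<in> carrier R ==> [((-1 :: int) ^ i)] \<cdot> x = (if even i then x else \<ominus> x)"
 by (simp add: add_pow_int_lt)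

lemma signed_closed [simp, intro]: "x \<in> carrier R ==> [(k :: int)] \<cdot> x \<in> carrier R"
 by (rule add.int_pow_closed)

lemma signed_zero [simp]: "[(k :: int)] \<cdot> \<zero> = \<zero>"
 by (rule add.int_pow_one)

definition frag_eval :: "('w => 'a) => ('w \<Rightarrow>\<^sub>0 int) => 'a" where
 "frag_eval f = (SOME h. h \<in> hom (free_Abelian_group UNIV) (add_monoid R) \<and> (\<forall>x. h (frag_of x) = f x))"

lemma frag_eval:
 assumes "range f \<subseteq> carrier R"
 shows frag_eval_hom: "frag_eval f \<in> hom (free_Abelian_group UNIV) (add_monoid R)"
  and frag_eval_of: "frag_eval f (frag_of x) = f x"
proof -
 obtain h where "h \<in> hom (free_Abelian_group UNIV) (add_monoid R)"
   "\<And>x. x \<in> UNIV ==> h (frag_of x) = f x"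
  using comm_group.free_Abelian_group_universal[OF a_comm_group, of f UNIV] assms by auto
 then have "\<exists>h. h \<in> hom (free_Abelian_group UNIV) (add_monoid R) \<and> (\<forall>x. h (frag_of x) = f x)"
  by auto
 from someI_ex[OF this] show "frag_eval f \<in> hom (free_Abelian_group UNIV) (add_monoid R)"
   "frag_eval f (frag_of x) = f x"
  unfolding frag_eval_def by auto
qed

lemma frag_eval_closed:
 assumes "range f \<subseteq> carrier R"
 shows "frag_eval f c \<in> carrier R"
 using frag_eval_hom[OF assms] by (auto simp: hom_def free_Abelian_group_def Pi_iff)

lemma frag_eval_add:
 assumes "range f \<subseteq> carrier R"
 shows "frag_eval f (a + b) = frag_eval f a \<oplus> frag_eval f b"
 using frag_eval_hom[OF assms] by (auto simp: hom_def free_Abelian_group_def)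

lemma frag_eval_0:
 assumes "range f \<subseteq> carrier R"
 shows "frag_eval f 0 = \<zero>"
 using frag_eval_add[OF assms, of 0 0] frag_eval_closed[OF assms, of 0]
 by (metis add.right_neutral add.r_cancel_one')

lemma frag_eval_minus:
 assumes "range f \<subseteq> carrier R"
 shows "frag_eval f (- a) = \<ominus> frag_eval f a"
proof -
 have "frag_eval f (- a) \<oplus> frag_eval f a = \<zero>"
  using frag_eval_add[OF assms, of "- a" a] by (simp add: frag_eval_0[OF assms])
 then show ?thesis
  using frag_eval_closed[OF assms] by (metis add.inv_equality)
qed

lemma frag_eval_signed:
 assumes "range f \<subseteq> carrier R"
 shows "frag_eval f (frag_cmul ((-1) ^ i) a) = [((-1 :: int) ^ i)] \<cdot> frag_eval f a"
 using frag_eval_minus[OF assms, of a] frag_eval_closed[OF assms]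
 by (simp add: signed_multiple)

lemma frag_eval_sum:
 assumes "range f \<subseteq> carrier R" and "finite S"
 shows "frag_eval f (sum g S) = (\<Oplus>s\<in>S. frag_eval f (g s))"
 using assms(2)
proof induction
 case (insert x F)
 then show ?case
  by (simp add: frag_eval_add[OF assms(1)] frag_eval_closed[OF assms(1)] Pi_iff)
qed (simp add: frag_eval_0[OF assms(1)])

lemma frag_eval_alt_sum:
 assumes "range f \<subseteq> carrier R" and "finite S"
 shows "frag_eval f (\<Sum>i\<in>S. frag_cmul ((-1) ^ i) (c i)) = alt_sum R S (\<lambda>i. frag_eval f (c i))"
 by (simp add: frag_eval_sum[OF assms] frag_eval_signed[OF assms(1)])

lemma alt_sum_closed [simp, intro]:
 "(\<And>i. i \<in> S ==> t i \<in> carrier R) ==> alt_sum R S t \<in> carrier R"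
 by (auto intro!: finsum_closed)

lemma alt_sum_cong:
 assumes "\<And>i. i \<in> S ==> t i = t' i" "\<And>i. i \<in> S ==> t' i \<in> carrier R"
 shows "alt_sum R S t = alt_sum R S t'"
 using assms by (intro finsum_cong') auto

lemma alt_sum_zero:
 assumes "\<And>i. i \<in> S ==> t i = \<zero>"
 shows "alt_sum R S t = \<zero>"
 using assms by (intro add.finprod_one_eqI) auto

lemma alt_sum_single:
 assumes "j \<in> S" "finite S" "\<And>i. i \<in> S ==> i \<noteq> j ==> t i = \<zero>" "t j \<in> carrier R"
 shows "alt_sum R S t = [((-1 :: int) ^ j)] \<cdot> t j"
proof -
 have closed: "t i \<in> carrier R" if "i \<in> S" for i
  using assms(3,4) that by (cases "i = j") auto
 have "alt_sum R S t = (\<Oplus>i\<in>S. if j = i then [((-1 :: int) ^ i)] \<cdot> t i else \<zero>)"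
  using assms(3,4) by (intro finsum_cong') auto
 also have "\<dots> = [((-1 :: int) ^ j)] \<cdot> t j"
  using assms(1,2) closed by (intro add.finprod_singleton) auto
 finally show ?thesis .
qed

lemma alt_sum_add:
 assumes "\<And>i. i \<in> S ==> s i \<in> carrier R" "\<And>i. i \<in> S ==> t i \<in> carrier R"
 shows "alt_sum R S (\<lambda>i. s i \<oplus> t i) = alt_sum R S s \<oplus> alt_sum R S t"
proof -
 have "alt_sum R S (\<lambda>i. s i \<oplus> t i) =
   (\<Oplus>i\<in>S. [((-1 :: int) ^ i)] \<cdot> s i \<oplus> [((-1 :: int) ^ i)] \<cdot> t i)"
  using assms by (intro finsum_cong') (auto simp: add.int_pow_mult_distrib a_comm)
 also have "\<dots> = alt_sum R S s \<oplus> alt_sum R S t"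
  using assms by (intro finsum_addf) auto
 finally show ?thesis .
qed

lemma alt_sum_smult:
 assumes "\<And>i. i \<in> S ==> t i \<in> carrier R" "c \<in> carrier R" "finite S"
 shows "alt_sum R S (\<lambda>i. c \<otimes> t i) = c \<otimes> alt_sum R S t"
 using assms by (subst finsum_rdistr) (auto intro!: finsum_cong' simp: add_pow_rdistr_int)

lemma alt_sum_minus:
 assumes "\<And>i. i \<in> S ==> t i \<in> carrier R" "finite S"
 shows "alt_sum R S (\<lambda>i. \<ominus> t i) = \<ominus> alt_sum R S t"
proof -
 have "alt_sum R S (\<lambda>i. \<ominus> t i) = alt_sum R S (\<lambda>i. \<ominus> \<one> \<otimes> t i)"
  using assms by (intro alt_sum_cong) (auto simp: l_minus)
 then show ?thesis using alt_sum_smult[of S t "\<ominus> \<one>"] assms by (simp add: l_minus)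
qed

lemma alt_sum_faces_square:
 assumes "\<And>i j. i < j ==> j \<le> Suc N ==> u j i = u i (j - 1)" and "range f \<subseteq> carrier R"
 shows "alt_sum R {0..Suc N} (\<lambda>j. alt_sum R {0..N} (\<lambda>i. f (u j i))) = \<zero>"
proof -
 have "frag_eval f (\<Sum>j\<in>{0..Suc N}. frag_cmul ((-1) ^ j) (\<Sum>i\<in>{0..N}. frag_cmul ((-1) ^ i) (frag_of (u j i)))) = \<zero>"
  by (subst sum_faces_square) (auto simp: assms frag_eval_0)
 then show ?thesis
  by (simp only: frag_eval_alt_sum[OF assms(2)] finite_atLeastAtMost frag_eval_of[OF assms(2)])
qed

lemma alt_sum_prism:
 assumes "\<And>i k. i < k ==> k \<le> Suc N ==> a i k = b (k - 1) i"
  and "\<And>i k. Suc k < i ==> i \<le> Suc (Suc N) ==> a i k = b k (i - 1)"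
  and "\<And>k. k \<le> N ==> a (Suc k) k = a (Suc k) (Suc k)"
  and f: "range f \<subseteq> carrier R"
 shows "alt_sum R {0..Suc N} (\<lambda>i. alt_sum R {0..N} (\<lambda>k. f (b k i))) \<oplus>
   alt_sum R {0..Suc N} (\<lambda>k. alt_sum R {0..Suc (Suc N)} (\<lambda>i. f (a i k))) =
  f (a 0 0) \<ominus> f (a (Suc (Suc N)) (Suc N))"
proof -
 have "frag_eval f ((\<Sum>i\<in>{0..Suc N}. frag_cmul ((-1) ^ i) (\<Sum>k\<in>{0..N}. frag_cmul ((-1) ^ k) (frag_of (b k i)))) +
   (\<Sum>k\<in>{0..Suc N}. frag_cmul ((-1) ^ k) (\<Sum>i\<in>{0..Suc (Suc N)}. frag_cmul ((-1) ^ i) (frag_of (a i k))))) =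
  frag_eval f (frag_of (a 0 0) + - frag_of (a (Suc (Suc N)) (Suc N)))"
  by (subst sum_prism) (auto simp: assms(1-3))
 then show ?thesis
  by (simp only: frag_eval_add[OF f] frag_eval_minus[OF f] frag_eval_alt_sum[OF f]
    finite_atLeastAtMost frag_eval_of[OF f] a_minus_def)
qed

end

section \<open>The local complex of a finite set\<close>

text \<open>A function \<open>p\<close> with \<open>p x = k\<close> if \<open>x\<close> lies in the block number \<open>k\<close>, and \<open>p x = 0\<close> if \<open>x\<close> lies
 in no block, encodes a decomposition. Composition with \<open>merge_pos i\<close> then merges the blocks \<open>i\<close> and
 \<open>i + 1\<close>, and it drops a block if \<open>i\<close> is at either end.\<close>

definition merge_pos :: "nat => nat => nat" where
 "merge_pos i k = (if k \<le> i then k else k - 1)"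

definition gap_pos :: "nat => nat => nat" where
 "gap_pos i k = (if k \<le> i then k else Suc k)"

definition positions :: "nat => nat set => (nat => nat) set" where
 "positions n I = {p. \<forall>x. if x \<in> I then 1 \<le> p x \<and> p x \<le> n else p x = 0}"

text \<open>The point \<open>x\<close> is swept through the other blocks: a new block is opened at \<open>k + 1\<close>, and \<open>x\<close> is
 moved there unless it lies in an earlier one.\<close>

definition prism :: "nat => nat => (nat => nat) => nat => nat" where
 "prism x k p = (gap_pos k \<circ> p)(x := min (p x) (Suc k))"

lemma merge_positions_bound:
 assumes "p \<in> positions (Suc n) I" "i \<le> Suc n"
 shows "merge_pos i (p y) \<le> Suc n" "y \<notin> I ==> merge_pos i (p y) = 0"
proof -
 have "if y \<in> I then 1 \<le> p y \<and> p y \<le> Suc n else p y = 0"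
  using assms(1) unfolding positions_def by blast
 then show "merge_pos i (p y) \<le> Suc n" "y \<notin> I ==> merge_pos i (p y) = 0"
  by (auto simp: merge_pos_def split: if_splits)
qed

lemma positions_failure:
 assumes "p \<notin> positions n I"
 obtains x where "x \<in> I" "p x = 0 \<or> Suc n \<le> p x" | x where "x \<notin> I" "p x \<noteq> 0"
 using assms unfolding positions_def by (force split: if_splits simp: not_le Suc_le_eq)

lemma positions_failureI:
 shows "x \<in> I ==> p x = 0 \<or> Suc n \<le> p x ==> p \<notin> positions n I"
  and "x \<notin> I ==> p x \<noteq> 0 ==> p \<notin> positions n I"
 unfolding positions_def by (auto intro!: exI[of _ x])

lemma merge_outside:
 assumes "p \<notin> positions (Suc n) I" "i \<le> Suc n" "\<And>x. x \<notin> I ==> p x = 0"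
 shows "merge_pos i \<circ> p \<notin> positions n I"
 using assms(1)
proof (cases rule: positions_failure)
 case (1 x)
 then show ?thesis
  using assms(2) by (intro positions_failureI(1)[of x]) (auto simp: merge_pos_def)
next
 case (2 x)
 then show ?thesis using assms(3) by simp
qed

lemma prism_outside:
 assumes "q(x := 0) \<notin> positions n I" "k \<le> n" "x \<notin> I"
 shows "prism x k q \<notin> positions (Suc n) (insert x I)"
 using assms(1)
proof (cases rule: positions_failure)
 case (1 y)
 then show ?thesis
  using assms by (intro positions_failureI(1)[of y]) (auto simp: prism_def gap_pos_def)
next
 case (2 y)
 then show ?thesis
  using assms by (intro positions_failureI(2)[of y]) (auto simp: prism_def gap_pos_def split: if_splits)
qed

lemma prism_zero: "x \<noteq> y ==> p y = 0 ==> prism x k p y = 0"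
 by (simp add: prism_def gap_pos_def)

lemma merge_merge: "i < j ==> merge_pos i \<circ> (merge_pos j \<circ> p) = merge_pos (j - 1) \<circ> (merge_pos i \<circ> p)"
 by (auto simp: merge_pos_def fun_eq_iff)

lemma merge_prism_lower: "i < k ==> merge_pos i \<circ> prism x k p = prism x (k - 1) (merge_pos i \<circ> p)"
 by (auto simp: merge_pos_def prism_def gap_pos_def fun_eq_iff min_def)

lemma merge_prism_upper: "Suc k < i ==> merge_pos i \<circ> prism x k p = prism x k (merge_pos (i - 1) \<circ> p)"
 by (auto simp: merge_pos_def prism_def gap_pos_def fun_eq_iff min_def)

lemma merge_prism_diagonal: "merge_pos (Suc k) \<circ> prism x k p = merge_pos (Suc k) \<circ> prism x (Suc k) p"
 by (auto simp: merge_pos_def prism_def gap_pos_def fun_eq_iff min_def)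

lemma merge_prism_last: "p x \<le> Suc n ==> merge_pos (Suc n) \<circ> prism x n p = p"
 by (auto simp: merge_pos_def prism_def gap_pos_def fun_eq_iff min_def)

context cring
begin

text \<open>Local cochains are zero at functions that are not positions. This stands for the base point
 of the simplicial set, and makes the formula of the differential uniform in all faces.\<close>

definition local_cochains :: "nat => nat set => ((nat => nat) => 'a) set" where
 "local_cochains n I = {f. range f \<subseteq> carrier R \<and> (\<forall>p. p \<notin> positions n I --> f p = \<zero>)}"

definition local_diff :: "nat set => nat => ((nat => nat) => 'a) => (nat => nat) => 'a" where
 "local_diff I n f p =
   (if \<forall>x. x \<notin> I --> p x = 0 then alt_sum R {0..Suc n} (\<lambda>i. f (merge_pos i \<circ> p)) else \<zero>)"

definition prism_op :: "nat => nat => ((nat => nat) => 'a) => (nat => nat) => 'a" where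
 "prism_op x n f p = alt_sum R {0..n} (\<lambda>k. f (prism x k p))"

text \<open>Integration over the circle factor of \<open>x\<close>: the alternating sum over all ways to insert \<open>x\<close> as
 a block of its own.\<close>

definition integrate :: "nat => nat => ((nat => nat) => 'a) => (nat => nat) => 'a" where
 "integrate x n f v =
   (if v x = 0 then alt_sum R {0..n} (\<lambda>k. f ((gap_pos k \<circ> v)(x := Suc k))) else \<zero>)"

text \<open>The evaluation on the fundamental cycle of the sphere, one circle at a time.\<close>

fun top_value :: "nat list => ((nat => nat) => 'a) => 'a" where
 "top_value [] f = f (\<lambda>_. 0)"
| "top_value (x # xs) f = top_value xs (integrate x (length xs) f)"

lemma local_cochains_closed: "f \<in> local_cochains n I ==> f p \<in> carrier R"
 and local_cochains_range: "f \<in> local_cochains n I ==> range f \<subseteq> carrier R"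
 and local_cochains_outside: "f \<in> local_cochains n I ==> p \<notin> positions n I ==> f p = \<zero>"
 by (auto simp: local_cochains_def)

lemma local_cochainsI:
 "[|\<And>p. f p \<in> carrier R; \<And>p. p \<notin> positions n I ==> f p = \<zero>|] ==> f \<in> local_cochains n I"
 by (auto simp: local_cochains_def)

lemma local_diff_closed:
 assumes "range f \<subseteq> carrier R"
 shows "local_diff I n f p \<in> carrier R" "prism_op x n f p \<in> carrier R" "integrate x n f p \<in> carrier R"
 unfolding local_diff_def prism_op_def integrate_def
 using assms by (auto intro!: alt_sum_closed split: if_splits)

lemma local_diff_add:
 assumes "range f \<subseteq> carrier R" "range g \<subseteq> carrier R"
 shows "local_diff I n (\<lambda>p. f p \<oplus> g p) p = local_diff I n f p \<oplus> local_diff I n g p"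
 unfolding local_diff_def using assms by (auto intro!: alt_sum_add)

lemma local_diff_smult:
 assumes "range f \<subseteq> carrier R" "c \<in> carrier R"
 shows "local_diff I n (\<lambda>p. c \<otimes> f p) p = c \<otimes> local_diff I n f p"
 unfolding local_diff_def using assms by (auto intro!: alt_sum_smult)

lemma local_diff_minus:
 assumes "range f \<subseteq> carrier R"
 shows "local_diff I n (\<lambda>p. \<ominus> f p) p = \<ominus> local_diff I n f p"
 unfolding local_diff_def using assms by (auto intro!: alt_sum_minus)

lemma local_diff_zero: "local_diff I n (\<lambda>p. \<zero>) p = \<zero>"
 unfolding local_diff_def by (auto intro: alt_sum_zero)

lemma local_diff_square:
 assumes "range f \<subseteq> carrier R"
 shows "local_diff I (Suc n) (local_diff I n f) p = \<zero>"
proof (cases "\<forall>x. x \<notin> I --> p x = 0")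
 case True
 then have "\<forall>x. x \<notin> I --> (merge_pos i \<circ> p) x = 0" for i by (simp add: merge_pos_def)
 then show ?thesis
  unfolding local_diff_def
  using alt_sum_faces_square[of "Suc n" "\<lambda>j i. merge_pos i \<circ> (merge_pos j \<circ> p)" f] assms True
  by (simp add: merge_merge)
next
 case False
 then show ?thesis unfolding local_diff_def by auto
qed

lemma local_diff_in:
 assumes f: "f \<in> local_cochains n I"
 shows "local_diff I n f \<in> local_cochains (Suc n) I"
proof (rule local_cochainsI)
 show "local_diff I n f p \<in> carrier R" for p
  by (rule local_diff_closed[OF local_cochains_range[OF f]])
 fix p assume "p \<notin> positions (Suc n) I"
 then have "merge_pos i \<circ> p \<notin> positions n I" if "i \<le> Suc n" "\<forall>x. x \<notin> I --> p x = 0" for i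
  using merge_outside that by blast
 then show "local_diff I n f p = \<zero>"
  unfolding local_diff_def by (auto intro!: alt_sum_zero local_cochains_outside[OF f])
qed

text \<open>The prism contracts the circle of \<open>x\<close> up to the boundary terms at its two ends; one end
 gives \<open>f\<close>, and the other has \<open>x\<close> in the position zero, where \<open>f\<close> vanishes.\<close>

lemma local_diff_prism_op:
 assumes f: "f \<in> local_cochains (Suc n) I" and "x \<in> I" "p x \<le> Suc (Suc n)"
  and zero: "\<And>y. y \<notin> I ==> p y = 0"
 shows "local_diff I n (prism_op x n f) p \<oplus> prism_op x (Suc n) (local_diff I (Suc n) f) p = \<ominus> f p"
proof -
 have prism_outside_zero: "prism x k p y = 0" if "y \<notin> I" for k y
  using prism_zero[of x y p k] zero[OF that] that \<open>x \<in> I\<close> by auto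
 have "local_diff I n (prism_op x n f) p \<oplus> prism_op x (Suc n) (local_diff I (Suc n) f) p =
   f (merge_pos 0 \<circ> prism x 0 p) \<ominus> f (merge_pos (n + 2) \<circ> prism x (Suc n) p)"
  unfolding local_diff_def prism_op_def
  using alt_sum_prism[of n "\<lambda>i k. merge_pos i \<circ> prism x k p" "\<lambda>k i. prism x k (merge_pos i \<circ> p)" f]
   local_cochains_range[OF f]
  by (simp add: merge_prism_lower merge_prism_upper merge_prism_diagonal zero prism_outside_zero
    merge_pos_def)
 moreover have "merge_pos 0 \<circ> prism x 0 p \<notin> positions (Suc n) I"
  using \<open>x \<in> I\<close> by (auto simp: positions_def prism_def merge_pos_def intro!: exI[of _ x])
 then have "f (merge_pos 0 \<circ> prism x 0 p) = \<zero>" by (rule local_cochains_outside[OF f])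
 moreover have "merge_pos (n + 2) \<circ> prism x (Suc n) p = p"
  using merge_prism_last[of p x "Suc n"] assms(3) by simp
 ultimately show ?thesis using local_cochains_closed[OF f] by (simp add: a_minus_def)
qed

lemma integrate_in:
 assumes f: "f \<in> local_cochains (Suc n) (insert x I)" and "x \<notin> I"
 shows "integrate x n f \<in> local_cochains n I"
proof (rule local_cochainsI)
 show "integrate x n f p \<in> carrier R" for p
  by (rule local_diff_closed[OF local_cochains_range[OF f]])
 fix v assume "v \<notin> positions n I"
 then have "(gap_pos k \<circ> v)(x := Suc k) \<notin> positions (Suc n) (insert x I)" if "k \<le> n" "v x = 0" for k
 proof -
  have "v(x := 0) \<notin> positions n I" using \<open>v \<notin> positions n I\<close> that by (simp add: fun_upd_idem)
  moreover have "prism x k (v(x := Suc n)) = (gap_pos k \<circ> v)(x := Suc k)"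
   using that by (auto simp: prism_def)
  ultimately show ?thesis using prism_outside[of "v(x := Suc n)" x n I k] that \<open>x \<notin> I\<close> by simp
 qed
 then have "f ((gap_pos k \<circ> v)(x := Suc k)) = \<zero>" if "k \<le> n" "v x = 0" for k
  using local_cochains_outside[OF f] that by blast
 then show "integrate x n f v = \<zero>"
  unfolding integrate_def by (auto intro: alt_sum_zero)
qed

lemma prism_op_top:
 assumes "p x = Suc n" "range f \<subseteq> carrier R"
 shows "prism_op x n f p = integrate x n f (p(x := 0))"
proof -
 have "prism x k p = (gap_pos k \<circ> p(x := 0))(x := Suc k)" if "k \<le> n" for k
  using assms that by (auto simp: prism_def)
 then show ?thesis
  unfolding prism_op_def integrate_def using assms(2) by (auto intro!: alt_sum_cong)
qed

lemma merge_update: "(merge_pos i \<circ> p)(x := 0) = merge_pos i \<circ> p(x := 0)"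
 by (auto simp: merge_pos_def)

text \<open>Inserting \<open>x\<close> as a block of its own and then merging this block with either neighbour gives the
 same function for two consecutive insertions; these terms telescope, and the remaining merges are
 those of the differential without \<open>x\<close>.\<close>

lemma integrate_diff:
 assumes f: "f \<in> local_cochains (Suc n) (insert x I)" and "x \<notin> I"
 shows "integrate x (Suc n) (local_diff (insert x I) (Suc n) f) v = \<ominus> local_diff I n (integrate x n f) v"
proof (cases "\<forall>y. y \<notin> I --> v y = 0")
 case True
 note f_range = local_cochains_range[OF f]
 let ?p = "v(x := Suc (Suc n))"
 have vx: "v x = 0" using True \<open>x \<notin> I\<close> by simp
 then have v: "?p(x := 0) = v" by auto
 have "f ?p = \<zero>"
  by (rule local_cochains_outside[OF f], rule positions_failureI(1)[of x]) auto
 then have "local_diff (insert x I) n (prism_op x n f) ?p \<oplus>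
   prism_op x (Suc n) (local_diff (insert x I) (Suc n) f) ?p = \<zero>"
  using local_diff_prism_op[OF f, of x ?p] True by simp
 moreover have "prism_op x (Suc n) (local_diff (insert x I) (Suc n) f) ?p =
   integrate x (Suc n) (local_diff (insert x I) (Suc n) f) v"
  using prism_op_top[of ?p x "Suc n"] v local_diff_closed(1)[OF f_range]
  by (simp add: image_subset_iff)
 moreover have "local_diff (insert x I) n (prism_op x n f) ?p = local_diff I n (integrate x n f) v"
 proof -
  have "prism_op x n f (merge_pos i \<circ> ?p) = integrate x n f (merge_pos i \<circ> v)" if "i \<le> Suc n" for i
  proof -
   have "(merge_pos i \<circ> ?p) x = Suc n" using that by (simp add: merge_pos_def)
   then show ?thesis using prism_op_top[OF _ f_range, of "merge_pos i \<circ> ?p" x n] v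
    by (simp only: merge_update)
  qed
  then show ?thesis
   unfolding local_diff_def using True
   by (auto intro!: alt_sum_cong local_diff_closed[OF f_range])
 qed
 ultimately show ?thesis
  using local_diff_closed[OF local_cochains_range[OF integrate_in[OF assms]]]
   local_diff_closed(3)[OF local_cochains_range[OF local_diff_in[OF f]]]
  by (metis minus_equality a_comm)
next
 case False
 then obtain y where y: "y \<notin> I" "v y \<noteq> 0" by blast
 have "local_diff (insert x I) (Suc n) f ((gap_pos k \<circ> v)(x := Suc k)) = \<zero>" if "v x = 0" for k
 proof -
  have "y \<notin> insert x I \<and> ((gap_pos k \<circ> v)(x := Suc k)) y \<noteq> 0"
   using y that by (auto simp: gap_pos_def)
  then show ?thesis unfolding local_diff_def by metis
 qed
 then show ?thesis
  using False by (auto simp: integrate_def local_diff_def[of I] intro!: alt_sum_zero)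
qed

lemma top_value_closed: "range f \<subseteq> carrier R ==> top_value xs f \<in> carrier R"
proof (induction xs arbitrary: f)
 case (Cons x xs)
 then show ?case using local_diff_closed(3)[OF Cons.prems] by (auto simp: image_subset_iff)
qed auto

lemma top_value_add:
 assumes "range f \<subseteq> carrier R" "range g \<subseteq> carrier R"
 shows "top_value xs (\<lambda>p. f p \<oplus> g p) = top_value xs f \<oplus> top_value xs g"
 using assms
proof (induction xs arbitrary: f g)
 case (Cons x xs)
 have "integrate x (length xs) (\<lambda>p. f p \<oplus> g p) =
   (\<lambda>p. integrate x (length xs) f p \<oplus> integrate x (length xs) g p)"
  unfolding integrate_def using Cons.prems
  by (intro ext) (auto intro!: alt_sum_add simp: image_subset_iff)
 then show ?case
  using Cons.IH[of "integrate x (length xs) f" "integrate x (length xs) g"]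
   local_diff_closed(3)[OF Cons.prems(1)] local_diff_closed(3)[OF Cons.prems(2)]
  by (auto simp: image_subset_iff)
qed auto

lemma top_value_smult:
 assumes "range f \<subseteq> carrier R" "c \<in> carrier R"
 shows "top_value xs (\<lambda>p. c \<otimes> f p) = c \<otimes> top_value xs f"
 using assms
proof (induction xs arbitrary: f)
 case (Cons x xs)
 have "integrate x (length xs) (\<lambda>p. c \<otimes> f p) = (\<lambda>p. c \<otimes> integrate x (length xs) f p)"
  unfolding integrate_def using Cons.prems
  by (intro ext) (auto intro!: alt_sum_smult simp: image_subset_iff)
 then show ?case
  using Cons.IH[of "integrate x (length xs) f"] local_diff_closed(3)[OF Cons.prems(1)] Cons.prems(2)
  by (auto simp: image_subset_iff)
qed auto

lemma top_value_minus:
 assumes "range f \<subseteq> carrier R"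
 shows "top_value xs (\<lambda>p. \<ominus> f p) = \<ominus> top_value xs f"
proof -
 have "(\<lambda>p. \<ominus> f p) = (\<lambda>p. \<ominus> \<one> \<otimes> f p)"
  using assms by (intro ext) (simp add: l_minus range_subsetD)
 then show ?thesis
  using top_value_smult[OF assms, of "\<ominus> \<one>" xs] top_value_closed[OF assms] by (simp add: l_minus)
qed

lemma top_value_diff:
 assumes "distinct xs" "length xs = Suc n" "f \<in> local_cochains n (set xs)"
 shows "top_value xs (local_diff (set xs) n f) = \<zero>"
 using assms
proof (induction n arbitrary: xs f)
 case 0
 then obtain x where xs: "xs = [x]" by (cases xs) auto
 have "f = (\<lambda>_. \<zero>)"
 proof
  fix p
  have "p x = 0 \<or> Suc 0 \<le> p x" by auto
  then show "f p = \<zero>"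
   using local_cochains_outside[OF 0(3)] positions_failureI(1)[of x "set xs" p 0] by (simp add: xs)
 qed
 then show ?case by (simp add: xs integrate_def local_diff_zero del: One_nat_def)
next
 case (Suc n)
 then obtain x ys where xs: "xs = x # ys" "x \<notin> set ys" "distinct ys" "length ys = Suc n"
  by (cases xs) auto
 have f: "f \<in> local_cochains (Suc n) (insert x (set ys))" using Suc.prems(3) by (simp add: xs)
 have i: "integrate x n f \<in> local_cochains n (set ys)" by (rule integrate_in[OF f xs(2)])
 have "integrate x (Suc n) (local_diff (set xs) (Suc n) f) = (\<lambda>v. \<ominus> local_diff (set ys) n (integrate x n f) v)"
  using integrate_diff[OF f xs(2)] by (intro ext) (simp add: xs(1))
 then have "top_value xs (local_diff (set xs) (Suc n) f) = \<ominus> top_value ys (local_diff (set ys) n (integrate x n f))"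
  using top_value_minus[OF local_cochains_range[OF local_diff_in[OF i]]] by (simp add: xs(1,4))
 also have "\<dots> = \<zero>" using Suc.IH[OF xs(3,4) i] by simp
 finally show ?case .
qed

text \<open>The prism operator contracts the complex, except that its values need not vanish at the
 position functions with \<open>x\<close> in the last block \<open>n + 1\<close>, where they are given by \<open>integrate x n f\<close>. A cocycle
 \<open>G\<close> that cancels these values repairs this.\<close>

lemma local_primitive:
 assumes f: "f \<in> local_cochains (Suc n) (insert x I)" and x: "x \<notin> I"
  and cocycle: "\<And>p. local_diff (insert x I) (Suc n) f p = \<zero>"
  and G: "range G \<subseteq> carrier R"
  and G_0: "\<And>q. q x = 0 ==> G q = \<zero>"
  and G_outside: "\<And>q. q(x := 0) \<notin> positions n I ==> G q = \<zero>"
  and G_top: "\<And>q. q x = Suc n ==> G q = \<ominus> integrate x n f (q(x := 0))"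
  and G_cocycle: "\<And>p. local_diff (insert x I) n G p = \<zero>"
 shows "\<exists>g\<in>local_cochains n (insert x I). local_diff (insert x I) n g = f"
proof -
 define g where "g q = (if q \<in> positions n (insert x I) then \<ominus> (prism_op x n f q \<oplus> G q) else \<zero>)" for q
 note H = local_diff_closed(2)[OF local_cochains_range[OF f]]
 have G': "G q \<in> carrier R" for q using G by auto
 have g: "g \<in> local_cochains n (insert x I)"
  by (rule local_cochainsI) (auto simp: g_def H G')
 moreover have "local_diff (insert x I) n g p = f p" for p
 proof (cases "p \<in> positions (Suc n) (insert x I)")
  case False
  then show ?thesis
   using local_cochains_outside[OF local_diff_in[OF g]] local_cochains_outside[OF f] by simp
 next
  case p: True
  have "g (merge_pos i \<circ> p) = \<ominus> (prism_op x n f (merge_pos i \<circ> p) \<oplus> G (merge_pos i \<circ> p))"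
   if "i \<le> Suc n" for i
  proof (cases "merge_pos i \<circ> p \<in> positions n (insert x I)")
   case False
   let ?q = "merge_pos i \<circ> p"
   consider "?q(x := 0) \<notin> positions n I" | "?q x = 0" | "?q x = Suc n"
   proof (cases rule: positions_failure[OF False])
    case (1 y)
    then show ?thesis
     using merge_positions_bound(1)[OF p \<open>i \<le> Suc n\<close>, of y] x
      positions_failureI(1)[of y I "?q(x := 0)" n] that
     by (cases "y = x") auto
   next
    case (2 y)
    then show ?thesis using positions_failureI(2)[of y I "?q(x := 0)" n] that(1) by auto
   qed
   then have "prism_op x n f ?q \<oplus> G ?q = \<zero>"
   proof cases
    case 1
    then have "f (prism x k ?q) = \<zero>" if "k \<le> n" for k
     using local_cochains_outside[OF f] prism_outside[OF 1 that x] by blast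
    then have "prism_op x n f ?q = \<zero>" unfolding prism_op_def by (intro alt_sum_zero) auto
    then show ?thesis using G_outside[OF 1] by simp
   next
    case 2
    have "prism x k ?q \<notin> positions (Suc n) (insert x I)" for k
     using 2 by (intro positions_failureI(1)[of x]) (auto simp: prism_def)
    then have "prism_op x n f ?q = \<zero>"
     unfolding prism_op_def by (intro alt_sum_zero) (auto intro: local_cochains_outside[OF f])
    then show ?thesis using G_0[of ?q, OF 2] by simp
   next
    case 3
    show ?thesis
     using prism_op_top[of ?q, OF 3 local_cochains_range[OF f]] G_top[of ?q, OF 3] local_diff_closed(3)[OF local_cochains_range[OF f]]
     by (simp add: r_neg)
   qed
   then show ?thesis using False by (simp add: g_def)
  qed (simp add: g_def)
  then have "local_diff (insert x I) n g p = local_diff (insert x I) n (\<lambda>q. \<ominus> (prism_op x n f q \<oplus> G q)) p"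
   unfolding local_diff_def by (auto intro!: alt_sum_cong simp: H G')
  also have "\<dots> = \<ominus> (local_diff (insert x I) n (prism_op x n f) p \<oplus> local_diff (insert x I) n G p)"
   using H G by (subst local_diff_minus; (subst local_diff_add)?) auto
  also have "local_diff (insert x I) n G p = \<zero>" by (rule G_cocycle)
  also have "local_diff (insert x I) n (prism_op x n f) p = \<ominus> f p"
  proof -
   have "prism_op x (Suc n) (local_diff (insert x I) (Suc n) f) p = \<zero>"
    unfolding prism_op_def by (intro alt_sum_zero cocycle)
   moreover have "p x \<le> Suc (Suc n)" using p unfolding positions_def by (auto dest: spec[of _ x])
   moreover have "\<And>y. y \<notin> insert x I ==> p y = 0" using p positions_failureI(2) by blast
   ultimately show ?thesis
    using local_diff_prism_op[OF f, of x p] local_diff_closed(1)[of "prism_op x n f" "insert x I" n p] H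
    by (auto simp: image_subset_iff)
  qed
  finally show ?thesis using local_cochains_closed[OF f] by simp
 qed
 ultimately show ?thesis by blast
qed

text \<open>Induction on the set. By \<open>integrate_diff\<close>, integration over the circle of the first point gives a
 cocycle on the remaining points, in one degree less; a primitive of it yields the correction needed in
 \<open>local_primitive\<close>.\<close>

theorem local_exactness:
 assumes "distinct xs" "f \<in> local_cochains n (set xs)" "\<And>p. local_diff (set xs) n f p = \<zero>"
  and "n = length xs ==> top_value xs f = \<zero>"
 shows "case n of 0 => f = (\<lambda>_. \<zero>) | Suc m => \<exists>g\<in>local_cochains m (set xs). local_diff (set xs) m g = f"
 using assms
proof (induction xs arbitrary: n f)
 case Nil
 have P: "positions n {} = {\<lambda>_. 0}" for n by (auto simp: positions_def)
 show ?case
 proof (cases n)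
  case 0
  then have "f p = \<zero>" for p
   using Nil local_cochains_outside[OF Nil(2)] by (cases "p = (\<lambda>_. 0)") (auto simp: P)
  then show ?thesis using 0 by auto
 next
  case (Suc m)
  note f = local_cochains_closed[OF Nil(2)]
  have f0: "local_diff {} k f (\<lambda>_. 0) = (if even k then \<zero> else f (\<lambda>_. 0))" for k
  proof -
   have "alt_sum R {0..Suc k} (\<lambda>i. c) = (if even k then \<zero> else c)" if "c \<in> carrier R" for c
   proof (induction k)
    case 0
    then show ?case
     using that by (simp add: atLeast0_atMost_Suc signed_multiple l_neg del: One_nat_def)
   next
    case (Suc k)
    have "alt_sum R {0..Suc (Suc k)} (\<lambda>i. c) =
      [((-1 :: int) ^ Suc (Suc k))] \<cdot> c \<oplus> alt_sum R {0..Suc k} (\<lambda>i. c)"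
     by (subst atLeast0_atMost_Suc[of "Suc k"], subst finsum_insert) (auto simp: that)
    then show ?case using Suc that by (simp add: signed_multiple l_neg del: power_Suc)
   qed
   then show ?thesis
    using f unfolding local_diff_def by (simp add: merge_pos_def comp_def)
  qed
  have fp: "f p = \<zero>" if "p \<noteq> (\<lambda>_. 0)" for p
   using local_cochains_outside[OF Nil(2)] that by (simp add: P)
  have f': "f \<in> local_cochains m {}"
   using f fp by (intro local_cochainsI) (auto simp: P)
  have "local_diff {} m f p = f p" for p
  proof (cases "p = (\<lambda>_. 0)")
   case True
   then show ?thesis
    using f0[of m] f0[of n] Nil(3)[of "\<lambda>_. 0"] Suc by (auto split: if_splits)
  next
   case False
   then show ?thesis using local_cochains_outside[OF local_diff_in[OF f']] fp by (simp add: P)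
  qed
  then show ?thesis using f' Suc by auto
 qed
next
 case (Cons x xs)
 show ?case
 proof (cases n)
  case 0
  have "p \<notin> positions 0 (set (x # xs))" for p
   by (auto simp: positions_def intro!: exI[of _ x])
  then show ?thesis using 0 local_cochains_outside[OF Cons.prems(2)] by auto
 next
  case (Suc m)
  have x: "x \<notin> set xs" and f: "f \<in> local_cochains (Suc m) (insert x (set xs))"
   using Cons.prems Suc by auto
  let ?t = "integrate x m f"
  have t: "?t \<in> local_cochains m (set xs)" by (rule integrate_in[OF f x])
  have "local_diff (set xs) m ?t p = \<zero>" for p
  proof -
   have "local_diff (insert x (set xs)) (Suc m) f = (\<lambda>_. \<zero>)" using Cons.prems(3) Suc by auto
   then have "integrate x (Suc m) (local_diff (insert x (set xs)) (Suc m) f) p = \<zero>"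
    unfolding integrate_def by (auto intro!: alt_sum_zero)
   then show ?thesis
    using integrate_diff[OF f x, of p] local_diff_closed(1)[OF local_cochains_range[OF t]]
    by (metis minus_minus minus_zero)
  qed
  moreover have "top_value xs ?t = \<zero>" if "m = length xs"
   using Cons.prems(4) that Suc by simp
  ultimately have IH: "case m of 0 => ?t = (\<lambda>_. \<zero>)
    | Suc l => \<exists>g\<in>local_cochains l (set xs). local_diff (set xs) l g = ?t"
   using Cons.IH[OF _ t] Cons.prems(1) by simp
  have cocycle: "local_diff (insert x (set xs)) (Suc m) f p = \<zero>" for p using Cons.prems(3) Suc by simp
  have "\<exists>g\<in>local_cochains m (insert x (set xs)). local_diff (insert x (set xs)) m g = f"
  proof (cases m)
   case 0
   then have t0: "?t = (\<lambda>_. \<zero>)" using IH by simp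
   show ?thesis
    by (rule local_primitive[OF f x cocycle, of "\<lambda>_. \<zero>"]) (auto simp: t0 local_diff_zero)
  next
   case (Suc l)
   then obtain h where h: "h \<in> local_cochains l (set xs)" "local_diff (set xs) l h = ?t" using IH by auto
   \<comment> \<open>the primitive of the integral, placed at the functions with \<open>x\<close> in the block \<open>l + 1\<close>; its differential has the values that cancel\<close>
   define G where "G q = (if q x = Suc l then \<ominus> h (q(x := 0)) else \<zero>)" for q
   have G: "range G \<subseteq> carrier R" using local_cochains_closed[OF h(1)] by (auto simp: G_def)
   show ?thesis
   proof (rule local_primitive[OF f x cocycle, of "local_diff (insert x (set xs)) l G"])
    show "range (local_diff (insert x (set xs)) l G) \<subseteq> carrier R" using local_diff_closed(1)[OF G] by auto
    show "local_diff (insert x (set xs)) l G q = \<zero>" if "q x = 0" for q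
     unfolding local_diff_def using that by (auto intro!: alt_sum_zero simp: G_def merge_pos_def)
    show "local_diff (insert x (set xs)) l G q = \<zero>" if "q(x := 0) \<notin> positions m (set xs)" for q
    proof -
     have "h ((merge_pos i \<circ> q)(x := 0)) = \<zero>"
      if "i \<le> Suc l" "\<forall>y. y \<notin> insert x (set xs) --> q y = 0" for i
      using merge_outside[of "q(x := 0)" l "set xs" i] local_cochains_outside[OF h(1)] that
       \<open>q(x := 0) \<notin> positions m (set xs)\<close> Suc by (simp add: merge_update)
     then show ?thesis unfolding local_diff_def by (auto intro!: alt_sum_zero simp: G_def)
    qed
    show "local_diff (insert x (set xs)) l G q = \<ominus> ?t (q(x := 0))" if "q x = Suc m" for q
    proof -
     have "local_diff (insert x (set xs)) l G q = local_diff (set xs) l (\<lambda>p. \<ominus> h p) (q(x := 0))"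
     proof -
      have "G (merge_pos i \<circ> q) = \<ominus> h (merge_pos i \<circ> q(x := 0))" if "i \<le> Suc l" for i
       using that \<open>q x = Suc m\<close> Suc unfolding G_def merge_update by (simp add: merge_pos_def)
      then show ?thesis
       unfolding local_diff_def using x local_cochains_closed[OF h(1)]
       by (auto intro!: alt_sum_cong)
     qed
     also have "\<dots> = \<ominus> ?t (q(x := 0))"
      using local_diff_minus[OF local_cochains_range[OF h(1)]] h(2) by simp
     finally show ?thesis .
    qed
    show "local_diff (insert x (set xs)) m (local_diff (insert x (set xs)) l G) p = \<zero>" for p
     unfolding Suc by (rule local_diff_square[OF G])
   qed
  qed
  then show ?thesis using Suc by simp
 qed
qed

fun order_pos :: "nat list => nat => nat" where
 "order_pos [] y = 0"
| "order_pos (x # xs) y = (if y = x then 1 else gap_pos 0 (order_pos xs y))"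

lemma top_value_order:
 assumes "distinct xs"
 shows "top_value xs (\<lambda>p. if p = order_pos xs then \<one> else \<zero>) = \<one>"
 using assms
proof (induction xs)
 case (Cons x xs)
 have out: "y \<notin> set ys ==> order_pos ys y = 0" for y ys
  by (induction ys) (auto simp: gap_pos_def)
 let ?e = "\<lambda>p. if p = order_pos (x # xs) then \<one> else \<zero>"
 have "integrate x (length xs) ?e v = (if v = order_pos xs then \<one> else \<zero>)" for v
 proof (cases "v x = 0")
  case True
  have "(gap_pos k \<circ> v)(x := Suc k) = order_pos (x # xs) \<longleftrightarrow> k = 0 \<and> v = order_pos xs" for k
  proof
   assume eq: "(gap_pos k \<circ> v)(x := Suc k) = order_pos (x # xs)"
   then have k: "k = 0" by (auto dest!: fun_cong[of _ _ x])
   have "v y = order_pos xs y" for y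
    using fun_cong[OF eq, of y] True out[of x xs] Cons.prems k
    by (cases "y = x") (auto simp: gap_pos_def split: if_splits)
   then show "k = 0 \<and> v = order_pos xs" using k by auto
  qed auto
  then have "integrate x (length xs) ?e v =
    alt_sum R {0..length xs} (\<lambda>k. if k = 0 \<and> v = order_pos xs then \<one> else \<zero>)"
   using True by (simp add: integrate_def)
  also have "\<dots> = [((-1 :: int) ^ 0)] \<cdot> (if v = order_pos xs then \<one> else \<zero>)"
   by (subst alt_sum_single[of 0]) auto
  finally show ?thesis by simp
 next
  case False
  then have "v \<noteq> order_pos xs" using out[of x xs] Cons.prems by auto
  then show ?thesis using False by (simp add: integrate_def)
 qed
 then have "integrate x (length xs) ?e = (\<lambda>v. if v = order_pos xs then \<one> else \<zero>)" by (rule ext)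
 then show ?case using Cons by (simp del: order_pos.simps)
qed auto

end

section \<open>Free modules and linear maps\<close>

lemma additive_map:
 assumes "abelian_group M" "abelian_group N"
  and closed: "\<And>x. x \<in> carrier M ==> e x \<in> carrier N"
  and add: "\<And>x y. x \<in> carrier M ==> y \<in> carrier M ==> e (x \<oplus>\<^bsub>M\<^esub> y) = e x \<oplus>\<^bsub>N\<^esub> e y"
 shows additive_map_zero: "e \<zero>\<^bsub>M\<^esub> = \<zero>\<^bsub>N\<^esub>"
  and additive_map_minus: "x \<in> carrier M ==> e (\<ominus>\<^bsub>M\<^esub> x) = \<ominus>\<^bsub>N\<^esub> e x"
  and additive_map_signed: "x \<in> carrier M ==>
   e ([((-1 :: int) ^ i)] \<cdot>\<^bsub>M\<^esub> x) = [((-1 :: int) ^ i)] \<cdot>\<^bsub>N\<^esub> e x"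
  and additive_map_finsum: "finite A ==> (\<And>a. a \<in> A ==> g a \<in> carrier M) ==>
   e (\<Oplus>\<^bsub>M\<^esub> a\<in>A. g a) = (\<Oplus>\<^bsub>N\<^esub> a\<in>A. e (g a))"
proof -
 interpret M: abelian_group M by fact
 interpret N: abelian_group N by fact
 show zero: "e \<zero>\<^bsub>M\<^esub> = \<zero>\<^bsub>N\<^esub>"
  using add[of "\<zero>\<^bsub>M\<^esub>" "\<zero>\<^bsub>M\<^esub>"] closed[of "\<zero>\<^bsub>M\<^esub>"]
   N.add.r_cancel_one'[of "e \<zero>\<^bsub>M\<^esub>" "e \<zero>\<^bsub>M\<^esub>"] by simp
 show minus: "e (\<ominus>\<^bsub>M\<^esub> x) = \<ominus>\<^bsub>N\<^esub> e x" if "x \<in> carrier M" for x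
 proof -
  have "e (\<ominus>\<^bsub>M\<^esub> x) \<oplus>\<^bsub>N\<^esub> e x = \<zero>\<^bsub>N\<^esub>"
   using add[of "\<ominus>\<^bsub>M\<^esub> x" x] that zero by (simp add: M.l_neg)
  then show ?thesis using N.minus_equality closed that M.a_inv_closed[OF that] by simp
 qed
 have pow: "[((-1 :: int) ^ i)] \<cdot>\<^bsub>G\<^esub> y = (if even i then y else \<ominus>\<^bsub>G\<^esub> y)"
  if "abelian_group G" "y \<in> carrier G" for i y and G :: "('g, 'h) ring_scheme"
 proof -
  interpret G: abelian_group G by fact
  show ?thesis using that(2) by (simp add: add_pow_int_lt)
 qed
 show "e ([((-1 :: int) ^ i)] \<cdot>\<^bsub>M\<^esub> x) = [((-1 :: int) ^ i)] \<cdot>\<^bsub>N\<^esub> e x" if "x \<in> carrier M"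
  using pow[OF assms(1) that] pow[OF assms(2) closed[OF that]] minus[OF that] by simp
 show "e (\<Oplus>\<^bsub>M\<^esub> a\<in>A. g a) = (\<Oplus>\<^bsub>N\<^esub> a\<in>A. e (g a))" if "finite A" "\<And>a. a \<in> A ==> g a \<in> carrier M"
  using that
 proof (induction A)
  case (insert a A)
  then have "e (finsum M g (insert a A)) = e (g a \<oplus>\<^bsub>M\<^esub> finsum M g A)"
   by (subst M.finsum_insert) auto
  also have "\<dots> = e (g a) \<oplus>\<^bsub>N\<^esub> e (finsum M g A)"
   using insert by (intro add) (auto intro!: M.finsum_closed)
  also have "\<dots> = finsum N (\<lambda>a. e (g a)) (insert a A)"
   using insert closed by (subst N.finsum_insert) auto
  finally show ?case .
 qed (simp add: zero)
qed

text \<open>The module axioms pass to a surjective image of the operations; this avoids verifying them for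
 cosets one by one.\<close>

lemma module_surjective_image:
 fixes R (structure) and M N
 assumes M: "module R M"
  and surj: "\<And>y. y \<in> carrier N ==> \<exists>x\<in>carrier M. f x = y"
  and closed: "\<And>x. x \<in> carrier M ==> f x \<in> carrier N"
  and add: "\<And>x y. [|x \<in> carrier M; y \<in> carrier M|] ==> f (x \<oplus>\<^bsub>M\<^esub> y) = f x \<oplus>\<^bsub>N\<^esub> f y"
  and smult: "\<And>c x. [|c \<in> carrier R; x \<in> carrier M|] ==> f (c \<odot>\<^bsub>M\<^esub> x) = c \<odot>\<^bsub>N\<^esub> f x"
  and zero: "f \<zero>\<^bsub>M\<^esub> = \<zero>\<^bsub>N\<^esub>"
 shows "module R N"
proof -
 interpret M: module R M by fact
 note pre = surj
 show ?thesis
 proof (rule moduleI)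
  show "cring R" by (rule M.R.is_cring)
  show "abelian_group N"
  proof (rule abelian_groupI)
   fix x y z assume "x \<in> carrier N" "y \<in> carrier N" "z \<in> carrier N"
   then obtain a b c where abc: "a \<in> carrier M" "b \<in> carrier M" "c \<in> carrier M"
     "x = f a" "y = f b" "z = f c" using surj by metis
   then show "(x \<oplus>\<^bsub>N\<^esub> y) \<oplus>\<^bsub>N\<^esub> z = x \<oplus>\<^bsub>N\<^esub> (y \<oplus>\<^bsub>N\<^esub> z)"
    by (metis add M.M.a_closed M.M.a_assoc)
  next
   fix x y assume "x \<in> carrier N" "y \<in> carrier N"
   then obtain a b where ab: "a \<in> carrier M" "b \<in> carrier M" "x = f a" "y = f b" using surj by metis
   then show "x \<oplus>\<^bsub>N\<^esub> y \<in> carrier N" "x \<oplus>\<^bsub>N\<^esub> y = y \<oplus>\<^bsub>N\<^esub> x"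
    by (metis add closed M.M.a_closed M.M.a_comm)+
  next
   fix x assume "x \<in> carrier N"
   then obtain a where a: "a \<in> carrier M" "x = f a" using surj by metis
   then show "\<zero>\<^bsub>N\<^esub> \<oplus>\<^bsub>N\<^esub> x = x" by (metis add zero M.M.zero_closed M.M.l_zero)
   show "\<exists>y\<in>carrier N. y \<oplus>\<^bsub>N\<^esub> x = \<zero>\<^bsub>N\<^esub>"
    using a by (metis add zero closed M.M.a_inv_closed M.M.l_neg)
  next
   show "\<zero>\<^bsub>N\<^esub> \<in> carrier N" by (metis zero closed M.M.zero_closed)
  qed
 next
  fix c x assume "c \<in> carrier R" "x \<in> carrier N"
  then show "c \<odot>\<^bsub>N\<^esub> x \<in> carrier N" by (metis surj smult closed M.smult_closed)
 next
  fix a b x assume R: "a \<in> carrier R" "b \<in> carrier R" and "x \<in> carrier N"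
  then obtain u where u: "u \<in> carrier M" "x = f u" using surj by metis
  show "(a \<oplus> b) \<odot>\<^bsub>N\<^esub> x = a \<odot>\<^bsub>N\<^esub> x \<oplus>\<^bsub>N\<^esub> b \<odot>\<^bsub>N\<^esub> x"
   using u R smult[of "a \<oplus> b" u] smult[of a u] smult[of b u] add[of "a \<odot>\<^bsub>M\<^esub> u" "b \<odot>\<^bsub>M\<^esub> u"]
   by (simp add: M.smult_l_distr)
  show "(a \<otimes> b) \<odot>\<^bsub>N\<^esub> x = a \<odot>\<^bsub>N\<^esub> (b \<odot>\<^bsub>N\<^esub> x)"
   using u R smult[of "a \<otimes> b" u] smult[of b u] smult[of a "b \<odot>\<^bsub>M\<^esub> u"] by (simp add: M.smult_assoc1)
 next
  fix a x y assume R: "a \<in> carrier R" and "x \<in> carrier N" "y \<in> carrier N"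
  then obtain u v where u: "u \<in> carrier M" "v \<in> carrier M" "x = f u" "y = f v" using surj by metis
  show "a \<odot>\<^bsub>N\<^esub> (x \<oplus>\<^bsub>N\<^esub> y) = a \<odot>\<^bsub>N\<^esub> x \<oplus>\<^bsub>N\<^esub> a \<odot>\<^bsub>N\<^esub> y"
   using u R add[of u v] smult[of a "u \<oplus>\<^bsub>M\<^esub> v"] smult[of a u] smult[of a v]
    add[of "a \<odot>\<^bsub>M\<^esub> u" "a \<odot>\<^bsub>M\<^esub> v"] by (simp add: M.smult_r_distr)
 next
  fix x assume "x \<in> carrier N"
  then obtain u where u: "u \<in> carrier M" "x = f u" using surj by metis
  then show "\<one> \<odot>\<^bsub>N\<^esub> x = x" using smult[of \<one> u] by simp
 qed
qed

lemma restricted_module: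
 fixes R (structure) and M
 assumes "module R M" and "H \<subseteq> carrier M" and "\<zero>\<^bsub>M\<^esub> \<in> H"
  and add: "\<And>x y. [|x \<in> H; y \<in> H|] ==> x \<oplus>\<^bsub>M\<^esub> y \<in> H"
  and smult: "\<And>c x. [|c \<in> carrier R; x \<in> H|] ==> c \<odot>\<^bsub>M\<^esub> x \<in> H"
 shows "module R (M\<lparr>carrier := H\<rparr>)"
proof -
 interpret M: module R M by fact
 have H: "x \<in> H ==> x \<in> carrier M" for x using assms(2) by auto
 have minus: "\<ominus>\<^bsub>M\<^esub> x \<in> H" if "x \<in> H" for x
  using smult[of "\<ominus> \<one>" x] that H M.smult_l_minus[of \<one> x] by simp
 show ?thesis
 proof (rule moduleI)
  show "abelian_group (M\<lparr>carrier := H\<rparr>)"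
  proof (rule abelian_groupI)
   fix x assume "x \<in> carrier (M\<lparr>carrier := H\<rparr>)"
   then show "\<exists>y\<in>carrier (M\<lparr>carrier := H\<rparr>). y \<oplus>\<^bsub>M\<lparr>carrier := H\<rparr>\<^esub> x = \<zero>\<^bsub>M\<lparr>carrier := H\<rparr>\<^esub>"
    using minus H M.M.l_neg by (intro bexI[of _ "\<ominus>\<^bsub>M\<^esub> x"]) auto
  next
   fix x y assume "x \<in> carrier (M\<lparr>carrier := H\<rparr>)" "y \<in> carrier (M\<lparr>carrier := H\<rparr>)"
   then show "x \<oplus>\<^bsub>M\<lparr>carrier := H\<rparr>\<^esub> y = y \<oplus>\<^bsub>M\<lparr>carrier := H\<rparr>\<^esub> x"
    using H M.M.a_comm by simp
  next
   fix x y z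
   assume "x \<in> carrier (M\<lparr>carrier := H\<rparr>)" "y \<in> carrier (M\<lparr>carrier := H\<rparr>)" "z \<in> carrier (M\<lparr>carrier := H\<rparr>)"
   then show "x \<oplus>\<^bsub>M\<lparr>carrier := H\<rparr>\<^esub> y \<oplus>\<^bsub>M\<lparr>carrier := H\<rparr>\<^esub> z =
     x \<oplus>\<^bsub>M\<lparr>carrier := H\<rparr>\<^esub> (y \<oplus>\<^bsub>M\<lparr>carrier := H\<rparr>\<^esub> z)"
    using H M.M.a_assoc by simp
  qed (use assms(3) add H in simp_all)
 qed (use smult H M.R.is_cring M.smult_l_distr M.smult_r_distr M.smult_assoc1 in simp_all)
qed

context cring
begin

lemma free_module_carrier:
 "finite B ==> f \<in> carrier (fmod B) \<longleftrightarrow> (\<forall>b. f b \<in> carrier R) \<and> (\<forall>b. b \<notin> B --> f b = \<zero>)"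
 by (auto simp: free_module_def intro: finite_subset[of _ B])

lemma free_module_carrier':
 "f \<in> carrier (fmod B) \<longleftrightarrow>
   (\<forall>b. f b \<in> carrier R) \<and> finite {b. f b \<noteq> \<zero>} \<and> (\<forall>b. b \<notin> B --> f b = \<zero>)"
 by (auto simp: free_module_def)

lemma free_module_module: "module R (fmod B)"
proof (rule moduleI)
 let ?F = "fmod B"
 have ops: "\<zero>\<^bsub>?F\<^esub> = (\<lambda>b. \<zero>)" "f \<oplus>\<^bsub>?F\<^esub> g = (\<lambda>b. f b \<oplus> g b)" "c \<odot>\<^bsub>?F\<^esub> f = (\<lambda>b. c \<otimes> f b)" for f g c
  by (simp_all add: free_module_def)
 have closed: "f b \<in> carrier R" if "f \<in> carrier ?F" for f b using that by (simp add: free_module_carrier')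
 have sub: "finite {b. g b \<noteq> \<zero>}" if "f \<in> carrier ?F" "\<And>b. f b = \<zero> ==> g b = \<zero>" for f g
  using that by (auto simp: free_module_carrier' elim!: rev_finite_subset)
 show "abelian_group ?F"
 proof (rule abelian_groupI)
  fix f g assume fg: "f \<in> carrier ?F" "g \<in> carrier ?F"
  then have "finite ({b. f b \<noteq> \<zero>} \<union> {b. g b \<noteq> \<zero>})" by (simp add: free_module_carrier')
  then have "finite {b. f b \<oplus> g b \<noteq> \<zero>}" by (rule rev_finite_subset) auto
  then show "f \<oplus>\<^bsub>?F\<^esub> g \<in> carrier ?F" using fg by (simp add: ops free_module_carrier')
  show "f \<oplus>\<^bsub>?F\<^esub> g = g \<oplus>\<^bsub>?F\<^esub> f" using fg closed by (simp add: ops a_comm)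
 next
  fix f assume f: "f \<in> carrier ?F"
  have "(\<lambda>b. \<ominus> f b) \<in> carrier ?F"
   using f sub[OF f, of "\<lambda>b. \<ominus> f b"] by (simp add: free_module_carrier')
  moreover have "(\<lambda>b. \<ominus> f b) \<oplus>\<^bsub>?F\<^esub> f = \<zero>\<^bsub>?F\<^esub>" using closed[OF f] by (simp add: ops l_neg)
  ultimately show "\<exists>g\<in>carrier ?F. g \<oplus>\<^bsub>?F\<^esub> f = \<zero>\<^bsub>?F\<^esub>" by blast
 next
  fix f g h assume "f \<in> carrier ?F" "g \<in> carrier ?F" "h \<in> carrier ?F"
  then show "f \<oplus>\<^bsub>?F\<^esub> g \<oplus>\<^bsub>?F\<^esub> h = f \<oplus>\<^bsub>?F\<^esub> (g \<oplus>\<^bsub>?F\<^esub> h)"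
   using closed by (simp add: ops a_assoc)
 next
  fix f assume "f \<in> carrier ?F"
  then show "\<zero>\<^bsub>?F\<^esub> \<oplus>\<^bsub>?F\<^esub> f = f" using closed by (simp add: ops)
 next
  show "\<zero>\<^bsub>?F\<^esub> \<in> carrier ?F" by (simp add: ops free_module_carrier')
 qed
 fix c f assume c: "c \<in> carrier R" and f: "f \<in> carrier ?F"
 then show "c \<odot>\<^bsub>?F\<^esub> f \<in> carrier ?F"
  using sub[OF f, of "\<lambda>b. c \<otimes> f b"] by (simp add: ops free_module_carrier')
 fix d assume d: "d \<in> carrier R"
 show "(c \<oplus> d) \<odot>\<^bsub>?F\<^esub> f = c \<odot>\<^bsub>?F\<^esub> f \<oplus>\<^bsub>?F\<^esub> d \<odot>\<^bsub>?F\<^esub> f"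
  using c d closed[OF f] by (simp add: ops l_distr)
 show "(c \<otimes> d) \<odot>\<^bsub>?F\<^esub> f = c \<odot>\<^bsub>?F\<^esub> (d \<odot>\<^bsub>?F\<^esub> f)"
  using c d closed[OF f] by (simp add: ops m_assoc)
 fix g assume g: "g \<in> carrier ?F"
 show "c \<odot>\<^bsub>?F\<^esub> (f \<oplus>\<^bsub>?F\<^esub> g) = c \<odot>\<^bsub>?F\<^esub> f \<oplus>\<^bsub>?F\<^esub> c \<odot>\<^bsub>?F\<^esub> g"
  using c closed[OF f] closed[OF g] by (simp add: ops r_distr)
next
 fix f assume "f \<in> carrier (fmod B)"
 then show "\<one> \<odot>\<^bsub>fmod B\<^esub> f = f" by (simp add: free_module_def image_subset_iff)
qed (rule is_cring)

lemma free_module_simps: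
 "\<zero>\<^bsub>fmod B\<^esub> = (\<lambda>b. \<zero>)"
 "f \<oplus>\<^bsub>fmod B\<^esub> g = (\<lambda>b. f b \<oplus> g b)"
 "c \<odot>\<^bsub>fmod B\<^esub> f = (\<lambda>b. c \<otimes> f b)"
 by (simp_all add: free_module_def)

lemma free_module_closed: "f \<in> carrier (fmod B) ==> f b \<in> carrier R"
 by (auto simp: free_module_def)

lemma free_module_range: "f \<in> carrier (fmod B) ==> range f \<subseteq> carrier R"
 by (auto simp: free_module_def)

lemma free_module_outside: "f \<in> carrier (fmod B) ==> b \<notin> B ==> f b = \<zero>"
 by (auto simp: free_module_def)

lemma free_module_abelian: "abelian_group (fmod B)"
 by (rule module.axioms(2)[OF free_module_module])

lemma free_module_eval:
 shows free_module_minus: "f \<in> carrier (fmod B) ==> (\<ominus>\<^bsub>fmod B\<^esub> f) b = \<ominus> f b"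
  and free_module_signed: "f \<in> carrier (fmod B) ==>
   ([((-1 :: int) ^ i)] \<cdot>\<^bsub>fmod B\<^esub> f) b = [((-1 :: int) ^ i)] \<cdot> f b"
  and free_module_finsum: "finite A ==> (\<And>a. a \<in> A ==> g a \<in> carrier (fmod B)) ==>
   (\<Oplus>\<^bsub>fmod B\<^esub> a\<in>A. g a) b = (\<Oplus>a\<in>A. g a b)"
 using additive_map(2,3)[OF free_module_abelian is_abelian_group, of B "\<lambda>f. f b"]
  additive_map(4)[OF free_module_abelian is_abelian_group, of B "\<lambda>f. f b" A g]
 by (auto simp: free_module_closed free_module_simps)

lemma basis_vec_closed [simp]: "bas b c \<in> carrier R"
 by (simp add: basis_vec_def)

lemma basis_vec_in: "b \<in> B ==> bas b \<in> carrier (fmod B)"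
proof -
 assume "b \<in> B"
 then have "{c. bas b c \<noteq> \<zero>} \<subseteq> {b} \<inter> B" by (auto simp: basis_vec_def)
 then show ?thesis using finite_subset[of _ "{b} \<inter> B"] by (auto simp: free_module_def)
qed

lemma lin_ext_eval:
 assumes "finite B" "\<And>b. b \<in> B ==> u b \<in> carrier (fmod C)" "\<And>b. b \<in> B ==> f b \<in> carrier R"
 shows "lin_ext (fmod C) B u f c = (\<Oplus>b\<in>B. f b \<otimes> u b c)"
proof -
 interpret F: module R "fmod C" by (rule free_module_module)
 show ?thesis
  unfolding lin_ext_def using assms
  by (subst free_module_finsum) (auto simp: free_module_simps(3) intro: F.smult_closed[simplified])
qed

lemma finsum_single_term:
 assumes "finite B" "b \<in> B" "\<And>c. c \<in> B ==> c \<noteq> b ==> h c = \<zero>" "h b \<in> carrier R"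
 shows "(\<Oplus>c\<in>B. h c) = h b"
proof -
 have "(\<Oplus>c\<in>B. h c) = (\<Oplus>c\<in>B. if b = c then h c else \<zero>)"
  using assms(3,4) by (intro finsum_cong') auto
 also have "\<dots> = h b"
 proof (rule finsum_singleton[OF assms(2,1)])
  show "h \<in> B \<rightarrow> carrier R" using assms(3,4) by (metis Pi_I zero_closed)
 qed
 finally show ?thesis .
qed

lemma lin_ext_basis:
 assumes "finite B" "inj_on u B" "\<And>b. b \<in> B ==> u b \<in> C" "\<And>b. b \<in> B ==> f b \<in> carrier R"
 shows lin_ext_basis_image: "b \<in> B ==> lin_ext (fmod C) B (\<lambda>b. bas (u b)) f (u b) = f b"
  and lin_ext_basis_outside: "c \<notin> u ` B ==> lin_ext (fmod C) B (\<lambda>b. bas (u b)) f c = \<zero>"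
proof -
 have eval: "lin_ext (fmod C) B (\<lambda>b. bas (u b)) f c =
   (\<Oplus>b\<in>B. f b \<otimes> bas (u b) c)" for c
  by (rule lin_ext_eval) (use assms in \<open>auto intro!: basis_vec_in\<close>)
 show "lin_ext (fmod C) B (\<lambda>b. bas (u b)) f (u b) = f b" if "b \<in> B"
  unfolding eval
  by (subst finsum_single_term[of _ b]) (use assms that in \<open>auto simp: basis_vec_def dest: inj_onD\<close>)
 show "lin_ext (fmod C) B (\<lambda>b. bas (u b)) f c = \<zero>" if "c \<notin> u ` B"
  unfolding eval using that assms by (intro add.finprod_one_eqI) (auto simp: basis_vec_def)
qed

end

lemma lin_homD:
 assumes "f \<in> lin_hom R M N"
 shows "x \<in> carrier M ==> f x \<in> carrier N"
  and "[|x \<in> carrier M; y \<in> carrier M|] ==> f (x \<oplus>\<^bsub>M\<^esub> y) = f x \<oplus>\<^bsub>N\<^esub> f y"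
  and "[|c \<in> carrier R; x \<in> carrier M|] ==> f (c \<odot>\<^bsub>M\<^esub> x) = c \<odot>\<^bsub>N\<^esub> f x"
  and "x \<notin> carrier M ==> f x = undefined"
 using assms by (auto simp: lin_hom_def PiE_def extensional_def)

lemma lin_homI:
 assumes "\<And>x. x \<in> carrier M ==> f x \<in> carrier N"
  and "\<And>x y. [|x \<in> carrier M; y \<in> carrier M|] ==> f (x \<oplus>\<^bsub>M\<^esub> y) = f x \<oplus>\<^bsub>N\<^esub> f y"
  and "\<And>c x. [|c \<in> carrier R; x \<in> carrier M|] ==> f (c \<odot>\<^bsub>M\<^esub> x) = c \<odot>\<^bsub>N\<^esub> f x"
  and "\<And>x. x \<notin> carrier M ==> f x = undefined"
 shows "f \<in> lin_hom R M N"
 using assms by (auto simp: lin_hom_def PiE_def extensional_def)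

lemma lin_hom_zero:
 assumes "module R M" "module R N" "f \<in> lin_hom R M N"
 shows "f \<zero>\<^bsub>M\<^esub> = \<zero>\<^bsub>N\<^esub>"
 using additive_map(1)[OF module.axioms(2)[OF assms(1)] module.axioms(2)[OF assms(2)], of f]
  lin_homD(1,2)[OF assms(3)] by blast

lemma hom_module_module:
 fixes R (structure)
 assumes "module R M" "module R N"
 shows "module R (hom_module R M N)"
proof -
 interpret M: module R M by fact
 interpret N: module R N by fact
 note D = lin_homD
 have minus: "(\<lambda>x\<in>carrier M. \<ominus>\<^bsub>N\<^esub> f x) \<in> lin_hom R M N" if "f \<in> lin_hom R M N" for f
  by (rule lin_homI) (auto simp: D[OF that] N.M.minus_add N.M.a_comm N.smult_r_minus)
 show ?thesis
 proof (rule moduleI)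
  show "abelian_group (hom_module R M N)"
  proof (rule abelian_groupI)
   fix f assume f: "f \<in> carrier (hom_module R M N)"
   show "\<exists>g\<in>carrier (hom_module R M N). g \<oplus>\<^bsub>hom_module R M N\<^esub> f = \<zero>\<^bsub>hom_module R M N\<^esub>"
    using f D(1)[of f R M N] by (intro bexI[of _ "\<lambda>x\<in>carrier M. \<ominus>\<^bsub>N\<^esub> f x"])
     (auto simp: hom_module_def N.M.l_neg intro!: minus restrict_ext)
   show "\<zero>\<^bsub>hom_module R M N\<^esub> \<oplus>\<^bsub>hom_module R M N\<^esub> f = f"
    using f D[of f R M N] by (auto simp: hom_module_def intro!: ext)
  next
   fix f g assume fg: "f \<in> carrier (hom_module R M N)" "g \<in> carrier (hom_module R M N)"
   then show "f \<oplus>\<^bsub>hom_module R M N\<^esub> g \<in> carrier (hom_module R M N)"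
    using D[of f R M N] D[of g R M N]
    by (auto simp: hom_module_def N.M.a_ac N.smult_r_distr intro!: lin_homI)
   show "f \<oplus>\<^bsub>hom_module R M N\<^esub> g = g \<oplus>\<^bsub>hom_module R M N\<^esub> f"
    using fg D[of f R M N] D[of g R M N] by (auto simp: hom_module_def N.M.a_comm intro!: restrict_ext)
   fix h assume h: "h \<in> carrier (hom_module R M N)"
   show "f \<oplus>\<^bsub>hom_module R M N\<^esub> g \<oplus>\<^bsub>hom_module R M N\<^esub> h =
     f \<oplus>\<^bsub>hom_module R M N\<^esub> (g \<oplus>\<^bsub>hom_module R M N\<^esub> h)"
    using fg h D[of f R M N] D[of g R M N] D[of h R M N]
    by (auto simp: hom_module_def N.M.a_assoc intro!: restrict_ext)
  next
   show "\<zero>\<^bsub>hom_module R M N\<^esub> \<in> carrier (hom_module R M N)"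
    by (auto simp: hom_module_def intro!: lin_homI)
  qed
 next
  fix a f assume f: "a \<in> carrier R" "f \<in> carrier (hom_module R M N)"
  then show "a \<odot>\<^bsub>hom_module R M N\<^esub> f \<in> carrier (hom_module R M N)"
   using D[of f R M N] by (auto simp: hom_module_def N.smult_r_distr N.smult_assoc1[symmetric] M.R.m_comm
     intro!: lin_homI)
  fix b assume b: "b \<in> carrier R"
  show "(a \<oplus> b) \<odot>\<^bsub>hom_module R M N\<^esub> f =
    a \<odot>\<^bsub>hom_module R M N\<^esub> f \<oplus>\<^bsub>hom_module R M N\<^esub> b \<odot>\<^bsub>hom_module R M N\<^esub> f"
   using f b D[of f R M N] by (auto simp: hom_module_def N.smult_l_distr intro!: restrict_ext)
  show "(a \<otimes> b) \<odot>\<^bsub>hom_module R M N\<^esub> f = a \<odot>\<^bsub>hom_module R M N\<^esub> (b \<odot>\<^bsub>hom_module R M N\<^esub> f)"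
   using f b D[of f R M N] by (auto simp: hom_module_def N.smult_assoc1 intro!: restrict_ext)
 next
  fix a f g assume f: "a \<in> carrier R" "f \<in> carrier (hom_module R M N)" "g \<in> carrier (hom_module R M N)"
  then show "a \<odot>\<^bsub>hom_module R M N\<^esub> (f \<oplus>\<^bsub>hom_module R M N\<^esub> g) =
    a \<odot>\<^bsub>hom_module R M N\<^esub> f \<oplus>\<^bsub>hom_module R M N\<^esub> a \<odot>\<^bsub>hom_module R M N\<^esub> g"
   using D[of f R M N] D[of g R M N] by (auto simp: hom_module_def N.smult_r_distr intro!: restrict_ext)
 next
  fix f assume f: "f \<in> carrier (hom_module R M N)"
  then show "\<one> \<odot>\<^bsub>hom_module R M N\<^esub> f = f"
   using D[of f R M N] by (auto simp: hom_module_def intro!: ext)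
 qed (rule M.R.is_cring)
qed

section \<open>Quotient modules and morphisms of species\<close>

lemma coset_simps:
 fixes M (structure)
 shows "H +>\<^bsub>M\<^esub> x = {h \<oplus>\<^bsub>M\<^esub> x | h. h \<in> H}"
  and "a_rcosets\<^bsub>M\<^esub> H = {H +>\<^bsub>M\<^esub> x | x. x \<in> carrier M}"
  and "Y <+>\<^bsub>M\<^esub> Z = {y \<oplus>\<^bsub>M\<^esub> z | y z. y \<in> Y \<and> z \<in> Z}"
 by (auto simp: a_r_coset_def' A_RCOSETS_def' set_add_def')

text \<open>The hypotheses say that \<open>H\<close> is a submodule. They are stated elementwise, as this is the form in
 which they are known for cocycles and coboundaries.\<close>

locale quotient_module = module R M
 for R :: "('k, 'r) ring_scheme" (structure) and M :: "('k, 'a) module" (structure) +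
 fixes H :: "'a set"
 assumes H_subset: "H \<subseteq> carrier M" and H_zero: "\<zero>\<^bsub>M\<^esub> \<in> H"
  and H_add: "\<And>x y. [|x \<in> H; y \<in> H|] ==> x \<oplus>\<^bsub>M\<^esub> y \<in> H"
  and H_smult: "\<And>c x. [|c \<in> carrier R; x \<in> H|] ==> c \<odot>\<^bsub>M\<^esub> x \<in> H"
begin

lemma H_closed: "x \<in> H ==> x \<in> carrier M"
 using H_subset by auto

lemma H_minus: "x \<in> H ==> \<ominus>\<^bsub>M\<^esub> x \<in> H"
 using H_smult[of "\<ominus> \<one>" x] smult_l_minus[of \<one> x] H_closed by simp

lemma mem_coset:
 assumes "x \<in> carrier M"
 shows "y \<in> H +>\<^bsub>M\<^esub> x \<longleftrightarrow> y \<in> carrier M \<and> y \<ominus>\<^bsub>M\<^esub> x \<in> H"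
proof
 assume "y \<in> H +>\<^bsub>M\<^esub> x"
 then obtain h where h: "h \<in> H" "y = h \<oplus>\<^bsub>M\<^esub> x" by (auto simp: coset_simps)
 then have "y \<ominus>\<^bsub>M\<^esub> x = h"
  using assms H_closed[OF h(1)] by (simp add: a_minus_def M.a_assoc M.r_neg)
 then show "y \<in> carrier M \<and> y \<ominus>\<^bsub>M\<^esub> x \<in> H" using h assms H_closed by auto
next
 assume y: "y \<in> carrier M \<and> y \<ominus>\<^bsub>M\<^esub> x \<in> H"
 then have "y = (y \<ominus>\<^bsub>M\<^esub> x) \<oplus>\<^bsub>M\<^esub> x" using assms by (simp add: a_minus_def M.a_assoc M.l_neg)
 then show "y \<in> H +>\<^bsub>M\<^esub> x" using y by (auto simp: coset_simps)
qed

lemma coset_self: "x \<in> carrier M ==> x \<in> H +>\<^bsub>M\<^esub> x"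
 by (simp add: mem_coset a_minus_def M.r_neg H_zero)

lemma coset_eq:
 assumes "x \<in> carrier M" "y \<in> carrier M"
 shows "H +>\<^bsub>M\<^esub> x = H +>\<^bsub>M\<^esub> y \<longleftrightarrow> x \<ominus>\<^bsub>M\<^esub> y \<in> H"
proof
 assume "H +>\<^bsub>M\<^esub> x = H +>\<^bsub>M\<^esub> y"
 then show "x \<ominus>\<^bsub>M\<^esub> y \<in> H" using coset_self[OF assms(1)] by (simp add: mem_coset assms)
next
 assume xy: "x \<ominus>\<^bsub>M\<^esub> y \<in> H"
 have "z \<ominus>\<^bsub>M\<^esub> x \<in> H \<longleftrightarrow> z \<ominus>\<^bsub>M\<^esub> y \<in> H" if "z \<in> carrier M" for z
 proof
  have a: "z \<ominus>\<^bsub>M\<^esub> y = (z \<ominus>\<^bsub>M\<^esub> x) \<oplus>\<^bsub>M\<^esub> (x \<ominus>\<^bsub>M\<^esub> y)"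
   using that assms by (simp add: a_minus_def M.a_assoc M.r_neg1)
  show "z \<ominus>\<^bsub>M\<^esub> y \<in> H" if "z \<ominus>\<^bsub>M\<^esub> x \<in> H" using a H_add[OF that xy] by simp
  have "z \<ominus>\<^bsub>M\<^esub> x = (z \<ominus>\<^bsub>M\<^esub> y) \<oplus>\<^bsub>M\<^esub> \<ominus>\<^bsub>M\<^esub> (x \<ominus>\<^bsub>M\<^esub> y)"
   unfolding a using that assms M.minus_closed[of z x] M.minus_closed[of x y]
   by (simp only: M.a_assoc M.r_neg M.a_inv_closed M.r_zero)
  then show "z \<ominus>\<^bsub>M\<^esub> x \<in> H" if "z \<ominus>\<^bsub>M\<^esub> y \<in> H" using H_add[OF that H_minus[OF xy]] by simp
 qed
 then show "H +>\<^bsub>M\<^esub> x = H +>\<^bsub>M\<^esub> y" by (auto simp: mem_coset assms)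
qed

lemma coset_add:
 assumes "x \<in> carrier M" "y \<in> carrier M"
 shows "(H +>\<^bsub>M\<^esub> x) <+>\<^bsub>M\<^esub> (H +>\<^bsub>M\<^esub> y) = H +>\<^bsub>M\<^esub> (x \<oplus>\<^bsub>M\<^esub> y)"
proof -
 have closed: "h \<in> H ==> h \<in> carrier M" for h by (rule H_closed)
 have eq: "(h \<oplus>\<^bsub>M\<^esub> x) \<oplus>\<^bsub>M\<^esub> (k \<oplus>\<^bsub>M\<^esub> y) = (h \<oplus>\<^bsub>M\<^esub> k) \<oplus>\<^bsub>M\<^esub> (x \<oplus>\<^bsub>M\<^esub> y)" if "h \<in> H" "k \<in> H" for h k
  using that[THEN closed] assms by (simp add: M.a_ac)
 show ?thesis
 proof (intro equalityI subsetI)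
  fix z assume "z \<in> (H +>\<^bsub>M\<^esub> x) <+>\<^bsub>M\<^esub> (H +>\<^bsub>M\<^esub> y)"
  then obtain h k where "h \<in> H" "k \<in> H" "z = (h \<oplus>\<^bsub>M\<^esub> x) \<oplus>\<^bsub>M\<^esub> (k \<oplus>\<^bsub>M\<^esub> y)"
   unfolding coset_simps by blast
  then show "z \<in> H +>\<^bsub>M\<^esub> (x \<oplus>\<^bsub>M\<^esub> y)" unfolding coset_simps using eq H_add by blast
 next
  fix z assume "z \<in> H +>\<^bsub>M\<^esub> (x \<oplus>\<^bsub>M\<^esub> y)"
  then obtain h where h: "h \<in> H" "z = h \<oplus>\<^bsub>M\<^esub> (x \<oplus>\<^bsub>M\<^esub> y)" unfolding coset_simps by blast
  then have "z = (h \<oplus>\<^bsub>M\<^esub> x) \<oplus>\<^bsub>M\<^esub> (\<zero>\<^bsub>M\<^esub> \<oplus>\<^bsub>M\<^esub> y)"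
   using eq[OF h(1) H_zero] closed by simp
  then show "z \<in> (H +>\<^bsub>M\<^esub> x) <+>\<^bsub>M\<^esub> (H +>\<^bsub>M\<^esub> y)" unfolding coset_simps using h(1) H_zero by blast
 qed
qed

lemma coset_smult:
 assumes "x \<in> carrier M" "c \<in> carrier R"
 shows "(\<Union>y\<in>H +>\<^bsub>M\<^esub> x. H +>\<^bsub>M\<^esub> (c \<odot>\<^bsub>M\<^esub> y)) = H +>\<^bsub>M\<^esub> (c \<odot>\<^bsub>M\<^esub> x)"
proof -
 have "H +>\<^bsub>M\<^esub> (c \<odot>\<^bsub>M\<^esub> y) = H +>\<^bsub>M\<^esub> (c \<odot>\<^bsub>M\<^esub> x)" if "y \<in> H +>\<^bsub>M\<^esub> x" for y
 proof -
  have y: "y \<in> carrier M" "y \<ominus>\<^bsub>M\<^esub> x \<in> H" using that assms by (auto simp: mem_coset)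
  have "c \<odot>\<^bsub>M\<^esub> y \<ominus>\<^bsub>M\<^esub> c \<odot>\<^bsub>M\<^esub> x = c \<odot>\<^bsub>M\<^esub> (y \<ominus>\<^bsub>M\<^esub> x)"
   using y(1) assms by (simp add: a_minus_def smult_r_distr smult_r_minus)
  then show ?thesis using H_smult[OF assms(2) y(2)] y(1) assms by (subst coset_eq) auto
 qed
 then show ?thesis using coset_self[OF assms(1)] by blast
qed

lemma coset_zero: "H +>\<^bsub>M\<^esub> \<zero>\<^bsub>M\<^esub> = H"
 using H_closed by (force simp: coset_simps)

lemma quot_module_simps:
 "carrier (quot_module M H) = {H +>\<^bsub>M\<^esub> x | x. x \<in> carrier M}"
 "\<zero>\<^bsub>quot_module M H\<^esub> = H +>\<^bsub>M\<^esub> \<zero>\<^bsub>M\<^esub>"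
 "[|x \<in> carrier M; y \<in> carrier M|] ==>
  (H +>\<^bsub>M\<^esub> x) \<oplus>\<^bsub>quot_module M H\<^esub> (H +>\<^bsub>M\<^esub> y) = H +>\<^bsub>M\<^esub> (x \<oplus>\<^bsub>M\<^esub> y)"
 "[|x \<in> carrier M; c \<in> carrier R|] ==>
  c \<odot>\<^bsub>quot_module M H\<^esub> (H +>\<^bsub>M\<^esub> x) = H +>\<^bsub>M\<^esub> (c \<odot>\<^bsub>M\<^esub> x)"
proof -
 show "\<zero>\<^bsub>quot_module M H\<^esub> = H +>\<^bsub>M\<^esub> \<zero>\<^bsub>M\<^esub>" by (simp add: quot_module_def coset_zero)
qed (simp_all add: quot_module_def coset_simps(2) coset_add coset_smult)

lemma quot_module_module: "module R (quot_module M H)"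
 by (rule module_surjective_image[OF module_axioms, of _ "\<lambda>x. H +>\<^bsub>M\<^esub> x"])
  (auto simp: quot_module_simps)

end

text \<open>The isomorphism goes against the direction of \<open>f\<close>: it maps a coset to its preimage, which is again
 a coset by the hypotheses on kernel and image. In this way no representatives have to be chosen.\<close>

lemma quot_module_iso:
 fixes R (structure) and f
 assumes M: "quotient_module R M B" and N: "quotient_module R N C"
  and closed: "\<And>a. a \<in> carrier N ==> f a \<in> carrier M"
  and add: "\<And>a b. [|a \<in> carrier N; b \<in> carrier N|] ==> f (a \<oplus>\<^bsub>N\<^esub> b) = f a \<oplus>\<^bsub>M\<^esub> f b"
  and smult: "\<And>c a. [|c \<in> carrier R; a \<in> carrier N|] ==> f (c \<odot>\<^bsub>N\<^esub> a) = c \<odot>\<^bsub>M\<^esub> f a"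
  and kernel: "\<And>a. a \<in> carrier N ==> f a \<in> B \<longleftrightarrow> a \<in> C"
  and surj: "\<And>z. z \<in> carrier M ==> \<exists>a\<in>carrier N. z \<ominus>\<^bsub>M\<^esub> f a \<in> B"
 shows "\<exists>h. h \<in> lin_iso R (quot_module M B) (quot_module N C)"
proof -
 interpret M: quotient_module R M B by fact
 interpret N: quotient_module R N C by fact
 have minus: "f (a \<ominus>\<^bsub>N\<^esub> b) = f a \<ominus>\<^bsub>M\<^esub> f b" if "a \<in> carrier N" "b \<in> carrier N" for a b
  using additive_map(2)[OF module.axioms(2)[OF N.module_axioms] module.axioms(2)[OF M.module_axioms] closed add] that add
  by (simp add: a_minus_def)
 define h where "h = (\<lambda>Y\<in>carrier (quot_module M B). {a \<in> carrier N. f a \<in> Y})"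
 have cos: "B +>\<^bsub>M\<^esub> f a \<in> carrier (quot_module M B)" if "a \<in> carrier N" for a
  using closed[OF that] by (auto simp: M.quot_module_simps)
 have h: "h (B +>\<^bsub>M\<^esub> f a) = C +>\<^bsub>N\<^esub> a" if "a \<in> carrier N" for a
  using cos[OF that] that closed
  by (auto simp: h_def M.mem_coset N.mem_coset minus[symmetric] kernel)
 have all: "\<exists>a\<in>carrier N. Y = B +>\<^bsub>M\<^esub> f a" if Y: "Y \<in> carrier (quot_module M B)" for Y
 proof -
  obtain z where z: "z \<in> carrier M" "Y = B +>\<^bsub>M\<^esub> z" using Y by (auto simp: M.quot_module_simps)
  obtain a where "a \<in> carrier N" "z \<ominus>\<^bsub>M\<^esub> f a \<in> B" using surj[OF z(1)] by blast
  then show ?thesis using z closed by (auto simp: M.coset_eq)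
 qed
 have "h \<in> lin_hom R (quot_module M B) (quot_module N C)"
 proof (rule lin_homI)
  fix Y assume "Y \<in> carrier (quot_module M B)"
  then obtain a where a: "a \<in> carrier N" "Y = B +>\<^bsub>M\<^esub> f a" using all by blast
  then show "h Y \<in> carrier (quot_module N C)" by (auto simp: h N.quot_module_simps)
  show "h (c \<odot>\<^bsub>quot_module M B\<^esub> Y) = c \<odot>\<^bsub>quot_module N C\<^esub> h Y" if "c \<in> carrier R" for c
   using a that closed h by (simp add: M.quot_module_simps N.quot_module_simps smult[symmetric])
  fix Z assume "Z \<in> carrier (quot_module M B)"
  then obtain b where b: "b \<in> carrier N" "Z = B +>\<^bsub>M\<^esub> f b" using all by blast
  show "h (Y \<oplus>\<^bsub>quot_module M B\<^esub> Z) = h Y \<oplus>\<^bsub>quot_module N C\<^esub> h Z"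
   using a b closed h by (simp add: M.quot_module_simps N.quot_module_simps add[symmetric])
 qed (simp add: h_def)
 moreover have "bij_betw h (carrier (quot_module M B)) (carrier (quot_module N C))"
 proof (rule bij_betwI')
  fix Y Z assume "Y \<in> carrier (quot_module M B)" "Z \<in> carrier (quot_module M B)"
  then obtain a b where ab: "a \<in> carrier N" "Y = B +>\<^bsub>M\<^esub> f a" "b \<in> carrier N" "Z = B +>\<^bsub>M\<^esub> f b"
   using all by metis
  then show "h Y = h Z \<longleftrightarrow> Y = Z"
   using closed by (simp add: h M.coset_eq N.coset_eq minus[symmetric] kernel)
 next
  fix Y assume "Y \<in> carrier (quot_module M B)"
  then obtain a where a: "a \<in> carrier N" "Y = B +>\<^bsub>M\<^esub> f a" using all by blast
  then show "h Y \<in> carrier (quot_module N C)" by (auto simp: h N.quot_module_simps)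
 next
  fix W assume "W \<in> carrier (quot_module N C)"
  then obtain a where "a \<in> carrier N" "W = C +>\<^bsub>N\<^esub> a" by (auto simp: N.quot_module_simps)
  then show "\<exists>Y\<in>carrier (quot_module M B). W = h Y" using h cos by metis
 qed
 ultimately show ?thesis by (auto simp: lin_iso_def)
qed

definition linear_relabelling :: "('k, 'r) ring_scheme => ('k, 'm) species => bool" where
 "linear_relabelling R Y \<longleftrightarrow> (\<forall>I. finite I --> module R (sp_val Y I) \<and>
   (\<forall>\<sigma>. inj_on \<sigma> I --> sp_map Y I \<sigma> \<in> lin_hom R (sp_val Y I) (sp_val Y (\<sigma> ` I))))"

lemma (in species) linear_relabelling: "linear_relabelling R X"
 using val_module map_hom by (simp add: linear_relabelling_def)

lemma linear_relabellingD:
 assumes "linear_relabelling R Y" "finite I"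
 shows "module R (sp_val Y I)" "abelian_group (sp_val Y I)"
  and "inj_on \<sigma> I ==> sp_map Y I \<sigma> \<in> lin_hom R (sp_val Y I) (sp_val Y (\<sigma> ` I))"
 using assms by (auto simp: linear_relabelling_def intro: module.axioms(2))

lemma species_hom_carrier:
 "f \<in> carrier (species_hom R X Y) \<longleftrightarrow>
   (\<forall>I. finite I --> f I \<in> lin_hom R (sp_val X I) (sp_val Y I)) \<and>
   (\<forall>I. \<not> finite I --> f I = undefined) \<and>
   (\<forall>I \<sigma>. finite I --> inj_on \<sigma> I -->
    (\<forall>z\<in>carrier (sp_val X I). f (\<sigma> ` I) (sp_map X I \<sigma> z) = sp_map Y I \<sigma> (f I z)))"
 by (auto simp: species_hom_def PiE_def extensional_def Pi_def)

lemma species_homD: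
 assumes "f \<in> carrier (species_hom R X Y)" "finite I"
 shows "z \<in> carrier (sp_val X I) ==> f I z \<in> carrier (sp_val Y I)"
  and "[|z \<in> carrier (sp_val X I); w \<in> carrier (sp_val X I)|] ==>
   f I (z \<oplus>\<^bsub>sp_val X I\<^esub> w) = f I z \<oplus>\<^bsub>sp_val Y I\<^esub> f I w"
  and "[|c \<in> carrier R; z \<in> carrier (sp_val X I)|] ==>
   f I (c \<odot>\<^bsub>sp_val X I\<^esub> z) = c \<odot>\<^bsub>sp_val Y I\<^esub> f I z"
  and "[|inj_on \<sigma> I; z \<in> carrier (sp_val X I)|] ==>
   f (\<sigma> ` I) (sp_map X I \<sigma> z) = sp_map Y I \<sigma> (f I z)"
  and "f I \<in> lin_hom R (sp_val X I) (sp_val Y I)"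
 using assms lin_homD[of "f I" R "sp_val X I" "sp_val Y I"] by (auto simp: species_hom_carrier)

lemma (in species) species_homI:
 assumes "\<And>I z. [|finite I; z \<in> carrier (sp_val X I)|] ==> f I z \<in> carrier (sp_val Y I)"
  and "\<And>I z w. [|finite I; z \<in> carrier (sp_val X I); w \<in> carrier (sp_val X I)|] ==>
   f I (z \<oplus>\<^bsub>sp_val X I\<^esub> w) = f I z \<oplus>\<^bsub>sp_val Y I\<^esub> f I w"
  and "\<And>I c z. [|finite I; c \<in> carrier R; z \<in> carrier (sp_val X I)|] ==>
   f I (c \<odot>\<^bsub>sp_val X I\<^esub> z) = c \<odot>\<^bsub>sp_val Y I\<^esub> f I z"
  and "\<And>I \<sigma> z. [|finite I; inj_on \<sigma> I; z \<in> carrier (sp_val X I)|] ==>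
   f (\<sigma> ` I) (sp_map X I \<sigma> z) = sp_map Y I \<sigma> (f I z)"
 shows "(\<lambda>I\<in>{I. finite I}. \<lambda>z\<in>carrier (sp_val X I). f I z) \<in> carrier (species_hom R X Y)"
proof -
 have "sp_map X I \<sigma> z \<in> carrier (sp_val X (\<sigma> ` I))"
  if "finite I" "inj_on \<sigma> I" "z \<in> carrier (sp_val X I)" for I \<sigma> z
  using lin_homD(1)[OF map_hom] that by blast
 moreover have "z \<oplus>\<^bsub>sp_val X I\<^esub> w \<in> carrier (sp_val X I)"
  if "finite I" "z \<in> carrier (sp_val X I)" "w \<in> carrier (sp_val X I)" for I z w
  using abelian_groupE(1)[OF module.axioms(2)[OF val_module[OF that(1)]] that(2,3)] .
 moreover have "c \<odot>\<^bsub>sp_val X I\<^esub> z \<in> carrier (sp_val X I)"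
  if "finite I" "c \<in> carrier R" "z \<in> carrier (sp_val X I)" for I c z
  using module.smult_closed[OF val_module[OF that(1)] that(2,3)] .
 ultimately show ?thesis
  unfolding species_hom_carrier using assms by (auto intro!: lin_homI)
qed

lemma species_hom_ext:
 assumes "f \<in> carrier (species_hom R X Y)" "g \<in> carrier (species_hom R X Y)"
  and "\<And>I z. [|finite I; z \<in> carrier (sp_val X I)|] ==> f I z = g I z"
 shows "f = g"
proof (intro ext)
 fix I z
 have "finite I ==> z \<notin> carrier (sp_val X I) ==> f I z = g I z"
  using assms(1,2) lin_homD(4) by (metis species_hom_carrier)
 moreover have "infinite I ==> f I z = g I z" using assms(1,2) by (simp add: species_hom_carrier)
 ultimately show "f I z = g I z" using assms(3) by blast
qed

lemma species_hom_ops: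
 assumes "finite I" "z \<in> carrier (sp_val X I)"
 shows "(\<zero>\<^bsub>species_hom R X Y\<^esub>) I z = \<zero>\<^bsub>sp_val Y I\<^esub>"
  and "(f \<oplus>\<^bsub>species_hom R X Y\<^esub> g) I z = f I z \<oplus>\<^bsub>sp_val Y I\<^esub> g I z"
  and "(c \<odot>\<^bsub>species_hom R X Y\<^esub> f) I z = c \<odot>\<^bsub>sp_val Y I\<^esub> f I z"
 using assms by (simp_all add: species_hom_def hom_module_def)

lemma species_hom_module:
 fixes R (structure)
 assumes "species R X" "linear_relabelling R Y"
 shows "module R (species_hom R X Y)"
proof -
 interpret species R X by fact
 let ?S = "species_hom R X Y"
 note Y = linear_relabellingD[OF assms(2)]
 have mod: "module R (hom_module R (sp_val X I) (sp_val Y I))" if "finite I" for I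
  by (rule hom_module_module[OF val_module[OF that] Y(1)[OF that]])
 have X_map: "sp_map X I \<sigma> z \<in> carrier (sp_val X (\<sigma> ` I))"
  if "finite I" "inj_on \<sigma> I" "z \<in> carrier (sp_val X I)" for I \<sigma> z
  using lin_homD(1)[OF map_hom] that by blast
 have ops: "\<zero>\<^bsub>?S\<^esub> I = \<zero>\<^bsub>hom_module R (sp_val X I) (sp_val Y I)\<^esub>"
   "(f \<oplus>\<^bsub>?S\<^esub> g) I = f I \<oplus>\<^bsub>hom_module R (sp_val X I) (sp_val Y I)\<^esub> g I"
   "(c \<odot>\<^bsub>?S\<^esub> f) I = c \<odot>\<^bsub>hom_module R (sp_val X I) (sp_val Y I)\<^esub> f I" if "finite I" for f g c I
  using that by (simp_all add: species_hom_def)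
 have undef: "\<zero>\<^bsub>?S\<^esub> I = undefined" "(f \<oplus>\<^bsub>?S\<^esub> g) I = undefined" "(c \<odot>\<^bsub>?S\<^esub> f) I = undefined"
  if "infinite I" for f g c I
  using that by (simp_all add: species_hom_def)
 have car: "f I \<in> carrier (hom_module R (sp_val X I) (sp_val Y I))"
  if "f \<in> carrier ?S" "finite I" for f I
  using that by (simp add: species_hom_carrier hom_module_def)
 have zero: "\<zero>\<^bsub>?S\<^esub> \<in> carrier ?S"
  unfolding species_hom_carrier
 proof (intro conjI allI impI ballI)
  fix I :: "nat set" assume I: "finite I"
  interpret H: module R "hom_module R (sp_val X I) (sp_val Y I)" by (rule mod[OF I])
  show "\<zero>\<^bsub>?S\<^esub> I \<in> lin_hom R (sp_val X I) (sp_val Y I)"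
   using H.M.zero_closed unfolding ops(1)[OF I] unfolding hom_module_def by simp
  fix \<sigma> :: "nat => nat" and z assume s: "inj_on \<sigma> I" "z \<in> carrier (sp_val X I)"
  have J: "finite (\<sigma> ` I)" using I by simp
  show "\<zero>\<^bsub>?S\<^esub> (\<sigma> ` I) (sp_map X I \<sigma> z) = sp_map Y I \<sigma> (\<zero>\<^bsub>?S\<^esub> I z)"
   using lin_hom_zero[OF Y(1)[OF I] Y(1)[OF J] Y(3)[OF I s(1)]] X_map[OF I s]
   by (simp add: species_hom_ops(1)[OF I s(2)] species_hom_ops(1)[OF J])
 qed (simp add: undef)
 have add: "f \<oplus>\<^bsub>?S\<^esub> g \<in> carrier ?S" if fg: "f \<in> carrier ?S" "g \<in> carrier ?S" for f g
  unfolding species_hom_carrier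
 proof (intro conjI allI impI ballI)
  fix I :: "nat set" assume I: "finite I"
  interpret H: module R "hom_module R (sp_val X I) (sp_val Y I)" by (rule mod[OF I])
  show "(f \<oplus>\<^bsub>?S\<^esub> g) I \<in> lin_hom R (sp_val X I) (sp_val Y I)"
   using H.M.a_closed[OF car[OF fg(1) I] car[OF fg(2) I]] unfolding ops(2)[OF I] by (simp add: hom_module_def)
  fix \<sigma> :: "nat => nat" and z assume s: "inj_on \<sigma> I" "z \<in> carrier (sp_val X I)"
  have J: "finite (\<sigma> ` I)" using I by simp
  show "(f \<oplus>\<^bsub>?S\<^esub> g) (\<sigma> ` I) (sp_map X I \<sigma> z) = sp_map Y I \<sigma> ((f \<oplus>\<^bsub>?S\<^esub> g) I z)"
   using lin_homD(2)[OF Y(3)[OF I s(1)]] species_homD(1,4)[OF fg(1) I] species_homD(1,4)[OF fg(2) I] s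
   by (simp add: species_hom_ops(2)[OF I s(2)] species_hom_ops(2)[OF J X_map[OF I s]])
 qed (simp add: undef)
 have smult: "c \<odot>\<^bsub>?S\<^esub> f \<in> carrier ?S" if c: "c \<in> carrier R" and f: "f \<in> carrier ?S" for c f
  unfolding species_hom_carrier
 proof (intro conjI allI impI ballI)
  fix I :: "nat set" assume I: "finite I"
  interpret H: module R "hom_module R (sp_val X I) (sp_val Y I)" by (rule mod[OF I])
  show "(c \<odot>\<^bsub>?S\<^esub> f) I \<in> lin_hom R (sp_val X I) (sp_val Y I)"
   using H.smult_closed[OF c car[OF f I]] unfolding ops(3)[OF I] by (simp add: hom_module_def)
  fix \<sigma> :: "nat => nat" and z assume s: "inj_on \<sigma> I" "z \<in> carrier (sp_val X I)"
  have J: "finite (\<sigma> ` I)" using I by simp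
  show "(c \<odot>\<^bsub>?S\<^esub> f) (\<sigma> ` I) (sp_map X I \<sigma> z) = sp_map Y I \<sigma> ((c \<odot>\<^bsub>?S\<^esub> f) I z)"
   using lin_homD(3)[OF Y(3)[OF I s(1)] c] species_homD(1,4)[OF f I] s
   by (simp add: species_hom_ops(3)[OF I s(2)] species_hom_ops(3)[OF J X_map[OF I s]])
 qed (simp add: undef)
 have ext: "f = g" if "\<And>I. finite I ==> f I = g I" "\<And>I. infinite I ==> f I = undefined"
  "\<And>I. infinite I ==> g I = undefined" for f g :: "nat set => _ => _"
  using that by (metis ext)
 have undef': "f I = undefined" if "f \<in> carrier ?S" "infinite I" for f I
  using that by (simp add: species_hom_carrier)
 note H = mod[THEN module.axioms(2)]
 show ?thesis
 proof (rule moduleI)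
  show "abelian_group ?S"
  proof (rule abelian_groupI)
   fix f g h assume fgh: "f \<in> carrier ?S" "g \<in> carrier ?S" "h \<in> carrier ?S"
   show "f \<oplus>\<^bsub>?S\<^esub> g \<oplus>\<^bsub>?S\<^esub> h = f \<oplus>\<^bsub>?S\<^esub> (g \<oplus>\<^bsub>?S\<^esub> h)"
    by (rule ext) (simp_all add: undef ops abelian_groupE(3)[OF H] car fgh)
  next
   fix f g assume fgh: "f \<in> carrier ?S" "g \<in> carrier ?S"
   show "f \<oplus>\<^bsub>?S\<^esub> g = g \<oplus>\<^bsub>?S\<^esub> f"
    by (rule ext) (simp_all add: undef ops abelian_groupE(4)[OF H] car fgh)
  next
   fix f assume f: "f \<in> carrier ?S"
   show "\<zero>\<^bsub>?S\<^esub> \<oplus>\<^bsub>?S\<^esub> f = f"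
    by (rule ext) (simp_all add: undef undef' ops abelian_groupE(5)[OF H] car f)
   have "(\<ominus> \<one>) \<odot>\<^bsub>?S\<^esub> f \<oplus>\<^bsub>?S\<^esub> f = \<zero>\<^bsub>?S\<^esub>"
   proof (rule ext)
    fix I :: "nat set" assume I: "finite I"
    interpret H: module R "hom_module R (sp_val X I) (sp_val Y I)" by (rule mod[OF I])
    show "((\<ominus> \<one>) \<odot>\<^bsub>?S\<^esub> f \<oplus>\<^bsub>?S\<^esub> f) I = \<zero>\<^bsub>?S\<^esub> I"
     using car[OF f I] by (simp add: ops I H.smult_l_minus H.M.l_neg)
   qed (simp_all add: undef)
   then show "\<exists>g\<in>carrier ?S. g \<oplus>\<^bsub>?S\<^esub> f = \<zero>\<^bsub>?S\<^esub>" using smult[OF _ f, of "\<ominus> \<one>"] by auto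
  qed (use add zero in auto)
 next
  fix c d f assume c: "c \<in> carrier R" "d \<in> carrier R" and f: "f \<in> carrier ?S"
  show "(c \<oplus> d) \<odot>\<^bsub>?S\<^esub> f = c \<odot>\<^bsub>?S\<^esub> f \<oplus>\<^bsub>?S\<^esub> d \<odot>\<^bsub>?S\<^esub> f"
   by (rule ext) (simp_all add: undef ops module.smult_l_distr[OF mod] car f c)
  show "(c \<otimes> d) \<odot>\<^bsub>?S\<^esub> f = c \<odot>\<^bsub>?S\<^esub> (d \<odot>\<^bsub>?S\<^esub> f)"
   by (rule ext) (simp_all add: undef ops module.smult_assoc1[OF mod] car f c)
 next
  fix c f g assume c: "c \<in> carrier R" and f: "f \<in> carrier ?S" "g \<in> carrier ?S"
  show "c \<odot>\<^bsub>?S\<^esub> (f \<oplus>\<^bsub>?S\<^esub> g) = c \<odot>\<^bsub>?S\<^esub> f \<oplus>\<^bsub>?S\<^esub> c \<odot>\<^bsub>?S\<^esub> g"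
   by (rule ext) (simp_all add: undef ops module.smult_r_distr[OF mod] car f c)
 next
  fix f assume f: "f \<in> carrier ?S"
  show "\<one> \<odot>\<^bsub>?S\<^esub> f = f"
   by (rule ext) (simp_all add: undef undef' ops module.smult_one[OF mod] car f)
 qed (use smult is_cring in auto)
qed

lemma species_hom_eval:
 assumes "species R X" "linear_relabelling R Y" "finite I" "z \<in> carrier (sp_val X I)"
 shows species_hom_minus: "f \<in> carrier (species_hom R X Y) ==>
   (\<ominus>\<^bsub>species_hom R X Y\<^esub> f) I z = \<ominus>\<^bsub>sp_val Y I\<^esub> f I z"
  and species_hom_signed: "f \<in> carrier (species_hom R X Y) ==>
   ([((-1 :: int) ^ i)] \<cdot>\<^bsub>species_hom R X Y\<^esub> f) I z = [((-1 :: int) ^ i)] \<cdot>\<^bsub>sp_val Y I\<^esub> f I z"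
 using additive_map(2,3)[OF module.axioms(2)[OF species_hom_module[OF assms(1,2)]]
   linear_relabellingD(2)[OF assms(2,3)], of "\<lambda>f. f I z"] species_homD(1)[OF _ assms(3,4)]
  species_hom_ops(2)[OF assms(3,4)]
 by blast+

section \<open>Decompositions as position functions\<close>

definition blocks :: "nat => (nat => nat) => nat set list" where
 "blocks n p = map (\<lambda>k. {x. p x = Suc k}) [0..<n]"

definition position_of :: "nat set list => nat => nat" where
 "position_of F x = (if x \<in> \<Union> (set F) then Suc (LEAST k. k < length F \<and> x \<in> F ! k) else 0)"

lemma positionsD:
 assumes "p \<in> positions n I"
 shows "x \<in> I ==> 1 \<le> p x" "x \<in> I ==> p x \<le> n" "x \<notin> I ==> p x = 0"
proof -
 have "if x \<in> I then 1 \<le> p x \<and> p x \<le> n else p x = 0" using assms unfolding positions_def by blast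
 then show "x \<in> I ==> 1 \<le> p x" "x \<in> I ==> p x \<le> n" "x \<notin> I ==> p x = 0" by simp_all
qed

lemma length_blocks [simp]: "length (blocks n p) = n"
 by (simp add: blocks_def)

lemma nth_blocks [simp]: "k < n ==> blocks n p ! k = {x. p x = Suc k}"
 by (simp add: blocks_def)

lemma Union_blocks: "\<Union> (set (blocks n p)) = {x. 1 \<le> p x \<and> p x \<le> n}"
proof -
 have "1 \<le> k \<and> k \<le> n \<longleftrightarrow> (\<exists>l<n. k = Suc l)" for k by (cases k) auto
 then show ?thesis by (auto simp: blocks_def)
qed

lemma blocks_in_decomps: "p \<in> positions n I ==> blocks n p \<in> decomps n I"
proof -
 assume p: "p \<in> positions n I"
 have "pairwise_disjoint (blocks n p)"
  unfolding pairwise_disjoint_def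
 proof (intro allI impI)
  fix i j assume "i < j \<and> j < length (blocks n p)"
  then show "blocks n p ! i \<inter> blocks n p ! j = {}" by auto
 qed
 moreover have "{x. 1 \<le> p x \<and> p x \<le> n} = I"
 proof (intro equalityI subsetI CollectI)
  show "x \<in> I" if "x \<in> {x. 1 \<le> p x \<and> p x \<le> n}" for x
   using that positionsD(3)[OF p, of x] by auto
  show "1 \<le> p x \<and> p x \<le> n" if "x \<in> I" for x
   using that positionsD[OF p, of x] by auto
 qed
 ultimately show ?thesis by (simp add: decomps_def Union_blocks)
qed

lemma decomps_nth_disjoint:
 assumes F: "F \<in> decomps n I" and ij: "i < n" "j < n" "x \<in> F ! i" "x \<in> F ! j"
 shows "i = j"
proof (rule ccontr)
 assume "i \<noteq> j"
 moreover have "F ! k \<inter> F ! l = {}" if "k < l" "l < n" for k l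
  using F that by (simp add: decomps_def pairwise_disjoint_def)
 ultimately show False using ij by (metis IntI empty_iff linorder_neqE_nat)
qed

lemma position_of_nth:
 assumes "F \<in> decomps n I" "k < n" "x \<in> F ! k"
 shows "position_of F x = Suc k"
proof -
 have l: "length F = n" using assms(1) by (simp add: decomps_def)
 then have "x \<in> \<Union> (set F)" using assms(2,3) by (auto intro: nth_mem)
 moreover have "(LEAST k. k < length F \<and> x \<in> F ! k) = k"
  using assms l decomps_nth_disjoint[OF assms(1)] by (intro Least_equality) (auto simp: order_le_less)
 ultimately show ?thesis by (simp add: position_of_def)
qed

lemma position_of_cases:
 assumes "F \<in> decomps n I"
 obtains "x \<notin> I" "position_of F x = 0" | k where "x \<in> I" "k < n" "x \<in> F ! k" "position_of F x = Suc k"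
proof (cases "x \<in> I")
 case False
 then have "position_of F x = 0" using assms by (simp add: position_of_def decomps_def)
 then show ?thesis using False that(1) by blast
next
 case True
 then obtain k where "k < n" "x \<in> F ! k" using assms by (auto simp: decomps_def in_set_conv_nth)
 then show ?thesis using True that(2) position_of_nth[OF assms] by blast
qed

lemma position_of_in_positions: "F \<in> decomps n I ==> position_of F \<in> positions n I"
 unfolding positions_def
proof (intro CollectI allI)
 fix x assume F: "F \<in> decomps n I"
 show "if x \<in> I then 1 \<le> position_of F x \<and> position_of F x \<le> n else position_of F x = 0"
  by (rule position_of_cases[OF F, of x]) auto
qed

lemma blocks_position_of: "F \<in> decomps n I ==> blocks n (position_of F) = F"
proof (rule nth_equalityI)
 assume F: "F \<in> decomps n I"
 show "length (blocks n (position_of F)) = length F" using F by (simp add: decomps_def)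
 fix k assume "k < length (blocks n (position_of F))"
 then have k: "k < n" by simp
 have "position_of F x = Suc k \<longleftrightarrow> x \<in> F ! k" for x
  by (rule position_of_cases[OF F, of x])
   (use F k position_of_nth[OF F k, of x] in auto)
 then show "blocks n (position_of F) ! k = F ! k" using k by auto
qed

lemma position_of_blocks:
 assumes "p \<in> positions n I"
 shows "position_of (blocks n p) = p"
proof
 fix x
 show "position_of (blocks n p) x = p x"
 proof (cases "x \<in> I")
  case True
  then obtain k where k: "p x = Suc k" "k < n"
   using positionsD(1,2)[OF assms True] by (cases "p x") auto
  then show ?thesis using position_of_nth[OF blocks_in_decomps[OF assms], of k x] by simp
 next
  case False
  have "p x = 0" using positionsD(3)[OF assms False] .
  moreover have "position_of (blocks n p) x = 0"
   by (rule position_of_cases[OF blocks_in_decomps[OF assms], of x]) (use False in auto)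
  ultimately show ?thesis by simp
 qed
qed

lemma positions_support:
 assumes "p \<in> positions n I"
 shows "{x. p x \<noteq> 0} = I"
proof (intro equalityI subsetI CollectI)
 show "x \<in> I" if "x \<in> {x. p x \<noteq> 0}" for x
  using that positionsD(3)[OF assms, of x] by auto
 show "p x \<noteq> 0" if "x \<in> I" for x
  using that positionsD(1)[OF assms, of x] by auto
qed

lemma finite_decomps: "finite I ==> finite (decomps n I)"
 by (rule finite_subset[OF _ finite_lists_length_eq[of "Pow I" n]]) (auto simp: decomps_def)

lemma decomps_block_subset: "F \<in> decomps n I ==> G \<in> set F ==> G \<subseteq> I"
 by (auto simp: decomps_def)

lemma relabel_decomps:
 assumes "inj_on \<sigma> I" "F \<in> decomps n I"
 shows "map (image \<sigma>) F \<in> decomps n (\<sigma> ` I)"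
proof -
 have "(\<sigma> ` (F ! i)) \<inter> (\<sigma> ` (F ! j)) = {}" if "i < j" "j < length F" for i j
 proof -
  have "F ! i \<subseteq> I" "F ! j \<subseteq> I" using assms(2) that by (auto simp: decomps_def)
  moreover have "F ! i \<inter> F ! j = {}" using assms(2) that by (simp add: decomps_def pairwise_disjoint_def)
  ultimately show ?thesis using inj_on_image_Int[OF assms(1), of "F ! i" "F ! j"] by simp
 qed
 then show ?thesis using assms(2) by (auto simp: decomps_def pairwise_disjoint_def)
qed

lemma relabel_compositions:
 assumes "inj_on \<sigma> I" "F \<in> compositions I"
 shows "map (image \<sigma>) F \<in> compositions (\<sigma> ` I)"
 using relabel_decomps[OF assms(1), of F "length F"] assms(2) by (auto simp: compositions_def decomps_def)

lemma inj_relabel: "inj_on \<sigma> I ==> inj_on (map (image \<sigma>)) {F. \<Union> (set F) \<subseteq> I}"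
proof (rule inj_onI)
 fix F G assume s: "inj_on \<sigma> I" "F \<in> {F. \<Union> (set F) \<subseteq> I}" "G \<in> {F. \<Union> (set F) \<subseteq> I}"
  "map (image \<sigma>) F = map (image \<sigma>) G"
 have "inj_on (image \<sigma>) (Pow I)" by (rule inj_on_image_Pow[OF s(1)])
 then have "inj_on (image \<sigma>) (set F \<union> set G)" by (rule inj_on_subset) (use s in auto)
 then show "F = G" using s(4) inj_on_map_eq_map by blast
qed

lemma relabel_surj:
 assumes "inj_on \<sigma> I" "\<Union> (set G) \<subseteq> \<sigma> ` I"
 shows "map (image \<sigma>) (map (\<lambda>A. {i \<in> I. \<sigma> i \<in> A}) G) = G"
proof -
 have "\<sigma> ` {i \<in> I. \<sigma> i \<in> A} = A" if "A \<in> set G" for A using that assms by auto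
 then show ?thesis by (simp add: map_idI)
qed

lemma relabel_decomps_image:
 assumes "inj_on \<sigma> I"
 shows "map (image \<sigma>) ` decomps n I = decomps n (\<sigma> ` I)"
proof (intro equalityI subsetI)
 fix G assume G: "G \<in> decomps n (\<sigma> ` I)"
 let ?F = "map (\<lambda>A. {i \<in> I. \<sigma> i \<in> A}) G"
 have "map (image \<sigma>) ?F = G" using relabel_surj[OF assms, of G] G by (simp add: decomps_def)
 moreover have "?F \<in> decomps n I"
 proof -
  have "?F ! i \<inter> ?F ! j = {}" if "i < j" "j < length ?F" for i j
  proof -
   have "G ! i \<inter> G ! j = {}" using G that by (simp add: decomps_def pairwise_disjoint_def)
   then show ?thesis using that by auto
  qed
  moreover have "\<Union> (set ?F) = I"
  proof (intro equalityI subsetI)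
   fix i assume "i \<in> I"
   then have "\<sigma> i \<in> \<Union> (set G)" using G by (simp add: decomps_def)
   then show "i \<in> \<Union> (set ?F)" using \<open>i \<in> I\<close> by auto
  qed auto
  ultimately show ?thesis using G by (simp add: decomps_def pairwise_disjoint_def)
 qed
 ultimately show "G \<in> map (image \<sigma>) ` decomps n I" by (intro rev_image_eqI[of ?F]) simp_all
qed (use relabel_decomps[OF assms] in auto)

lemma relabel_compositions_image:
 assumes "inj_on \<sigma> I"
 shows "map (image \<sigma>) ` compositions I = compositions (\<sigma> ` I)"
proof (intro equalityI subsetI)
 fix G assume G: "G \<in> compositions (\<sigma> ` I)"
 then have "G \<in> map (image \<sigma>) ` decomps (length G) I"
  unfolding relabel_decomps_image[OF assms] by (simp add: decomps_def compositions_def)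
 then obtain F where "F \<in> decomps (length G) I" "G = map (image \<sigma>) F" by auto
 then show "G \<in> map (image \<sigma>) ` compositions I"
  using G by (auto simp: decomps_def compositions_def intro!: image_eqI[of _ _ F])
qed (use relabel_compositions[OF assms] in auto)

lemma (in cring) lin_ext_basis_hom:
 assumes "finite B" "inj_on u B" "u ` B = C"
 shows "(\<lambda>f\<in>carrier (free_module R B). lin_ext (free_module R C) B (\<lambda>b. basis_vec R (u b)) f)
  \<in> lin_hom R (free_module R B) (free_module R C)"
proof -
 let ?L = "lin_ext (free_module R C) B (\<lambda>b. basis_vec R (u b))"
 have uC: "\<And>b. b \<in> B ==> u b \<in> C" using assms by auto
 note im = lin_ext_basis_image[OF assms(1,2) uC]
 note out = lin_ext_basis_outside[OF assms(1,2) uC]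
 have fin: "finite C" using assms by auto
 interpret F: module R "free_module R B" by (rule free_module_module)
 interpret G: module R "free_module R C" by (rule free_module_module)
 have eqI: "?L f = g" if "f \<in> carrier (free_module R B)" "\<And>c. c \<notin> C ==> g c = \<zero>"
  "\<And>b. b \<in> B ==> g (u b) = f b" for f g
 proof
  fix c show "?L f c = g c"
  proof (cases "c \<in> C")
   case True
   then show ?thesis using that im[of f] assms(3) free_module_closed[OF that(1)] by auto
  next
   case False
   then show ?thesis using that out[of f] assms(3) free_module_closed[OF that(1)] by auto
  qed
 qed
 have closed: "?L f \<in> carrier (free_module R C)" if "f \<in> carrier (free_module R B)" for f
  unfolding free_module_carrier[OF fin]
 proof (intro conjI allI impI)
  fix c
  show "?L f c \<in> carrier R"
   using im[of f] out[of f] free_module_closed[OF that] assms(3) by (cases "c \<in> C") auto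
  show "c \<notin> C ==> ?L f c = \<zero>" using out[of f] free_module_closed[OF that] assms(3) by simp
 qed
 show ?thesis
 proof (rule lin_homI)
  fix f g assume fg: "f \<in> carrier (free_module R B)" "g \<in> carrier (free_module R B)"
  have "?L (f \<oplus>\<^bsub>free_module R B\<^esub> g) = ?L f \<oplus>\<^bsub>free_module R C\<^esub> ?L g"
  proof (rule eqI)
   show "f \<oplus>\<^bsub>free_module R B\<^esub> g \<in> carrier (free_module R B)" using fg by simp
   show "(?L f \<oplus>\<^bsub>free_module R C\<^esub> ?L g) c = \<zero>" if "c \<notin> C" for c
    using that out[of f] out[of g] fg[THEN free_module_closed] assms(3) by (simp add: free_module_simps)
   show "(?L f \<oplus>\<^bsub>free_module R C\<^esub> ?L g) (u b) = (f \<oplus>\<^bsub>free_module R B\<^esub> g) b" if "b \<in> B" for b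
    using im[OF _ _ that, of f] im[OF _ _ that, of g] fg[THEN free_module_closed] by (simp add: free_module_simps)
  qed
  then show "(\<lambda>f\<in>carrier (free_module R B). ?L f) (f \<oplus>\<^bsub>free_module R B\<^esub> g) =
    (\<lambda>f\<in>carrier (free_module R B). ?L f) f \<oplus>\<^bsub>free_module R C\<^esub> (\<lambda>f\<in>carrier (free_module R B). ?L f) g"
   using fg by simp
 next
  fix c f assume f: "c \<in> carrier R" "f \<in> carrier (free_module R B)"
  have "?L (c \<odot>\<^bsub>free_module R B\<^esub> f) = c \<odot>\<^bsub>free_module R C\<^esub> ?L f"
  proof (rule eqI)
   show "c \<odot>\<^bsub>free_module R B\<^esub> f \<in> carrier (free_module R B)" using f by simp
   show "(c \<odot>\<^bsub>free_module R C\<^esub> ?L f) d = \<zero>" if "d \<notin> C" for d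
    using that out[of f] f(1) f(2)[THEN free_module_closed] assms(3) by (simp add: free_module_simps)
   show "(c \<odot>\<^bsub>free_module R C\<^esub> ?L f) (u b) = (c \<odot>\<^bsub>free_module R B\<^esub> f) b" if "b \<in> B" for b
    using im[OF _ _ that, of f] f(2)[THEN free_module_closed] by (simp add: free_module_simps)
  qed
  then show "(\<lambda>f\<in>carrier (free_module R B). ?L f) (c \<odot>\<^bsub>free_module R B\<^esub> f) =
    c \<odot>\<^bsub>free_module R C\<^esub> (\<lambda>f\<in>carrier (free_module R B). ?L f) f"
   using f by simp
 qed (use closed in auto)
qed

lemma (in cring) exp_power_map:
 assumes "finite I" "inj_on \<sigma> I"
 shows exp_power_map_hom: "sp_map (exp_power R n) I \<sigma> \<in>
   lin_hom R (sp_val (exp_power R n) I) (sp_val (exp_power R n) (\<sigma> ` I))"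
  and exp_power_map_relabel: "[|f \<in> carrier (free_module R (decomps n I)); F \<in> decomps n I|] ==>
   sp_map (exp_power R n) I \<sigma> f (map (image \<sigma>) F) = f F"
proof -
 have inj: "inj_on (map (image \<sigma>)) (decomps n I)"
  by (rule inj_on_subset[OF inj_relabel[OF assms(2)]]) (auto simp: decomps_def)
 show "sp_map (exp_power R n) I \<sigma> \<in>
   lin_hom R (sp_val (exp_power R n) I) (sp_val (exp_power R n) (\<sigma> ` I))"
  using lin_ext_basis_hom[OF finite_decomps[OF assms(1)] inj relabel_decomps_image[OF assms(2)]]
  by (simp add: exp_power_def)
 show "sp_map (exp_power R n) I \<sigma> f (map (image \<sigma>) F) = f F"
  if "f \<in> carrier (free_module R (decomps n I))" "F \<in> decomps n I"
  using lin_ext_basis_image[OF finite_decomps[OF assms(1)] inj relabel_decomps[OF assms(2)], of n f F]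
   that free_module_closed[OF that(1)]
  by (simp add: exp_power_def)
qed

lemma (in cring) linear_relabelling_exp_power: "linear_relabelling R (exp_power R n)"
 using exp_power_map_hom by (simp add: linear_relabelling_def) (simp add: exp_power_def free_module_module)

section \<open>The complex of a bicomodule\<close>

definition face_pos :: "nat => nat => (nat => nat) => nat => nat" where
 "face_pos n i p x = (let k = merge_pos i (p x) in if k \<le> n then k else 0)"

definition support :: "(nat => nat) => nat set" where
 "support p = {x. p x \<noteq> 0}"

lemma support_positions: "p \<in> positions n I ==> support p = I"
 using positions_support by (simp add: support_def)

lemma face_pos_subset: "support (face_pos n i p) \<subseteq> support p"
 by (auto simp: support_def face_pos_def merge_pos_def Let_def)

lemma face_pos_in_positions: "face_pos n i p \<in> positions n (support (face_pos n i p))"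
 by (auto simp: positions_def support_def face_pos_def Let_def)

lemma face_pos_face_pos:
 assumes "i < j"
 shows "face_pos n i (face_pos (Suc n) j p) = face_pos n (j - 1) (face_pos (Suc n) i p)"
 using assms by (auto simp: fun_eq_iff face_pos_def merge_pos_def Let_def)

lemma face_pos_inner:
 assumes "p \<in> positions (Suc n) I" "0 < i" "i \<le> n"
 shows "face_pos n i p = merge_pos i \<circ> p" and "support (face_pos n i p) = I"
proof -
 have b: "p x \<le> Suc n" "x \<in> I ==> 1 \<le> p x" "x \<notin> I ==> p x = 0" for x
  using positionsD[OF assms(1), of x] by (cases "x \<in> I"; simp)+
 show "face_pos n i p = merge_pos i \<circ> p"
 proof
  show "face_pos n i p x = (merge_pos i \<circ> p) x" for x
   using b(1)[of x] assms by (auto simp: face_pos_def merge_pos_def Let_def)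
 qed
 show "support (face_pos n i p) = I"
 proof (intro equalityI subsetI)
  show "x \<in> I" if "x \<in> support (face_pos n i p)" for x
   using that b(3)[of x] by (cases "x \<in> I") (auto simp: support_def face_pos_def merge_pos_def)
  show "x \<in> support (face_pos n i p)" if "x \<in> I" for x
   using b(1)[of x] b(2)[OF that] assms by (auto simp: support_def face_pos_def merge_pos_def Let_def)
 qed
qed

definition merge_blocks :: "nat => nat set list => nat set list" where
 "merge_blocks i F = take (i - 1) F @ [F ! (i - 1) \<union> F ! i] @ drop (i + 1) F"

lemma map_merge_blocks:
 "[|0 < i; i < length F|] ==> map (image \<sigma>) (merge_blocks i F) = merge_blocks i (map (image \<sigma>) F)"
 by (simp add: merge_blocks_def image_Un take_map drop_map)

lemma blocks_merge:
 assumes "0 < i" "i \<le> n"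
 shows "merge_blocks i (blocks (Suc n) p) = blocks n (merge_pos i \<circ> p)"
 unfolding merge_blocks_def
proof (rule nth_equalityI)
 let ?F = "blocks (Suc n) p"
 show "length (take (i - 1) ?F @ [?F ! (i - 1) \<union> ?F ! i] @ drop (i + 1) ?F) = length (blocks n (merge_pos i \<circ> p))"
  using assms by auto
 fix k assume "k < length (take (i - 1) ?F @ [?F ! (i - 1) \<union> ?F ! i] @ drop (i + 1) ?F)"
 then have k: "k < n" using assms by auto
 have "merge_pos i l = Suc k \<longleftrightarrow> (if k < i - 1 then l = Suc k else if k = i - 1 then l = i \<or> l = Suc i else l = Suc (Suc k))" for l
  using assms by (auto simp: merge_pos_def)
 then show "(take (i - 1) ?F @ [?F ! (i - 1) \<union> ?F ! i] @ drop (i + 1) ?F) ! k = blocks n (merge_pos i \<circ> p) ! k"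
  using assms k by (auto simp: nth_append nth_Cons' split: if_splits)
qed

lemma blocks_tl: "tl (blocks (Suc n) p) = blocks n (face_pos n 0 p)"
 by (rule nth_equalityI) (auto simp: nth_tl face_pos_def merge_pos_def Let_def split: if_splits)

lemma blocks_butlast: "butlast (blocks (Suc n) p) = blocks n (face_pos n (Suc n) p)"
 by (rule nth_equalityI) (auto simp: nth_butlast face_pos_def merge_pos_def Let_def split: if_splits)

lemma blocks_hd_last: "hd (blocks (Suc n) p) = {x. p x = 1}" "last (blocks (Suc n) p) = {x. p x = Suc n}"
 by (simp_all add: hd_conv_nth last_conv_nth flip: length_0_conv)

context exp_bicomodule
begin

text \<open>Short names for the modules and differentials attached to the fixed bicomodule.\<close>

abbreviation "XV \<equiv> sp_val X"
abbreviation "Coch \<equiv> cochains R X"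
abbreviation "Kos \<equiv> koszul R X"
abbreviation "cdiff \<equiv> cochain_diff R X lam rho"
abbreviation "kdiff \<equiv> koszul_diff R X lam rho"
abbreviation "HomEd \<equiv> species_hom R X (exp_dual R)"

lemma carrier_map:
 "[|finite I; inj_on \<sigma> I; z \<in> carrier (XV I)|] ==> sp_map X I \<sigma> z \<in> carrier (XV (\<sigma> ` I))"
 using lin_homD(1)[OF map_hom] by blast

lemma cauchy_component:
 assumes h: "h \<in> carrier (species_hom R X (cauchy_exp s X))"
  and I: "finite I" "z \<in> carrier (XV I)" and D: "D \<in> decomps2 I"
 shows "h I z D \<in> carrier (XV (s D))"
  and "w \<in> carrier (XV I) ==> h I (z \<oplus>\<^bsub>XV I\<^esub> w) D = h I z D \<oplus>\<^bsub>XV (s D)\<^esub> h I w D"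
  and "c \<in> carrier R ==> h I (c \<odot>\<^bsub>XV I\<^esub> z) D = c \<odot>\<^bsub>XV (s D)\<^esub> h I z D"
  and "inj_on \<sigma> I ==> (s = fst \<or> s = snd) ==>
   h (\<sigma> ` I) (sp_map X I \<sigma> z) (\<sigma> ` fst D, \<sigma> ` snd D) = sp_map X (s D) \<sigma> (h I z D)"
proof -
 note H = species_homD[OF h I(1)]
 show "h I z D \<in> carrier (XV (s D))"
  using H(1)[OF I(2)] D by (auto simp: cauchy_exp_def Let_def)
 show "h I (z \<oplus>\<^bsub>XV I\<^esub> w) D = h I z D \<oplus>\<^bsub>XV (s D)\<^esub> h I w D" if "w \<in> carrier (XV I)"
  using H(2)[OF I(2) that] D by (simp add: cauchy_exp_def Let_def)
 show "h I (c \<odot>\<^bsub>XV I\<^esub> z) D = c \<odot>\<^bsub>XV (s D)\<^esub> h I z D" if "c \<in> carrier R"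
  using H(3)[OF that I(2)] D by (simp add: cauchy_exp_def Let_def)
 show "h (\<sigma> ` I) (sp_map X I \<sigma> z) (\<sigma> ` fst D, \<sigma> ` snd D) = sp_map X (s D) \<sigma> (h I z D)"
  if s: "inj_on \<sigma> I" "s = fst \<or> s = snd"
 proof -
  have D': "fst D \<union> snd D = I" "fst D \<inter> snd D = {}" using D by (auto simp: decomps2_def)
  have "\<sigma> ` fst D \<inter> \<sigma> ` snd D = {}"
   using inj_on_image_Int[OF s(1), of "fst D" "snd D"] D' by auto
  then have im: "(\<sigma> ` fst D, \<sigma> ` snd D) \<in> decomps2 (\<sigma> ` I)"
   using D' by (auto simp: decomps2_def)
  have "{i \<in> I. \<sigma> i \<in> \<sigma> ` A} = A" if "A \<subseteq> I" for A using s(1) that by (auto dest: inj_onD)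
  then have "{i \<in> I. \<sigma> i \<in> \<sigma> ` fst D} = fst D" "{i \<in> I. \<sigma> i \<in> \<sigma> ` snd D} = snd D"
   using D' by auto
  moreover have "h I z \<in> carrier (sp_val (cauchy_exp s X) I)" using H(1)[OF I(2)] .
  ultimately show ?thesis
   using H(4)[OF s(1) I(2)] im by (simp add: cauchy_exp_def Let_def)
 qed
qed

lemma lquot:
 assumes "finite I" "z \<in> carrier (XV I)" "T \<subseteq> I"
 shows lquot_closed: "lquot lam I z T \<in> carrier (XV T)"
  and lquot_add: "w \<in> carrier (XV I) ==>
   lquot lam I (z \<oplus>\<^bsub>XV I\<^esub> w) T = lquot lam I z T \<oplus>\<^bsub>XV T\<^esub> lquot lam I w T"
  and lquot_smult: "c \<in> carrier R ==> lquot lam I (c \<odot>\<^bsub>XV I\<^esub> z) T = c \<odot>\<^bsub>XV T\<^esub> lquot lam I z T"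
  and lquot_map: "inj_on \<sigma> I ==>
   lquot lam (\<sigma> ` I) (sp_map X I \<sigma> z) (\<sigma> ` T) = sp_map X T \<sigma> (lquot lam I z T)"
proof -
 have D: "(I - T, T) \<in> decomps2 I" using assms(3) by (auto simp: decomps2_def)
 note C = cauchy_component[OF lam_hom assms(1,2) D]
 show "lquot lam I z T \<in> carrier (XV T)" using C(1) by (simp add: lquot_def)
 show "w \<in> carrier (XV I) ==>
   lquot lam I (z \<oplus>\<^bsub>XV I\<^esub> w) T = lquot lam I z T \<oplus>\<^bsub>XV T\<^esub> lquot lam I w T"
  using C(2) by (simp add: lquot_def)
 show "c \<in> carrier R ==> lquot lam I (c \<odot>\<^bsub>XV I\<^esub> z) T = c \<odot>\<^bsub>XV T\<^esub> lquot lam I z T"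
  using C(3) by (simp add: lquot_def)
 show "lquot lam (\<sigma> ` I) (sp_map X I \<sigma> z) (\<sigma> ` T) = sp_map X T \<sigma> (lquot lam I z T)" if "inj_on \<sigma> I"
  using C(4)[OF that] inj_on_image_set_diff[OF that, of I T] assms(3) by (simp add: lquot_def)
qed

lemma rquot:
 assumes "finite I" "z \<in> carrier (XV I)" "S \<subseteq> I"
 shows rquot_closed: "rquot rho I z S \<in> carrier (XV S)"
  and rquot_add: "w \<in> carrier (XV I) ==>
   rquot rho I (z \<oplus>\<^bsub>XV I\<^esub> w) S = rquot rho I z S \<oplus>\<^bsub>XV S\<^esub> rquot rho I w S"
  and rquot_smult: "c \<in> carrier R ==> rquot rho I (c \<odot>\<^bsub>XV I\<^esub> z) S = c \<odot>\<^bsub>XV S\<^esub> rquot rho I z S"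
  and rquot_map: "inj_on \<sigma> I ==>
   rquot rho (\<sigma> ` I) (sp_map X I \<sigma> z) (\<sigma> ` S) = sp_map X S \<sigma> (rquot rho I z S)"
proof -
 have D: "(S, I - S) \<in> decomps2 I" using assms(3) by (auto simp: decomps2_def)
 note C = cauchy_component[OF rho_hom assms(1,2) D]
 show "rquot rho I z S \<in> carrier (XV S)" using C(1) by (simp add: rquot_def)
 show "w \<in> carrier (XV I) ==>
   rquot rho I (z \<oplus>\<^bsub>XV I\<^esub> w) S = rquot rho I z S \<oplus>\<^bsub>XV S\<^esub> rquot rho I w S"
  using C(2) by (simp add: rquot_def)
 show "c \<in> carrier R ==> rquot rho I (c \<odot>\<^bsub>XV I\<^esub> z) S = c \<odot>\<^bsub>XV S\<^esub> rquot rho I z S"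
  using C(3) by (simp add: rquot_def)
 show "rquot rho (\<sigma> ` I) (sp_map X I \<sigma> z) (\<sigma> ` S) = sp_map X S \<sigma> (rquot rho I z S)" if "inj_on \<sigma> I"
  using C(4)[OF that] inj_on_image_set_diff[OF that, of I S] assms(3) by (simp add: rquot_def)
qed

lemma lquot_lquot:
 assumes "finite I" "z \<in> carrier (XV I)" "K \<subseteq> J" "J \<subseteq> I"
 shows "lquot lam J (lquot lam I z J) K = lquot lam I z K"
proof -
 have "(I - J) \<union> (J - K) \<union> K = I" "(I - J) \<inter> (J - K) = {}" "(I - J) \<inter> K = {}" "(J - K) \<inter> K = {}"
   "(J - K) \<union> K = J"
  using assms(3,4) by auto
 then show ?thesis using lam_coassoc[OF assms(1,2), of "I - J" "J - K" K] by simp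
qed

lemma rquot_rquot:
 assumes "finite I" "z \<in> carrier (XV I)" "K \<subseteq> J" "J \<subseteq> I"
 shows "rquot rho J (rquot rho I z J) K = rquot rho I z K"
proof -
 have "K \<union> (J - K) \<union> (I - J) = I" "K \<inter> (J - K) = {}" "K \<inter> (I - J) = {}" "(J - K) \<inter> (I - J) = {}"
   "K \<union> (J - K) = J"
  using assms(3,4) by auto
 then show ?thesis using rho_coassoc[OF assms(1,2), of K "J - K" "I - J"] by simp
qed

lemma lquot_rquot:
 assumes "finite I" "z \<in> carrier (XV I)" "J \<union> L = I"
 shows "lquot lam J (rquot rho I z J) (J \<inter> L) = rquot rho L (lquot lam I z L) (J \<inter> L)"
proof -
 have "(J - L) \<union> (J \<inter> L) = J" "(J \<inter> L) \<union> (L - J) = L" by auto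
 then show ?thesis
  using compatible[OF assms(1,2), of "J - L" "J \<inter> L" "L - J"] assms(3) by auto
qed

definition face_elt :: "nat => nat => 'm => (nat => nat) => 'm" where
 "face_elt n i z p = (let I = support p; J = support (face_pos n i p) in
   if i = 0 then lquot lam I z J else if i \<le> n then z else rquot rho I z J)"

text \<open>The faces of a pair \<open>(z, p)\<close>: the coactions act on \<open>z\<close> in the two outer faces. With this, the
 coefficients of \<open>d\<^sup>i \<alpha>\<close> are those of \<open>\<alpha>\<close> at a face, and \<open>\<delta> \<circ> \<delta> = 0\<close> is the simplicial identity
 \<open>face_face\<close>.\<close>

definition face :: "nat => nat => 'm \<times> (nat => nat) => 'm \<times> (nat => nat)" where
 "face n i = (\<lambda>(z, p). (face_elt n i z p, face_pos n i p))"

lemma face_elt_closed: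
 assumes "p \<in> positions (Suc n) I" "finite I" "z \<in> carrier (XV I)"
 shows "face_elt n i z p \<in> carrier (XV (support (face_pos n i p)))"
proof -
 have "support p = I" "support (face_pos n i p) \<subseteq> I"
  using support_positions[OF assms(1)] face_pos_subset[of n i p] by auto
 then show ?thesis
  using lquot_closed[OF assms(2,3)] rquot_closed[OF assms(2,3)] assms(3) face_pos_inner(2)[OF assms(1), of i]
  by (auto simp: face_elt_def Let_def)
qed

lemma face_face:
 assumes p: "p \<in> positions (Suc (Suc n)) I" and I: "finite I" and z: "z \<in> carrier (XV I)"
  and ij: "i < j" "j \<le> Suc (Suc n)"
 shows "face n i (face (Suc n) j (z, p)) = face n (j - 1) (face (Suc n) i (z, p))"
proof -
 let ?J = "support (face_pos (Suc n) j p)" and ?L = "support (face_pos (Suc n) i p)"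
 let ?K = "support (face_pos n i (face_pos (Suc n) j p))"
 have supp: "support p = I" by (rule support_positions[OF p])
 have K: "?K = support (face_pos n (j - 1) (face_pos (Suc n) i p))"
  using face_pos_face_pos[OF ij(1), of n p] by simp
 have J_sub: "?J \<subseteq> I" "?K \<subseteq> ?J" and L_sub: "?L \<subseteq> I" "?K \<subseteq> ?L"
  using face_pos_subset[of "Suc n" j p] face_pos_subset[of "Suc n" i p]
   face_pos_subset[of n i "face_pos (Suc n) j p"] face_pos_subset[of n "j - 1" "face_pos (Suc n) i p"]
  unfolding K[symmetric] supp by auto
 have inner: "?J = I" if "j \<le> Suc n"
  using face_pos_inner(2)[OF p, of j] ij that by simp
 have inner': "?L = I" if "0 < i"
  using face_pos_inner(2)[OF p, of i] ij that by simp
 have "face_elt n i (face_elt (Suc n) j z p) (face_pos (Suc n) j p) =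
   face_elt n (j - 1) (face_elt (Suc n) i z p) (face_pos (Suc n) i p)"
 proof -
  consider "i = 0" "j = 1" | "i = 0" "1 < j" "j \<le> Suc n" | "i = 0" "j = Suc (Suc n)" "1 < j"
   | "0 < i" "j \<le> Suc n" | "0 < i" "j = Suc (Suc n)" "i \<le> n" | "0 < i" "j = Suc (Suc n)" "i = Suc n"
   using ij by linarith
  then show ?thesis
  proof cases
   case 1
   then show ?thesis
    using inner lquot_lquot[OF I z L_sub(2,1)] supp unfolding face_elt_def Let_def K[symmetric] by simp
  next
   case 2
   have "?L = ?K"
    using 2 face_pos_inner(2)[OF face_pos_in_positions[of "Suc n" i p], of "j - 1"] K by simp
   moreover have "j - 1 \<le> n" "j - 1 \<noteq> 0" using 2 by auto
   ultimately show ?thesis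
    using 2 inner supp unfolding face_elt_def Let_def K[symmetric] by simp
  next
   case 3
   have b: "p x \<le> Suc (Suc n)" "x \<in> I ==> 1 \<le> p x" "x \<notin> I ==> p x = 0" for x
    using positionsD[OF p, of x] by (cases "x \<in> I"; simp)+
   have JL: "?J \<union> ?L = I"
   proof (rule Set.set_eqI)
    show "x \<in> ?J \<union> ?L \<longleftrightarrow> x \<in> I" for x
     using 3 b(1)[of x] b(2,3)[of x]
     by (cases "x \<in> I") (auto simp: support_def face_pos_def merge_pos_def Let_def)
   qed
   have "?K = ?J \<inter> ?L"
   proof (rule Set.set_eqI)
    show "x \<in> ?K \<longleftrightarrow> x \<in> ?J \<inter> ?L" for x
     using 3 b(1)[of x] by (auto simp: support_def face_pos_def merge_pos_def Let_def)
   qed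
   then show ?thesis
    using 3 lquot_rquot[OF I z JL] supp unfolding face_elt_def Let_def K[symmetric] by simp
  next
   case 4
   then have "j - 1 \<le> n" "j - 1 \<noteq> 0" "i \<le> n" using ij by auto
   then show ?thesis
    using 4 inner inner' supp ij unfolding face_elt_def Let_def K[symmetric] by simp
  next
   case 5
   have "?J = ?K" using face_pos_inner(2)[OF face_pos_in_positions[of "Suc n" j p], of i] 5 by simp
   then show ?thesis
    using 5 inner' supp ij unfolding face_elt_def Let_def K[symmetric] by simp
  next
   case 6
   then have "\<not> j - 1 \<le> n" "j - 1 \<noteq> 0" "\<not> j \<le> Suc n" "\<not> i \<le> n" "i \<le> Suc n" by auto
   then show ?thesis
    using inner' rquot_rquot[OF I z J_sub(2,1)] supp ij unfolding face_elt_def Let_def K[symmetric] by simp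
  qed
 qed
 then show ?thesis using face_pos_face_pos[OF ij(1), of n p] by (simp add: face_def)
qed

lemma cochain_carrier: "sp_val (exp_power R n) I = fmod (decomps n I)"
 by (simp add: exp_power_def)

lemma cochains_module: "module R (Coch n)"
 unfolding cochains_def by (rule species_hom_module[OF species_axioms linear_relabelling_exp_power])

lemma cochainD:
 assumes "\<alpha> \<in> carrier (Coch n)" "finite I" "z \<in> carrier (XV I)"
 shows "\<alpha> I z \<in> carrier (fmod (decomps n I))"
  and "\<alpha> I z F \<in> carrier R"
  and "F \<notin> decomps n I ==> \<alpha> I z F = \<zero>"
  and "w \<in> carrier (XV I) ==> \<alpha> I (z \<oplus>\<^bsub>XV I\<^esub> w) F = \<alpha> I z F \<oplus> \<alpha> I w F"
  and "c \<in> carrier R ==> \<alpha> I (c \<odot>\<^bsub>XV I\<^esub> z) F = c \<otimes> \<alpha> I z F"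
  and "[|inj_on \<sigma> I; F \<in> decomps n I|] ==> \<alpha> (\<sigma> ` I) (sp_map X I \<sigma> z) (map (image \<sigma>) F) = \<alpha> I z F"
proof -
 note H = species_homD[OF assms(1)[unfolded cochains_def] assms(2)]
 show c: "\<alpha> I z \<in> carrier (fmod (decomps n I))"
  using H(1)[OF assms(3)] by (simp add: cochain_carrier)
 show "\<alpha> I z F \<in> carrier R" "F \<notin> decomps n I ==> \<alpha> I z F = \<zero>"
  using free_module_closed[OF c] free_module_outside[OF c] by auto
 show "w \<in> carrier (XV I) ==> \<alpha> I (z \<oplus>\<^bsub>XV I\<^esub> w) F = \<alpha> I z F \<oplus> \<alpha> I w F"
  using H(2)[OF assms(3)] by (simp add: cochain_carrier free_module_simps)
 show "c \<in> carrier R ==> \<alpha> I (c \<odot>\<^bsub>XV I\<^esub> z) F = c \<otimes> \<alpha> I z F"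
  using H(3)[OF _ assms(3)] by (simp add: cochain_carrier free_module_simps)
 show "\<alpha> (\<sigma> ` I) (sp_map X I \<sigma> z) (map (image \<sigma>) F) = \<alpha> I z F" if "inj_on \<sigma> I" "F \<in> decomps n I"
  using H(4)[OF that(1) assms(3)] exp_power_map_relabel[OF assms(2) that(1) c that(2)] by simp
qed

lemma cochainI:
 assumes closed: "\<And>I z F. [|finite I; z \<in> carrier (XV I)|] ==> f I z F \<in> carrier R"
  and outside: "\<And>I z F. [|finite I; z \<in> carrier (XV I); F \<notin> decomps n I|] ==> f I z F = \<zero>"
  and add: "\<And>I z w F. [|finite I; z \<in> carrier (XV I); w \<in> carrier (XV I); F \<in> decomps n I|] ==>
   f I (z \<oplus>\<^bsub>XV I\<^esub> w) F = f I z F \<oplus> f I w F"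
  and smult: "\<And>I c z F. [|finite I; z \<in> carrier (XV I); c \<in> carrier R; F \<in> decomps n I|] ==>
   f I (c \<odot>\<^bsub>XV I\<^esub> z) F = c \<otimes> f I z F"
  and map: "\<And>I \<sigma> z F. [|finite I; z \<in> carrier (XV I); inj_on \<sigma> I; F \<in> decomps n I|] ==>
   f (\<sigma> ` I) (sp_map X I \<sigma> z) (map (image \<sigma>) F) = f I z F"
 shows "(\<lambda>I\<in>{I. finite I}. \<lambda>z\<in>carrier (XV I). f I z) \<in> carrier (Coch n)"
 unfolding cochains_def
proof (rule species_homI)
 fix I z assume I: "finite I" "z \<in> carrier (XV I)"
 interpret X: module R "XV I" by (rule val_module[OF I(1)])
 show c: "f I z \<in> carrier (sp_val (exp_power R n) I)"
  unfolding cochain_carrier free_module_carrier[OF finite_decomps[OF I(1)]] using closed[OF I] outside[OF I] by blast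
 show "f I (z \<oplus>\<^bsub>XV I\<^esub> w) = f I z \<oplus>\<^bsub>sp_val (exp_power R n) I\<^esub> f I w" if w: "w \<in> carrier (XV I)" for w
 proof
  show "f I (z \<oplus>\<^bsub>XV I\<^esub> w) F = (f I z \<oplus>\<^bsub>sp_val (exp_power R n) I\<^esub> f I w) F" for F
   using add[OF I w, of F] outside[OF I, of F] outside[OF I(1) w, of F]
    outside[OF I(1) X.M.a_closed[OF I(2) w], of F]
   by (cases "F \<in> decomps n I") (auto simp: cochain_carrier free_module_simps)
 qed
 show "f I (c \<odot>\<^bsub>XV I\<^esub> z) = c \<odot>\<^bsub>sp_val (exp_power R n) I\<^esub> f I z" if c: "c \<in> carrier R" for c
 proof
  show "f I (c \<odot>\<^bsub>XV I\<^esub> z) F = (c \<odot>\<^bsub>sp_val (exp_power R n) I\<^esub> f I z) F" for F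
   using smult[OF I c, of F] outside[OF I, of F] outside[OF I(1) X.smult_closed[OF c I(2)], of F] c
   by (cases "F \<in> decomps n I") (auto simp: cochain_carrier free_module_simps)
 qed
 show "f (\<sigma> ` I) (sp_map X I \<sigma> z) = sp_map (exp_power R n) I \<sigma> (f I z)" if s: "inj_on \<sigma> I" for \<sigma>
 proof
  fix G
  have fin: "finite (\<sigma> ` I)" using I(1) by simp
  show "f (\<sigma> ` I) (sp_map X I \<sigma> z) G = sp_map (exp_power R n) I \<sigma> (f I z) G"
  proof (cases "G \<in> decomps n (\<sigma> ` I)")
   case True
   then obtain F where F: "F \<in> decomps n I" "G = map (image \<sigma>) F"
    using relabel_decomps_image[OF s, of n] by blast
   then show ?thesis
    using map[OF I s F(1)] exp_power_map_relabel[OF I(1) s c[unfolded cochain_carrier] F(1)] by simp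
  next
   case False
   have "sp_map (exp_power R n) I \<sigma> (f I z) \<in> carrier (sp_val (exp_power R n) (\<sigma> ` I))"
    by (rule lin_homD(1)[OF exp_power_map_hom[OF I(1) s] c])
   then show ?thesis
    using outside[OF fin carrier_map[OF I(1) s I(2)] False] free_module_outside[OF _ False]
    by (simp add: cochain_carrier)
  qed
 qed
qed

lemma cochain_ext:
 assumes "\<alpha> \<in> carrier (Coch n)" "\<beta> \<in> carrier (Coch n)"
  and "\<And>I z p. [|finite I; z \<in> carrier (XV I); p \<in> positions n I|] ==>
   \<alpha> I z (blocks n p) = \<beta> I z (blocks n p)"
 shows "\<alpha> = \<beta>"
proof (rule species_hom_ext[OF assms(1,2)[unfolded cochains_def]], rule ext)
 fix I z F assume I: "finite I" "z \<in> carrier (XV I)"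
 show "\<alpha> I z F = \<beta> I z F"
 proof (cases "F \<in> decomps n I")
  case True
  then show ?thesis
   using assms(3)[OF I position_of_in_positions[OF True]] by (simp add: blocks_position_of)
 qed (simp add: cochainD(3)[OF assms(1) I] cochainD(3)[OF assms(2) I])
qed

lemma face_support:
 assumes "p \<in> positions (Suc n) I"
 shows "support (face_pos n 0 p) = I - {x. p x = 1}"
  and "support (face_pos n (Suc n) p) = I - {x. p x = Suc n}"
proof -
 have b: "p x \<le> Suc n" "x \<in> I \<longleftrightarrow> p x \<noteq> 0" for x
  using positionsD[OF assms, of x] by (cases "x \<in> I"; simp)+
 show "support (face_pos n 0 p) = I - {x. p x = 1}"
 proof (rule Set.set_eqI)
  show "x \<in> support (face_pos n 0 p) \<longleftrightarrow> x \<in> I - {x. p x = 1}" for x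
   using b[of x] by (auto simp: support_def face_pos_def merge_pos_def Let_def)
 qed
 show "support (face_pos n (Suc n) p) = I - {x. p x = Suc n}"
 proof (rule Set.set_eqI)
  show "x \<in> support (face_pos n (Suc n) p) \<longleftrightarrow> x \<in> I - {x. p x = Suc n}" for x
   using b[of x] by (auto simp: support_def face_pos_def merge_pos_def Let_def)
 qed
qed

lemma Union_blocks_support: "p \<in> positions n I ==> \<Union> (set (blocks n p)) = I"
 using blocks_in_decomps by (auto simp: decomps_def)

definition eval_cochain :: "nat => (nat set => 'm => nat set list => 'k) => 'm \<times> (nat => nat) => 'k" where
 "eval_cochain n \<alpha> = (\<lambda>(z, p). \<alpha> (support p) z (blocks n p))"

lemma coface_blocks:
 assumes p: "p \<in> positions (Suc n) I" and i: "i \<le> Suc n"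
 shows "coface lam rho i \<alpha> (blocks (Suc n) p) z = eval_cochain n \<alpha> (face n i (z, p))"
proof -
 have U: "\<Union> (set (blocks (Suc n) p)) = I" by (rule Union_blocks_support[OF p])
 have U': "\<Union> (set (blocks n (face_pos n i p))) = support (face_pos n i p)"
  by (rule Union_blocks_support[OF face_pos_in_positions])
 have supp: "support p = I" by (rule support_positions[OF p])
 consider "i = 0" | "0 < i" "i \<le> n" | "i = Suc n" using i by linarith
 then show ?thesis
 proof cases
  case 1
  then show ?thesis
   using U' face_support(1)[OF p]
   by (simp add: coface_def Let_def U blocks_tl blocks_hd_last coeff_def eval_cochain_def face_def face_elt_def supp)
 next
  case 2
  then show ?thesis
   using U' face_pos_inner[OF p 2] blocks_merge[OF 2, of p]
   by (simp add: coface_def Let_def coeff_def eval_cochain_def face_def face_elt_def supp merge_blocks_def)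
 next
  case 3
  then show ?thesis
   using U' face_support(2)[OF p]
   by (simp add: coface_def Let_def U blocks_butlast blocks_hd_last coeff_def eval_cochain_def face_def face_elt_def supp)
 qed
qed

lemma face_elt_linear:
 assumes p: "p \<in> positions (Suc n) I" and I: "finite I" "z \<in> carrier (XV I)" and i: "i \<le> Suc n"
 defines "J \<equiv> support (face_pos n i p)"
 shows "w \<in> carrier (XV I) ==>
   face_elt n i (z \<oplus>\<^bsub>XV I\<^esub> w) p = face_elt n i z p \<oplus>\<^bsub>XV J\<^esub> face_elt n i w p"
  and "c \<in> carrier R ==> face_elt n i (c \<odot>\<^bsub>XV I\<^esub> z) p = c \<odot>\<^bsub>XV J\<^esub> face_elt n i z p"
proof -
 have supp: "support p = I" "J \<subseteq> I"
  using support_positions[OF p] face_pos_subset[of n i p] by (auto simp: J_def)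
 have inner: "J = I" if "0 < i" "i \<le> n" using face_pos_inner(2)[OF p that] by (simp add: J_def)
 show "face_elt n i (z \<oplus>\<^bsub>XV I\<^esub> w) p = face_elt n i z p \<oplus>\<^bsub>XV J\<^esub> face_elt n i w p"
  if "w \<in> carrier (XV I)"
  using lquot_add[OF I supp(2) that] rquot_add[OF I supp(2) that] inner
  by (simp add: face_elt_def Let_def supp(1) flip: J_def)
 show "face_elt n i (c \<odot>\<^bsub>XV I\<^esub> z) p = c \<odot>\<^bsub>XV J\<^esub> face_elt n i z p" if "c \<in> carrier R"
  using lquot_smult[OF I supp(2) that] rquot_smult[OF I supp(2) that] inner
  by (simp add: face_elt_def Let_def supp(1) flip: J_def)
qed

lemma coface_linear:
 assumes \<alpha>: "\<alpha> \<in> carrier (Coch n)" and F: "F \<in> decomps (Suc n) I"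
  and I: "finite I" "z \<in> carrier (XV I)" and i: "i \<le> Suc n"
 shows "coface lam rho i \<alpha> F z \<in> carrier R"
  and "w \<in> carrier (XV I) ==>
   coface lam rho i \<alpha> F (z \<oplus>\<^bsub>XV I\<^esub> w) = coface lam rho i \<alpha> F z \<oplus> coface lam rho i \<alpha> F w"
  and "c \<in> carrier R ==> coface lam rho i \<alpha> F (c \<odot>\<^bsub>XV I\<^esub> z) = c \<otimes> coface lam rho i \<alpha> F z"
proof -
 define p where "p = position_of F"
 have p: "p \<in> positions (Suc n) I" and F': "F = blocks (Suc n) p"
  using position_of_in_positions[OF F] blocks_position_of[OF F] by (simp_all add: p_def)
 let ?J = "support (face_pos n i p)"
 have J: "finite ?J" using face_pos_subset[of n i p] support_positions[OF p] I(1) finite_subset by auto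
 have cf: "coface lam rho i \<alpha> F w = \<alpha> ?J (face_elt n i w p) (blocks n (face_pos n i p))" for w
  unfolding F' coface_blocks[OF p i] by (simp add: eval_cochain_def face_def)
 note D = cochainD[OF \<alpha> J face_elt_closed[OF p I]]
 show "coface lam rho i \<alpha> F z \<in> carrier R" unfolding cf by (rule D(2))
 show "coface lam rho i \<alpha> F (z \<oplus>\<^bsub>XV I\<^esub> w) = coface lam rho i \<alpha> F z \<oplus> coface lam rho i \<alpha> F w"
  if w: "w \<in> carrier (XV I)"
  unfolding cf face_elt_linear(1)[OF p I i w] by (rule D(4)[OF face_elt_closed[OF p I(1) w]])
 show "coface lam rho i \<alpha> F (c \<odot>\<^bsub>XV I\<^esub> z) = c \<otimes> coface lam rho i \<alpha> F z" if c: "c \<in> carrier R"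
  unfolding cf face_elt_linear(2)[OF p I i c] by (rule D(5)[OF c])
qed

lemma coface_map:
 assumes \<alpha>: "\<alpha> \<in> carrier (Coch n)" and F: "F \<in> decomps (Suc n) I"
  and I: "finite I" "z \<in> carrier (XV I)" and i: "i \<le> Suc n" and \<sigma>: "inj_on \<sigma> I"
 shows "coface lam rho i \<alpha> (map (image \<sigma>) F) (sp_map X I \<sigma> z) = coface lam rho i \<alpha> F z"
proof -
 define p where "p = position_of F"
 have p: "p \<in> positions (Suc n) I" and F': "F = blocks (Suc n) p"
  using position_of_in_positions[OF F] blocks_position_of[OF F] by (simp_all add: p_def)
 have len: "length F = Suc n" using F by (simp add: decomps_def)
 then have ne: "F \<noteq> []" by auto
 have U: "\<Union> (set F) = I" using F by (simp add: decomps_def)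
 have U\<sigma>: "\<Union> (set (map (image \<sigma>) F)) = \<sigma> ` I" using U by auto
 have sub: "G \<in> decomps n J ==> \<Union> (set G) = J" for G J by (simp add: decomps_def)
 have im_diff: "\<sigma> ` I - \<sigma> ` A = \<sigma> ` (I - A)" if "A \<in> set F" for A
  using inj_on_image_set_diff[OF \<sigma>, of I A] that U by auto
 have fin: "finite (I - A)" and inj: "inj_on \<sigma> (I - A)" for A
  using I(1) \<sigma> by (auto intro: inj_on_subset)
 consider "i = 0" | "0 < i" "i \<le> n" | "i = Suc n" using i by linarith
 then show ?thesis
 proof cases
  case 1
  have tl: "tl F \<in> decomps n (I - hd F)"
   using blocks_in_decomps[OF face_pos_in_positions, of n 0 p] face_support(1)[OF p]
   by (simp add: F' blocks_tl blocks_hd_last)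
  have "\<alpha> (\<sigma> ` (I - hd F)) (sp_map X (I - hd F) \<sigma> (lquot lam I z (I - hd F))) (map (image \<sigma>) (tl F)) =
    \<alpha> (I - hd F) (lquot lam I z (I - hd F)) (tl F)"
   by (rule cochainD(6)[OF \<alpha> fin lquot_closed[OF I] inj tl]) auto
  moreover have "lquot lam (\<sigma> ` I) (sp_map X I \<sigma> z) (\<sigma> ` (I - hd F)) =
    sp_map X (I - hd F) \<sigma> (lquot lam I z (I - hd F))"
   by (rule lquot_map[OF I _ \<sigma>]) auto
  ultimately show ?thesis
   using 1 ne U U\<sigma> im_diff[of "hd F"] sub[OF tl] sub[OF relabel_decomps[OF inj tl]]
   by (simp add: coface_def Let_def coeff_def map_tl hd_map)
 next
  case 2
  have m: "merge_blocks i F \<in> decomps n I"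
   using blocks_in_decomps[OF face_pos_in_positions, of n i p] face_pos_inner[OF p 2] blocks_merge[OF 2, of p]
   by (simp add: F')
  have "\<alpha> (\<sigma> ` I) (sp_map X I \<sigma> z) (map (image \<sigma>) (merge_blocks i F)) = \<alpha> I z (merge_blocks i F)"
   by (rule cochainD(6)[OF \<alpha> I \<sigma> m])
  moreover have "map (image \<sigma>) (merge_blocks i F) = merge_blocks i (map (image \<sigma>) F)"
   by (rule map_merge_blocks) (use 2 len in auto)
  ultimately show ?thesis
   using 2 len sub[OF m] sub[OF relabel_decomps[OF \<sigma> m]]
   by (simp add: coface_def Let_def coeff_def merge_blocks_def)
 next
  case 3
  have bl: "butlast F \<in> decomps n (I - last F)"
   using blocks_in_decomps[OF face_pos_in_positions, of n "Suc n" p] face_support(2)[OF p]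
   by (simp add: F' blocks_butlast blocks_hd_last)
  have "\<alpha> (\<sigma> ` (I - last F)) (sp_map X (I - last F) \<sigma> (rquot rho I z (I - last F))) (map (image \<sigma>) (butlast F)) =
    \<alpha> (I - last F) (rquot rho I z (I - last F)) (butlast F)"
   by (rule cochainD(6)[OF \<alpha> fin rquot_closed[OF I] inj bl]) auto
  moreover have "rquot rho (\<sigma> ` I) (sp_map X I \<sigma> z) (\<sigma> ` (I - last F)) =
    sp_map X (I - last F) \<sigma> (rquot rho I z (I - last F))"
   by (rule rquot_map[OF I _ \<sigma>]) auto
  ultimately show ?thesis
   using 3 ne len U U\<sigma> im_diff[of "last F"] sub[OF bl] sub[OF relabel_decomps[OF inj bl]]
   by (simp add: coface_def Let_def coeff_def map_butlast last_map)
 qed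
qed

text \<open>Partial sums of the alternating sum that defines the differential; single cofaces are cochains as
 well, and the comparison with the Koszul differential treats outer and interior cofaces apart.\<close>

definition partial_diff :: "nat set => nat => (nat set => 'm => nat set list => 'k) =>
  nat set => 'm => nat set list => 'k" where
 "partial_diff S n \<alpha> = (\<lambda>I\<in>{I. finite I}. \<lambda>z\<in>carrier (XV I). \<lambda>F.
   if F \<in> decomps (Suc n) I then alt_sum R S (\<lambda>i. coface lam rho i \<alpha> F z) else \<zero>)"

lemma partial_diff_apply:
 "[|finite I; z \<in> carrier (XV I)|] ==> partial_diff S n \<alpha> I z F =
   (if F \<in> decomps (Suc n) I then alt_sum R S (\<lambda>i. coface lam rho i \<alpha> F z) else \<zero>)"
 by (simp add: partial_diff_def)

lemma cochain_diff_eq: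
 "\<alpha> \<in> carrier (Coch n) ==> cdiff n \<alpha> = partial_diff {0..Suc n} n \<alpha>"
 unfolding cochain_diff_def partial_diff_def Suc_eq_plus1[symmetric] by simp

lemma partial_diff_closed:
 assumes \<alpha>: "\<alpha> \<in> carrier (Coch n)" and S: "S \<subseteq> {0..Suc n}"
 shows "partial_diff S n \<alpha> \<in> carrier (Coch (Suc n))"
 unfolding partial_diff_def
proof (rule cochainI)
 have le: "i \<le> Suc n" if "i \<in> S" for i using S that by auto
 have finS: "finite S" using S finite_subset by blast
 fix I z F assume I: "finite I" "z \<in> carrier (XV I)"
 show "(if F \<in> decomps (Suc n) I then alt_sum R S (\<lambda>i. coface lam rho i \<alpha> F z) else \<zero>) \<in> carrier R"
  using coface_linear(1)[OF \<alpha> _ I le] by (auto intro: alt_sum_closed)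
 interpret X: module R "XV I" by (rule val_module[OF I(1)])
 assume F: "F \<in> decomps (Suc n) I"
 note L = coface_linear[OF \<alpha> F I le]
 show "(if F \<in> decomps (Suc n) I then alt_sum R S (\<lambda>i. coface lam rho i \<alpha> F (z \<oplus>\<^bsub>XV I\<^esub> w)) else \<zero>) =
   (if F \<in> decomps (Suc n) I then alt_sum R S (\<lambda>i. coface lam rho i \<alpha> F z) else \<zero>) \<oplus>
   (if F \<in> decomps (Suc n) I then alt_sum R S (\<lambda>i. coface lam rho i \<alpha> F w) else \<zero>)"
  if w: "w \<in> carrier (XV I)" for w
  using F L w coface_linear(1)[OF \<alpha> F I(1) w le]
  by (simp add: alt_sum_add[symmetric] cong: alt_sum_cong)
 show "(if F \<in> decomps (Suc n) I then alt_sum R S (\<lambda>i. coface lam rho i \<alpha> F (c \<odot>\<^bsub>XV I\<^esub> z)) else \<zero>) =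
   c \<otimes> (if F \<in> decomps (Suc n) I then alt_sum R S (\<lambda>i. coface lam rho i \<alpha> F z) else \<zero>)"
  if c: "c \<in> carrier R" for c
  using F L c by (simp add: alt_sum_smult[OF _ c finS, symmetric] cong: alt_sum_cong)
 show "(if map (image \<sigma>) F \<in> decomps (Suc n) (\<sigma> ` I)
   then alt_sum R S (\<lambda>i. coface lam rho i \<alpha> (map (image \<sigma>) F) (sp_map X I \<sigma> z)) else \<zero>) =
   (if F \<in> decomps (Suc n) I then alt_sum R S (\<lambda>i. coface lam rho i \<alpha> F z) else \<zero>)"
  if s: "inj_on \<sigma> I" for \<sigma>
  using F relabel_decomps[OF s F] coface_map[OF \<alpha> F I le s] L(1) by (simp cong: alt_sum_cong)
qed simp

lemma cochain_diff_closed: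
 "\<alpha> \<in> carrier (Coch n) ==> cdiff n \<alpha> \<in> carrier (Coch (Suc n))"
 using partial_diff_closed[of \<alpha> n "{0..Suc n}"] by (simp add: cochain_diff_eq)

lemma cochain_diff_blocks:
 assumes \<alpha>: "\<alpha> \<in> carrier (Coch n)" and p: "p \<in> positions (Suc n) I"
  and I: "finite I" "z \<in> carrier (XV I)"
 shows "cdiff n \<alpha> I z (blocks (Suc n) p) =
  alt_sum R {0..Suc n} (\<lambda>i. eval_cochain n \<alpha> (face n i (z, p)))"
proof -
 have "coface lam rho i \<alpha> (blocks (Suc n) p) z = eval_cochain n \<alpha> (face n i (z, p))"
  if "i \<in> {0..Suc n}" for i
  using coface_blocks[OF p] that by simp
 moreover have "coface lam rho i \<alpha> (blocks (Suc n) p) z \<in> carrier R" if "i \<in> {0..Suc n}" for i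
  using coface_linear(1)[OF \<alpha> blocks_in_decomps[OF p] I] that by simp
 ultimately have "alt_sum R {0..Suc n} (\<lambda>i. coface lam rho i \<alpha> (blocks (Suc n) p) z) =
   alt_sum R {0..Suc n} (\<lambda>i. eval_cochain n \<alpha> (face n i (z, p)))"
  by (intro alt_sum_cong) auto
 then show ?thesis
  using blocks_in_decomps[OF p] by (simp add: cochain_diff_eq[OF \<alpha>] partial_diff_apply[OF I])
qed

lemma cochain_ops:
 assumes "finite I" "z \<in> carrier (XV I)"
 shows "(\<zero>\<^bsub>Coch n\<^esub>) I z F = \<zero>"
  and "(\<alpha> \<oplus>\<^bsub>Coch n\<^esub> \<beta>) I z F = \<alpha> I z F \<oplus> \<beta> I z F"
  and "(c \<odot>\<^bsub>Coch n\<^esub> \<alpha>) I z F = c \<otimes> \<alpha> I z F"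
  and "\<alpha> \<in> carrier (Coch n) ==> (\<ominus>\<^bsub>Coch n\<^esub> \<alpha>) I z F = \<ominus> \<alpha> I z F"
 using species_hom_ops[OF assms, of R "exp_power R n"]
  species_hom_minus[OF species_axioms linear_relabelling_exp_power assms, of \<alpha> n] cochainD(1)[OF _ assms]
 unfolding cochains_def
 by (simp_all add: cochain_carrier free_module_simps free_module_minus)

lemma cochain_diff_linear:
 assumes \<alpha>: "\<alpha> \<in> carrier (Coch n)"
 shows "\<beta> \<in> carrier (Coch n) ==> cdiff n (\<alpha> \<oplus>\<^bsub>Coch n\<^esub> \<beta>) =
   cdiff n \<alpha> \<oplus>\<^bsub>Coch (Suc n)\<^esub> cdiff n \<beta>"
  and "c \<in> carrier R ==> cdiff n (c \<odot>\<^bsub>Coch n\<^esub> \<alpha>) =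
   c \<odot>\<^bsub>Coch (Suc n)\<^esub> cdiff n \<alpha>"
proof -
 interpret C: module R "Coch n" by (rule cochains_module)
 interpret D: module R "Coch (Suc n)" by (rule cochains_module)
 note closed = cochain_diff_closed
 have fin: "finite (support (face_pos n i p))" if "p \<in> positions (Suc n) I" "finite I" for i p I
  using face_pos_subset[of n i p] support_positions[OF that(1)] that(2) finite_subset by auto
 show "cdiff n (\<alpha> \<oplus>\<^bsub>Coch n\<^esub> \<beta>) =
   cdiff n \<alpha> \<oplus>\<^bsub>Coch (Suc n)\<^esub> cdiff n \<beta>"
  if \<beta>: "\<beta> \<in> carrier (Coch n)"
 proof (rule cochain_ext)
  fix I z p assume I: "finite I" "z \<in> carrier (XV I)" and p: "p \<in> positions (Suc n) I"
  note f = fin[OF p I(1)] face_elt_closed[OF p I]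
  show "cdiff n (\<alpha> \<oplus>\<^bsub>Coch n\<^esub> \<beta>) I z (blocks (Suc n) p) =
   (cdiff n \<alpha> \<oplus>\<^bsub>Coch (Suc n)\<^esub> cdiff n \<beta>) I z (blocks (Suc n) p)"
   unfolding cochain_ops(2)[OF I] cochain_diff_blocks[OF C.M.a_closed[OF \<alpha> \<beta>] p I]
    cochain_diff_blocks[OF \<alpha> p I] cochain_diff_blocks[OF \<beta> p I]
   using cochainD(2)[OF \<alpha> f] cochainD(2)[OF \<beta> f]
   by (simp add: alt_sum_add[symmetric] eval_cochain_def face_def cochain_ops(2)[OF f])
 qed (use \<alpha> \<beta> closed in auto)
 show "cdiff n (c \<odot>\<^bsub>Coch n\<^esub> \<alpha>) =
   c \<odot>\<^bsub>Coch (Suc n)\<^esub> cdiff n \<alpha>" if c: "c \<in> carrier R"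
 proof (rule cochain_ext)
  fix I z p assume I: "finite I" "z \<in> carrier (XV I)" and p: "p \<in> positions (Suc n) I"
  note f = fin[OF p I(1)] face_elt_closed[OF p I]
  show "cdiff n (c \<odot>\<^bsub>Coch n\<^esub> \<alpha>) I z (blocks (Suc n) p) =
   (c \<odot>\<^bsub>Coch (Suc n)\<^esub> cdiff n \<alpha>) I z (blocks (Suc n) p)"
   unfolding cochain_ops(3)[OF I] cochain_diff_blocks[OF C.smult_closed[OF c \<alpha>] p I]
    cochain_diff_blocks[OF \<alpha> p I]
   using cochainD(2)[OF \<alpha> f]
   by (simp add: alt_sum_smult[OF _ c, symmetric] eval_cochain_def face_def cochain_ops(3)[OF f])
 qed (use \<alpha> c closed in auto)
qed

lemma cochain_diff_square:
 assumes \<alpha>: "\<alpha> \<in> carrier (Coch n)"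
 shows "cdiff (Suc n) (cdiff n \<alpha>) = \<zero>\<^bsub>Coch (Suc (Suc n))\<^esub>"
proof (rule cochain_ext)
 interpret C: module R "Coch (Suc (Suc n))" by (rule cochains_module)
 note closed = cochain_diff_closed[OF \<alpha>]
 fix I z p assume I: "finite I" "z \<in> carrier (XV I)" and p: "p \<in> positions (Suc (Suc n)) I"
 define f where "f t = (if eval_cochain n \<alpha> t \<in> carrier R then eval_cochain n \<alpha> t else \<zero>)" for t
 have fR: "range f \<subseteq> carrier R" by (auto simp: f_def)
 have fin: "finite (support q)" if "support q \<subseteq> I" for q using that I(1) finite_subset by blast
 have outer: "eval_cochain (Suc n) (cdiff n \<alpha>) (face (Suc n) j (z, p)) =
   alt_sum R {0..Suc n} (\<lambda>i. f (face n i (face (Suc n) j (z, p))))" if j: "j \<in> {0..Suc (Suc n)}" for j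
 proof -
  let ?q = "face_pos (Suc n) j p" and ?w = "face_elt (Suc n) j z p"
  have q: "?q \<in> positions (Suc n) (support ?q)" by (rule face_pos_in_positions)
  have s: "support ?q \<subseteq> I" using face_pos_subset[of "Suc n" j p] support_positions[OF p] by simp
  have w: "?w \<in> carrier (XV (support ?q))" by (rule face_elt_closed[OF p I])
  have "eval_cochain n \<alpha> (face n i (?w, ?q)) \<in> carrier R" for i
  proof -
   have "finite (support (face_pos n i ?q))"
    using face_pos_subset[of n i ?q] s by (intro fin) auto
   from cochainD(2)[OF \<alpha> this face_elt_closed[OF q fin[OF s] w]] show ?thesis
    by (simp add: eval_cochain_def face_def)
  qed
  then have "f (face n i (?w, ?q)) = eval_cochain n \<alpha> (face n i (?w, ?q))" for i by (simp add: f_def)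
  then show ?thesis
   using cochain_diff_blocks[OF \<alpha> q fin[OF s] w] by (simp add: eval_cochain_def face_def)
 qed
 have "cdiff (Suc n) (cdiff n \<alpha>) I z (blocks (Suc (Suc n)) p) =
   alt_sum R {0..Suc (Suc n)} (\<lambda>j. eval_cochain (Suc n) (cdiff n \<alpha>) (face (Suc n) j (z, p)))"
  by (rule cochain_diff_blocks[OF closed p I])
 also have "\<dots> = alt_sum R {0..Suc (Suc n)} (\<lambda>j. alt_sum R {0..Suc n} (\<lambda>i. f (face n i (face (Suc n) j (z, p)))))"
  by (rule alt_sum_cong) (use outer fR in \<open>auto intro!: alt_sum_closed\<close>)
 also have "\<dots> = \<zero>"
  by (rule alt_sum_faces_square[of "Suc n" "\<lambda>j i. face n i (face (Suc n) j (z, p))", OF _ fR])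
   (rule face_face[OF p I])
 finally show "cdiff (Suc n) (cdiff n \<alpha>) I z (blocks (Suc (Suc n)) p) =
   (\<zero>\<^bsub>Coch (Suc (Suc n))\<^esub>) I z (blocks (Suc (Suc n)) p)"
  by (simp add: cochain_ops(1)[OF I])
next
 interpret C: module R "Coch (Suc (Suc n))" by (rule cochains_module)
 show "\<zero>\<^bsub>Coch (Suc (Suc n))\<^esub> \<in> carrier (Coch (Suc (Suc n)))" by (rule C.M.zero_closed)
qed (rule cochain_diff_closed[OF cochain_diff_closed[OF \<alpha>]])

end

section \<open>The Koszul dual of the exponential species\<close>

lemma pairwise_disjoint_sorted: "pairwise_disjoint F \<longleftrightarrow> sorted_wrt (\<lambda>A B. A \<inter> B = {}) F"
 by (auto simp: pairwise_disjoint_def sorted_wrt_iff_nth_less)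

lemma compositions_iff:
 "F \<in> compositions I \<longleftrightarrow> sorted_wrt (\<lambda>A B. A \<inter> B = {}) F \<and> {} \<notin> set F \<and> \<Union> (set F) = I"
 by (simp add: compositions_def pairwise_disjoint_sorted)

lemma split_blocks:
 assumes "0 < i" "i < length G"
 shows "G = take (i - 1) G @ [G ! (i - 1), G ! i] @ drop (i + 1) G"
proof -
 have "G = take (i - 1) G @ drop (i - 1) G" by simp
 also have "drop (i - 1) G = G ! (i - 1) # drop i G"
  using assms Cons_nth_drop_Suc[of "i - 1" G] by simp
 also have "drop i G = G ! i # drop (i + 1) G"
  using assms by (simp add: Cons_nth_drop_Suc)
 finally show ?thesis by simp
qed

lemma merge_blocks_append: "merge_blocks (Suc (length u)) (u @ [A, B] @ v) = u @ [A \<union> B] @ v"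
 by (simp add: merge_blocks_def nth_append)

lemma length_merge_blocks: "[|0 < i; i < length G|] ==> length (merge_blocks i G) = length G - 1"
 by (auto simp: merge_blocks_def)

lemma Union_merge_blocks:
 assumes "0 < i" "i < length G"
 shows "\<Union> (set (merge_blocks i G)) = \<Union> (set G)"
proof -
 have "set G = set (take (i - 1) G @ [G ! (i - 1), G ! i] @ drop (i + 1) G)"
  using split_blocks[OF assms] by simp
 then have "\<Union> (set G) = \<Union> (set (take (i - 1) G @ [G ! (i - 1), G ! i] @ drop (i + 1) G))" by simp
 then show ?thesis by (auto simp: merge_blocks_def)
qed

lemma merge_blocks_composition:
 assumes i: "0 < i" "i < length G" and G: "G \<in> compositions I"
 shows "merge_blocks i G \<in> compositions I"
proof -
 let ?u = "take (i - 1) G" and ?v = "drop (i + 1) G" and ?A = "G ! (i - 1)" and ?B = "G ! i"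
 have "sorted_wrt (\<lambda>A B. A \<inter> B = {}) (?u @ [?A, ?B] @ ?v) \<and> {} \<notin> set (?u @ [?A, ?B] @ ?v)"
  using G split_blocks[OF i] by (simp add: compositions_iff)
 then have "sorted_wrt (\<lambda>A B. A \<inter> B = {}) (?u @ [?A \<union> ?B] @ ?v) \<and> {} \<notin> set (?u @ [?A \<union> ?B] @ ?v)"
  by (auto simp: sorted_wrt_append Int_Un_distrib Int_Un_distrib2)
 then show ?thesis
  using Union_merge_blocks[OF i] G by (simp add: compositions_iff merge_blocks_def)
qed

lemma length_composition_le:
 assumes I: "finite I" and F: "F \<in> compositions I"
 shows "length F \<le> card I"
proof -
 define x where "x k = (SOME y. y \<in> F ! k)" for k
 have x: "x k \<in> F ! k" if "k < length F" for k
 proof -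
  have "F ! k \<in> set F" "{} \<notin> set F" using F that by (auto simp: compositions_def)
  then have "F ! k \<noteq> {}" by metis
  then show ?thesis unfolding x_def by (simp add: some_in_eq)
 qed
 have "inj_on x {..<length F}"
 proof (rule inj_onI)
  fix k l assume kl: "k \<in> {..<length F}" "l \<in> {..<length F}" "x k = x l"
  have "F \<in> decomps (length F) I" using F by (simp add: decomps_def compositions_def)
  from decomps_nth_disjoint[OF this, of k l "x k"] show "k = l" using kl x[of k] x[of l] by simp
 qed
 moreover have "x ` {..<length F} \<subseteq> I"
  using x F by (force simp: compositions_def dest: nth_mem)
 ultimately show ?thesis using card_inj_on_le[of x "{..<length F}" I] I by simp
qed

lemma finite_compositions: "finite I ==> finite (compositions I)"
 by (rule finite_subset[OF _ finite_lists_length_le[of "Pow I" "card I"]])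
  (auto simp: length_composition_le, auto simp: compositions_def)

lemma composition_decomps: "F \<in> compositions I \<longleftrightarrow> F \<in> decomps (length F) I \<and> {} \<notin> set F"
 by (auto simp: compositions_def decomps_def)

context cring
begin

lemma finsum_swap:
 assumes "finite A" "finite B" "\<And>a b. [|a \<in> A; b \<in> B|] ==> h a b \<in> carrier R"
 shows "(\<Oplus>a\<in>A. \<Oplus>b\<in>B. h a b) = (\<Oplus>b\<in>B. \<Oplus>a\<in>A. h a b)"
 using assms(1,3)
proof (induction A)
 case (insert x A)
 have "(\<Oplus>a\<in>insert x A. \<Oplus>b\<in>B. h a b) = (\<Oplus>b\<in>B. h x b) \<oplus> (\<Oplus>b\<in>B. \<Oplus>a\<in>A. h a b)"
  using insert by (subst finsum_insert) (auto intro!: finsum_closed)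
 also have "\<dots> = (\<Oplus>b\<in>B. h x b \<oplus> (\<Oplus>a\<in>A. h a b))"
  using insert by (subst finsum_addf) (auto intro!: finsum_closed)
 also have "\<dots> = (\<Oplus>b\<in>B. \<Oplus>a\<in>insert x A. h a b)"
  using insert by (intro finsum_cong') (auto intro!: finsum_closed)
 finally show ?case .
qed simp

lemma omega_carrier:
 assumes "finite I"
 shows "f \<in> carrier (omega R I n) \<longleftrightarrow> (\<forall>F. f F \<in> carrier R) \<and>
  (\<forall>F. f F \<noteq> \<zero> --> F \<in> compositions I \<and> int (length F) - int (card I) = n)"
 unfolding omega_def using finite_compositions[OF assms]
 by (subst free_module_carrier) auto

lemma omega_module: "module R (omega R I n)"
 unfolding omega_def by (rule free_module_module)

lemma omega_simps:
 "\<zero>\<^bsub>omega R I n\<^esub> = (\<lambda>b. \<zero>)"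
 "f \<oplus>\<^bsub>omega R I n\<^esub> g = (\<lambda>b. f b \<oplus> g b)"
 "c \<odot>\<^bsub>omega R I n\<^esub> f = (\<lambda>b. c \<otimes> f b)"
 by (simp_all add: omega_def free_module_def)

text \<open>The differential splits blocks of basis elements; on coefficient functions this is the transposed
 operation, which merges neighbouring blocks of the argument.\<close>

lemma omega_diff_apply:
 assumes I: "finite I" and f: "f \<in> carrier (omega R I n)"
 shows "omega_diff R I f G =
  (if G \<in> compositions I then alt_sum R {1..<length G} (\<lambda>i. f (merge_blocks i G)) else \<zero>)"
proof -
 let ?W = "fmod (compositions I)"
 let ?D = "\<lambda>F i. {(A, B) \<in> decomps2 (F ! (i - 1)). A \<noteq> {} \<and> B \<noteq> {}}"
 let ?s = "\<lambda>F i D. take (i - 1) F @ [fst D, snd D] @ drop i F"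
 let ?U = "\<lambda>F. \<Oplus>\<^bsub>?W\<^esub> i\<in>{1..length F}. [((-1 :: int) ^ i)] \<cdot>\<^bsub>?W\<^esub>
   (\<Oplus>\<^bsub>?W\<^esub> D\<in>?D F i. bas (?s F i D))"
 interpret W: module R ?W by (rule free_module_module)
 have fin: "finite (compositions I)" by (rule finite_compositions[OF I])
 have fR: "f F \<in> carrier R" for F using f by (simp add: omega_carrier[OF I])
 have fin_D: "finite (?D F i)" if "F \<in> compositions I" "1 \<le> i" "i \<le> length F" for F i
 proof -
  have "F ! (i - 1) \<subseteq> I" using that nth_mem[of "i - 1" F] by (auto simp: compositions_def)
  then have "finite (F ! (i - 1))" using I finite_subset by blast
  then have "finite (Pow (F ! (i - 1)) \<times> Pow (F ! (i - 1)))" by simp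
  then show ?thesis by (rule rev_finite_subset) (auto simp: decomps2_def)
 qed
 have merge_split: "merge_blocks i (?s F i D) = F \<and> i < length (?s F i D)"
  if "F \<in> compositions I" "1 \<le> i" "i \<le> length F" "D \<in> ?D F i" for F i D
 proof -
  have "fst D \<union> snd D = F ! (i - 1)" using that by (auto simp: decomps2_def)
  moreover have "F = take (i - 1) F @ [F ! (i - 1)] @ drop i F"
   using that id_take_nth_drop[of "i - 1" F] by simp
  moreover have "Suc (length (take (i - 1) F)) = i" using that by simp
  ultimately show ?thesis
   using that merge_blocks_append[of "take (i - 1) F" "fst D" "snd D" "drop i F"] by simp
 qed
 have split_in: "?s F i D \<in> compositions I"
  if F: "F \<in> compositions I" "1 \<le> i" "i \<le> length F" and D: "D \<in> ?D F i" for F i D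
 proof -
  let ?G = "?s F i D"
  let ?u = "take (i - 1) F" and ?v = "drop i F"
  have eq: "F = ?u @ [fst D \<union> snd D] @ ?v"
   using merge_split[OF F D] F(2,3) merge_blocks_append[of ?u "fst D" "snd D" ?v] by simp
  then have "sorted_wrt (\<lambda>A B. A \<inter> B = {}) (?u @ [fst D \<union> snd D] @ ?v)
    \<and> {} \<notin> set (?u @ [fst D \<union> snd D] @ ?v) \<and> \<Union> (set (?u @ [fst D \<union> snd D] @ ?v)) = I"
   using F(1) unfolding compositions_iff by metis
  then show ?thesis
   using D unfolding compositions_iff
   by (auto simp: sorted_wrt_append decomps2_def Int_Un_distrib Int_Un_distrib2)
 qed
 have inner: "(\<Oplus>D\<in>?D F i. bas (?s F i D) G) =
   (if i < length G \<and> G \<in> compositions I \<and> F = merge_blocks i G then \<one> else \<zero>)"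
  if F: "F \<in> compositions I" "1 \<le> i" "i \<le> length F" for F i
 proof (cases "i < length G \<and> G \<in> compositions I \<and> F = merge_blocks i G")
  case True
  let ?E = "(G ! (i - 1), G ! i)"
  have sp: "G = take (i - 1) G @ [G ! (i - 1), G ! i] @ drop (i + 1) G"
   by (rule split_blocks) (use True F in auto)
  have F': "F = take (i - 1) G @ [G ! (i - 1) \<union> G ! i] @ drop (i + 1) G"
   using True by (simp add: merge_blocks_def)
  have Fi: "F ! (i - 1) = G ! (i - 1) \<union> G ! i" unfolding F' using True F by (simp add: nth_append min_def)
  have "{} \<notin> set G" "G ! (i - 1) \<in> set G" "G ! i \<in> set G"
   using True F by (auto simp: compositions_def)
  then have ne: "G ! (i - 1) \<noteq> {}" "G ! i \<noteq> {}" by metis+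
  have "G ! (i - 1) \<inter> G ! i = {}"
   using True F by (auto simp: compositions_def pairwise_disjoint_def)
  then have E: "?E \<in> ?D F i" using ne Fi by (auto simp: decomps2_def)
  have tk: "take (i - 1) F = take (i - 1) G" "drop i F = drop (i + 1) G"
   unfolding F' using True F by (auto simp: min_def Suc_diff_le)
  have sE: "?s F i ?E = G" using sp tk by simp
  have "D = ?E" if "?s F i D = G" for D
  proof -
   have "take (i - 1) G @ [fst D, snd D] @ drop (i + 1) G = take (i - 1) G @ [G ! (i - 1), G ! i] @ drop (i + 1) G"
    using that tk sp by simp
   then show ?thesis by (simp add: prod_eq_iff)
  qed
  then have "(\<Oplus>D\<in>?D F i. bas (?s F i D) G) = bas (?s F i ?E) G"
   by (intro finsum_single_term[OF fin_D[OF F] E]) (auto simp: basis_vec_def)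
  then show ?thesis using True sE by (simp add: basis_vec_def)
 next
  case False
  have "bas (?s F i D) G = \<zero>" if "D \<in> ?D F i" for D
   using merge_split[OF F that] split_in[OF F that] False by (auto simp: basis_vec_def)
  then have "(\<Oplus>D\<in>?D F i. bas (?s F i D) G) = \<zero>" by (rule add.finprod_one_eqI)
  then show ?thesis unfolding if_not_P[OF False] .
 qed
 have in_W: "(\<Oplus>\<^bsub>?W\<^esub> D\<in>?D F i. bas (?s F i D)) \<in> carrier ?W"
  if "F \<in> compositions I" "1 \<le> i" "i \<le> length F" for F i
  by (rule W.M.finsum_closed) (use split_in[OF that] in \<open>auto intro!: basis_vec_in\<close>)
 have U_in: "?U F \<in> carrier ?W" if "F \<in> compositions I" for F
  by (rule W.M.finsum_closed) (use in_W[OF that] in \<open>auto intro!: W.M.add.int_pow_closed\<close>)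
 have U: "?U F G = (if G \<in> compositions I then
   alt_sum R {1..<length G} (\<lambda>i. if F = merge_blocks i G then \<one> else \<zero>) else \<zero>)"
  if F: "F \<in> compositions I" for F
 proof -
  have "?U F G = (\<Oplus>i\<in>{1..length F}. ([((-1 :: int) ^ i)] \<cdot>\<^bsub>?W\<^esub>
   (\<Oplus>\<^bsub>?W\<^esub> D\<in>?D F i. bas (?s F i D))) G)"
   by (rule free_module_finsum) (use in_W[OF F] in \<open>auto intro!: W.M.add.int_pow_closed\<close>)
  also have "\<dots> = alt_sum R {1..length F}
    (\<lambda>i. if i < length G \<and> G \<in> compositions I \<and> F = merge_blocks i G then \<one> else \<zero>)"
  proof (rule finsum_cong')
   fix i assume i: "i \<in> {1..length F}"
   then have "(\<Oplus>\<^bsub>?W\<^esub> D\<in>?D F i. bas (?s F i D)) G = (\<Oplus>D\<in>?D F i. bas (?s F i D) G)"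
    by (intro free_module_finsum fin_D[OF F]) (use split_in[OF F] in \<open>auto intro!: basis_vec_in\<close>)
   then show "([((-1 :: int) ^ i)] \<cdot>\<^bsub>?W\<^esub> (\<Oplus>\<^bsub>?W\<^esub> D\<in>?D F i. bas (?s F i D))) G =
    [((-1 :: int) ^ i)] \<cdot> (if i < length G \<and> G \<in> compositions I \<and> F = merge_blocks i G then \<one> else \<zero>)"
    using free_module_signed[OF in_W[OF F]] inner[OF F] i by simp
  qed auto
  also have "\<dots> = (if G \<in> compositions I then
   alt_sum R {1..<length G} (\<lambda>i. if F = merge_blocks i G then \<one> else \<zero>) else \<zero>)"
  proof (cases "G \<in> compositions I \<and> length G = Suc (length F)")
   case True
   then show ?thesis by (auto intro!: alt_sum_cong simp: atLeastLessThanSuc_atLeastAtMost)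
  next
   case False
   have "length F = length G - 1" if "F = merge_blocks i G" "0 < i" "i < length G" for i
    using that length_merge_blocks by simp
   then have no: "\<not> (i < length G \<and> G \<in> compositions I \<and> F = merge_blocks i G)" if "0 < i" for i
    using that False by (metis Suc_pred' gr_implies_not0 neq0_conv)
   have "alt_sum R {1..length F}
     (\<lambda>i. if i < length G \<and> G \<in> compositions I \<and> F = merge_blocks i G then \<one> else \<zero>) = \<zero>"
    by (rule alt_sum_zero, rule if_not_P, rule no) simp
   moreover have "alt_sum R {1..<length G} (\<lambda>i. if F = merge_blocks i G then \<one> else \<zero>) = \<zero>"
    if "G \<in> compositions I"
    by (rule alt_sum_zero, rule if_not_P) (use no that in auto)
   ultimately show ?thesis by simp
  qed
  finally show ?thesis .
 qed
 have "omega_diff R I f G = (\<Oplus>F\<in>compositions I. f F \<otimes> ?U F G)"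
  unfolding omega_diff_def Let_def by (rule lin_ext_eval[OF fin U_in fR])
 also have "\<dots> = (\<Oplus>F\<in>compositions I. f F \<otimes> (if G \<in> compositions I then
   alt_sum R {1..<length G} (\<lambda>i. if F = merge_blocks i G then \<one> else \<zero>) else \<zero>))"
 proof (rule finsum_cong')
  show "f F \<otimes> ?U F G = f F \<otimes> (if G \<in> compositions I then
    alt_sum R {1..<length G} (\<lambda>i. if F = merge_blocks i G then \<one> else \<zero>) else \<zero>)"
   if "F \<in> compositions I" for F
   unfolding U[OF that] ..
 qed (use fR in \<open>auto intro!: alt_sum_closed\<close>)
 also have "\<dots> = (if G \<in> compositions I then alt_sum R {1..<length G} (\<lambda>i. f (merge_blocks i G)) else \<zero>)"
 proof (cases "G \<in> compositions I")
  case True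
  have "(\<Oplus>F\<in>compositions I. f F \<otimes> alt_sum R {1..<length G} (\<lambda>i. if F = merge_blocks i G then \<one> else \<zero>)) =
    (\<Oplus>F\<in>compositions I. alt_sum R {1..<length G} (\<lambda>i. if F = merge_blocks i G then f F else \<zero>))"
  proof (rule finsum_cong')
   fix F
   have "alt_sum R {1..<length G} (\<lambda>i. if F = merge_blocks i G then f F else \<zero>) =
     alt_sum R {1..<length G} (\<lambda>i. f F \<otimes> (if F = merge_blocks i G then \<one> else \<zero>))"
    using fR by (intro alt_sum_cong) auto
   also have "\<dots> = f F \<otimes> alt_sum R {1..<length G} (\<lambda>i. if F = merge_blocks i G then \<one> else \<zero>)"
    using fR by (intro alt_sum_smult) auto
   finally show "f F \<otimes> alt_sum R {1..<length G} (\<lambda>i. if F = merge_blocks i G then \<one> else \<zero>) =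
    alt_sum R {1..<length G} (\<lambda>i. if F = merge_blocks i G then f F else \<zero>)" by simp
  qed (use fR in \<open>auto intro!: alt_sum_closed\<close>)
  also have "\<dots> = (\<Oplus>i\<in>{1..<length G}. \<Oplus>F\<in>compositions I. [((-1 :: int) ^ i)] \<cdot> (if F = merge_blocks i G then f F else \<zero>))"
   using fR fin by (intro finsum_swap) auto
  also have "\<dots> = alt_sum R {1..<length G} (\<lambda>i. f (merge_blocks i G))"
  proof (rule finsum_cong')
   fix i assume "i \<in> {1..<length G}"
   then have "merge_blocks i G \<in> compositions I" using merge_blocks_composition[OF _ _ True] by simp
   then show "(\<Oplus>F\<in>compositions I. [((-1 :: int) ^ i)] \<cdot> (if F = merge_blocks i G then f F else \<zero>)) =
     [((-1 :: int) ^ i)] \<cdot> f (merge_blocks i G)"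
    using fR by (subst finsum_single_term[OF fin, of "merge_blocks i G"]) auto
  qed (use fR in auto)
  finally show ?thesis using True by simp
 next
  case False
  then show ?thesis using fR by (simp add: add.finprod_one_eqI)
 qed
 finally show ?thesis .
qed

end

lemma merge_blocks_take:
 assumes "0 < i" "i < s" "s \<le> length G"
 shows "take (s - 1) (merge_blocks i G) = merge_blocks i (take s G)"
  and "drop (s - 1) (merge_blocks i G) = drop s G"
proof -
 have "merge_blocks i (H @ V) = merge_blocks i H @ V" if "i < length H" for H V
 proof -
  have "i - 1 < length H" using that by simp
  then show ?thesis using that by (simp add: merge_blocks_def nth_append)
 qed
 from this[of "take s G" "drop s G"]
 have "merge_blocks i G = merge_blocks i (take s G) @ drop s G" using assms by simp
 moreover have "length (merge_blocks i (take s G)) = s - 1"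
  using assms by (simp add: length_merge_blocks)
 ultimately show "take (s - 1) (merge_blocks i G) = merge_blocks i (take s G)"
  "drop (s - 1) (merge_blocks i G) = drop s G" by simp_all
qed

lemma merge_blocks_drop:
 assumes "s < i" "i < length G"
 shows "take s (merge_blocks i G) = take s G"
  and "drop s (merge_blocks i G) = merge_blocks (i - s) (drop s G)"
proof -
 have "merge_blocks (length U + k) (U @ H) = U @ merge_blocks k H" if "0 < k" for U H k
  using that by (cases k) (auto simp: merge_blocks_def nth_append)
 from this[of "i - s" "take s G" "drop s G"]
 have "merge_blocks i G = take s G @ merge_blocks (i - s) (drop s G)" using assms by simp
 moreover have "length (take s G) = s" using assms by simp
 ultimately show "take s (merge_blocks i G) = take s G"
  "drop s (merge_blocks i G) = merge_blocks (i - s) (drop s G)" by simp_all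
qed

lemma merge_blocks_composition_iff:
 assumes i: "0 < i" "i < length G" and G: "sorted_wrt (\<lambda>A B. A \<inter> B = {}) G" "{} \<notin> set G"
 shows "merge_blocks i G \<in> compositions I \<longleftrightarrow> G \<in> compositions I"
proof
 assume "merge_blocks i G \<in> compositions I"
 then show "G \<in> compositions I" using G Union_merge_blocks[OF i] by (simp add: compositions_iff)
qed (rule merge_blocks_composition[OF i])

lemma append_composition:
 assumes "F \<in> compositions S" "G \<in> compositions T" "S \<inter> T = {}"
 shows "F @ G \<in> compositions (S \<union> T)"
proof -
 have "A \<inter> B = {}" if "A \<in> set F" "B \<in> set G" for A B
  using that assms by (auto simp: compositions_def)
 then show ?thesis using assms(1,2) by (auto simp: compositions_iff sorted_wrt_append)
qed

lemma append_composition_inj: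
 assumes "F \<in> compositions S" "G \<in> compositions T" "F' \<in> compositions S" "G' \<in> compositions T"
  and "S \<inter> T = {}" "F @ G = F' @ G'"
 shows "F = F' \<and> G = G'"
proof -
 have "filter (\<lambda>A. A \<subseteq> S) (U @ V) = U" if "U \<in> compositions S" "V \<in> compositions T" for U V
 proof -
  have "\<forall>A\<in>set U. A \<subseteq> S" using that by (auto simp: compositions_def)
  then have "filter (\<lambda>A. A \<subseteq> S) U = U" by (simp add: filter_id_conv)
  moreover have "\<not> A \<subseteq> S" if "A \<in> set V" for A
  proof -
   have "A \<noteq> {}" "A \<subseteq> T" using that \<open>V \<in> compositions T\<close> by (auto simp: compositions_def)
   then show ?thesis using assms(5) by auto
  qed
  then have "filter (\<lambda>A. A \<subseteq> S) V = []" by (simp add: filter_empty_conv)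
  ultimately show ?thesis by simp
 qed
 then have "F = F'" using assms by metis
 then show ?thesis using assms(6) by simp
qed

context cring
begin

lemma omegaI:
 assumes "finite I" "\<And>F. f F \<in> carrier R"
  and "\<And>F. F \<notin> compositions I ==> f F = \<zero>"
  and "\<And>F. [|F \<in> compositions I; int (length F) \<noteq> n + int (card I)|] ==> f F = \<zero>"
 shows "f \<in> carrier (omega R I n)"
 unfolding omega_carrier[OF assms(1)]
proof (intro conjI allI impI assms(2))
 fix F assume "f F \<noteq> \<zero>"
 then show "F \<in> compositions I" "int (length F) - int (card I) = n"
  using assms(3,4)[of F] by (cases "F \<in> compositions I"; force)+
qed

lemma omegaD:
 assumes "finite I" "f \<in> carrier (omega R I n)"
 shows "f F \<in> carrier R" "F \<notin> compositions I ==> f F = \<zero>"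
  "int (length F) \<noteq> n + int (card I) ==> f F = \<zero>"
 using assms(2) unfolding omega_carrier[OF assms(1)] by force+

lemma omega_diff_closed:
 assumes I: "finite I" and f: "f \<in> carrier (omega R I (n - 1))"
 shows "omega_diff R I f \<in> carrier (omega R I n)"
proof (rule omegaI[OF I])
 note D = omegaD[OF I f]
 show "omega_diff R I f F \<in> carrier R" for F
  unfolding omega_diff_apply[OF I f] using D(1) by (auto intro!: alt_sum_closed)
 show "omega_diff R I f F = \<zero>" if "F \<notin> compositions I" for F
  unfolding omega_diff_apply[OF I f] using that by simp
 fix F assume F: "F \<in> compositions I" "int (length F) \<noteq> n + int (card I)"
 have "f (merge_blocks i F) = \<zero>" if "i \<in> {1..<length F}" for i
  using that F(2) length_merge_blocks[of i F] by (intro D(3)) auto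
 then show "omega_diff R I f F = \<zero>"
  unfolding omega_diff_apply[OF I f] by (auto intro: alt_sum_zero)
qed

lemma omega_diff_linear:
 assumes I: "finite I" and f: "f \<in> carrier (omega R I n)"
 shows "g \<in> carrier (omega R I n) ==>
   omega_diff R I (\<lambda>F. f F \<oplus> g F) = (\<lambda>F. omega_diff R I f F \<oplus> omega_diff R I g F)"
  and "c \<in> carrier R ==> omega_diff R I (\<lambda>F. c \<otimes> f F) = (\<lambda>F. c \<otimes> omega_diff R I f F)"
proof -
 interpret W: module R "omega R I n" by (rule omega_module)
 show "omega_diff R I (\<lambda>F. f F \<oplus> g F) = (\<lambda>F. omega_diff R I f F \<oplus> omega_diff R I g F)"
  if g: "g \<in> carrier (omega R I n)"
 proof
  fix F
  have fg: "(\<lambda>F. f F \<oplus> g F) \<in> carrier (omega R I n)" using W.M.a_closed[OF f g] by (simp add: omega_simps)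
  show "omega_diff R I (\<lambda>F. f F \<oplus> g F) F = omega_diff R I f F \<oplus> omega_diff R I g F"
   unfolding omega_diff_apply[OF I f] omega_diff_apply[OF I g] omega_diff_apply[OF I fg]
   using omegaD(1)[OF I f] omegaD(1)[OF I g] by (simp add: alt_sum_add[symmetric])
 qed
 show "omega_diff R I (\<lambda>F. c \<otimes> f F) = (\<lambda>F. c \<otimes> omega_diff R I f F)" if c: "c \<in> carrier R"
 proof
  fix F
  have cf: "(\<lambda>F. c \<otimes> f F) \<in> carrier (omega R I n)" using W.smult_closed[OF c f] by (simp add: omega_simps)
  show "omega_diff R I (\<lambda>F. c \<otimes> f F) F = c \<otimes> omega_diff R I f F"
   unfolding omega_diff_apply[OF I f] omega_diff_apply[OF I cf]
   using omegaD(1)[OF I f] c by (simp add: alt_sum_smult[symmetric])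
 qed
qed

text \<open>A composition cannot have more blocks than elements, so \<open>\<Omega>(E)\<close> ends in degree zero.\<close>

lemma omega_cocycles_eq:
 assumes I: "finite I"
 shows "omega_cocycles R I 0 = carrier (omega R I 0)"
proof -
 have "omega_diff R I f = (\<lambda>_. \<zero>)" if f: "f \<in> carrier (omega R I 0)" for f
 proof
  fix F
  have d: "omega_diff R I f \<in> carrier (omega R I 1)"
   by (rule omega_diff_closed[OF I]) (simp add: f)
  show "omega_diff R I f F = \<zero>"
  proof (cases "F \<in> compositions I")
   case True
   then show ?thesis using omegaD(3)[OF I d, of F] length_composition_le[OF I True] by simp
  qed (rule omegaD(2)[OF I d])
 qed
 then show ?thesis by (auto simp: omega_cocycles_def omega_simps)
qed

lemma omega_quotient:
 assumes I: "finite I"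
 shows "quotient_module R (omega R I 0) (cobd I 0)"
proof -
 interpret W: module R "omega R I 0" by (rule omega_module)
 interpret V: module R "omega R I (- 1)" by (rule omega_module)
 have Bd: "cobd I 0 = omega_diff R I ` carrier (omega R I (- 1))"
  by (simp add: omega_coboundaries_def)
 show ?thesis
 proof (unfold_locales)
  show "cobd I 0 \<subseteq> carrier (omega R I 0)"
   unfolding omega_coboundaries_def using omega_diff_closed[OF I] by auto
  have z: "(\<lambda>_. \<zero>) \<in> carrier (omega R I (- 1))" using V.M.zero_closed by (simp add: omega_simps)
  have "omega_diff R I (\<lambda>_. \<zero>) = (\<lambda>_. \<zero>)"
   unfolding fun_eq_iff omega_diff_apply[OF I z] by (auto intro: alt_sum_zero)
  then show "\<zero>\<^bsub>omega R I 0\<^esub> \<in> cobd I 0"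
   unfolding Bd omega_simps by (rule image_eqI[OF sym z])
  fix x y assume "x \<in> cobd I 0" "y \<in> cobd I 0"
  then obtain f g where fg: "f \<in> carrier (omega R I (- 1))" "g \<in> carrier (omega R I (- 1))"
    "x = omega_diff R I f" "y = omega_diff R I g" unfolding Bd by blast
  have "(\<lambda>F. f F \<oplus> g F) \<in> carrier (omega R I (- 1))"
   using V.M.a_closed[OF fg(1,2)] by (simp add: omega_simps)
  then show "x \<oplus>\<^bsub>omega R I 0\<^esub> y \<in> cobd I 0"
   unfolding Bd omega_simps fg(3,4) omega_diff_linear(1)[OF I fg(1,2), symmetric] by (rule imageI)
 next
  fix c x assume c: "c \<in> carrier R" and "x \<in> cobd I 0"
  then obtain f where f: "f \<in> carrier (omega R I (- 1))" "x = omega_diff R I f" unfolding Bd by blast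
  have "(\<lambda>F. c \<otimes> f F) \<in> carrier (omega R I (- 1))"
   using V.smult_closed[OF c f(1)] by (simp add: omega_simps)
  then show "c \<odot>\<^bsub>omega R I 0\<^esub> x \<in> cobd I 0"
   unfolding Bd omega_simps f(2) omega_diff_linear(2)[OF I f(1) c, symmetric] by (rule imageI)
 qed
qed

lemma exp_dual_val:
 assumes "finite I"
 shows "Ed I = quot_module (omega R I 0) (cobd I 0)"
 unfolding exp_dual_def Let_def subquotient_def
 by (simp add: omega_cocycles_eq[OF assms])

lemma exp_dual_simps:
 assumes I: "finite I"
 shows "carrier (Ed I) = {dcl I f | f. f \<in> carrier (omega R I 0)}"
  and "\<zero>\<^bsub>Ed I\<^esub> = dcl I (\<lambda>_. \<zero>)"
  and "[|f \<in> carrier (omega R I 0); g \<in> carrier (omega R I 0)|] ==>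
   dcl I f \<oplus>\<^bsub>Ed I\<^esub> dcl I g = dcl I (\<lambda>F. f F \<oplus> g F)"
  and "[|f \<in> carrier (omega R I 0); c \<in> carrier R|] ==>
   c \<odot>\<^bsub>Ed I\<^esub> dcl I f = dcl I (\<lambda>F. c \<otimes> f F)"
  and "module R (Ed I)"
proof -
 interpret Q: quotient_module R "omega R I 0" "cobd I 0" by (rule omega_quotient[OF I])
 show "carrier (Ed I) = {dcl I f | f. f \<in> carrier (omega R I 0)}"
  by (simp add: exp_dual_val[OF I] Q.quot_module_simps dual_class_def)
 show "\<zero>\<^bsub>Ed I\<^esub> = dcl I (\<lambda>_. \<zero>)"
  by (simp add: exp_dual_val[OF I] Q.quot_module_simps dual_class_def omega_simps)
 show "dcl I f \<oplus>\<^bsub>Ed I\<^esub> dcl I g = dcl I (\<lambda>F. f F \<oplus> g F)"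
  if "f \<in> carrier (omega R I 0)" "g \<in> carrier (omega R I 0)"
  using Q.quot_module_simps(3)[OF that] by (simp add: exp_dual_val[OF I] dual_class_def omega_simps)
 show "c \<odot>\<^bsub>Ed I\<^esub> dcl I f = dcl I (\<lambda>F. c \<otimes> f F)"
  if "f \<in> carrier (omega R I 0)" "c \<in> carrier R"
  using Q.quot_module_simps(4)[OF that] by (simp add: exp_dual_val[OF I] dual_class_def omega_simps)
 show "module R (Ed I)" unfolding exp_dual_val[OF I] by (rule Q.quot_module_module)
qed

lemma omega_difference:
 assumes "f \<in> carrier (omega R I n)" "g \<in> carrier (omega R I n)"
 shows "f \<ominus>\<^bsub>omega R I n\<^esub> g = (\<lambda>F. f F \<ominus> g F)"
 using free_module_minus[OF assms(2)[unfolded omega_def]]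
 by (simp add: a_minus_def omega_def free_module_simps)

lemma dual_class_eq:
 assumes I: "finite I" and "f \<in> carrier (omega R I 0)" "g \<in> carrier (omega R I 0)"
 shows "dcl I f = dcl I g \<longleftrightarrow> (\<lambda>F. f F \<ominus> g F) \<in> cobd I 0"
proof -
 interpret Q: quotient_module R "omega R I 0" "cobd I 0" by (rule omega_quotient[OF I])
 show ?thesis using Q.coset_eq[OF assms(2,3)] by (simp add: dual_class_def omega_difference[OF assms(2,3)])
qed

lemma dual_class_mem:
 assumes I: "finite I" and "f \<in> carrier (omega R I 0)"
 shows "f \<in> dcl I f"
  and "g \<in> dcl I f \<longleftrightarrow>
   g \<in> carrier (omega R I 0) \<and> (\<lambda>F. g F \<ominus> f F) \<in> cobd I 0"
proof -
 interpret Q: quotient_module R "omega R I 0" "cobd I 0" by (rule omega_quotient[OF I])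
 show "f \<in> dcl I f" using Q.coset_self[OF assms(2)] by (simp add: dual_class_def)
 show "g \<in> dcl I f \<longleftrightarrow>
   g \<in> carrier (omega R I 0) \<and> (\<lambda>F. g F \<ominus> f F) \<in> cobd I 0"
  using Q.mem_coset[OF assms(2), of g] omega_difference[OF _ assms(2), of g] by (auto simp: dual_class_def)
qed

lemma dual_class_zero:
 assumes I: "finite I" and f: "f \<in> carrier (omega R I 0)"
 shows "dcl I f = \<zero>\<^bsub>Ed I\<^esub> \<longleftrightarrow> f \<in> cobd I 0"
proof -
 have z: "(\<lambda>_. \<zero>) \<in> carrier (omega R I 0)"
  using abelian_groupE(2)[OF module.axioms(2)[OF omega_module[of I 0]]] by (simp add: omega_simps)
 have "(\<lambda>F. f F \<ominus> \<zero>) = f"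
 proof
  show "f F \<ominus> \<zero> = f F" for F using omegaD(1)[OF I f, of F] by (simp add: a_minus_def)
 qed
 then show ?thesis using dual_class_eq[OF I f z] by (simp add: exp_dual_simps(2)[OF I])
qed

text \<open>The linear map underlying the action of a bijection on \<open>E\<^sup>!\<close>.\<close>

definition relabel :: "(nat => nat) => nat set => (nat set list => 'a) => nat set list => 'a" where
 "relabel \<sigma> I = lin_ext (fmod (compositions (\<sigma> ` I))) (compositions I)
   (\<lambda>F. bas (map (image \<sigma>) F))"

lemma relabel:
 assumes I: "finite I" and \<sigma>: "inj_on \<sigma> I" and f: "f \<in> carrier (omega R I n)"
 shows relabel_apply: "F \<in> compositions I ==> relabel \<sigma> I f (map (image \<sigma>) F) = f F"
  and relabel_closed: "relabel \<sigma> I f \<in> carrier (omega R (\<sigma> ` I) n)"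
proof -
 have inj: "inj_on (map (image \<sigma>)) (compositions I)"
  by (rule inj_on_subset[OF inj_relabel[OF \<sigma>]]) (auto simp: compositions_def)
 note fin = finite_compositions[OF I]
 have into: "F \<in> compositions I ==> map (image \<sigma>) F \<in> compositions (\<sigma> ` I)" for F
  by (rule relabel_compositions[OF \<sigma>])
 note fR = omegaD(1)[OF I f]
 show app: "relabel \<sigma> I f (map (image \<sigma>) F) = f F" if "F \<in> compositions I" for F
  unfolding relabel_def by (rule lin_ext_basis_image[OF fin inj into fR that])
 have out: "relabel \<sigma> I f G = \<zero>" if "G \<notin> compositions (\<sigma> ` I)" for G
  unfolding relabel_def using that relabel_compositions_image[OF \<sigma>]
  by (intro lin_ext_basis_outside[OF fin inj into fR]) auto
 have card: "card (\<sigma> ` I) = card I" by (rule card_image[OF \<sigma>])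
 have finJ: "finite (\<sigma> ` I)" using I by simp
 have cases: "(\<exists>F\<in>compositions I. G = map (image \<sigma>) F) \<or> G \<notin> compositions (\<sigma> ` I)" for G
  using relabel_compositions_image[OF \<sigma>] by blast
 show "relabel \<sigma> I f \<in> carrier (omega R (\<sigma> ` I) n)"
 proof (rule omegaI[OF finJ])
  show "relabel \<sigma> I f G \<in> carrier R" for G using cases[of G] app out fR by auto
  show "relabel \<sigma> I f G = \<zero>" if "G \<notin> compositions (\<sigma> ` I)" for G by (rule out[OF that])
  fix G assume G: "G \<in> compositions (\<sigma> ` I)" "int (length G) \<noteq> n + int (card (\<sigma> ` I))"
  then obtain F where "F \<in> compositions I" "G = map (image \<sigma>) F" using cases by blast
  then show "relabel \<sigma> I f G = \<zero>" using G(2) app omegaD(3)[OF I f, of F] by (simp add: card)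
 qed
qed

lemma relabel_eqI:
 assumes "inj_on \<sigma> I" "finite I" "g \<in> carrier (omega R (\<sigma> ` I) n)" "h \<in> carrier (omega R (\<sigma> ` I) m)"
  and "\<And>F. F \<in> compositions I ==> g (map (image \<sigma>) F) = h (map (image \<sigma>) F)"
 shows "g = h"
proof
 fix G
 have fin: "finite (\<sigma> ` I)" using assms(2) by simp
 show "g G = h G"
 proof (cases "G \<in> compositions (\<sigma> ` I)")
  case True
  then obtain F where "F \<in> compositions I" "G = map (image \<sigma>) F"
   using relabel_compositions_image[OF assms(1)] by blast
  then show ?thesis using assms(5) by simp
 qed (use omegaD(2)[OF fin assms(3)] omegaD(2)[OF fin assms(4)] in auto)
qed

lemma relabel_diff:
 assumes I: "finite I" and \<sigma>: "inj_on \<sigma> I" and f: "f \<in> carrier (omega R I (n - 1))"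
 shows "relabel \<sigma> I (omega_diff R I f) = omega_diff R (\<sigma> ` I) (relabel \<sigma> I f)"
proof (rule relabel_eqI[OF \<sigma> I relabel_closed[OF I \<sigma> omega_diff_closed[OF I f]]
   omega_diff_closed[OF _ relabel_closed[OF I \<sigma> f]]])
 show fin: "finite (\<sigma> ` I)" using I by simp
 fix F assume F: "F \<in> compositions I"
 note r = relabel_closed[OF I \<sigma> f]
 have "omega_diff R (\<sigma> ` I) (relabel \<sigma> I f) (map (image \<sigma>) F) =
   alt_sum R {1..<length F} (\<lambda>i. relabel \<sigma> I f (merge_blocks i (map (image \<sigma>) F)))"
  unfolding omega_diff_apply[OF fin r] using relabel_compositions[OF \<sigma> F] by simp
 also have "\<dots> = alt_sum R {1..<length F} (\<lambda>i. f (merge_blocks i F))"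
 proof (rule alt_sum_cong)
  fix i assume i: "i \<in> {1..<length F}"
  then have "merge_blocks i (map (image \<sigma>) F) = map (image \<sigma>) (merge_blocks i F)"
   by (intro map_merge_blocks[symmetric]) auto
  moreover have "merge_blocks i F \<in> compositions I"
   using merge_blocks_composition[OF _ _ F] i by simp
  ultimately show "relabel \<sigma> I f (merge_blocks i (map (image \<sigma>) F)) = f (merge_blocks i F)"
   by (simp add: relabel_apply[OF I \<sigma> f])
 qed (rule omegaD(1)[OF I f])
 also have "\<dots> = omega_diff R I f F" using F by (simp add: omega_diff_apply[OF I f])
 finally show "relabel \<sigma> I (omega_diff R I f) (map (image \<sigma>) F) =
   omega_diff R (\<sigma> ` I) (relabel \<sigma> I f) (map (image \<sigma>) F)"
  by (simp add: relabel_apply[OF I \<sigma> omega_diff_closed[OF I f] F])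
qed

lemma relabel_linear:
 assumes I: "finite I" and \<sigma>: "inj_on \<sigma> I" and f: "f \<in> carrier (omega R I n)"
 shows "g \<in> carrier (omega R I n) ==>
   relabel \<sigma> I (\<lambda>F. f F \<oplus> g F) = (\<lambda>F. relabel \<sigma> I f F \<oplus> relabel \<sigma> I g F)"
  and "g \<in> carrier (omega R I n) ==>
   relabel \<sigma> I (\<lambda>F. f F \<ominus> g F) = (\<lambda>F. relabel \<sigma> I f F \<ominus> relabel \<sigma> I g F)"
  and "c \<in> carrier R ==> relabel \<sigma> I (\<lambda>F. c \<otimes> f F) = (\<lambda>F. c \<otimes> relabel \<sigma> I f F)"
proof -
 interpret W: module R "omega R I n" by (rule omega_module)
 interpret V: module R "omega R (\<sigma> ` I) n" by (rule omega_module)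
 note rc = relabel_closed[OF I \<sigma>] and ra = relabel_apply[OF I \<sigma>]
 show "relabel \<sigma> I (\<lambda>F. f F \<oplus> g F) = (\<lambda>F. relabel \<sigma> I f F \<oplus> relabel \<sigma> I g F)"
  if g: "g \<in> carrier (omega R I n)"
 proof -
  have fg: "(\<lambda>F. f F \<oplus> g F) \<in> carrier (omega R I n)" using W.M.a_closed[OF f g] by (simp add: omega_simps)
  have r: "(\<lambda>F. relabel \<sigma> I f F \<oplus> relabel \<sigma> I g F) \<in> carrier (omega R (\<sigma> ` I) n)"
   using V.M.a_closed[OF rc[OF f] rc[OF g]] by (simp add: omega_simps)
  show ?thesis by (rule relabel_eqI[OF \<sigma> I rc[OF fg] r]) (simp add: ra[OF f] ra[OF g] ra[OF fg])
 qed
 show "relabel \<sigma> I (\<lambda>F. f F \<ominus> g F) = (\<lambda>F. relabel \<sigma> I f F \<ominus> relabel \<sigma> I g F)"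
  if g: "g \<in> carrier (omega R I n)"
 proof -
  have fg: "(\<lambda>F. f F \<ominus> g F) \<in> carrier (omega R I n)"
   using W.M.minus_closed[OF f g] by (simp add: omega_difference[OF f g])
  have r: "(\<lambda>F. relabel \<sigma> I f F \<ominus> relabel \<sigma> I g F) \<in> carrier (omega R (\<sigma> ` I) n)"
   using V.M.minus_closed[OF rc[OF f] rc[OF g]] by (simp add: omega_difference[OF rc[OF f] rc[OF g]])
  show ?thesis by (rule relabel_eqI[OF \<sigma> I rc[OF fg] r]) (simp add: ra[OF f] ra[OF g] ra[OF fg])
 qed
 show "relabel \<sigma> I (\<lambda>F. c \<otimes> f F) = (\<lambda>F. c \<otimes> relabel \<sigma> I f F)" if c: "c \<in> carrier R"
 proof -
  have cf: "(\<lambda>F. c \<otimes> f F) \<in> carrier (omega R I n)" using W.smult_closed[OF c f] by (simp add: omega_simps)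
  have r: "(\<lambda>F. c \<otimes> relabel \<sigma> I f F) \<in> carrier (omega R (\<sigma> ` I) n)"
   using V.smult_closed[OF c rc[OF f]] by (simp add: omega_simps)
  show ?thesis by (rule relabel_eqI[OF \<sigma> I rc[OF cf] r]) (simp add: ra[OF f] ra[OF cf])
 qed
qed

lemma exp_dual_map:
 assumes I: "finite I" and \<sigma>: "inj_on \<sigma> I" and f: "f \<in> carrier (omega R I 0)"
 shows "sp_map (exp_dual R) I \<sigma> (dcl I f) = dcl (\<sigma> ` I) (relabel \<sigma> I f)"
proof -
 have fin: "finite (\<sigma> ` I)" using I by simp
 have "dcl I f \<in> carrier (Ed I)"
  using f by (auto simp: exp_dual_simps(1)[OF I])
 then have "sp_map (exp_dual R) I \<sigma> (dcl I f) =
   (\<Union>g\<in>dcl I f. dcl (\<sigma> ` I) (relabel \<sigma> I g))"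
  by (simp add: exp_dual_def Let_def relabel_def)
 also have "\<dots> = dcl (\<sigma> ` I) (relabel \<sigma> I f)"
 proof -
  have "dcl (\<sigma> ` I) (relabel \<sigma> I g) = dcl (\<sigma> ` I) (relabel \<sigma> I f)"
   if g: "g \<in> dcl I f" for g
  proof -
   have g': "g \<in> carrier (omega R I 0)" and "(\<lambda>F. g F \<ominus> f F) \<in> cobd I 0"
    using g dual_class_mem(2)[OF I f] by auto
   then obtain h where h: "h \<in> carrier (omega R I (0 - 1))" "(\<lambda>F. g F \<ominus> f F) = omega_diff R I h"
    by (auto simp: omega_coboundaries_def)
   have "(\<lambda>F. relabel \<sigma> I g F \<ominus> relabel \<sigma> I f F) = omega_diff R (\<sigma> ` I) (relabel \<sigma> I h)"
    using relabel_linear(2)[OF I \<sigma> g' f] relabel_diff[OF I \<sigma> h(1)] h(2) by simp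
   then have "(\<lambda>F. relabel \<sigma> I g F \<ominus> relabel \<sigma> I f F) \<in> cobd (\<sigma> ` I) 0"
    using relabel_closed[OF I \<sigma> h(1)] by (auto simp: omega_coboundaries_def)
   then show ?thesis
    using dual_class_eq[OF fin relabel_closed[OF I \<sigma> g'] relabel_closed[OF I \<sigma> f]] by simp
  qed
  then show ?thesis using dual_class_mem(1)[OF I f] by blast
 qed
 finally show ?thesis .
qed

lemma linear_relabelling_exp_dual: "linear_relabelling R (exp_dual R)"
 unfolding linear_relabelling_def
proof (intro allI impI conjI)
 fix I :: "nat set" assume I: "finite I"
 show "module R (Ed I)" by (rule exp_dual_simps(5)[OF I])
 fix \<sigma> :: "nat => nat" assume \<sigma>: "inj_on \<sigma> I"
 have fin: "finite (\<sigma> ` I)" using I by simp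
 note C = exp_dual_simps[OF I] and D = exp_dual_simps[OF fin]
 note rc = relabel_closed[OF I \<sigma>] and em = exp_dual_map[OF I \<sigma>]
 interpret W: module R "omega R I 0" by (rule omega_module)
 show "sp_map (exp_dual R) I \<sigma> \<in> lin_hom R (Ed I) (Ed (\<sigma> ` I))"
 proof (rule lin_homI)
  fix x assume "x \<in> carrier (Ed I)"
  then obtain f where f: "f \<in> carrier (omega R I 0)" "x = dcl I f" by (auto simp: C(1))
  show "sp_map (exp_dual R) I \<sigma> x \<in> carrier (Ed (\<sigma> ` I))"
   unfolding f(2) em[OF f(1)] D(1) using rc[OF f(1)] by blast
  show "sp_map (exp_dual R) I \<sigma> (c \<odot>\<^bsub>Ed I\<^esub> x) =
    c \<odot>\<^bsub>Ed (\<sigma> ` I)\<^esub> sp_map (exp_dual R) I \<sigma> x" if c: "c \<in> carrier R" for c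
  proof -
   have cf: "(\<lambda>F. c \<otimes> f F) \<in> carrier (omega R I 0)"
    using W.smult_closed[OF c f(1)] by (simp add: omega_simps)
   show ?thesis
    unfolding f(2) C(4)[OF f(1) c] em[OF f(1)] em[OF cf] D(4)[OF rc[OF f(1)] c]
    by (simp add: relabel_linear(3)[OF I \<sigma> f(1) c])
  qed
  fix y assume "y \<in> carrier (Ed I)"
  then obtain g where g: "g \<in> carrier (omega R I 0)" "y = dcl I g" by (auto simp: C(1))
  have fg: "(\<lambda>F. f F \<oplus> g F) \<in> carrier (omega R I 0)"
   using W.M.a_closed[OF f(1) g(1)] by (simp add: omega_simps)
  show "sp_map (exp_dual R) I \<sigma> (x \<oplus>\<^bsub>Ed I\<^esub> y) =
    sp_map (exp_dual R) I \<sigma> x \<oplus>\<^bsub>Ed (\<sigma> ` I)\<^esub> sp_map (exp_dual R) I \<sigma> y"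
   unfolding f(2) g(2) C(3)[OF f(1) g(1)] em[OF f(1)] em[OF g(1)] em[OF fg] D(3)[OF rc[OF f(1)] rc[OF g(1)]]
   by (simp add: relabel_linear(1)[OF I \<sigma> f(1) g(1)])
 next
  fix x assume "x \<notin> carrier (Ed I)"
  then show "sp_map (exp_dual R) I \<sigma> x = undefined" by (simp add: exp_dual_def Let_def)
 qed
qed

end

context cring
begin

text \<open>The concatenation product in terms of coefficient functions, the left factor having words of
 length \<open>s\<close>.\<close>

definition conc :: "nat => (nat set list => 'a) => (nat set list => 'a) => nat set list => 'a" where
 "conc s f g H = f (take s H) \<otimes> g (drop s H)"

lemma conc_closed:
 assumes "finite S" "finite T" "S \<inter> T = {}"
  and f: "f \<in> carrier (omega R S m)" and g: "g \<in> carrier (omega R T n)"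
  and s: "s = nat (m + int (card S))"
 shows "conc s f g \<in> carrier (omega R (S \<union> T) (m + n))"
proof -
 have fin: "finite (S \<union> T)" using assms(1,2) by simp
 note F = omegaD[OF assms(1) f] and G = omegaD[OF assms(2) g]
 have *: "H \<in> compositions (S \<union> T) \<and> int (length H) = m + n + int (card (S \<union> T))"
  if "conc s f g H \<noteq> \<zero>" for H
 proof -
  have ne: "f (take s H) \<noteq> \<zero>" "g (drop s H) \<noteq> \<zero>"
   using that F(1) G(1) by (auto simp: conc_def)
  then have "take s H \<in> compositions S" "drop s H \<in> compositions T" using F(2) G(2) by blast+
  then have "H \<in> compositions (S \<union> T)"
   using append_composition[OF _ _ assms(3), of "take s H" "drop s H"] by simp
  moreover have "int (length (take s H)) = m + int (card S)" "int (length (drop s H)) = n + int (card T)"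
   using F(3) G(3) ne by blast+
  then have "int (length H) = m + n + int (card S) + int (card T)"
   by (metis (no_types, lifting) add.assoc add.commute add.left_commute append_take_drop_id length_append of_nat_add)
  ultimately show ?thesis using card_Un_disjoint[OF assms(1-3)] by simp
 qed
 show ?thesis
  by (rule omegaI[OF fin]) (use * F(1) G(1) in \<open>auto simp: conc_def\<close>)
qed

lemma conc_lin_ext:
 assumes "finite S" "finite T" "S \<inter> T = {}"
  and f: "f \<in> carrier (omega R S 0)" and g: "g \<in> carrier (omega R T 0)"
 shows "lin_ext (fmod (compositions (S \<union> T))) (compositions S)
  (\<lambda>F. lin_ext (fmod (compositions (S \<union> T))) (compositions T) (\<lambda>G. bas (F @ G)) g) f =
  conc (card S) f g"
proof
 fix H
 let ?W = "fmod (compositions (S \<union> T))"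
 let ?V = "\<lambda>F. lin_ext ?W (compositions T) (\<lambda>G. bas (F @ G)) g"
 note F = omegaD[OF assms(1) f] and G = omegaD[OF assms(2) g]
 have fin: "finite (compositions S)" "finite (compositions T)" "finite (compositions (S \<union> T))"
  using assms(1,2) by (auto intro: finite_compositions)
 have app: "A @ B \<in> compositions (S \<union> T)" if "A \<in> compositions S" "B \<in> compositions T" for A B
  by (rule append_composition[OF that assms(3)])
 have V_im: "?V A (A @ B) = g B" if "A \<in> compositions S" "B \<in> compositions T" for A B
  by (rule lin_ext_basis_image[OF fin(2)]) (use app that G(1) in \<open>auto simp: inj_on_def\<close>)
 have V_out: "?V A H = \<zero>" if "A \<in> compositions S" "\<nexists>B. B \<in> compositions T \<and> H = A @ B" for A H
  by (rule lin_ext_basis_outside[OF fin(2)]) (use app that G(1) in \<open>auto simp: inj_on_def\<close>)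
 have V_closed: "?V A H \<in> carrier R" if "A \<in> compositions S" for A H
 proof (cases "\<exists>B. B \<in> compositions T \<and> H = A @ B")
  case True
  then obtain B where "B \<in> compositions T" "H = A @ B" by blast
  then show ?thesis using V_im[OF that] G(1) by simp
 next
  case False
  then show ?thesis using V_out[OF that False] by simp
 qed
 have V_in: "?V A \<in> carrier ?W" if "A \<in> compositions S" for A
  unfolding free_module_carrier[OF fin(3)]
 proof (intro conjI allI impI)
  show "?V A H \<in> carrier R" for H by (rule V_closed[OF that])
  show "?V A H = \<zero>" if "H \<notin> compositions (S \<union> T)" for H
   by (rule V_out[OF \<open>A \<in> compositions S\<close>]) (use app[OF \<open>A \<in> compositions S\<close>] that in blast)
 qed
 have eval: "lin_ext ?W (compositions S) ?V f H = (\<Oplus>A\<in>compositions S. f A \<otimes> ?V A H)"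
  by (rule lin_ext_eval[OF fin(1) V_in F(1)])
 show "lin_ext ?W (compositions S) ?V f H = conc (card S) f g H"
 proof (cases "\<exists>A\<in>compositions S. \<exists>B\<in>compositions T. H = A @ B")
  case True
  then obtain A B where AB: "A \<in> compositions S" "B \<in> compositions T" "H = A @ B" by blast
  have "f A' \<otimes> ?V A' H = \<zero>" if "A' \<in> compositions S" "A' \<noteq> A" for A'
  proof -
   have "\<nexists>B'. B' \<in> compositions T \<and> H = A' @ B'"
   proof
    assume "\<exists>B'. B' \<in> compositions T \<and> H = A' @ B'"
    then obtain B' where "B' \<in> compositions T" "H = A' @ B'" by blast
    then have "A = A'" using append_composition_inj[OF AB(1,2) that(1) _ assms(3), of B'] AB(3) by simp
    then show False using that(2) by simp
   qed
   then show ?thesis using V_out[OF that(1)] F(1) by simp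
  qed
  then have "lin_ext ?W (compositions S) ?V f H = f A \<otimes> ?V A H"
   unfolding eval using V_closed[OF AB(1)] F(1) by (intro finsum_single_term[OF fin(1) AB(1)]) auto
  also have "\<dots> = f A \<otimes> g B" using V_im[OF AB(1,2)] AB(3) by simp
  also have "\<dots> = conc (card S) f g H"
  proof (cases "length A = card S")
   case True
   then show ?thesis using AB(3) by (simp add: conc_def)
  next
   case False
   then have "f A = \<zero>" using F(3)[of A] by simp
   moreover have "conc (card S) f g H = \<zero>"
   proof (rule ccontr)
    assume "conc (card S) f g H \<noteq> \<zero>"
    then have "f (take (card S) H) \<noteq> \<zero>" "g (drop (card S) H) \<noteq> \<zero>"
     using F(1) G(1) by (auto simp: conc_def)
    then have th: "take (card S) H \<in> compositions S" "drop (card S) H \<in> compositions T"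
      "int (length (take (card S) H)) = 0 + int (card S)"
     using F(2) G(2) F(3) by blast+
    have "A @ B = take (card S) H @ drop (card S) H"
     unfolding append_take_drop_id by (rule AB(3)[symmetric])
    note A = conjunct1[OF append_composition_inj[OF AB(1,2) th(1,2) assms(3) this]]
    then show False using False th(3) arg_cong[OF A, of length] by linarith
   qed
   ultimately show ?thesis using G(1) by simp
  qed
  finally show ?thesis .
 next
  case False
  have "f A \<otimes> ?V A H = \<zero>" if "A \<in> compositions S" for A
   using V_out[OF that, of H] F(1) False that by auto
  then have "lin_ext ?W (compositions S) ?V f H = \<zero>"
   unfolding eval by (rule add.finprod_one_eqI)
  moreover have "take (card S) H \<notin> compositions S \<or> drop (card S) H \<notin> compositions T"
   using False by (metis append_take_drop_id)
  then have "conc (card S) f g H = \<zero>" using F(1,2) G(1,2) by (auto simp: conc_def)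
  ultimately show ?thesis by simp
 qed
qed

lemma alt_sum_filter:
 assumes "finite B" "A \<subseteq> B" "\<And>i. i \<in> B ==> P i \<longleftrightarrow> i \<in> A" "\<And>i. i \<in> A ==> u i \<in> carrier R"
 shows "alt_sum R B (\<lambda>i. if P i then u i else \<zero>) = alt_sum R A u"
proof (rule add.finprod_mono_neutral_cong_right[OF assms(1,2)])
 show "(\<lambda>i. [((-1 :: int) ^ i)] \<cdot> (if P i then u i else \<zero>)) \<in> B \<rightarrow> carrier R"
 proof
  show "[((-1 :: int) ^ i)] \<cdot> (if P i then u i else \<zero>) \<in> carrier R" if "i \<in> B" for i
   using assms(3)[OF that] assms(4)[of i] by (cases "P i") auto
 qed
qed (use assms in auto)

text \<open>The coboundaries form an ideal: the differential of a product with a factor of top degree is the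
 product with the differential of the other factor.\<close>

lemma conc_coboundary_left:
 assumes "finite S" "finite T" "S \<inter> T = {}"
  and h: "h \<in> carrier (omega R S (0 - 1))" and g: "g \<in> carrier (omega R T 0)"
 shows "conc (card S) (omega_diff R S h) g = omega_diff R (S \<union> T) (conc (card S - 1) h g)"
proof
 fix G
 let ?s = "card S"
 have fin: "finite (S \<union> T)" using assms(1,2) by simp
 note H = omegaD[OF assms(1) h] and D = omegaD[OF assms(2) g]
 have pred: "?s - 1 = nat (0 - 1 + int ?s)" by simp
 have k: "conc (?s - 1) h g \<in> carrier (omega R (S \<union> T) (0 - 1))"
  using conc_closed[OF assms(1-3) h g, of "?s - 1", OF pred] by simp
 have L: "conc ?s (omega_diff R S h) g \<in> carrier (omega R (S \<union> T) 0)"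
  using conc_closed[OF assms(1-3) omega_diff_closed[OF assms(1) h] g, of ?s] by simp
 have Rt: "omega_diff R (S \<union> T) (conc (?s - 1) h g) \<in> carrier (omega R (S \<union> T) 0)"
  by (rule omega_diff_closed[OF fin k])
 show "conc ?s (omega_diff R S h) g G = omega_diff R (S \<union> T) (conc (?s - 1) h g) G"
 proof (cases "G \<in> compositions (S \<union> T) \<and> length G = card (S \<union> T)")
  case False
  then show ?thesis using omegaD(2,3)[OF fin L, of G] omegaD(2,3)[OF fin Rt, of G] by auto
 next
  case True
  have len: "length G = ?s + card T" using True card_Un_disjoint[OF assms(1-3)] by simp
  have sorted: "sorted_wrt (\<lambda>A B. A \<inter> B = {}) G" "{} \<notin> set G" using True by (auto simp: compositions_iff)
  have take_ok: "sorted_wrt (\<lambda>A B. A \<inter> B = {}) (take k G)" "{} \<notin> set (take k G)"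
   and drop_ok: "sorted_wrt (\<lambda>A B. A \<inter> B = {}) (drop k G)" "{} \<notin> set (drop k G)" for k
   using sorted by (auto simp: sorted_wrt_take sorted_wrt_drop dest: in_set_takeD in_set_dropD)
  have low: "conc (?s - 1) h g (merge_blocks i G) = h (merge_blocks i (take ?s G)) \<otimes> g (drop ?s G)"
   if "0 < i" "i < ?s" for i
   using merge_blocks_take[OF that, of G] len by (simp add: conc_def)
  have high: "conc (?s - 1) h g (merge_blocks i G) = \<zero>" if i: "?s \<le> i" "i < length G" for i
  proof (rule ccontr)
   assume "conc (?s - 1) h g (merge_blocks i G) \<noteq> \<zero>"
   then have ne: "h (take (?s - 1) (merge_blocks i G)) \<noteq> \<zero>" "g (drop (?s - 1) (merge_blocks i G)) \<noteq> \<zero>"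
    using H(1) D(1) by (auto simp: conc_def)
   have s: "0 < ?s"
    using H(3)[of "take (?s - 1) (merge_blocks i G)"] ne(1) by (cases ?s) auto
   have drop: "drop (?s - 1) (merge_blocks i G) = merge_blocks (i - (?s - 1)) (drop (?s - 1) G)"
    by (rule merge_blocks_drop) (use i s in auto)
   have "merge_blocks (i - (?s - 1)) (drop (?s - 1) G) \<in> compositions T"
    using D(2) ne(2) drop by metis
   then have "drop (?s - 1) G \<in> compositions T"
    by (subst (asm) merge_blocks_composition_iff) (use i s drop_ok in auto)
   from length_composition_le[OF assms(2) this] show False using len s by simp
  qed
  have "omega_diff R (S \<union> T) (conc (?s - 1) h g) G =
    alt_sum R {1..<length G} (\<lambda>i. if i < ?s then h (merge_blocks i (take ?s G)) \<otimes> g (drop ?s G) else \<zero>)"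
   unfolding omega_diff_apply[OF fin k] using True low high H(1) D(1)
   by (auto intro!: alt_sum_cong)
  also have "\<dots> = alt_sum R {1..<?s} (\<lambda>i. h (merge_blocks i (take ?s G)) \<otimes> g (drop ?s G))"
   using len H(1) D(1) by (intro alt_sum_filter) auto
  also have "\<dots> = alt_sum R {1..<?s} (\<lambda>i. h (merge_blocks i (take ?s G))) \<otimes> g (drop ?s G)"
   using H(1) D(1) by (simp add: m_comm[of _ "g (drop ?s G)"] alt_sum_smult alt_sum_closed)
  also have "\<dots> = omega_diff R S h (take ?s G) \<otimes> g (drop ?s G)"
  proof (cases "take ?s G \<in> compositions S")
   case True
   then show ?thesis using len by (simp add: omega_diff_apply[OF assms(1) h])
  next
   case False
   have "h (merge_blocks i (take ?s G)) = \<zero>" if "i \<in> {1..<?s}" for i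
    by (rule H(2), subst merge_blocks_composition_iff) (use that len False take_ok in auto)
   then have "alt_sum R {1..<?s} (\<lambda>i. h (merge_blocks i (take ?s G))) = \<zero>" by (rule alt_sum_zero)
   then show ?thesis using False by (simp add: omega_diff_apply[OF assms(1) h])
  qed
  finally show ?thesis by (simp add: conc_def)
 qed
qed

lemma conc_coboundary_right:
 assumes "finite S" "finite T" "S \<inter> T = {}"
  and f: "f \<in> carrier (omega R S 0)" and h: "h \<in> carrier (omega R T (0 - 1))"
 shows "conc (card S) f (omega_diff R T h) =
  omega_diff R (S \<union> T) (\<lambda>F. (if even (card S) then \<one> else \<ominus> \<one>) \<otimes> conc (card S) f h F)"
proof
 fix G
 let ?s = "card S" and ?e = "if even (card S) then \<one> else \<ominus> \<one>"
 have fin: "finite (S \<union> T)" using assms(1,2) by simp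
 note F = omegaD[OF assms(1) f] and H = omegaD[OF assms(2) h]
 have k: "conc ?s f h \<in> carrier (omega R (S \<union> T) (0 - 1))"
  using conc_closed[OF assms(1-3) f h, of ?s] by simp
 interpret V: module R "omega R (S \<union> T) (0 - 1)" by (rule omega_module)
 have ek: "(\<lambda>F. ?e \<otimes> conc ?s f h F) \<in> carrier (omega R (S \<union> T) (0 - 1))"
  using V.smult_closed[OF _ k, of ?e] by (simp add: omega_simps)
 have L: "conc ?s f (omega_diff R T h) \<in> carrier (omega R (S \<union> T) 0)"
  using conc_closed[OF assms(1-3) f omega_diff_closed[OF assms(2) h], of ?s] by simp
 have Rt: "omega_diff R (S \<union> T) (\<lambda>F. ?e \<otimes> conc ?s f h F) \<in> carrier (omega R (S \<union> T) 0)"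
  by (rule omega_diff_closed[OF fin ek])
 show "conc ?s f (omega_diff R T h) G = omega_diff R (S \<union> T) (\<lambda>F. ?e \<otimes> conc ?s f h F) G"
 proof (cases "G \<in> compositions (S \<union> T) \<and> length G = card (S \<union> T)")
  case False
  then show ?thesis using omegaD(2,3)[OF fin L, of G] omegaD(2,3)[OF fin Rt, of G] by auto
 next
  case True
  have len: "length G = ?s + card T" using True card_Un_disjoint[OF assms(1-3)] by simp
  have sorted: "sorted_wrt (\<lambda>A B. A \<inter> B = {}) G" "{} \<notin> set G" using True by (auto simp: compositions_iff)
  have take_ok: "sorted_wrt (\<lambda>A B. A \<inter> B = {}) (take k G)" "{} \<notin> set (take k G)"
   and drop_ok: "sorted_wrt (\<lambda>A B. A \<inter> B = {}) (drop k G)" "{} \<notin> set (drop k G)" for k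
   using sorted by (auto simp: sorted_wrt_take sorted_wrt_drop dest: in_set_takeD in_set_dropD)
  have high: "conc ?s f h (merge_blocks i G) = f (take ?s G) \<otimes> h (merge_blocks (i - ?s) (drop ?s G))"
   if "?s < i" "i < length G" for i
   using merge_blocks_drop[OF that] by (simp add: conc_def)
  have low: "conc ?s f h (merge_blocks i G) = \<zero>" if i: "0 < i" "i \<le> ?s" "i < length G" for i
  proof (rule ccontr)
   assume "conc ?s f h (merge_blocks i G) \<noteq> \<zero>"
   then have ne: "f (take ?s (merge_blocks i G)) \<noteq> \<zero>"
    using F(1) H(1) by (auto simp: conc_def)
   have "int (length (take ?s (merge_blocks i G))) = 0 + int ?s" using F(3) ne by blast
   then have "Suc ?s \<le> length G" using length_merge_blocks[OF i(1,3)] i by simp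
   then have "take ?s (merge_blocks i G) = merge_blocks i (take (Suc ?s) G)"
    using merge_blocks_take(1)[of i "Suc ?s" G] i by simp
   then have "merge_blocks i (take (Suc ?s) G) \<in> compositions S" using F(2) ne by metis
   then have "take (Suc ?s) G \<in> compositions S"
    by (subst (asm) merge_blocks_composition_iff) (use i take_ok in auto)
   from length_composition_le[OF assms(1) this] show False using \<open>Suc ?s \<le> length G\<close> by simp
  qed
  have "omega_diff R (S \<union> T) (\<lambda>F. ?e \<otimes> conc ?s f h F) G =
    alt_sum R {1..<length G} (\<lambda>i. if ?s < i then ?e \<otimes> (f (take ?s G) \<otimes> h (merge_blocks (i - ?s) (drop ?s G))) else \<zero>)"
   unfolding omega_diff_apply[OF fin ek] using True low high H(1) F(1)
   by (auto intro!: alt_sum_cong)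
  also have "\<dots> = alt_sum R {Suc ?s..<length G} (\<lambda>i. ?e \<otimes> (f (take ?s G) \<otimes> h (merge_blocks (i - ?s) (drop ?s G))))"
   using len H(1) F(1) by (intro alt_sum_filter) auto
  also have "{Suc ?s..<length G} = (\<lambda>j. ?s + j) ` {1..<card T}"
   unfolding len by (simp add: image_add_atLeastLessThan' add.commute)
  also have "alt_sum R ((\<lambda>j. ?s + j) ` {1..<card T}) (\<lambda>i. ?e \<otimes> (f (take ?s G) \<otimes> h (merge_blocks (i - ?s) (drop ?s G)))) =
    (\<Oplus>j\<in>{1..<card T}. [((-1 :: int) ^ (?s + j))] \<cdot> (?e \<otimes> (f (take ?s G) \<otimes> h (merge_blocks j (drop ?s G)))))"
   using H(1) F(1) by (subst finsum_reindex) (auto simp: inj_on_def)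
  also have "\<dots> = alt_sum R {1..<card T} (\<lambda>j. f (take ?s G) \<otimes> h (merge_blocks j (drop ?s G)))"
   using H(1) F(1) by (intro finsum_cong') (auto simp: signed_multiple l_minus)
  also have "\<dots> = f (take ?s G) \<otimes> alt_sum R {1..<card T} (\<lambda>j. h (merge_blocks j (drop ?s G)))"
   using H(1) F(1) by (intro alt_sum_smult) auto
  also have "\<dots> = f (take ?s G) \<otimes> omega_diff R T h (drop ?s G)"
  proof (cases "drop ?s G \<in> compositions T")
   case True
   then show ?thesis using len by (simp add: omega_diff_apply[OF assms(2) h])
  next
   case False
   have "h (merge_blocks i (drop ?s G)) = \<zero>" if "i \<in> {1..<card T}" for i
    by (rule H(2), subst merge_blocks_composition_iff) (use that len False drop_ok in auto)
   then have "alt_sum R {1..<card T} (\<lambda>i. h (merge_blocks i (drop ?s G))) = \<zero>" by (rule alt_sum_zero)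
   then show ?thesis using False by (simp add: omega_diff_apply[OF assms(2) h])
  qed
  finally show ?thesis by (simp add: conc_def)
 qed
qed

text \<open>The product is defined as a union over all representatives; by the two preceding lemmas all of
 them give the same class.\<close>

lemma dual_mult_class:
 assumes "finite S" "finite T" "S \<inter> T = {}"
  and f: "f \<in> carrier (omega R S 0)" and g: "g \<in> carrier (omega R T 0)"
 shows "dual_mult R S T (dcl S f) (dcl T g) = dcl (S \<union> T) (conc (card S) f g)"
proof -
 have fin: "finite (S \<union> T)" using assms(1,2) by simp
 interpret Q: quotient_module R "omega R (S \<union> T) 0" "cobd (S \<union> T) 0" by (rule omega_quotient[OF fin])
 have cc: "conc (card S) f g \<in> carrier (omega R (S \<union> T) 0)"
  if "f \<in> carrier (omega R S 0)" "g \<in> carrier (omega R T 0)" for f g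
  using conc_closed[OF assms(1-3) that, of "card S"] by simp
 have eq: "dcl (S \<union> T) (conc (card S) f' g') = dcl (S \<union> T) (conc (card S) f g)"
  if f': "f' \<in> dcl S f" and g': "g' \<in> dcl T g" for f' g'
 proof -
  have f'c: "f' \<in> carrier (omega R S 0)" "(\<lambda>F. f' F \<ominus> f F) \<in> cobd S 0"
   using f' dual_class_mem(2)[OF assms(1) f] by auto
  have g'c: "g' \<in> carrier (omega R T 0)" "(\<lambda>F. g' F \<ominus> g F) \<in> cobd T 0"
   using g' dual_class_mem(2)[OF assms(2) g] by auto
  obtain h where h: "h \<in> carrier (omega R S (0 - 1))" "(\<lambda>F. f' F \<ominus> f F) = omega_diff R S h"
   using f'c(2) by (auto simp: omega_coboundaries_def)
  obtain k where k: "k \<in> carrier (omega R T (0 - 1))" "(\<lambda>F. g' F \<ominus> g F) = omega_diff R T k"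
   using g'c(2) by (auto simp: omega_coboundaries_def)
  interpret V: module R "omega R (S \<union> T) (0 - 1)" by (rule omega_module)
  have "conc (card S) (omega_diff R S h) g' \<in> cobd (S \<union> T) 0"
   unfolding conc_coboundary_left[OF assms(1-3) h(1) g'c(1)] omega_coboundaries_def
   using conc_closed[OF assms(1-3) h(1) g'c(1), of "card S - 1"] by (intro imageI) (simp add: nat_diff_distrib')
  moreover have "conc (card S) f (omega_diff R T k) \<in> cobd (S \<union> T) 0"
   unfolding conc_coboundary_right[OF assms(1-3) f k(1)] omega_coboundaries_def
  proof (rule imageI)
   have "conc (card S) f k \<in> carrier (omega R (S \<union> T) (0 - 1))"
    using conc_closed[OF assms(1-3) f k(1), of "card S"] by simp
   from V.smult_closed[OF _ this, of "if even (card S) then \<one> else \<ominus> \<one>"]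
   show "(\<lambda>F. (if even (card S) then \<one> else \<ominus> \<one>) \<otimes> conc (card S) f k F) \<in> carrier (omega R (S \<union> T) (0 - 1))"
    by (simp add: omega_simps)
  qed
  ultimately have "(\<lambda>F. conc (card S) (omega_diff R S h) g' F \<oplus> conc (card S) f (omega_diff R T k) F)
    \<in> cobd (S \<union> T) 0"
   using Q.H_add by (simp add: omega_simps)
  moreover have "(\<lambda>F. conc (card S) (omega_diff R S h) g' F \<oplus> conc (card S) f (omega_diff R T k) F) =
    (\<lambda>F. conc (card S) f' g' F \<ominus> conc (card S) f g F)"
  proof
   fix F :: "nat set list"
   let ?A = "take (card S) F" and ?B = "drop (card S) F"
   have c: "f ?A \<in> carrier R" "f' ?A \<in> carrier R" "g ?B \<in> carrier R" "g' ?B \<in> carrier R"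
    using omegaD(1)[OF assms(1) f] omegaD(1)[OF assms(1) f'c(1)] omegaD(1)[OF assms(2) g]
     omegaD(1)[OF assms(2) g'c(1)] by auto
   have "conc (card S) (omega_diff R S h) g' F \<oplus> conc (card S) f (omega_diff R T k) F =
     (f' ?A \<ominus> f ?A) \<otimes> g' ?B \<oplus> f ?A \<otimes> (g' ?B \<ominus> g ?B)"
    by (simp add: conc_def flip: h(2) k(2))
   also have "\<dots> = f' ?A \<otimes> g' ?B \<ominus> f ?A \<otimes> g ?B"
    using c by algebra
   finally show "conc (card S) (omega_diff R S h) g' F \<oplus> conc (card S) f (omega_diff R T k) F =
     conc (card S) f' g' F \<ominus> conc (card S) f g F" by (simp add: conc_def)
  qed
  ultimately show ?thesis
   using dual_class_eq[OF fin cc[OF f'c(1) g'c(1)] cc[OF f g]] by simp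
 qed
 have "dual_mult R S T (dcl S f) (dcl T g) =
   (\<Union>f'\<in>dcl S f. \<Union>g'\<in>dcl T g. dcl (S \<union> T) (conc (card S) f' g'))"
  unfolding dual_mult_def Let_def
 proof (intro SUP_cong refl)
  fix f' g' assume "f' \<in> dcl S f" "g' \<in> dcl T g"
  then show "dcl (S \<union> T) (lin_ext (fmod (compositions (S \<union> T))) (compositions S)
    (\<lambda>F. lin_ext (fmod (compositions (S \<union> T))) (compositions T) (\<lambda>G. bas (F @ G)) g') f') =
   dcl (S \<union> T) (conc (card S) f' g')"
   using conc_lin_ext[OF assms(1-3)] dual_class_mem(2)[OF assms(1) f] dual_class_mem(2)[OF assms(2) g] by simp
 qed
 also have "\<dots> = dcl (S \<union> T) (conc (card S) f g)"
 proof (intro equalityI subsetI)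
  fix x assume "x \<in> (\<Union>f'\<in>dcl S f. \<Union>g'\<in>dcl T g. dcl (S \<union> T) (conc (card S) f' g'))"
  then show "x \<in> dcl (S \<union> T) (conc (card S) f g)" using eq by blast
 next
  fix x assume "x \<in> dcl (S \<union> T) (conc (card S) f g)"
  then show "x \<in> (\<Union>f'\<in>dcl S f. \<Union>g'\<in>dcl T g. dcl (S \<union> T) (conc (card S) f' g'))"
   using dual_class_mem(1)[OF assms(1) f] dual_class_mem(1)[OF assms(2) g] by blast
 qed
 finally show ?thesis .
qed

end

section \<open>The comparison map\<close>

context cring
begin

text \<open>The cut-off makes the value zero on sets with other than \<open>n\<close> elements, as required of an
 element of \<open>K\<^sup>n(X)\<close>. On a set with \<open>n\<close> elements the compositions into \<open>n\<close> blocks are the linear orders.\<close>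

definition top_part :: "nat => nat set => (nat set list => 'a) => nat set list => 'a" where
 "top_part n I \<phi> F = (if F \<in> compositions I \<and> length F = n \<and> card I = n then \<phi> F else \<zero>)"

lemma top_part_closed:
 assumes "finite I" "\<And>F. [|F \<in> compositions I; length F = n; card I = n|] ==> \<phi> F \<in> carrier R"
 shows "top_part n I \<phi> \<in> carrier (omega R I 0)"
 by (rule omegaI[OF assms(1)]) (use assms(2) in \<open>auto simp: top_part_def\<close>)

lemma top_part_degree: "card I \<noteq> n ==> top_part n I \<phi> = (\<lambda>_. \<zero>)"
 by (auto simp: top_part_def)

lemma dual_class_in: "finite I ==> f \<in> carrier (omega R I 0) ==> dcl I f \<in> carrier (Ed I)"
 by (auto simp: exp_dual_simps(1))

lemma dual_class_finsum:
 assumes I: "finite I" and A: "finite A" and g: "\<And>a. a \<in> A ==> g a \<in> carrier (omega R I 0)"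
 shows "(\<Oplus>\<^bsub>Ed I\<^esub> a\<in>A. dcl I (g a)) = dcl I (\<lambda>F. \<Oplus>a\<in>A. g a F)"
  and "(\<lambda>F. \<Oplus>a\<in>A. g a F) \<in> carrier (omega R I 0)"
proof -
 interpret W: module R "omega R I 0" by (rule omega_module)
 interpret E: module R "Ed I" by (rule exp_dual_simps(5)[OF I])
 have eq: "(\<Oplus>\<^bsub>omega R I 0\<^esub> a\<in>A. g a) = (\<lambda>F. \<Oplus>a\<in>A. g a F)"
 proof
  show "(\<Oplus>\<^bsub>omega R I 0\<^esub> a\<in>A. g a) F = (\<Oplus>a\<in>A. g a F)" for F
   unfolding omega_def by (rule free_module_finsum[OF A]) (use g in \<open>simp add: omega_def\<close>)
 qed
 have "dcl I (\<Oplus>\<^bsub>omega R I 0\<^esub> a\<in>A. g a) = (\<Oplus>\<^bsub>Ed I\<^esub> a\<in>A. dcl I (g a))"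
  by (rule additive_map_finsum[OF module.axioms(2)[OF W.module_axioms] module.axioms(2)[OF E.module_axioms] _ _ A g])
   (use exp_dual_simps(3)[OF I] dual_class_in[OF I] in \<open>auto simp: omega_simps\<close>)
 then show "(\<Oplus>\<^bsub>Ed I\<^esub> a\<in>A. dcl I (g a)) = dcl I (\<lambda>F. \<Oplus>a\<in>A. g a F)"
  by (simp add: eq)
 have "(\<Oplus>\<^bsub>omega R I 0\<^esub> a\<in>A. g a) \<in> carrier (omega R I 0)" using g by (intro W.M.finsum_closed) auto
 then show "(\<lambda>F. \<Oplus>a\<in>A. g a F) \<in> carrier (omega R I 0)" by (simp add: eq)
qed

definition point_vec :: "nat set => nat set list => 'a" where
 "point_vec S = (if card S = 1 then bas [S] else (\<lambda>_. \<zero>))"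

lemma point_vec_nonzero: "point_vec S F \<noteq> \<zero> ==> card S = 1 \<and> F = [S]"
 by (auto simp: point_vec_def basis_vec_def split: if_splits)

lemma point_vec_closed: "point_vec S F \<in> carrier R"
 by (simp add: point_vec_def)

lemma singleton_composition: "S \<noteq> {} ==> [S] \<in> compositions S"
 by (simp add: compositions_iff)

lemma point_vec_in: "finite S ==> point_vec S \<in> carrier (omega R S 0)"
 using point_vec_nonzero[of S] singleton_composition[of S]
 by (intro omegaI) (auto simp: point_vec_closed, fastforce+)

text \<open>The twisting map in terms of the generator of \<open>\<Omega>(E)\<close> on a singleton.\<close>

lemma tau_basis:
 assumes S: "finite S"
 shows "tau R S (bas S) = dcl S (point_vec S)"
proof (cases "card S = 1")
 case True
 then obtain i where i: "S = {i}" by (auto simp: card_1_singleton_iff)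
 have "bas S \<in> carrier (sp_val (exp_species R) S)"
  by (simp add: exp_species_def basis_vec_in)
 then have "tau R S (bas S) = \<one> \<odot>\<^bsub>Ed S\<^esub> dcl S (point_vec S)"
  using S True by (simp add: tau_def lin_order_class_def i point_vec_def basis_vec_def)
 also have "\<dots> = dcl S (point_vec S)"
  by (rule module.smult_one[OF exp_dual_simps(5)[OF S] dual_class_in[OF S point_vec_in[OF S]]])
 finally show ?thesis .
next
 case False
 have "bas S \<in> carrier (sp_val (exp_species R) S)"
  by (simp add: exp_species_def basis_vec_in)
 then show ?thesis
  using S False by (simp add: tau_def point_vec_def exp_dual_simps(2)[OF S])
qed

end

lemma finite_decomps2: "finite I ==> finite (decomps2 I)"
 by (rule finite_subset[of _ "Pow I \<times> Pow I"]) (auto simp: decomps2_def)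

lemma composition_tl:
 assumes "F \<in> compositions I" "F \<noteq> []"
 shows "tl F \<in> compositions (I - hd F)" "hd F \<subseteq> I" "hd F \<noteq> {}"
 using assms by (cases F; auto simp: compositions_iff)+

lemma composition_butlast:
 assumes "F \<in> compositions I" "F \<noteq> []"
 shows "butlast F \<in> compositions (I - last F)" "last F \<subseteq> I" "last F \<noteq> {}"
 using assms by (cases F rule: rev_cases; auto simp: compositions_iff sorted_wrt_append)+

text \<open>A composition of a set with \<open>n + 1\<close> elements that restricts to one with \<open>n\<close> blocks outside \<open>B\<close>
 forces \<open>B\<close> to be a singleton, by counting. Hence only the singletons contribute to the products with \<open>\<tau>\<close>.\<close>

lemma card_block_complement:
 assumes "finite I" "card I = Suc n" "B \<subseteq> I" "B \<noteq> {}" "G \<in> compositions (I - B)" "length G = n"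
 shows "card B = 1" "card (I - B) = n"
proof -
 have fin: "finite B" "finite (I - B)" using assms(1,3) finite_subset by auto
 have "n \<le> card (I - B)" using length_composition_le[OF fin(2) assms(5)] assms(6) by simp
 moreover have "card (I - B) = Suc n - card B" using card_Diff_subset[OF fin(1) assms(3)] assms(2) by simp
 moreover have "card B \<le> Suc n" using card_mono[OF assms(1,3)] assms(2) by simp
 moreover have "0 < card B" using fin(1) assms(4) by (simp add: card_gt_0_iff)
 ultimately have "card B = 1 \<and> card (I - B) = n" by presburger
 then show "card B = 1" "card (I - B) = n" by auto
qed

context exp_bicomodule
begin

text \<open>The comparison map from cochains to the Koszul complex.\<close>

definition top_class :: "nat => (nat set => 'm => nat set list => 'k) =>
  nat set => 'm => (nat set list => 'k) set" where
 "top_class n \<alpha> = (\<lambda>I\<in>{I. finite I}. \<lambda>z\<in>carrier (XV I). dcl I (top_part n I (\<alpha> I z)))"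

lemma top_class_apply:
 "[|finite I; z \<in> carrier (XV I)|] ==> top_class n \<alpha> I z = dcl I (top_part n I (\<alpha> I z))"
 by (simp add: top_class_def)

lemma top_part_cochain:
 "[|\<alpha> \<in> carrier (Coch n); finite I; z \<in> carrier (XV I)|] ==>
  top_part m I (\<alpha> I z) \<in> carrier (omega R I 0)"
 by (intro top_part_closed cochainD(2))

lemma koszul_carrier:
 "\<phi> \<in> carrier (Kos p) \<longleftrightarrow> \<phi> \<in> carrier (HomEd) \<and>
  (\<forall>I. finite I \<and> card I \<noteq> p --> (\<forall>z\<in>carrier (XV I). \<phi> I z = \<zero>\<^bsub>Ed I\<^esub>))"
 by (simp add: koszul_def)

lemma top_class_in:
 assumes \<alpha>: "\<alpha> \<in> carrier (Coch n)"
 shows "top_class n \<alpha> \<in> carrier (Kos n)"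
 unfolding koszul_carrier
proof (intro conjI allI impI ballI)
 show "top_class n \<alpha> \<in> carrier (HomEd)"
  unfolding top_class_def
 proof (rule species_homI)
  fix I z assume I: "finite I" "z \<in> carrier (XV I)"
  note t = top_part_cochain[OF \<alpha> I]
  note D = cochainD[OF \<alpha> I] and S = exp_dual_simps[OF I(1)]
  show "dcl I (top_part n I (\<alpha> I z)) \<in> carrier (Ed I)"
   by (rule dual_class_in[OF I(1) t])
  show "dcl I (top_part n I (\<alpha> I (z \<oplus>\<^bsub>XV I\<^esub> w))) =
    dcl I (top_part n I (\<alpha> I z)) \<oplus>\<^bsub>Ed I\<^esub> dcl I (top_part n I (\<alpha> I w))"
   if w: "w \<in> carrier (XV I)" for w
  proof -
   have "top_part n I (\<alpha> I (z \<oplus>\<^bsub>XV I\<^esub> w)) = (\<lambda>F. top_part n I (\<alpha> I z) F \<oplus> top_part n I (\<alpha> I w) F)"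
    using D(4)[OF w] by (auto simp: top_part_def)
   then show ?thesis by (simp add: S(3)[OF t top_part_cochain[OF \<alpha> I(1) w]])
  qed
  show "dcl I (top_part n I (\<alpha> I (c \<odot>\<^bsub>XV I\<^esub> z))) =
    c \<odot>\<^bsub>Ed I\<^esub> dcl I (top_part n I (\<alpha> I z))" if c: "c \<in> carrier R" for c
  proof -
   have "top_part n I (\<alpha> I (c \<odot>\<^bsub>XV I\<^esub> z)) = (\<lambda>F. c \<otimes> top_part n I (\<alpha> I z) F)"
    using D(5)[OF c] c by (auto simp: top_part_def)
   then show ?thesis by (simp add: S(4)[OF t c])
  qed
  show "dcl (\<sigma> ` I) (top_part n (\<sigma> ` I) (\<alpha> (\<sigma> ` I) (sp_map X I \<sigma> z))) =
    sp_map (exp_dual R) I \<sigma> (dcl I (top_part n I (\<alpha> I z)))" if s: "inj_on \<sigma> I" for \<sigma>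
  proof -
   have fin: "finite (\<sigma> ` I)" using I(1) by simp
   have "top_part n (\<sigma> ` I) (\<alpha> (\<sigma> ` I) (sp_map X I \<sigma> z)) = relabel \<sigma> I (top_part n I (\<alpha> I z))"
   proof (rule relabel_eqI[OF s I(1) top_part_cochain[OF \<alpha> fin carrier_map[OF I(1) s I(2)]] relabel_closed[OF I(1) s t]])
    fix F assume F: "F \<in> compositions I"
    have "F \<in> decomps n I" if "length F = n" using F that by (auto simp: composition_decomps)
    then show "top_part n (\<sigma> ` I) (\<alpha> (\<sigma> ` I) (sp_map X I \<sigma> z)) (map (image \<sigma>) F) =
      relabel \<sigma> I (top_part n I (\<alpha> I z)) (map (image \<sigma>) F)"
     using F D(6)[OF s, of F] relabel_compositions[OF s F] card_image[OF s]
     by (simp add: relabel_apply[OF I(1) s t F] top_part_def)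
   qed
   then show ?thesis by (simp add: exp_dual_map[OF I(1) s t])
  qed
 qed
 fix I z assume "finite I \<and> card I \<noteq> n" "z \<in> carrier (XV I)"
 then show "top_class n \<alpha> I z = \<zero>\<^bsub>Ed I\<^esub>"
  by (simp add: top_class_apply top_part_degree exp_dual_simps(2))
qed

lemma koszul_ops:
 "\<zero>\<^bsub>Kos p\<^esub> = \<zero>\<^bsub>HomEd\<^esub>"
 "\<phi> \<oplus>\<^bsub>Kos p\<^esub> \<psi> = \<phi> \<oplus>\<^bsub>HomEd\<^esub> \<psi>"
 "c \<odot>\<^bsub>Kos p\<^esub> \<phi> = c \<odot>\<^bsub>HomEd\<^esub> \<phi>"
 by (simp_all add: koszul_def)

lemma species_hom_exp_dual_module: "module R (HomEd)"
 by (rule species_hom_module[OF species_axioms linear_relabelling_exp_dual])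

lemma koszul_module: "module R (Kos p)"
proof -
 interpret S: module R "HomEd" by (rule species_hom_exp_dual_module)
 show ?thesis
  unfolding koszul_def
 proof (rule restricted_module[OF S.module_axioms])
  let ?H = "{\<phi> \<in> carrier (HomEd). \<forall>I. finite I \<and> card I \<noteq> p -->
   (\<forall>z\<in>carrier (XV I). \<phi> I z = \<zero>\<^bsub>Ed I\<^esub>)}"
  have E: "abelian_group (Ed I)" "module R (Ed I)" if "finite I" for I
   using exp_dual_simps(5)[OF that] by (auto intro: module.axioms(2))
  show "?H \<subseteq> carrier (HomEd)" by auto
  show "\<zero>\<^bsub>HomEd\<^esub> \<in> ?H" by (auto simp: species_hom_ops(1))
  fix \<phi> assume \<phi>: "\<phi> \<in> ?H"
  show "c \<odot>\<^bsub>HomEd\<^esub> \<phi> \<in> ?H" if "c \<in> carrier R" for c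
   using \<phi> that by (auto simp: species_hom_ops(3) module.smult_r_null[OF E(2)])
  fix \<psi> assume \<psi>: "\<psi> \<in> ?H"
  show "\<phi> \<oplus>\<^bsub>HomEd\<^esub> \<psi> \<in> ?H"
   using \<phi> \<psi> by (auto simp: species_hom_ops(2) abelian_groupE(2,5)[OF E(1)])
 qed
qed

lemma koszul_ext:
 assumes "\<phi> \<in> carrier (Kos p)" "\<psi> \<in> carrier (Kos p)"
  and "\<And>I z. [|finite I; card I = p; z \<in> carrier (XV I)|] ==> \<phi> I z = \<psi> I z"
 shows "\<phi> = \<psi>"
 using assms by (intro species_hom_ext[of \<phi> R X "exp_dual R" \<psi>]) (metis koszul_carrier)+

lemma top_class_linear:
 assumes \<alpha>: "\<alpha> \<in> carrier (Coch n)"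
 shows "\<beta> \<in> carrier (Coch n) ==>
   top_class n (\<alpha> \<oplus>\<^bsub>Coch n\<^esub> \<beta>) = top_class n \<alpha> \<oplus>\<^bsub>Kos n\<^esub> top_class n \<beta>"
  and "c \<in> carrier R ==> top_class n (c \<odot>\<^bsub>Coch n\<^esub> \<alpha>) = c \<odot>\<^bsub>Kos n\<^esub> top_class n \<alpha>"
proof -
 interpret C: module R "Coch n" by (rule cochains_module)
 interpret K: module R "Kos n" by (rule koszul_module)
 show "top_class n (\<alpha> \<oplus>\<^bsub>Coch n\<^esub> \<beta>) = top_class n \<alpha> \<oplus>\<^bsub>Kos n\<^esub> top_class n \<beta>"
  if \<beta>: "\<beta> \<in> carrier (Coch n)"
 proof (rule koszul_ext)
  fix I z assume I: "finite I" "z \<in> carrier (XV I)"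
  have "top_part n I ((\<alpha> \<oplus>\<^bsub>Coch n\<^esub> \<beta>) I z) = (\<lambda>F. top_part n I (\<alpha> I z) F \<oplus> top_part n I (\<beta> I z) F)"
   by (auto simp: top_part_def cochain_ops(2)[OF I])
  then show "top_class n (\<alpha> \<oplus>\<^bsub>Coch n\<^esub> \<beta>) I z = (top_class n \<alpha> \<oplus>\<^bsub>Kos n\<^esub> top_class n \<beta>) I z"
   by (simp add: koszul_ops species_hom_ops(2)[OF I] top_class_apply[OF I]
     exp_dual_simps(3)[OF I(1) top_part_cochain[OF \<alpha> I] top_part_cochain[OF \<beta> I]])
 qed (use \<alpha> \<beta> top_class_in in auto)
 show "top_class n (c \<odot>\<^bsub>Coch n\<^esub> \<alpha>) = c \<odot>\<^bsub>Kos n\<^esub> top_class n \<alpha>" if c: "c \<in> carrier R"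
 proof (rule koszul_ext)
  fix I z assume I: "finite I" "z \<in> carrier (XV I)"
  have "top_part n I ((c \<odot>\<^bsub>Coch n\<^esub> \<alpha>) I z) = (\<lambda>F. c \<otimes> top_part n I (\<alpha> I z) F)"
   using c by (auto simp: top_part_def cochain_ops(3)[OF I])
  then show "top_class n (c \<odot>\<^bsub>Coch n\<^esub> \<alpha>) I z = (c \<odot>\<^bsub>Kos n\<^esub> top_class n \<alpha>) I z"
   by (simp add: koszul_ops species_hom_ops(3)[OF I] top_class_apply[OF I]
     exp_dual_simps(4)[OF I(1) top_part_cochain[OF \<alpha> I] c])
 qed (use \<alpha> c top_class_in in auto)
qed

definition coface_cochain :: "nat => nat => (nat set => 'm => nat set list => 'k) =>
  nat set => 'm => nat set list => 'k" where
 "coface_cochain n i \<alpha> = (\<lambda>I\<in>{I. finite I}. \<lambda>z\<in>carrier (XV I). \<lambda>F.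
   if F \<in> decomps (Suc n) I then coface lam rho i \<alpha> F z else \<zero>)"

lemma coface_cochain_closed:
 assumes \<alpha>: "\<alpha> \<in> carrier (Coch n)" and i: "i \<le> Suc n"
 shows "coface_cochain n i \<alpha> \<in> carrier (Coch (Suc n))"
 unfolding coface_cochain_def
 by (rule cochainI) (use coface_linear[OF \<alpha> _ _ _ i] coface_map[OF \<alpha> _ _ _ i] relabel_decomps in auto)

lemma top_part_coface_closed:
 assumes \<alpha>: "\<alpha> \<in> carrier (Coch n)" and I: "finite I" "z \<in> carrier (XV I)" and i: "i \<le> Suc n"
 shows "top_part (Suc n) I (\<lambda>F. coface lam rho i \<alpha> F z) \<in> carrier (omega R I 0)"
 using coface_linear(1)[OF \<alpha> _ I i] by (intro top_part_closed[OF I(1)]) (auto simp: composition_decomps)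

lemma top_class_coface:
 assumes I: "finite I" "z \<in> carrier (XV I)"
 shows "top_class (Suc n) (coface_cochain n i \<alpha>) I z = dcl I (top_part (Suc n) I (\<lambda>F. coface lam rho i \<alpha> F z))"
proof -
 have "top_part (Suc n) I (coface_cochain n i \<alpha> I z) = top_part (Suc n) I (\<lambda>F. coface lam rho i \<alpha> F z)"
  using I by (intro ext) (auto simp: top_part_def coface_cochain_def composition_decomps)
 then show ?thesis by (simp add: top_class_apply[OF I])
qed

text \<open>The first block of a linear order is a singleton \<open>{i}\<close>, and the coefficient of the product
 \<open>\<tau> \<frown> \<phi>\<close> at this order is that of \<open>\<phi>\<close> at the remaining order and \<open>z // (I - {i})\<close>. This is the
 first coface.\<close>

lemma cap_left_top_class:
 assumes \<alpha>: "\<alpha> \<in> carrier (Coch n)"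
 shows "cap_left R X lam (tau R) (top_class n \<alpha>) = top_class (Suc n) (coface_cochain n 0 \<alpha>)"
proof (intro ext)
 fix I z
 show "cap_left R X lam (tau R) (top_class n \<alpha>) I z = top_class (Suc n) (coface_cochain n 0 \<alpha>) I z"
 proof (cases "finite I \<and> z \<in> carrier (XV I)")
  case False
  then show ?thesis by (auto simp: cap_left_def top_class_def)
 next
  case True
  then have I: "finite I" "z \<in> carrier (XV I)" by auto
  let ?t = "\<lambda>T. top_part n T (\<alpha> T (lquot lam I z T))"
  let ?c = "\<lambda>D. conc (card (fst D)) (point_vec (fst D)) (?t (snd D))"
  have D: "finite (fst D)" "finite (snd D)" "fst D \<inter> snd D = {}" "fst D \<union> snd D = I" "snd D \<subseteq> I"
   if "D \<in> decomps2 I" for D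
   using that I(1) by (auto simp: decomps2_def)
  have t: "?t (snd D) \<in> carrier (omega R (snd D) 0)" if "D \<in> decomps2 I" for D
   by (rule top_part_cochain[OF \<alpha> D(2)[OF that] lquot_closed[OF I D(5)[OF that]]])
  have c: "?c D \<in> carrier (omega R I 0)" if "D \<in> decomps2 I" for D
   using conc_closed[OF D(1-3)[OF that] point_vec_in[OF D(1)[OF that]] t[OF that], of "card (fst D)"]
    D(4)[OF that] by simp
  have "cap_left R X lam (tau R) (top_class n \<alpha>) I z =
    (\<Oplus>\<^bsub>Ed I\<^esub> D\<in>decomps2 I. dcl I (?c D))"
  proof -
   interpret E: module R "Ed I" by (rule exp_dual_simps(5)[OF I(1)])
   have "dual_mult R (fst D) (snd D) (tau R (fst D) (bas (fst D)))
     (top_class n \<alpha> (snd D) (lquot lam I z (snd D))) = dcl I (?c D)" if "D \<in> decomps2 I" for D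
    using D(4)[OF that]
    by (simp add: tau_basis[OF D(1)[OF that]] top_class_apply[OF D(2)[OF that] lquot_closed[OF I D(5)[OF that]]]
      dual_mult_class[OF D(1-3)[OF that] point_vec_in[OF D(1)[OF that]] t[OF that]])
   then show ?thesis
    using I dual_class_in[OF I(1) c] unfolding cap_left_def
    by (simp add: split_def) (rule E.M.finsum_cong', auto)
  qed
  also have "\<dots> = dcl I (\<lambda>F. \<Oplus>D\<in>decomps2 I. ?c D F)"
   by (rule dual_class_finsum(1)[OF I(1) finite_decomps2[OF I(1)] c])
  also have "(\<lambda>F. \<Oplus>D\<in>decomps2 I. ?c D F) = top_part (Suc n) I (\<lambda>F. coface lam rho 0 \<alpha> F z)"
  proof
   fix F
   have nz: "F = fst D # tl F \<and> card (fst D) = 1 \<and> tl F \<in> compositions (snd D) \<and> length (tl F) = n \<and> card (snd D) = n"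
    if "?c D F \<noteq> \<zero>" "D \<in> decomps2 I" for D
   proof -
    have ne: "point_vec (fst D) (take (card (fst D)) F) \<noteq> \<zero>" "?t (snd D) (drop (card (fst D)) F) \<noteq> \<zero>"
     using that omegaD(1)[OF D(2)[OF that(2)] t[OF that(2)]] point_vec_closed by (auto simp: conc_def)
    have p: "card (fst D) = 1" "take 1 F = [fst D]" using point_vec_nonzero[OF ne(1)] by auto
    then have F: "F = fst D # tl F" by (cases F) auto
    moreover have "?t (snd D) (tl F) \<noteq> \<zero>" using ne(2) p(1) by (simp add: drop_Suc)
    ultimately show ?thesis using p(1) by (auto simp: top_part_def split: if_splits)
   qed
   show "(\<Oplus>D\<in>decomps2 I. ?c D F) = top_part (Suc n) I (\<lambda>F. coface lam rho 0 \<alpha> F z) F"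
   proof (cases "F \<in> compositions I \<and> length F = Suc n \<and> card I = Suc n")
    case True
    then have ne: "F \<noteq> []" and len: "length (tl F) = n" by auto
    note tl = composition_tl[OF conjunct1[OF True] ne]
    have cards: "card (hd F) = 1" "card (I - hd F) = n"
     using card_block_complement[OF I(1) _ tl(2,3,1) len] True by auto
    let ?D = "(hd F, I - hd F)"
    have D0: "?D \<in> decomps2 I" using tl(2) by (auto simp: decomps2_def)
    have "(\<Oplus>D\<in>decomps2 I. ?c D F) = ?c ?D F"
    proof (rule finsum_single_term[OF finite_decomps2[OF I(1)] D0])
     show "?c D F = \<zero>" if "D \<in> decomps2 I" "D \<noteq> ?D" for D
     proof (rule ccontr)
      assume "?c D F \<noteq> \<zero>"
      from nz[OF this that(1)] have "fst D = hd F" by (metis list.sel(1))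
      moreover have "snd D = I - fst D" using that(1) by (auto simp: decomps2_def)
      ultimately show False using that(2) by (simp add: prod_eq_iff)
     qed
     show "?c ?D F \<in> carrier R" by (rule omegaD(1)[OF I(1) c[OF D0]])
    qed
    also have "\<dots> = point_vec (hd F) (take 1 F) \<otimes> ?t (I - hd F) (drop 1 F)"
     using cards(1) by (simp add: conc_def)
    also have "take 1 F = [hd F]" using ne by (cases F) auto
    also have "drop 1 F = tl F" by (simp add: drop_Suc)
    also have "point_vec (hd F) [hd F] = \<one>" using cards(1) by (simp add: point_vec_def basis_vec_def)
    also have "?t (I - hd F) (tl F) = \<alpha> (I - hd F) (lquot lam I z (I - hd F)) (tl F)"
     using tl(1) len cards(2) by (simp add: top_part_def)
    also have "\<one> \<otimes> \<dots> = \<dots>"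
    proof (rule l_one)
     show "\<alpha> (I - hd F) (lquot lam I z (I - hd F)) (tl F) \<in> carrier R"
      by (rule cochainD(2)[OF \<alpha> _ lquot_closed[OF I]]) (use I(1) in auto)
    qed
    also have "\<dots> = coface lam rho 0 \<alpha> F z"
     using True tl(1) by (simp add: coface_def coeff_def Let_def compositions_def)
    finally show ?thesis using True by (simp add: top_part_def[of "Suc n" I])
   next
    case False
    have "?c D F = \<zero>" if "D \<in> decomps2 I" for D
    proof (rule ccontr)
     assume "?c D F \<noteq> \<zero>"
     note N = nz[OF this that]
     have "[fst D] \<in> compositions (fst D)" using N by (intro singleton_composition) auto
     then have "[fst D] @ tl F \<in> compositions (fst D \<union> snd D)"
      using N by (intro append_composition[OF _ _ D(3)[OF that]]) auto
     then have "F \<in> compositions I" using N D(4)[OF that] by simp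
     moreover have "length F = Suc n" using N by (metis length_Cons)
     moreover have "card I = Suc n"
      using card_Un_disjoint[OF D(1-3)[OF that]] N D(4)[OF that] by simp
     ultimately show False using False by simp
    qed
    then have "(\<Oplus>D\<in>decomps2 I. ?c D F) = \<zero>" by (rule add.finprod_one_eqI)
    then show ?thesis using False by (auto simp: top_part_def)
   qed
  qed
  finally show ?thesis by (simp add: top_class_coface[OF I])
 qed
qed

lemma cap_right_top_class:
 assumes \<alpha>: "\<alpha> \<in> carrier (Coch n)"
 shows "cap_right R X rho (top_class n \<alpha>) (tau R) = top_class (Suc n) (coface_cochain n (Suc n) \<alpha>)"
proof (intro ext)
 fix I z
 show "cap_right R X rho (top_class n \<alpha>) (tau R) I z = top_class (Suc n) (coface_cochain n (Suc n) \<alpha>) I z"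
 proof (cases "finite I \<and> z \<in> carrier (XV I)")
  case False
  then show ?thesis by (auto simp: cap_right_def top_class_def)
 next
  case True
  then have I: "finite I" "z \<in> carrier (XV I)" by auto
  let ?t = "\<lambda>S. top_part n S (\<alpha> S (rquot rho I z S))"
  let ?c = "\<lambda>D. conc (card (fst D)) (?t (fst D)) (point_vec (snd D))"
  have D: "finite (fst D)" "finite (snd D)" "fst D \<inter> snd D = {}" "fst D \<union> snd D = I" "fst D \<subseteq> I"
   if "D \<in> decomps2 I" for D
   using that I(1) by (auto simp: decomps2_def)
  have t: "?t (fst D) \<in> carrier (omega R (fst D) 0)" if "D \<in> decomps2 I" for D
   by (rule top_part_cochain[OF \<alpha> D(1)[OF that] rquot_closed[OF I D(5)[OF that]]])
  have c: "?c D \<in> carrier (omega R I 0)" if "D \<in> decomps2 I" for D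
   using conc_closed[OF D(1-3)[OF that] t[OF that] point_vec_in[OF D(2)[OF that]], of "card (fst D)"]
    D(4)[OF that] by simp
  have "cap_right R X rho (top_class n \<alpha>) (tau R) I z =
    (\<Oplus>\<^bsub>Ed I\<^esub> D\<in>decomps2 I. dcl I (?c D))"
  proof -
   interpret E: module R "Ed I" by (rule exp_dual_simps(5)[OF I(1)])
   have "dual_mult R (fst D) (snd D) (top_class n \<alpha> (fst D) (rquot rho I z (fst D)))
     (tau R (snd D) (bas (snd D))) = dcl I (?c D)" if "D \<in> decomps2 I" for D
    using D(4)[OF that]
    by (simp add: tau_basis[OF D(2)[OF that]] top_class_apply[OF D(1)[OF that] rquot_closed[OF I D(5)[OF that]]]
      dual_mult_class[OF D(1-3)[OF that] t[OF that] point_vec_in[OF D(2)[OF that]]])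
   then show ?thesis
    using I dual_class_in[OF I(1) c] unfolding cap_right_def
    by (simp add: split_def) (rule E.M.finsum_cong', auto)
  qed
  also have "\<dots> = dcl I (\<lambda>F. \<Oplus>D\<in>decomps2 I. ?c D F)"
   by (rule dual_class_finsum(1)[OF I(1) finite_decomps2[OF I(1)] c])
  also have "(\<lambda>F. \<Oplus>D\<in>decomps2 I. ?c D F) = top_part (Suc n) I (\<lambda>F. coface lam rho (Suc n) \<alpha> F z)"
  proof
   fix F
   have nz: "F = take n F @ [snd D] \<and> card (snd D) = 1 \<and> take n F \<in> compositions (fst D) \<and>
     length (take n F) = n \<and> card (fst D) = n"
    if "?c D F \<noteq> \<zero>" "D \<in> decomps2 I" for D
   proof -
    have ne: "point_vec (snd D) (drop (card (fst D)) F) \<noteq> \<zero>" "?t (fst D) (take (card (fst D)) F) \<noteq> \<zero>"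
     using that omegaD(1)[OF D(1)[OF that(2)] t[OF that(2)]] point_vec_closed by (auto simp: conc_def)
    have p: "card (snd D) = 1" "drop (card (fst D)) F = [snd D]" using point_vec_nonzero[OF ne(1)] by auto
    have q: "take (card (fst D)) F \<in> compositions (fst D)" "length (take (card (fst D)) F) = n" "card (fst D) = n"
     using ne(2) by (auto simp: top_part_def split: if_splits)
    have "F = take (card (fst D)) F @ drop (card (fst D)) F" by simp
    then show ?thesis using p q by metis
   qed
   show "(\<Oplus>D\<in>decomps2 I. ?c D F) = top_part (Suc n) I (\<lambda>F. coface lam rho (Suc n) \<alpha> F z) F"
   proof (cases "F \<in> compositions I \<and> length F = Suc n \<and> card I = Suc n")
    case True
    then have ne: "F \<noteq> []" and len: "length (butlast F) = n" by auto
    note bl = composition_butlast[OF conjunct1[OF True] ne]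
    have cards: "card (last F) = 1" "card (I - last F) = n"
     using card_block_complement[OF I(1) _ bl(2,3,1) len] True by auto
    have F: "F = butlast F @ [last F]" using ne by simp
    have td: "take n F = butlast F" "drop n F = [last F]"
     using len by (subst F, simp)+
    let ?D = "(I - last F, last F)"
    have D0: "?D \<in> decomps2 I" using bl(2) by (auto simp: decomps2_def)
    have "(\<Oplus>D\<in>decomps2 I. ?c D F) = ?c ?D F"
    proof (rule finsum_single_term[OF finite_decomps2[OF I(1)] D0])
     show "?c D F = \<zero>" if "D \<in> decomps2 I" "D \<noteq> ?D" for D
     proof (rule ccontr)
      assume "?c D F \<noteq> \<zero>"
      from nz[OF this that(1)] have "snd D = last F" by (metis last_snoc)
      moreover have "fst D = I - snd D" using that(1) by (auto simp: decomps2_def)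
      ultimately show False using that(2) by (simp add: prod_eq_iff)
     qed
     show "?c ?D F \<in> carrier R" by (rule omegaD(1)[OF I(1) c[OF D0]])
    qed
    also have "\<dots> = ?t (I - last F) (take n F) \<otimes> point_vec (last F) (drop n F)"
     using cards(2) by (simp add: conc_def)
    also have "point_vec (last F) (drop n F) = \<one>"
     using cards(1) by (simp add: point_vec_def basis_vec_def td)
    also have "?t (I - last F) (take n F) = \<alpha> (I - last F) (rquot rho I z (I - last F)) (butlast F)"
     using bl(1) len cards(2) by (simp add: top_part_def td)
    also have "\<dots> \<otimes> \<one> = \<dots>"
    proof (rule r_one)
     show "\<alpha> (I - last F) (rquot rho I z (I - last F)) (butlast F) \<in> carrier R"
      by (rule cochainD(2)[OF \<alpha> _ rquot_closed[OF I]]) (use I(1) in auto)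
    qed
    also have "\<dots> = coface lam rho (Suc n) \<alpha> F z"
     using True bl(1) by (simp add: coface_def coeff_def Let_def compositions_def)
    finally show ?thesis using True by (simp add: top_part_def[of "Suc n" I])
   next
    case False
    have "?c D F = \<zero>" if "D \<in> decomps2 I" for D
    proof (rule ccontr)
     assume "?c D F \<noteq> \<zero>"
     note N = nz[OF this that]
     have "[snd D] \<in> compositions (snd D)" using N by (intro singleton_composition) auto
     then have "take n F @ [snd D] \<in> compositions (fst D \<union> snd D)"
      using N by (intro append_composition[OF _ _ D(3)[OF that]]) auto
     then have "F \<in> compositions I" using N D(4)[OF that] by simp
     moreover have "length F = Suc n" using N by (metis length_append_singleton)
     moreover have "card I = Suc n"
      using card_Un_disjoint[OF D(1-3)[OF that]] N D(4)[OF that] by simp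
     ultimately show False using False by simp
    qed
    then have "(\<Oplus>D\<in>decomps2 I. ?c D F) = \<zero>" by (rule add.finprod_one_eqI)
    then show ?thesis using False by (auto simp: top_part_def)
   qed
  qed
  finally show ?thesis by (simp add: top_class_coface[OF I])
 qed
qed

text \<open>The interior cofaces only contribute a coboundary of the complex computing the Koszul dual.\<close>

lemma koszul_diff_top_class:
 assumes \<alpha>: "\<alpha> \<in> carrier (Coch n)"
 shows "kdiff n (top_class n \<alpha>) = top_class (Suc n) (cdiff n \<alpha>)"
proof -
 interpret S: module R "HomEd" by (rule species_hom_exp_dual_module)
 let ?l = "top_class (Suc n) (coface_cochain n 0 \<alpha>)" and ?r = "top_class (Suc n) (coface_cochain n (Suc n) \<alpha>)"
 let ?m = "\<ominus>\<^bsub>HomEd\<^esub> ([((-1 :: int) ^ n)] \<cdot>\<^bsub>HomEd\<^esub> ?r)"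
 have l: "?l \<in> carrier (HomEd)" and r: "?r \<in> carrier (HomEd)"
  using top_class_in[OF coface_cochain_closed[OF \<alpha>]] by (simp_all add: koszul_carrier)
 have sr: "[((-1 :: int) ^ n)] \<cdot>\<^bsub>HomEd\<^esub> ?r \<in> carrier (HomEd)"
  using r by (intro S.M.add.int_pow_closed)
 have kd: "kdiff n (top_class n \<alpha>) = ?l \<oplus>\<^bsub>HomEd\<^esub> ?m"
  using top_class_in[OF \<alpha>]
  by (simp add: koszul_diff_def cap_left_top_class[OF \<alpha>] cap_right_top_class[OF \<alpha>] a_minus_def)
 show ?thesis
  unfolding kd
 proof (rule species_hom_ext)
  show "?l \<oplus>\<^bsub>HomEd\<^esub> ?m \<in> carrier (HomEd)"
   using l sr by simp
  show "top_class (Suc n) (cdiff n \<alpha>) \<in> carrier (HomEd)"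
   using top_class_in[OF cochain_diff_closed[OF \<alpha>]] by (simp add: koszul_carrier)
  fix I z assume I: "finite I" "z \<in> carrier (XV I)"
  interpret E: module R "Ed I" by (rule exp_dual_simps(5)[OF I(1)])
  interpret W: module R "omega R I 0" by (rule omega_module)
  let ?f = "\<lambda>i. top_part (Suc n) I (\<lambda>F. coface lam rho i \<alpha> F z)"
  have f: "?f i \<in> carrier (omega R I 0)" if "i \<le> Suc n" for i by (rule top_part_coface_closed[OF \<alpha> I that])
  have fR: "?f i F \<in> carrier R" if "i \<le> Suc n" for i F by (rule omegaD(1)[OF I(1) f[OF that]])
  let ?e = "if even (Suc n) then \<one> else \<ominus> \<one>"
  have e: "?e \<in> carrier R" by simp
  have ef: "(\<lambda>F. ?e \<otimes> ?f (Suc n) F) \<in> carrier (omega R I 0)"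
   using W.smult_closed[OF e f[of "Suc n"]] by (simp add: omega_simps)
  have "?m I z = \<ominus>\<^bsub>Ed I\<^esub> ([((-1 :: int) ^ n)] \<cdot>\<^bsub>Ed I\<^esub> ?r I z)"
   by (simp only: species_hom_minus[OF species_axioms linear_relabelling_exp_dual I sr]
     species_hom_signed[OF species_axioms linear_relabelling_exp_dual I r])
  also have "\<dots> = ?e \<odot>\<^bsub>Ed I\<^esub> ?r I z"
  proof -
   have "?r I z \<in> carrier (Ed I)" by (rule species_homD(1)[OF r I])
   then show ?thesis
    using E.smult_l_minus[of \<one> "?r I z"] by (simp add: add_pow_int_lt)
  qed
  also have "\<dots> = dcl I (\<lambda>F. ?e \<otimes> ?f (Suc n) F)"
   unfolding top_class_coface[OF I] by (rule exp_dual_simps(4)[OF I(1) f e]) simp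
  finally have "(?l \<oplus>\<^bsub>HomEd\<^esub> ?m) I z =
    dcl I (\<lambda>F. ?f 0 F \<oplus> ?e \<otimes> ?f (Suc n) F)"
   using exp_dual_simps(3)[OF I(1) f[of 0] ef]
   by (simp add: species_hom_ops(2)[OF I] top_class_coface[OF I])
  also have "\<dots> = dcl I (top_part (Suc n) I (cdiff n \<alpha> I z))"
  proof -
   define d where "d = top_part (Suc n) I (cdiff n \<alpha> I z)"
   define g where "g F = (if F \<in> compositions I \<and> card I = Suc n then \<alpha> I z F else \<zero>)" for F
   have d: "d \<in> carrier (omega R I 0)"
    unfolding d_def by (rule top_part_cochain[OF cochain_diff_closed[OF \<alpha>] I])
   have sum: "(\<lambda>F. ?f 0 F \<oplus> ?e \<otimes> ?f (Suc n) F) \<in> carrier (omega R I 0)"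
    using W.M.a_closed[OF f[of 0] ef] by (simp add: omega_simps)
   have g: "g \<in> carrier (omega R I (0 - 1))"
   proof (rule omegaI[OF I(1)])
    show "g F \<in> carrier R" for F using cochainD(2)[OF \<alpha> I] by (simp add: g_def)
    fix F assume "F \<in> compositions I" "int (length F) \<noteq> 0 - 1 + int (card I)"
    then show "g F = \<zero>"
     using cochainD(3)[OF \<alpha> I, of F] by (auto simp: g_def decomps_def)
   qed (simp add: g_def)
   have "d F = (?f 0 F \<oplus> ?e \<otimes> ?f (Suc n) F) \<oplus> omega_diff R I g F" for F
   proof (cases "F \<in> compositions I \<and> length F = Suc n \<and> card I = Suc n")
    case True
    have co: "coface lam rho i \<alpha> F z \<in> carrier R" if "i \<le> Suc n" for i
     using fR[OF that, of F] True by (simp add: top_part_def)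
    have mid: "alt_sum R {1..n} (\<lambda>i. coface lam rho i \<alpha> F z) = omega_diff R I g F"
    proof -
     have "coface lam rho i \<alpha> F z = g (merge_blocks i F)" if "i \<in> {1..n}" for i
     proof -
      have "merge_blocks i F \<in> compositions I"
       using merge_blocks_composition[of i F I] that True by simp
      moreover from this have "\<Union> (set (merge_blocks i F)) = I" by (simp add: compositions_def)
      ultimately show ?thesis
       using that True by (simp add: coface_def coeff_def Let_def g_def merge_blocks_def)
     qed
     then have "alt_sum R {1..n} (\<lambda>i. coface lam rho i \<alpha> F z) = alt_sum R {1..n} (\<lambda>i. g (merge_blocks i F))"
      using omegaD(1)[OF I(1) g] by (intro alt_sum_cong) auto
     then show ?thesis
      using True by (simp add: omega_diff_apply[OF I(1) g] atLeastLessThanSuc_atLeastAtMost)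
    qed
    have "d F = alt_sum R {0..Suc n} (\<lambda>i. coface lam rho i \<alpha> F z)"
     using True by (auto simp: d_def top_part_def cochain_diff_eq[OF \<alpha>] partial_diff_apply[OF I] composition_decomps)
    also have "{0..Suc n} = insert 0 (insert (Suc n) {1..n})" by auto
    also have "alt_sum R (insert 0 (insert (Suc n) {1..n})) (\<lambda>i. coface lam rho i \<alpha> F z) =
      coface lam rho 0 \<alpha> F z \<oplus> (?e \<otimes> coface lam rho (Suc n) \<alpha> F z \<oplus> alt_sum R {1..n} (\<lambda>i. coface lam rho i \<alpha> F z))"
     using co by (subst finsum_insert; (subst finsum_insert)?) (auto simp: signed_multiple l_minus simp del: power_Suc)
    also have "\<dots> = (?f 0 F \<oplus> ?e \<otimes> ?f (Suc n) F) \<oplus> omega_diff R I g F"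
     unfolding mid using True co omegaD(1)[OF I(1) omega_diff_closed[OF I(1) g]]
     by (simp add: top_part_def a_assoc)
    finally show ?thesis .
   next
    case False
    have "d F = \<zero>" "?f 0 F = \<zero>" "?f (Suc n) F = \<zero>" using False by (auto simp: d_def top_part_def)
    moreover have "omega_diff R I g F = \<zero>"
    proof (cases "card I = Suc n")
     case True
     then show ?thesis
      using False omegaD(2,3)[OF I(1) omega_diff_closed[OF I(1) g], of F] by auto
    next
     case False
     then have "g = (\<lambda>_. \<zero>)" by (auto simp: g_def)
     then show ?thesis unfolding omega_diff_apply[OF I(1) g] by (auto intro: alt_sum_zero)
    qed
    ultimately show ?thesis using e by simp
   qed
   then have "(\<lambda>F. d F \<ominus> (?f 0 F \<oplus> ?e \<otimes> ?f (Suc n) F)) = omega_diff R I g"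
   proof (intro ext)
    fix F assume dF: "\<And>F. d F = (?f 0 F \<oplus> ?e \<otimes> ?f (Suc n) F) \<oplus> omega_diff R I g F"
    have cancel: "(a \<oplus> b) \<ominus> a = b" if "a \<in> carrier R" "b \<in> carrier R" for a b
     using that by (simp add: a_minus_def a_comm[of a b] a_assoc r_neg)
    show "d F \<ominus> (?f 0 F \<oplus> ?e \<otimes> ?f (Suc n) F) = omega_diff R I g F"
     unfolding dF by (rule cancel[OF omegaD(1)[OF I(1) sum] omegaD(1)[OF I(1) omega_diff_closed[OF I(1) g]]])
   qed
   then have "(\<lambda>F. d F \<ominus> (?f 0 F \<oplus> ?e \<otimes> ?f (Suc n) F)) \<in> cobd I 0"
    using g by (simp add: omega_coboundaries_def)
   then show ?thesis using dual_class_eq[OF I(1) d sum] by (simp add: d_def)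
  qed
  finally show "(?l \<oplus>\<^bsub>HomEd\<^esub> ?m) I z =
    top_class (Suc n) (cdiff n \<alpha>) I z"
   by (simp add: top_class_apply[OF I])
 qed
qed

end

section \<open>The top degree of the local complex\<close>

context cring
begin

definition positional :: "nat => nat set => (nat set list => 'a) => (nat => nat) => 'a" where
 "positional n I a p = (if p \<in> positions n I then a (blocks n p) else \<zero>)"

lemma positional_in:
 assumes "range a \<subseteq> carrier R"
 shows "positional n I a \<in> local_cochains n I"
 using assms by (intro local_cochainsI) (auto simp: positional_def)

lemma positional_linear:
 assumes "range a \<subseteq> carrier R"
 shows "positional n I (\<lambda>F. a F \<oplus> b F) = (\<lambda>p. positional n I a p \<oplus> positional n I b p)"
  and "c \<in> carrier R ==> positional n I (\<lambda>F. c \<otimes> a F) = (\<lambda>p. c \<otimes> positional n I a p)"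
 by (auto simp: positional_def)

lemma top_value_cong:
 assumes "distinct xs" "range f \<subseteq> carrier R" "range g \<subseteq> carrier R"
  and "\<And>p. [|p \<in> positions (length xs) (set xs); inj_on p (set xs)|] ==> f p = g p"
 shows "top_value xs f = top_value xs g"
 using assms
proof (induction xs arbitrary: f g)
 case Nil
 have "(\<lambda>_. 0) \<in> positions 0 {}" by (simp add: positions_def)
 then show ?case using Nil by simp
next
 case (Cons x xs)
 have "top_value xs (integrate x (length xs) f) = top_value xs (integrate x (length xs) g)"
 proof (rule Cons.IH)
  show "distinct xs" using Cons.prems(1) by simp
  show "range (integrate x (length xs) f) \<subseteq> carrier R" "range (integrate x (length xs) g) \<subseteq> carrier R"
   using local_diff_closed(3)[OF Cons.prems(2)] local_diff_closed(3)[OF Cons.prems(3)] by auto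
  fix v assume v: "v \<in> positions (length xs) (set xs)" "inj_on v (set xs)"
  have x: "x \<notin> set xs" using Cons.prems(1) by simp
  have vx: "v x = 0" by (rule positionsD(3)[OF v(1) x])
  have eq: "f ((gap_pos k \<circ> v)(x := Suc k)) = g ((gap_pos k \<circ> v)(x := Suc k))" if k: "k \<le> length xs" for k
  proof (rule Cons.prems(4))
   let ?p = "(gap_pos k \<circ> v)(x := Suc k)"
   show "?p \<in> positions (length (x # xs)) (set (x # xs))"
    unfolding positions_def
   proof (intro CollectI allI)
    fix y
    show "if y \<in> set (x # xs) then 1 \<le> ?p y \<and> ?p y \<le> length (x # xs) else ?p y = 0"
     using k positionsD[OF v(1), of y] by (cases "y \<in> set xs") (auto simp: gap_pos_def)
   qed
   show "inj_on ?p (set (x # xs))"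
    using v(2) x by (auto simp: inj_on_def gap_pos_def split: if_splits)
  qed
  show "integrate x (length xs) f v = integrate x (length xs) g v"
   unfolding integrate_def using vx eq Cons.prems(3) by (auto intro!: alt_sum_cong)
 qed
 then show ?case by simp
qed

lemma inj_positions_image:
 assumes "finite I" "p \<in> positions (card I) I" "inj_on p I"
 shows "p ` I = {1..card I}"
proof (rule card_subset_eq)
 show "p ` I \<subseteq> {1..card I}" using positionsD[OF assms(2)] by auto
 show "card (p ` I) = card {1..card I}" using card_image[OF assms(3)] by simp
qed simp

lemma blocks_composition_iff:
 assumes p: "p \<in> positions n I"
 shows "blocks n p \<in> compositions I \<longleftrightarrow> {1..n} \<subseteq> p ` I"
proof -
 have D: "blocks n p \<in> decomps n I" by (rule blocks_in_decomps[OF p])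
 have "{} \<notin> set (blocks n p) \<longleftrightarrow> (\<forall>k<n. \<exists>x. p x = Suc k)"
  by (auto simp: blocks_def)
 also have "\<dots> \<longleftrightarrow> {1..n} \<subseteq> p ` I"
 proof
  assume L: "\<forall>k<n. \<exists>x. p x = Suc k"
  show "{1..n} \<subseteq> p ` I"
  proof
   fix k assume k: "k \<in> {1..n}"
   then have "k - 1 < n" by auto
   then obtain x where "p x = Suc (k - 1)" using L by blast
   then have "p x = k" using k by simp
   moreover have "x \<in> I" using positionsD(3)[OF p, of x] \<open>p x = k\<close> k by (cases "x \<in> I") auto
   ultimately show "k \<in> p ` I" by blast
  qed
 next
  assume R: "{1..n} \<subseteq> p ` I"
  show "\<forall>k<n. \<exists>x. p x = Suc k"
  proof (intro allI impI)
   fix k assume "k < n"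
   then have "Suc k \<in> p ` I" using R by auto
   then show "\<exists>x. p x = Suc k" by force
  qed
 qed
 finally show ?thesis using D by (simp add: composition_decomps)
qed

lemma top_value_top_part:
 assumes I: "distinct xs" "set xs = I" and a: "range a \<subseteq> carrier R"
 shows "top_value xs (positional (card I) I (top_part (card I) I a)) = top_value xs (positional (card I) I a)"
proof (rule top_value_cong[OF I(1)])
 have fin: "finite I" and len: "length xs = card I" using I distinct_card[OF I(1)] by auto
 have tR: "range (top_part (card I) I a) \<subseteq> carrier R" using a by (auto simp: top_part_def)
 show "range (positional (card I) I (top_part (card I) I a)) \<subseteq> carrier R" "range (positional (card I) I a) \<subseteq> carrier R"
  by (rule local_cochains_range[OF positional_in[OF tR]], rule local_cochains_range[OF positional_in[OF a]])
 fix p assume p: "p \<in> positions (length xs) (set xs)" "inj_on p (set xs)"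
 then have p': "p \<in> positions (card I) I" "inj_on p I" using I len by auto
 then have "blocks (card I) p \<in> compositions I"
  using inj_positions_image[OF fin p'] by (simp add: blocks_composition_iff[OF p'(1)])
 then show "positional (card I) I (top_part (card I) I a) p = positional (card I) I a p"
  by (simp add: positional_def top_part_def)
qed

lemma merge_pos_positions:
 assumes p: "p \<in> positions (Suc n) I" and i: "0 < i" "i \<le> n"
 shows "merge_pos i \<circ> p \<in> positions n I"
 using face_pos_in_positions[of n i p] face_pos_inner[OF p i] by simp

lemma merge_pos_ends:
 assumes p: "p \<in> positions (Suc n) I" and b: "blocks (Suc n) p \<in> compositions I"
 shows "merge_pos 0 \<circ> p \<notin> positions n I" "merge_pos (Suc n) \<circ> p \<notin> positions n I"
proof -
 have "{1..Suc n} \<subseteq> p ` I" using b blocks_composition_iff[OF p] by simp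
 then have "1 \<in> p ` I" "Suc n \<in> p ` I" by auto
 then obtain x y where x: "x \<in> I" "p x = 1" and y: "y \<in> I" "p y = Suc n" by (metis imageE)
 show "merge_pos 0 \<circ> p \<notin> positions n I"
  by (rule positions_failureI(1)[OF x(1)]) (simp add: merge_pos_def x)
 show "merge_pos (Suc n) \<circ> p \<notin> positions n I"
  by (rule positions_failureI(1)[OF y(1)]) (simp add: merge_pos_def y)
qed

lemma local_diff_positional:
 assumes h: "range h \<subseteq> carrier R" and p: "p \<in> positions (Suc n) I" and b: "blocks (Suc n) p \<in> compositions I"
 shows "local_diff I n (positional n I h) p = alt_sum R {1..n} (\<lambda>i. h (merge_blocks i (blocks (Suc n) p)))"
proof -
 have zero: "\<forall>x. x \<notin> I --> p x = 0" using positionsD(3)[OF p] by blast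
 note ends = merge_pos_ends[OF p b]
 have hR: "h F \<in> carrier R" for F using h by auto
 have "local_diff I n (positional n I h) p = alt_sum R {0..Suc n} (\<lambda>i. positional n I h (merge_pos i \<circ> p))"
  using zero by (simp add: local_diff_def)
 also have "\<dots> = alt_sum R {0..Suc n} (\<lambda>i. if 1 \<le> i \<and> i \<le> n then h (merge_blocks i (blocks (Suc n) p)) else \<zero>)"
 proof (rule alt_sum_cong)
  fix i assume "i \<in> {0..Suc n}"
  then consider "i = 0" | "0 < i" "i \<le> n" | "i = Suc n" by (auto simp: le_Suc_eq)
  then show "positional n I h (merge_pos i \<circ> p) =
    (if 1 \<le> i \<and> i \<le> n then h (merge_blocks i (blocks (Suc n) p)) else \<zero>)"
   by cases (use ends merge_pos_positions[OF p] blocks_merge in \<open>auto simp: positional_def\<close>)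
 qed (use hR in auto)
 also have "\<dots> = alt_sum R {1..n} (\<lambda>i. h (merge_blocks i (blocks (Suc n) p)))"
  using hR by (intro alt_sum_filter) auto
 finally show ?thesis .
qed

lemma top_value_coboundary:
 assumes xs: "distinct xs" "set xs = I" and f: "f \<in> cobd I 0"
 shows "top_value xs (positional (card I) I f) = \<zero>"
proof -
 have fin: "finite I" and len: "length xs = card I" using xs distinct_card[OF xs(1)] by auto
 obtain h where h: "h \<in> carrier (omega R I (0 - 1))" and f_eq: "f = omega_diff R I h"
  using f by (auto simp: omega_coboundaries_def)
 have hR: "range h \<subseteq> carrier R" using omegaD(1)[OF fin h] by auto
 have fR: "range f \<subseteq> carrier R" using omegaD(1)[OF fin omega_diff_closed[OF fin h]] f_eq by auto
 show ?thesis
 proof (cases "card I")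
  case 0
  then have "I = {}" using fin by simp
  then have "h = (\<lambda>_. \<zero>)" using omegaD(3)[OF fin h] by auto
  then have "f F = \<zero>" for F unfolding f_eq omega_diff_apply[OF fin h] by (auto intro: alt_sum_zero)
  then show ?thesis using 0 len by (simp add: positional_def)
 next
  case (Suc n)
  have "top_value xs (positional (card I) I f) = top_value xs (local_diff I n (positional n I h))"
  proof (rule top_value_cong[OF xs(1)])
   show "range (positional (card I) I f) \<subseteq> carrier R" by (rule local_cochains_range[OF positional_in[OF fR]])
   show "range (local_diff I n (positional n I h)) \<subseteq> carrier R"
    by (rule local_cochains_range[OF local_diff_in[OF positional_in[OF hR]]])
   fix p assume p: "p \<in> positions (length xs) (set xs)" "inj_on p (set xs)"
   then have p': "p \<in> positions (Suc n) I" "p \<in> positions (card I) I" "inj_on p I" using xs len Suc by auto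
   then have b: "blocks (Suc n) p \<in> compositions I"
    using inj_positions_image[OF fin p'(2,3)] Suc by (simp add: blocks_composition_iff[OF p'(1)])
   show "positional (card I) I f p = local_diff I n (positional n I h) p"
    unfolding local_diff_positional[OF hR p'(1) b]
    using p' b Suc by (simp add: positional_def f_eq omega_diff_apply[OF fin h] atLeastLessThanSuc_atLeastAtMost)
  qed
  also have "\<dots> = \<zero>"
   using top_value_diff[of xs n "positional n I h"] positional_in[OF hR] xs len Suc by simp
  finally show ?thesis .
 qed
qed

text \<open>A position function on \<open>m\<close> points with \<open>m + 1\<close> blocks misses some block \<open>j\<close>; a cochain
 supported on compositions only sees the two merges that swallow this block, and they cancel.\<close>

lemma omega_cocycle:
 assumes fin: "finite I" and f: "f \<in> carrier (omega R I 0)"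
 shows "local_diff I (card I) (positional (card I) I f) p = \<zero>"
proof (cases "p \<in> positions (Suc (card I)) I")
 case False
 have "range f \<subseteq> carrier R" using omegaD(1)[OF fin f] by auto
 from local_cochains_outside[OF local_diff_in[OF positional_in[OF this]] False] show ?thesis .
next
 case p: True
 let ?m = "card I"
 have zero: "\<forall>x. x \<notin> I --> p x = 0" using positionsD(3)[OF p] by blast
 note fR = omegaD(1)[OF fin f]
 have "\<not> {1..Suc ?m} \<subseteq> p ` I"
 proof
  assume "{1..Suc ?m} \<subseteq> p ` I"
  then have "card {1..Suc ?m} \<le> card (p ` I)" using fin by (intro card_mono) auto
  also have "\<dots> \<le> ?m" by (rule card_image_le[OF fin])
  finally show False by simp
 qed
 then obtain j where "j \<in> {1..Suc ?m}" and j': "j \<notin> p ` I" by blast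
 then have j: "1 \<le> j" "j \<le> Suc ?m" "j \<notin> p ` I" by auto
 have pj: "p x \<noteq> j" for x
  using j zero by (cases "x \<in> I") auto
 have same: "merge_pos (j - 1) \<circ> p = merge_pos j \<circ> p"
 proof
  show "(merge_pos (j - 1) \<circ> p) x = (merge_pos j \<circ> p) x" for x
   using pj[of x] by (auto simp: merge_pos_def)
 qed
 let ?t = "\<lambda>i. positional ?m I f (merge_pos i \<circ> p)"
 have tR: "?t i \<in> carrier R" for i using fR by (simp add: positional_def)
 have others: "?t i = \<zero>" if i: "i \<le> Suc ?m" "i \<noteq> j - 1" "i \<noteq> j" for i
 proof (cases "merge_pos i \<circ> p \<in> positions ?m I")
  case True
  have "merge_pos i j \<in> {1..?m}" using i j by (auto simp: merge_pos_def)
  moreover have "merge_pos i j \<notin> (merge_pos i \<circ> p) ` I"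
  proof
   assume "merge_pos i j \<in> (merge_pos i \<circ> p) ` I"
   then obtain x where "merge_pos i j = merge_pos i (p x)" by (metis comp_apply imageE)
   moreover have "j < i \<or> Suc i < j" using i(2,3) by linarith
   ultimately show False using pj[of x] unfolding merge_pos_def by (simp split: if_splits; linarith)
  qed
  ultimately have "blocks ?m (merge_pos i \<circ> p) \<notin> compositions I"
   using blocks_composition_iff[OF True] by blast
  then show ?thesis using omegaD(2)[OF fin f] by (simp add: positional_def)
 qed (simp add: positional_def)
 have "local_diff I ?m (positional ?m I f) p = alt_sum R {0..Suc ?m} ?t"
  using zero by (simp add: local_diff_def)
 also have "\<dots> = alt_sum R {0..Suc ?m} (\<lambda>i. if i = j - 1 \<or> i = j then ?t i else \<zero>)"
  using others tR by (intro alt_sum_cong) auto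
 also have "\<dots> = alt_sum R {j - 1, j} ?t"
  using j tR by (intro alt_sum_filter) auto
 also have "\<dots> = \<zero>"
 proof -
  obtain l where l: "j = Suc l" using j(1) by (cases j) auto
  have "alt_sum R {l, Suc l} ?t = [((-1 :: int) ^ l)] \<cdot> ?t l \<oplus> [((-1 :: int) ^ Suc l)] \<cdot> ?t (Suc l)"
   using tR by (subst finsum_insert; simp del: power_Suc)
  then show ?thesis using same tR[of "Suc l"] by (simp add: l signed_multiple r_neg l_neg del: power_Suc)
 qed
 finally show ?thesis .
qed

lemma positional_inverse:
 assumes "g \<in> local_cochains n I"
 shows "positional n I (\<lambda>F. if F \<in> decomps n I then g (position_of F) else \<zero>) = g"
proof
 fix p
 show "positional n I (\<lambda>F. if F \<in> decomps n I then g (position_of F) else \<zero>) p = g p"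
  using local_cochains_outside[OF assms, of p] position_of_blocks[of p n I] blocks_in_decomps[of p n I]
  by (simp add: positional_def)
qed

text \<open>A function on linear orders is a local cocycle of top degree. If its top value is zero, it has
 a local primitive, and the restriction of the primitive to the compositions exhibits it as a coboundary
 of \<open>\<Omega>(E)\<close>.\<close>

lemma coboundary_iff_top_value:
 assumes xs: "distinct xs" "set xs = I" and f: "f \<in> carrier (omega R I 0)"
 shows "f \<in> cobd I 0 \<longleftrightarrow> top_value xs (positional (card I) I f) = \<zero>"
proof
 assume top: "top_value xs (positional (card I) I f) = \<zero>"
 have fin: "finite I" and len: "length xs = card I" using xs distinct_card[OF xs(1)] by auto
 have fR: "range f \<subseteq> carrier R" using omegaD(1)[OF fin f] by auto
 note ex = local_exactness[of xs "positional (card I) I f" "card I"]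
 have exact: "case card I of 0 => positional (card I) I f = (\<lambda>_. \<zero>)
   | Suc m => \<exists>g\<in>local_cochains m I. local_diff I m g = positional (card I) I f"
  by (rule ex[unfolded xs(2), OF xs(1) positional_in[OF fR] omega_cocycle[OF fin f]]) (rule top)
 have at_f: "f F = positional (card I) I f (position_of F)" if "F \<in> compositions I" "length F = card I" for F
 proof -
  have D: "F \<in> decomps (card I) I" using that composition_decomps[of F I] by simp
  show ?thesis by (simp add: positional_def position_of_in_positions[OF D] blocks_position_of[OF D])
 qed
 show "f \<in> cobd I 0"
 proof (cases "card I")
  case 0
  then have "f F = \<zero>" for F
   using exact at_f[of F] omegaD(2,3)[OF fin f, of F] by (cases "F \<in> compositions I \<and> length F = card I") auto
  then have "f = \<zero>\<^bsub>omega R I 0\<^esub>" by (auto simp: omega_simps)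
  then show ?thesis using quotient_module.H_zero[OF omega_quotient[OF fin]] by simp
 next
  case (Suc m)
  then obtain g where g: "g \<in> local_cochains m I" "local_diff I m g = positional (card I) I f"
   using exact by auto
  let ?b = "\<lambda>F. if F \<in> decomps m I then g (position_of F) else \<zero>"
  define h where "h F = (if F \<in> compositions I \<and> length F = m then g (position_of F) else \<zero>)" for F
  have bR: "range ?b \<subseteq> carrier R" using local_cochains_closed[OF g(1)] by auto
  have h: "h \<in> carrier (omega R I (0 - 1))"
   by (rule omegaI[OF fin]) (use local_cochains_closed[OF g(1)] Suc in \<open>auto simp: h_def\<close>)
  have "omega_diff R I h F = f F" for F
  proof (cases "F \<in> compositions I \<and> length F = Suc m")
   case True
   then have F: "F \<in> decomps (Suc m) I" "F \<in> compositions I" by (auto simp: composition_decomps)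
   let ?p = "position_of F"
   have p: "?p \<in> positions (Suc m) I" "blocks (Suc m) ?p = F"
    using position_of_in_positions[OF F(1)] blocks_position_of[OF F(1)] by auto
   have "f F = local_diff I m g ?p" using at_f[of F] True Suc g(2) by simp
   also have "\<dots> = local_diff I m (positional m I ?b) ?p" by (simp add: positional_inverse[OF g(1)])
   also have "\<dots> = alt_sum R {1..m} (\<lambda>i. ?b (merge_blocks i F))"
    by (rule local_diff_positional[OF bR p(1), unfolded p(2), OF F(2)])
   also have "\<dots> = alt_sum R {1..m} (\<lambda>i. h (merge_blocks i F))"
   proof (rule alt_sum_cong)
    fix i assume i: "i \<in> {1..m}"
    then have "merge_blocks i F \<in> compositions I" "length (merge_blocks i F) = m"
     using merge_blocks_composition[OF _ _ F(2), of i] length_merge_blocks[of i F] True by auto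
    then show "?b (merge_blocks i F) = h (merge_blocks i F)" by (simp add: h_def composition_decomps)
   qed (rule omegaD(1)[OF fin h])
   also have "\<dots> = omega_diff R I h F"
    using True by (simp add: omega_diff_apply[OF fin h] atLeastLessThanSuc_atLeastAtMost)
   finally show ?thesis by simp
  next
   case False
   then show ?thesis
    using omegaD(2,3)[OF fin f, of F] omegaD(2,3)[OF fin omega_diff_closed[OF fin h], of F] Suc by auto
  qed
  then have "f = omega_diff R I h" by auto
  then show ?thesis using h by (auto simp: omega_coboundaries_def)
 qed
qed (rule top_value_coboundary[OF xs])

text \<open>The order in which the list enumerates its elements, as a generator of \<open>\<Omega>(E)\<close>.\<close>

definition standard_vec :: "nat list => nat set list => 'a" where
 "standard_vec xs = bas (blocks (length xs) (order_pos xs))"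

lemma order_pos_positions:
 assumes "distinct xs"
 shows "order_pos xs \<in> positions (length xs) (set xs)" "inj_on (order_pos xs) (set xs)"
proof -
 have "if y \<in> set xs then 1 \<le> order_pos xs y \<and> order_pos xs y \<le> length xs else order_pos xs y = 0" for y
  by (induction xs) (auto simp: gap_pos_def)
 then show "order_pos xs \<in> positions (length xs) (set xs)" unfolding positions_def by blast
 have pos: "1 \<le> order_pos ys y" if "y \<in> set ys" for y and ys
  using that by (induction ys) (auto simp: gap_pos_def)
 show "inj_on (order_pos xs) (set xs)" using assms
 proof (induction xs)
  case (Cons x xs)
  then show ?case using pos[of _ xs] by (force simp: inj_on_def gap_pos_def split: if_splits)
 qed simp
qed

lemma standard_vec:
 assumes xs: "distinct xs" "set xs = I"
 shows "standard_vec xs \<in> carrier (omega R I 0)"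
  and "top_value xs (positional (card I) I (standard_vec xs)) = \<one>"
proof -
 have fin: "finite I" and len: "length xs = card I" using xs distinct_card[OF xs(1)] by auto
 note o = order_pos_positions[OF xs(1), unfolded xs(2) len]
 have "blocks (card I) (order_pos xs) \<in> compositions I"
  using inj_positions_image[OF fin o] by (simp add: blocks_composition_iff[OF o(1)])
 then show "standard_vec xs \<in> carrier (omega R I 0)"
  by (intro omegaI[OF fin]) (auto simp: standard_vec_def basis_vec_def len)
 have "positional (card I) I (standard_vec xs) = (\<lambda>p. if p = order_pos xs then \<one> else \<zero>)"
 proof
  fix p
  have "blocks (card I) p = blocks (card I) (order_pos xs) \<longleftrightarrow> p = order_pos xs" if "p \<in> positions (card I) I"
   using position_of_blocks[OF that] position_of_blocks[OF o(1)] by metis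
  then show "positional (card I) I (standard_vec xs) p = (if p = order_pos xs then \<one> else \<zero>)"
   using o(1) by (auto simp: positional_def standard_vec_def basis_vec_def len)
 qed
 then show "top_value xs (positional (card I) I (standard_vec xs)) = \<one>"
  using top_value_order[OF xs(1)] by simp
qed

lemma dual_class_standard:
 assumes xs: "distinct xs" "set xs = I" and f: "f \<in> carrier (omega R I 0)"
 shows "dcl I f = dcl I (\<lambda>F. top_value xs (positional (card I) I f) \<otimes> standard_vec xs F)"
proof -
 have fin: "finite I" using xs by auto
 interpret W: module R "omega R I 0" by (rule omega_module)
 let ?c = "top_value xs (positional (card I) I f)"
 have fR: "range f \<subseteq> carrier R" using omegaD(1)[OF fin f] by auto
 have c: "?c \<in> carrier R" by (rule top_value_closed[OF local_cochains_range[OF positional_in[OF fR]]])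
 note e = standard_vec[OF xs]
 have eR: "range (standard_vec xs) \<subseteq> carrier R" using omegaD(1)[OF fin e(1)] by auto
 have ce: "(\<lambda>F. ?c \<otimes> standard_vec xs F) \<in> carrier (omega R I 0)"
  using W.smult_closed[OF c e(1)] by (simp add: omega_simps)
 have diff: "(\<lambda>F. f F \<ominus> ?c \<otimes> standard_vec xs F) \<in> carrier (omega R I 0)"
  using W.M.minus_closed[OF f ce] by (simp add: omega_difference[OF f ce])
 have "(\<lambda>F. f F \<ominus> ?c \<otimes> standard_vec xs F) = (\<lambda>F. f F \<oplus> \<ominus> ?c \<otimes> standard_vec xs F)"
  using c omegaD(1)[OF fin e(1)] by (simp add: a_minus_def l_minus)
 then have P: "positional (card I) I (\<lambda>F. f F \<ominus> ?c \<otimes> standard_vec xs F) =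
   (\<lambda>p. positional (card I) I f p \<oplus> \<ominus> ?c \<otimes> positional (card I) I (standard_vec xs) p)"
  using positional_linear(1)[OF fR, of "card I" I "\<lambda>F. \<ominus> ?c \<otimes> standard_vec xs F"]
   positional_linear(2)[OF eR, of "\<ominus> ?c"] c by simp
 have "top_value xs (positional (card I) I (\<lambda>F. f F \<ominus> ?c \<otimes> standard_vec xs F)) = ?c \<oplus> \<ominus> ?c \<otimes> \<one>"
 proof -
  note pf = local_cochains_range[OF positional_in[OF fR, of "card I" I]]
  note pe = local_cochains_range[OF positional_in[OF eR, of "card I" I]]
  have "range (\<lambda>p. \<ominus> ?c \<otimes> positional (card I) I (standard_vec xs) p) \<subseteq> carrier R"
   using pe c by auto
  then show ?thesis
   unfolding P using top_value_add[OF pf] top_value_smult[OF pe, of "\<ominus> ?c" xs] c e(2) by simp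
 qed
 also have "\<dots> = \<zero>" using c by (simp add: r_neg)
 finally have "(\<lambda>F. f F \<ominus> ?c \<otimes> standard_vec xs F) \<in> cobd I 0"
  using coboundary_iff_top_value[OF xs diff] by simp
 then show ?thesis using dual_class_eq[OF fin f ce] by simp
qed

text \<open>The cohomology of the local complex, in terms of decompositions; in the degree \<open>card I\<close> the
 primitive can be corrected by a multiple of the cocycle of a linear order.\<close>

lemma local_primitive_exists:
 assumes fin: "finite I" and a: "a \<in> carrier (fmod (decomps (Suc n) I))"
  and cocycle: "\<And>p. local_diff I (Suc n) (positional (Suc n) I a) p = \<zero>"
  and top: "Suc n = card I ==> top_part (Suc n) I a \<in> cobd I 0"
 shows "\<exists>b\<in>carrier (fmod (decomps n I)).
  local_diff I n (positional n I b) = positional (Suc n) I a \<and> top_part n I b \<in> cobd I 0"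
proof -
 define xs where "xs = sorted_list_of_set I"
 have xs: "distinct xs" "set xs = I" and len: "length xs = card I"
  using fin by (simp_all add: xs_def)
 have aR: "range a \<subseteq> carrier R" by (rule free_module_range[OF a])
 have "top_value xs (positional (Suc n) I a) = \<zero>" if "Suc n = length xs"
  using top_value_top_part[OF xs aR] top_value_coboundary[OF xs] top that len by simp
 then obtain g where g: "g \<in> local_cochains n I" "local_diff I n g = positional (Suc n) I a"
  using local_exactness[OF xs(1), of "positional (Suc n) I a" "Suc n"] positional_in[OF aR] cocycle xs by auto
 let ?b = "\<lambda>F. if F \<in> decomps n I then g (position_of F) else \<zero>"
 have b: "?b \<in> carrier (fmod (decomps n I))"
  unfolding free_module_carrier[OF finite_decomps[OF fin]] using local_cochains_closed[OF g(1)] by auto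
 have bR: "range ?b \<subseteq> carrier R" by (rule free_module_range[OF b])
 have pb: "positional n I ?b = g" by (rule positional_inverse[OF g(1)])
 show ?thesis
 proof (cases "n = card I")
  case False
  have "top_part n I ?b = \<zero>\<^bsub>omega R I 0\<^esub>" using False by (auto simp: top_part_def omega_simps)
  then have "top_part n I ?b \<in> cobd I 0"
   using quotient_module.H_zero[OF omega_quotient[OF fin]] by simp
  then show ?thesis using b pb g(2) by (intro bexI[of _ ?b]) auto
 next
  case n: True
  interpret F: module R "fmod (decomps n I)" by (rule free_module_module)
  note e = standard_vec[OF xs]
  have eR: "range (standard_vec xs) \<subseteq> carrier R" using omegaD(1)[OF fin e(1)] by auto
  have e_in: "standard_vec xs \<in> carrier (fmod (decomps n I))"
   unfolding free_module_carrier[OF finite_decomps[OF fin]]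
   using omegaD[OF fin e(1)] n by (auto simp: composition_decomps) (metis composition_decomps)+
  \<comment> \<open>\<open>g\<close> has the top value \<open>- ?c\<close>, and \<open>standard_vec xs\<close> is a cocycle of top value one\<close>
  let ?c = "\<ominus> top_value xs g"
  have c: "?c \<in> carrier R" "top_value xs g \<in> carrier R"
   using top_value_closed[OF local_cochains_range[OF g(1)]] by auto
  let ?d = "\<lambda>F. ?b F \<oplus> ?c \<otimes> standard_vec xs F"
  have d: "?d \<in> carrier (fmod (decomps n I))"
   using F.M.a_closed[OF b F.smult_closed[OF c(1) e_in]] by (simp add: free_module_simps)
  have dR: "range ?d \<subseteq> carrier R" by (rule free_module_range[OF d])
  have pe: "positional n I (standard_vec xs) \<in> local_cochains n I" by (rule positional_in[OF eR])
  have ceR: "range (\<lambda>p. ?c \<otimes> positional n I (standard_vec xs) p) \<subseteq> carrier R"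
   using c local_cochains_closed[OF pe] by auto
  have pd: "positional n I ?d = (\<lambda>p. g p \<oplus> ?c \<otimes> positional n I (standard_vec xs) p)"
   using positional_linear(1)[OF bR, of n I "\<lambda>F. ?c \<otimes> standard_vec xs F"]
    positional_linear(2)[OF eR c(1), of n I] pb by simp
  have "local_diff I n (positional n I ?d) p = positional (Suc n) I a p" for p
   unfolding pd local_diff_add[OF local_cochains_range[OF g(1)] ceR]
    local_diff_smult[OF local_cochains_range[OF pe] c(1)] g(2)
   using omega_cocycle[OF fin e(1), of p] n c local_cochains_closed[OF positional_in[OF aR]] by simp
  moreover have "top_value xs (positional n I ?d) = \<zero>"
   unfolding pd top_value_add[OF local_cochains_range[OF g(1)] ceR]
    top_value_smult[OF local_cochains_range[OF pe] c(1)]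
   using e(2) n c by (simp add: r_neg)
  then have "top_value xs (positional (card I) I (top_part n I ?d)) = \<zero>"
   using top_value_top_part[OF xs dR] n by simp
  then have "top_part n I ?d \<in> cobd I 0"
   using coboundary_iff_top_value[OF xs top_part_closed[OF fin]] dR by (simp add: image_subset_iff)
  ultimately show ?thesis using d by (intro bexI[of _ ?d]) auto
 qed
qed

end

section \<open>Lifting along projective representations\<close>

context cring
begin

text \<open>The linear extension of the values \<open>v\<close> on the basis, at the point \<open>w\<close>.\<close>

definition free_value :: "((nat => nat) \<times> 'c => 'w => 'a) => ((nat => nat) \<times> 'c => 'a) => 'w => 'a" where
 "free_value v u w = (\<Oplus>k\<in>{k. u k \<noteq> \<zero>}. u k \<otimes> v k w)"

lemma free_value_superset:
 assumes "finite S" "{k. u k \<noteq> \<zero>} \<subseteq> S" "\<And>k. u k \<in> carrier R" "\<And>k. v k w \<in> carrier R"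
 shows "free_value v u w = (\<Oplus>k\<in>S. u k \<otimes> v k w)"
 unfolding free_value_def using assms
 by (intro add.finprod_mono_neutral_cong_left) auto

lemma free_value_add:
 assumes "u \<in> carrier (fmod B)" "u' \<in> carrier (fmod B)" "\<And>k. v k w \<in> carrier R"
 shows "free_value v (\<lambda>k. u k \<oplus> u' k) w = free_value v u w \<oplus> free_value v u' w"
proof -
 let ?S = "{k. u k \<noteq> \<zero>} \<union> {k. u' k \<noteq> \<zero>}"
 have fin: "finite ?S" using assms(1,2) by (simp add: free_module_carrier')
 have c: "u k \<in> carrier R" "u' k \<in> carrier R" for k
  using free_module_closed[OF assms(1)] free_module_closed[OF assms(2)] by auto
 have "free_value v (\<lambda>k. u k \<oplus> u' k) w = (\<Oplus>k\<in>?S. (u k \<oplus> u' k) \<otimes> v k w)"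
  by (rule free_value_superset[OF fin]) (use c assms(3) in auto)
 also have "\<dots> = (\<Oplus>k\<in>?S. u k \<otimes> v k w \<oplus> u' k \<otimes> v k w)"
  using c assms(3) by (intro finsum_cong') (auto simp: l_distr)
 also have "\<dots> = (\<Oplus>k\<in>?S. u k \<otimes> v k w) \<oplus> (\<Oplus>k\<in>?S. u' k \<otimes> v k w)"
  using c assms(3) by (intro finsum_addf) auto
 also have "(\<Oplus>k\<in>?S. u k \<otimes> v k w) = free_value v u w"
  by (rule free_value_superset[OF fin, symmetric]) (use c assms(3) in auto)
 also have "(\<Oplus>k\<in>?S. u' k \<otimes> v k w) = free_value v u' w"
  by (rule free_value_superset[OF fin, symmetric]) (use c assms(3) in auto)
 finally show ?thesis .
qed

lemma free_value_smult:
 assumes "u \<in> carrier (fmod B)" "c \<in> carrier R" "\<And>k. v k w \<in> carrier R"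
 shows "free_value v (\<lambda>k. c \<otimes> u k) w = c \<otimes> free_value v u w"
proof -
 let ?S = "{k. u k \<noteq> \<zero>}"
 have fin: "finite ?S" and u: "u k \<in> carrier R" for k
  using assms(1) free_module_closed[OF assms(1)] by (simp_all add: free_module_carrier')
 have "free_value v (\<lambda>k. c \<otimes> u k) w = (\<Oplus>k\<in>?S. (c \<otimes> u k) \<otimes> v k w)"
  by (rule free_value_superset[OF fin]) (use u assms in auto)
 also have "\<dots> = (\<Oplus>k\<in>?S. c \<otimes> (u k \<otimes> v k w))"
  using u assms by (intro finsum_cong') (auto simp: m_assoc)
 also have "\<dots> = c \<otimes> free_value v u w"
  unfolding free_value_def using u assms fin by (intro finsum_rdistr[symmetric]) auto
 finally show ?thesis .
qed

lemma free_value_basis: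
 assumes "\<And>k. v k w \<in> carrier R"
 shows "free_value v (bas k) w = v k w"
proof -
 have "free_value v (bas k) w = (\<Oplus>l\<in>{k}. bas k l \<otimes> v l w)"
  by (rule free_value_superset) (use assms in \<open>auto simp: basis_vec_def split: if_splits\<close>)
 then show ?thesis using assms by (simp add: basis_vec_def)
qed

lemma free_module_induct [consumes 1, case_names zero add basis]:
 assumes "u \<in> carrier (fmod B)"
  and zero: "Q (\<lambda>_. \<zero>)"
  and add: "\<And>u u'. [|u \<in> carrier (fmod B); u' \<in> carrier (fmod B); Q u; Q u'|] ==> Q (\<lambda>k. u k \<oplus> u' k)"
  and basis: "\<And>c k. [|c \<in> carrier R; k \<in> B|] ==> Q (\<lambda>l. c \<otimes> bas k l)"
 shows "Q u"
proof -
 have "\<forall>u. u \<in> carrier (fmod B) \<and> {k. u k \<noteq> \<zero>} = S --> Q u" if "finite S" for S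
  using that
 proof (induction S)
  case empty
  show ?case
  proof (intro allI impI)
   fix u assume "u \<in> carrier (fmod B) \<and> {k. u k \<noteq> \<zero>} = {}"
   then have "u = (\<lambda>_. \<zero>)" by auto
   then show "Q u" using zero by simp
  qed
 next
  case (insert k S)
  show ?case
  proof (intro allI impI)
   fix u assume u: "u \<in> carrier (fmod B) \<and> {k. u k \<noteq> \<zero>} = insert k S"
   have uR: "u l \<in> carrier R" for l using u by (auto simp: free_module_carrier')
   let ?w = "u(k := \<zero>)"
   have supp: "{l. ?w l \<noteq> \<zero>} = S" using u insert(2) by auto
   have w: "?w \<in> carrier (fmod B)"
    using u insert(1) supp by (auto simp: free_module_carrier')
   have k: "k \<in> B" using u by (auto simp: free_module_carrier')
   interpret F: module R "fmod B" by (rule free_module_module)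
   have e: "(\<lambda>l. u k \<otimes> bas k l) \<in> carrier (fmod B)"
    using F.smult_closed[OF uR[of k] basis_vec_in[OF k]] by (simp add: free_module_simps)
   have "Q ?w" using insert.IH w supp by blast
   then have "Q (\<lambda>l. ?w l \<oplus> u k \<otimes> bas k l)" by (rule add[OF w e _ basis[OF uR k]])
   moreover have "(\<lambda>l. ?w l \<oplus> u k \<otimes> bas k l) = u"
    using uR by (auto simp: basis_vec_def)
   ultimately show "Q u" by simp
  qed
 qed
 then show ?thesis using assms(1) by (auto simp: free_module_carrier')
qed

text \<open>The relation \<open>P\<close> stands for a surjection of representations onto \<open>M\<close>, whose source consists of
 functions on a set with an action \<open>t\<close> of the symmetric group.\<close>

lemma projective_lifting:
 fixes P :: "'c => ('w => 'a) => bool" and t :: "(nat => nat) => 'w => 'w"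
 assumes proj: "projective_rep R j M act" and M: "module R M"
  and total: "\<And>x. x \<in> carrier M ==> \<exists>f. P x f"
  and closed: "\<And>x f. P x f ==> range f \<subseteq> carrier R"
  and P_zero: "P \<zero>\<^bsub>M\<^esub> (\<lambda>_. \<zero>)"
  and P_add: "\<And>x y f g. [|x \<in> carrier M; y \<in> carrier M; P x f; P y g|] ==> P (x \<oplus>\<^bsub>M\<^esub> y) (\<lambda>w. f w \<oplus> g w)"
  and P_smult: "\<And>c x f. [|c \<in> carrier R; x \<in> carrier M; P x f|] ==> P (c \<odot>\<^bsub>M\<^esub> x) (\<lambda>w. c \<otimes> f w)"
  and P_act: "\<And>\<sigma> x f. [|\<sigma> permutes {1..j}; x \<in> carrier M; P x f|] ==> P (act \<sigma> x) (\<lambda>w. f (t \<sigma> w))"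
  and t: "\<And>\<sigma> \<tau> w. [|\<sigma> permutes {1..j}; \<tau> permutes {1..j}|] ==> t (\<sigma> \<circ> \<tau>) w = t \<tau> (t \<sigma> w)"
 shows "\<exists>g. (\<forall>x\<in>carrier M. P x (g x)) \<and>
  (\<forall>x\<in>carrier M. \<forall>y\<in>carrier M. g (x \<oplus>\<^bsub>M\<^esub> y) = (\<lambda>w. g x w \<oplus> g y w)) \<and>
  (\<forall>c\<in>carrier R. \<forall>x\<in>carrier M. g (c \<odot>\<^bsub>M\<^esub> x) = (\<lambda>w. c \<otimes> g x w)) \<and>
  (\<forall>\<sigma>. \<sigma> permutes {1..j} --> (\<forall>x\<in>carrier M. g (act \<sigma> x) = (\<lambda>w. g x (t \<sigma> w))))"
proof -
 interpret M: module R M by (rule M)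
 obtain B :: "'c set" and \<iota> \<pi>
  where \<iota>: "\<iota> \<in> carrier (rep_hom R j M act (free_rep R j B) free_rep_act)"
   and \<pi>: "\<pi> \<in> carrier (rep_hom R j (free_rep R j B) free_rep_act M act)"
   and split: "\<And>x. x \<in> carrier M ==> \<pi> (\<iota> x) = x"
  using proj unfolding projective_rep_def by blast
 let ?K = "{\<pi>. \<pi> permutes {1..j}} \<times> B"
 let ?F = "fmod ?K"
 have fr: "free_rep R j B = ?F" by (simp add: free_rep_def)
 have \<iota>h: "\<iota> \<in> lin_hom R M ?F" and \<pi>h: "\<pi> \<in> lin_hom R ?F M"
  using \<iota> \<pi> by (simp_all add: rep_hom_def fr)
 have \<iota>e: "\<iota> (act \<sigma> x) = free_rep_act \<sigma> (\<iota> x)" if "\<sigma> permutes {1..j}" "x \<in> carrier M" for \<sigma> x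
  using \<iota> that by (simp add: rep_hom_def)
 have \<pi>e: "\<pi> (free_rep_act \<sigma> u) = act \<sigma> (\<pi> u)" if "\<sigma> permutes {1..j}" "u \<in> carrier ?F" for \<sigma> u
  using \<pi> that by (simp add: rep_hom_def fr)
 interpret F: module R ?F by (rule free_module_module)
 define e where "e b = bas (id :: nat => nat, b :: 'c)" for b
 have e_in: "e b \<in> carrier ?F" if "b \<in> B" for b
  using that unfolding e_def by (intro basis_vec_in) (simp add: permutes_id)
 define a where "a b = (SOME f. P (\<pi> (e b)) f)" for b
 have a: "P (\<pi> (e b)) (a b)" if "b \<in> B" for b
  unfolding a_def by (rule someI_ex[OF total[OF lin_homD(1)[OF \<pi>h e_in[OF that]]]])
 define v where "v k w = (if k \<in> ?K then a (snd k) (t (fst k) w) else \<zero>)" for k w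
 have vR: "v k w \<in> carrier R" for k w
 proof (cases "k \<in> ?K")
  case True
  then have "snd k \<in> B" by auto
  from closed[OF a[OF this]] show ?thesis using True by (auto simp: v_def)
 qed (simp add: v_def)
 have Pv: "P (\<pi> (bas k)) (v k)" if k: "k \<in> ?K" for k
 proof -
  obtain \<sigma> b where \<sigma>: "k = (\<sigma>, b)" "\<sigma> permutes {1..j}" "b \<in> B" using k by auto
  have "free_rep_act \<sigma> (e b) = bas k"
  proof
   fix l :: "(nat => nat) \<times> 'c"
   obtain \<rho> c where l: "l = (\<rho>, c)" by (cases l)
   have "inv_into UNIV \<sigma> \<circ> \<rho> = id \<longleftrightarrow> \<rho> = \<sigma>"
   proof
    assume "inv_into UNIV \<sigma> \<circ> \<rho> = id"
    then have "\<sigma> \<circ> (inv_into UNIV \<sigma> \<circ> \<rho>) = \<sigma>" by simp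
    then show "\<rho> = \<sigma>" by (simp add: o_assoc permutes_inv_o(1)[OF \<sigma>(2)])
   qed (simp add: permutes_inv_o(2)[OF \<sigma>(2)])
   then show "free_rep_act \<sigma> (e b) l = bas k l"
    by (simp add: l free_rep_act_def e_def basis_vec_def \<sigma>(1))
  qed
  then have "\<pi> (bas k) = act \<sigma> (\<pi> (e b))" using \<pi>e[OF \<sigma>(2) e_in[OF \<sigma>(3)]] by simp
  moreover have "v k = (\<lambda>w. a b (t \<sigma> w))" using k by (auto simp: v_def \<sigma>(1))
  ultimately show ?thesis using P_act[OF \<sigma>(2) lin_homD(1)[OF \<pi>h e_in[OF \<sigma>(3)]] a[OF \<sigma>(3)]] by simp
 qed
 have P_free: "P (\<pi> u) (free_value v u)" if "u \<in> carrier ?F" for u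
  using that
 proof (induction rule: free_module_induct)
  case zero
  have "\<pi> (\<lambda>_. \<zero>) = \<zero>\<^bsub>M\<^esub>"
   using lin_hom_zero[OF F.module_axioms M \<pi>h] by (simp add: free_module_simps)
  moreover have "free_value v (\<lambda>_. \<zero>) = (\<lambda>_. \<zero>)" by (simp add: free_value_def fun_eq_iff)
  ultimately show ?case using P_zero by simp
 next
  case (add u u')
  have "\<pi> (\<lambda>k. u k \<oplus> u' k) = \<pi> u \<oplus>\<^bsub>M\<^esub> \<pi> u'"
   using lin_homD(2)[OF \<pi>h add(1,2)] by (simp add: free_module_simps)
  moreover have "free_value v (\<lambda>k. u k \<oplus> u' k) = (\<lambda>w. free_value v u w \<oplus> free_value v u' w)"
   by (intro ext, rule free_value_add[OF add(1,2)], rule vR)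
  ultimately show ?case
   using P_add[OF lin_homD(1)[OF \<pi>h add(1)] lin_homD(1)[OF \<pi>h add(2)] add(3,4)] by simp
 next
  case (basis c k)
  have "\<pi> (\<lambda>l. c \<otimes> bas k l) = c \<odot>\<^bsub>M\<^esub> \<pi> (bas k)"
   using lin_homD(3)[OF \<pi>h basis(1) basis_vec_in[OF basis(2)]] by (simp add: free_module_simps)
  moreover have "free_value v (\<lambda>l. c \<otimes> bas k l) = (\<lambda>w. c \<otimes> v k w)"
  proof
   fix w
   have "free_value v (\<lambda>l. c \<otimes> bas k l) w = c \<otimes> free_value v (bas k) w"
    by (rule free_value_smult[OF basis_vec_in[OF basis(2)] basis(1)]) (rule vR)
   also have "free_value v (bas k) w = v k w" by (rule free_value_basis) (rule vR)
   finally show "free_value v (\<lambda>l. c \<otimes> bas k l) w = c \<otimes> v k w" .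
  qed
  ultimately show ?case
   using P_smult[OF basis(1) lin_homD(1)[OF \<pi>h basis_vec_in[OF basis(2)]] Pv[OF basis(2)]] by simp
 qed
 have equivariant: "free_value v (free_rep_act \<sigma> u) w = free_value v u (t \<sigma> w)"
  if \<sigma>: "\<sigma> permutes {1..j}" and u: "u \<in> carrier ?F" for \<sigma> u w
 proof -
  let ?h = "\<lambda>k :: (nat => nat) \<times> 'c. (\<sigma> \<circ> fst k, snd k)"
  have inv: "inv_into UNIV \<sigma> \<circ> (\<sigma> \<circ> \<rho>) = \<rho>" "\<sigma> \<circ> (inv_into UNIV \<sigma> \<circ> \<rho>) = \<rho>" for \<rho> :: "nat => nat"
   by (simp_all add: o_assoc permutes_inv_o[OF \<sigma>])
  have act: "free_rep_act \<sigma> u (?h k) = u k" for k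
   by (simp add: free_rep_act_def inv)
  have supp: "{k. free_rep_act \<sigma> u k \<noteq> \<zero>} = ?h ` {k. u k \<noteq> \<zero>}"
  proof (intro equalityI subsetI)
   fix k assume "k \<in> {k. free_rep_act \<sigma> u k \<noteq> \<zero>}"
   then have "u (inv_into UNIV \<sigma> \<circ> fst k, snd k) \<noteq> \<zero>" by (simp add: free_rep_act_def split_def)
   moreover have "k = ?h (inv_into UNIV \<sigma> \<circ> fst k, snd k)" by (simp add: inv)
   ultimately show "k \<in> ?h ` {k. u k \<noteq> \<zero>}" by blast
  qed (use act in force)
  have inj: "inj_on ?h {k. u k \<noteq> \<zero>}"
  proof (rule inj_onI)
   fix k l assume "?h k = ?h l"
   then have "inv_into UNIV \<sigma> \<circ> (\<sigma> \<circ> fst k) = inv_into UNIV \<sigma> \<circ> (\<sigma> \<circ> fst l)" "snd k = snd l" by auto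
   then show "k = l" unfolding inv by (simp add: prod_eq_iff)
  qed
  have uR: "u k \<in> carrier R" for k using u by (rule free_module_closed)
  have "free_value v (free_rep_act \<sigma> u) w = (\<Oplus>k\<in>{k. u k \<noteq> \<zero>}. free_rep_act \<sigma> u (?h k) \<otimes> v (?h k) w)"
   unfolding free_value_def supp by (rule finsum_reindex[OF _ inj]) (auto simp only: act intro!: m_closed uR vR)
  also have "\<dots> = (\<Oplus>k\<in>{k. u k \<noteq> \<zero>}. u k \<otimes> v k (t \<sigma> w))"
  proof (rule finsum_cong')
   fix k assume "k \<in> {k. u k \<noteq> \<zero>}"
   then have k: "k \<in> ?K" using free_module_outside[OF u, of k] by blast
   then have "?h k \<in> ?K" using permutes_compose[OF _ \<sigma>] by auto
   then have "v (?h k) w = v k (t \<sigma> w)" using k t[OF \<sigma>, of "fst k" w] by (auto simp: v_def)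
   then show "free_rep_act \<sigma> u (?h k) \<otimes> v (?h k) w = u k \<otimes> v k (t \<sigma> w)" unfolding act by simp
  qed (use uR vR in auto)
  finally show ?thesis by (simp add: free_value_def)
 qed
 show ?thesis
 proof (intro exI[of _ "\<lambda>x. free_value v (\<iota> x)"] conjI ballI allI impI)
  fix x assume x: "x \<in> carrier M"
  note \<iota>x = lin_homD(1)[OF \<iota>h x]
  show "P x (free_value v (\<iota> x))" using P_free[OF \<iota>x] split[OF x] by simp
  show "free_value v (\<iota> (x \<oplus>\<^bsub>M\<^esub> y)) = (\<lambda>w. free_value v (\<iota> x) w \<oplus> free_value v (\<iota> y) w)"
   if y: "y \<in> carrier M" for y
  proof
   fix w
   have "\<iota> (x \<oplus>\<^bsub>M\<^esub> y) = (\<lambda>k. \<iota> x k \<oplus> \<iota> y k)"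
    using lin_homD(2)[OF \<iota>h x y] by (simp add: free_module_simps)
   then show "free_value v (\<iota> (x \<oplus>\<^bsub>M\<^esub> y)) w = free_value v (\<iota> x) w \<oplus> free_value v (\<iota> y) w"
    using free_value_add[OF \<iota>x lin_homD(1)[OF \<iota>h y], of v w] vR by simp
  qed
  show "free_value v (\<iota> (c \<odot>\<^bsub>M\<^esub> x)) = (\<lambda>w. c \<otimes> free_value v (\<iota> x) w)" if c: "c \<in> carrier R" for c
  proof
   fix w
   have "\<iota> (c \<odot>\<^bsub>M\<^esub> x) = (\<lambda>k. c \<otimes> \<iota> x k)"
    using lin_homD(3)[OF \<iota>h c x] by (simp add: free_module_simps)
   then show "free_value v (\<iota> (c \<odot>\<^bsub>M\<^esub> x)) w = c \<otimes> free_value v (\<iota> x) w"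
    using free_value_smult[OF \<iota>x c, of v w] vR by simp
  qed
  show "free_value v (\<iota> (act \<sigma> x)) = (\<lambda>w. free_value v (\<iota> x) (t \<sigma> w))" if \<sigma>: "\<sigma> permutes {1..j}" for \<sigma>
   using equivariant[OF \<sigma> \<iota>x] \<iota>e[OF \<sigma> x] by (intro ext) simp
 qed
qed

end

context exp_bicomodule
begin

text \<open>A cochain is determined by its values on the sets \<open>{1..m}\<close>, where any equivariant linear map is
 allowed.\<close>

lemma cochain_extension:
 assumes closed: "\<And>z. z \<in> carrier (XV {1..m}) ==> g z \<in> carrier (fmod (decomps n {1..m}))"
  and add: "\<And>z w. [|z \<in> carrier (XV {1..m}); w \<in> carrier (XV {1..m})|] ==>
   g (z \<oplus>\<^bsub>XV {1..m}\<^esub> w) = (\<lambda>F. g z F \<oplus> g w F)"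
  and smult: "\<And>c z. [|c \<in> carrier R; z \<in> carrier (XV {1..m})|] ==>
   g (c \<odot>\<^bsub>XV {1..m}\<^esub> z) = (\<lambda>F. c \<otimes> g z F)"
  and map: "\<And>\<sigma> z. [|\<sigma> permutes {1..m}; z \<in> carrier (XV {1..m})|] ==>
   g (sp_map X {1..m} \<sigma> z) = (\<lambda>F. g z (unperm \<sigma> F))"
 shows "\<exists>\<beta>\<in>carrier (Coch n).
  (\<forall>z\<in>carrier (XV {1..m}). \<beta> {1..m} z = g z) \<and>
  (\<forall>I z F. finite I \<and> card I \<noteq> m \<and> z \<in> carrier (XV I) --> \<beta> I z F = \<zero>)"
proof -
 let ?N = "{1..m}"
 define \<kappa> where "\<kappa> I = (SOME f. bij_betw f I ?N)" for I :: "nat set"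
 have \<kappa>: "bij_betw (\<kappa> I) I ?N" if "finite I" "card I = m" for I
  unfolding \<kappa>_def
  by (rule someI_ex[of "\<lambda>f. bij_betw f I ?N"], rule finite_same_card_bij) (use that in auto)
 have indep: "g (sp_map X I \<kappa>1 z) (map (image \<kappa>1) F) = g (sp_map X I \<kappa>2 z) (map (image \<kappa>2) F)"
  if b1: "bij_betw \<kappa>1 I ?N" and b2: "bij_betw \<kappa>2 I ?N" and I: "finite I" "z \<in> carrier (XV I)"
   and F: "F \<in> decomps n I" for \<kappa>1 \<kappa>2 I z F
 proof -
  \<comment> \<open>the two identifications of \<open>I\<close> with \<open>{1..m}\<close> differ by a permutation, which \<open>g\<close> respects\<close>
  define \<rho> where "\<rho> i = (if i \<in> ?N then \<kappa>1 (inv_into I \<kappa>2 i) else i)" for i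
  have inj: "inj_on \<kappa>1 I" "inj_on \<kappa>2 I" and im: "\<kappa>1 ` I = ?N" "\<kappa>2 ` I = ?N"
   using b1 b2 by (auto simp: bij_betw_def)
  have "bij_betw \<rho> ?N ?N"
  proof -
   have "bij_betw (\<kappa>1 \<circ> inv_into I \<kappa>2) ?N ?N"
    by (rule bij_betw_trans[OF bij_betw_inv_into[OF b2] b1])
   then show ?thesis by (rule bij_betw_cong[THEN iffD1, rotated]) (simp add: \<rho>_def)
  qed
  then have \<rho>: "\<rho> permutes ?N" by (rule bij_imp_permutes) (auto simp: \<rho>_def)
  have comp: "\<rho> (\<kappa>2 i) = \<kappa>1 i" if "i \<in> I" for i
  proof -
   have "\<kappa>2 i \<in> ?N" using that im(2) by blast
   then show ?thesis using that inj(2) by (simp add: \<rho>_def)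
  qed
  have inj\<rho>: "inj_on \<rho> ?N" using \<rho> by (simp add: permutes_inj_on)
  have z2: "sp_map X I \<kappa>2 z \<in> carrier (XV ?N)" using carrier_map[OF I(1) inj(2) I(2)] im(2) by simp
  have "sp_map X I \<kappa>1 z = sp_map X I (\<rho> \<circ> \<kappa>2) z"
   using map_cong[OF I(1) inj(1), of "\<rho> \<circ> \<kappa>2"] comp by simp
  also have "\<dots> = sp_map X ?N \<rho> (sp_map X I \<kappa>2 z)"
   using map_comp[OF I(1) inj(2) _ I(2), of \<rho>] inj\<rho> im(2) by simp
  finally have z1: "sp_map X I \<kappa>1 z = sp_map X ?N \<rho> (sp_map X I \<kappa>2 z)" .
  have "map (image (inv_into UNIV \<rho>)) (map (image \<kappa>1) F) = map (image \<kappa>2) F"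
  proof -
   have "inv_into UNIV \<rho> ` \<kappa>1 ` A = \<kappa>2 ` A" if "A \<in> set F" for A
   proof -
    have "A \<subseteq> I" using F that by (rule decomps_block_subset)
    then have "inv_into UNIV \<rho> (\<kappa>1 i) = \<kappa>2 i" if "i \<in> A" for i
     using comp[of i] that permutes_inverses(2)[OF \<rho>, of "\<kappa>2 i"] by auto
    then show ?thesis by (auto simp: image_image)
   qed
   then show ?thesis by simp
  qed
  then show ?thesis unfolding z1 map[OF \<rho> z2] by (rule arg_cong)
 qed
 define h where "h I z F = (if card I = m \<and> F \<in> decomps n I
  then g (sp_map X I (\<kappa> I) z) (map (image (\<kappa> I)) F) else \<zero>)" for I z F
 have in_N: "sp_map X I (\<kappa> I) z \<in> carrier (XV ?N)" if "finite I" "card I = m" "z \<in> carrier (XV I)" for I z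
  using carrier_map[OF that(1) _ that(3), of "\<kappa> I"] \<kappa>[OF that(1,2)] by (simp add: bij_betw_def)
 have lin: "sp_map X I (\<kappa> I) \<in> lin_hom R (XV I) (XV ?N)" if "finite I" "card I = m" for I
  using map_hom[OF that(1), of "\<kappa> I"] \<kappa>[OF that] by (simp add: bij_betw_def)
 let ?\<beta> = "\<lambda>I\<in>{I. finite I}. \<lambda>z\<in>carrier (XV I). h I z"
 have "?\<beta> \<in> carrier (Coch n)"
 proof (rule cochainI)
  fix I z F assume I: "finite I" "z \<in> carrier (XV I)"
  show "h I z F \<in> carrier R"
   using free_module_closed[OF closed[OF in_N[OF I(1) _ I(2)]]] by (simp add: h_def)
  show "h I z F = \<zero>" if "F \<notin> decomps n I" using that by (simp add: h_def)
  show "h I (z \<oplus>\<^bsub>XV I\<^esub> w) F = h I z F \<oplus> h I w F" if "w \<in> carrier (XV I)" for w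
   using lin_homD(2)[OF lin[OF I(1)] I(2) that] add[OF in_N[OF I(1) _ I(2)] in_N[OF I(1) _ that]]
   by (simp add: h_def)
  show "h I (c \<odot>\<^bsub>XV I\<^esub> z) F = c \<otimes> h I z F" if "c \<in> carrier R" for c
   using lin_homD(3)[OF lin[OF I(1)] that I(2)] smult[OF that in_N[OF I(1) _ I(2)]] that
   by (simp add: h_def)
  show "h (\<sigma> ` I) (sp_map X I \<sigma> z) (map (image \<sigma>) F) = h I z F"
   if \<sigma>: "inj_on \<sigma> I" and F: "F \<in> decomps n I" for \<sigma>
  proof (cases "card I = m")
   case True
   have J: "finite (\<sigma> ` I)" "card (\<sigma> ` I) = m" using I(1) True card_image[OF \<sigma>] by auto
   have bJ: "bij_betw (\<kappa> (\<sigma> ` I)) (\<sigma> ` I) ?N" by (rule \<kappa>[OF J])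
   then have bc: "bij_betw (\<kappa> (\<sigma> ` I) \<circ> \<sigma>) I ?N"
    by (rule bij_betw_trans[rotated]) (simp add: bij_betw_def \<sigma>)
   have "sp_map X (\<sigma> ` I) (\<kappa> (\<sigma> ` I)) (sp_map X I \<sigma> z) = sp_map X I (\<kappa> (\<sigma> ` I) \<circ> \<sigma>) z"
    using map_comp[OF I(1) \<sigma> _ I(2), of "\<kappa> (\<sigma> ` I)"] bJ by (simp add: bij_betw_def)
   then show ?thesis
    using indep[OF bc \<kappa>[OF I(1) True] I F] J True F relabel_decomps[OF \<sigma> F]
    by (simp add: h_def image_comp comp_def)
  qed (use card_image[OF \<sigma>] in \<open>simp add: h_def\<close>)
 qed
 moreover have "?\<beta> ?N z = g z" if z: "z \<in> carrier (XV ?N)" for z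
 proof
  fix F
  show "?\<beta> ?N z F = g z F"
  proof (cases "F \<in> decomps n ?N")
   case True
   have "bij_betw id ?N ?N" by simp
   from indep[OF \<kappa>[of ?N] this _ z True] show ?thesis
    using z True map_id[of ?N z] by (simp add: h_def)
  next
   case False
   then show ?thesis using z free_module_outside[OF closed[OF z]] by (simp add: h_def)
  qed
 qed
 moreover have "\<forall>I z F. finite I \<and> card I \<noteq> m \<and> z \<in> carrier (XV I) --> ?\<beta> I z F = \<zero>"
  by (simp add: h_def)
 ultimately show ?thesis by blast
qed

end

section \<open>Surjectivity of the comparison map\<close>

lemma permuted_inverse:
 assumes "\<sigma> permutes I"
 shows "map (image \<sigma>) (map (image (inv_into UNIV \<sigma>)) F) = F"
  and "map (image (inv_into UNIV \<sigma>)) (map (image \<sigma>) F) = F"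
 by (simp_all add: comp_def image_image permutes_inverses[OF assms])

lemma permuted_decomps:
 assumes "\<sigma> permutes I"
 shows "map (image (inv_into UNIV \<sigma>)) F \<in> decomps n I \<longleftrightarrow> F \<in> decomps n I"
  and "map (image (inv_into UNIV \<sigma>)) F \<in> compositions I \<longleftrightarrow> F \<in> compositions I"
proof -
 note inj = permutes_inj_on[OF assms] permutes_inj_on[OF permutes_inv[OF assms]]
 note im = permutes_image[OF assms] permutes_image[OF permutes_inv[OF assms]]
 show "map (image (inv_into UNIV \<sigma>)) F \<in> decomps n I \<longleftrightarrow> F \<in> decomps n I"
  using relabel_decomps[OF inj(1)[of I], of "map (image (inv_into UNIV \<sigma>)) F" n]
   relabel_decomps[OF inj(2)[of I], of F n] im permuted_inverse(1)[OF assms, of F] by auto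
 show "map (image (inv_into UNIV \<sigma>)) F \<in> compositions I \<longleftrightarrow> F \<in> compositions I"
  using relabel_compositions[OF inj(1)[of I], of "map (image (inv_into UNIV \<sigma>)) F"]
   relabel_compositions[OF inj(2)[of I], of F] im permuted_inverse(1)[OF assms, of F] by auto
qed

lemma permuted_positions:
 assumes "\<sigma> permutes I"
 shows "p \<circ> \<sigma> \<in> positions n I \<longleftrightarrow> p \<in> positions n I"
  and "blocks n (p \<circ> \<sigma>) = map (image (inv_into UNIV \<sigma>)) (blocks n p)"
  and "(\<forall>x. x \<notin> I --> (p \<circ> \<sigma>) x = (0 :: nat)) \<longleftrightarrow> (\<forall>x. x \<notin> I --> p x = 0)"
proof -
 have m: "\<sigma> x \<in> I \<longleftrightarrow> x \<in> I" for x by (rule permutes_in_image[OF assms])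
 have all: "(\<forall>x. Q (\<sigma> x)) \<longleftrightarrow> (\<forall>x. Q x)" for Q
  using permutes_surj[OF assms] by (metis surjD)
 show "p \<circ> \<sigma> \<in> positions n I \<longleftrightarrow> p \<in> positions n I"
  unfolding positions_def
  using all[of "\<lambda>x. if x \<in> I then 1 \<le> p x \<and> p x \<le> n else p x = 0"] by (simp only: m comp_apply mem_Collect_eq)
 show "(\<forall>x. x \<notin> I --> (p \<circ> \<sigma>) x = 0) \<longleftrightarrow> (\<forall>x. x \<notin> I --> p x = 0)"
  using all[of "\<lambda>x. x \<notin> I --> p x = 0"] by (simp add: m)
 have "{x. p (\<sigma> x) = k} = inv_into UNIV \<sigma> ` {x. p x = k}" for k
 proof (intro equalityI subsetI)
  fix x assume "x \<in> {x. p (\<sigma> x) = k}"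
  then show "x \<in> inv_into UNIV \<sigma> ` {x. p x = k}"
   by (intro image_eqI[of _ _ "\<sigma> x"]) (simp_all add: permutes_inverses[OF assms])
 qed (auto simp: permutes_inverses[OF assms])
 then show "blocks n (p \<circ> \<sigma>) = map (image (inv_into UNIV \<sigma>)) (blocks n p)"
  by (simp add: blocks_def)
qed

context cring
begin

lemma relabel_permutation:
 assumes I: "finite I" and \<sigma>: "\<sigma> permutes I" and f: "f \<in> carrier (omega R I m)"
 shows "relabel \<sigma> I f = (\<lambda>F. f (unperm \<sigma> F))"
proof
 fix F
 have inj: "inj_on \<sigma> I" by (rule permutes_inj_on[OF \<sigma>])
 show "relabel \<sigma> I f F = f (unperm \<sigma> F)"
 proof (cases "F \<in> compositions I")
  case True
  then show ?thesis
   using relabel_apply[OF I inj f, of "unperm \<sigma> F"] permuted_decomps(2)[OF \<sigma>]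
    permuted_inverse(1)[OF \<sigma>, of F] by simp
 next
  case False
  have "relabel \<sigma> I f \<in> carrier (omega R I m)"
   using relabel_closed[OF I inj f] permutes_image[OF \<sigma>] by simp
  then show ?thesis
   using omegaD(2)[OF I _ False] omegaD(2)[OF I f] permuted_decomps(2)[OF \<sigma>] False by simp
 qed
qed

lemma positional_permutation:
 assumes "\<sigma> permutes I"
 shows "positional n I (\<lambda>F. a (unperm \<sigma> F)) p = positional n I a (p \<circ> \<sigma>)"
  and "local_diff I n (positional n I (\<lambda>F. a (unperm \<sigma> F))) p =
   local_diff I n (positional n I a) (p \<circ> \<sigma>)"
proof -
 show pos: "positional n I (\<lambda>F. a (unperm \<sigma> F)) p = positional n I a (p \<circ> \<sigma>)" for p
  by (simp add: positional_def permuted_positions[OF assms])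
 show "local_diff I n (positional n I (\<lambda>F. a (unperm \<sigma> F))) p =
   local_diff I n (positional n I a) (p \<circ> \<sigma>)"
  unfolding local_diff_def permuted_positions(3)[OF assms] pos by (simp only: comp_assoc)
qed

lemma top_part_permutation:
 assumes I: "finite I" and \<sigma>: "\<sigma> permutes I" and a: "range a \<subseteq> carrier R"
  and top: "top_part n I a \<in> cobd I 0"
 shows "top_part n I (\<lambda>F. a (unperm \<sigma> F)) \<in> cobd I 0"
proof -
 have inj: "inj_on \<sigma> I" by (rule permutes_inj_on[OF \<sigma>])
 have t: "top_part n I a \<in> carrier (omega R I 0)" using a by (intro top_part_closed[OF I]) auto
 obtain h where h: "h \<in> carrier (omega R I (0 - 1))" "top_part n I a = omega_diff R I h"
  using top by (auto simp: omega_coboundaries_def)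
 have "top_part n I (\<lambda>F. a (unperm \<sigma> F)) = relabel \<sigma> I (top_part n I a)"
  unfolding relabel_permutation[OF I \<sigma> t] by (auto simp: top_part_def permuted_decomps[OF \<sigma>])
 also have "\<dots> = omega_diff R I (relabel \<sigma> I h)"
  unfolding h(2) using relabel_diff[OF I inj h(1)] permutes_image[OF \<sigma>] by simp
 finally show ?thesis
  using relabel_closed[OF I inj h(1)] permutes_image[OF \<sigma>] by (simp add: omega_coboundaries_def)
qed

lemma positional_cancel:
 assumes "a \<in> carrier (fmod (decomps n I))" "b \<in> carrier (fmod (decomps n I))"
  and "positional n I a = positional n I b"
 shows "a = b"
proof
 fix F
 show "a F = b F"
 proof (cases "F \<in> decomps n I")
  case True
  show ?thesis
   using fun_cong[OF assms(3), of "position_of F"] position_of_in_positions[OF True] blocks_position_of[OF True]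
   by (simp add: positional_def)
 next
  case False
  then show ?thesis using free_module_outside[OF assms(1)] free_module_outside[OF assms(2)] by simp
 qed
qed

end

context exp_bicomodule
begin

\<comment> \<open>keeps the sets \<open>{1..m}\<close> in this form\<close>
declare One_nat_def [simp del]

text \<open>Every set with \<open>m\<close> elements is the image of \<open>{1..m}\<close> under a bijection, so naturality carries the
 equality over.\<close>

lemma species_hom_agree:
 assumes f: "f \<in> carrier (species_hom R X Y)" and g: "g \<in> carrier (species_hom R X Y)"
  and agree: "\<And>w. w \<in> carrier (XV {1..m}) ==> f {1..m} w = g {1..m} w"
  and I: "finite I" "card I = m" "z \<in> carrier (XV I)"
 shows "f I z = g I z"
proof -
 let ?N = "{1..m}"
 obtain \<kappa> where \<kappa>: "bij_betw \<kappa> ?N I"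
  using finite_same_card_bij[of ?N I] I by auto
 have inj: "inj_on \<kappa> ?N" and im: "\<kappa> ` ?N = I" using \<kappa> by (auto simp: bij_betw_def)
 let ?\<iota> = "inv_into ?N \<kappa>"
 have inj': "inj_on ?\<iota> I" and im': "?\<iota> ` I = ?N"
  using bij_betw_inv_into[OF \<kappa>] by (auto simp: bij_betw_def)
 let ?w = "sp_map X I ?\<iota> z"
 have w: "?w \<in> carrier (XV ?N)" using carrier_map[OF I(1) inj' I(3)] im' by simp
 have "sp_map X ?N \<kappa> ?w = sp_map X I (\<kappa> \<circ> ?\<iota>) z"
  using map_comp[OF I(1) inj' _ I(3), of \<kappa>] inj im' by simp
 also have "\<dots> = sp_map X I id z"
 proof -
  have "(\<kappa> \<circ> ?\<iota>) i = id i" if "i \<in> I" for i using that im by (simp add: f_inv_into_f)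
  moreover have "inj_on (\<kappa> \<circ> ?\<iota>) I" using inj inj' im' by (intro comp_inj_on) auto
  ultimately show ?thesis using map_cong[OF I(1), of "\<kappa> \<circ> ?\<iota>" id] by simp
 qed
 also have "\<dots> = z" by (rule map_id[OF I(1,3)])
 finally have z: "sp_map X ?N \<kappa> ?w = z" .
 show ?thesis
  using species_homD(4)[OF f _ inj w] species_homD(4)[OF g _ inj w] agree[OF w] by (simp add: z im)
qed

text \<open>A linear equivariant condition \<open>P z (\<beta> z)\<close> that can be satisfied for every single \<open>z\<close> can be satisfied
 by a cochain. The two applications are representatives of given classes and primitives of given cocycles.\<close>

lemma lifted_cochain:
 assumes wp: "weakly_projective R X"
  and closed: "\<And>z f. P z f ==> f \<in> carrier (fmod (decomps n {1..m}))"
  and total: "\<And>z. z \<in> carrier (XV {1..m}) ==> \<exists>f. P z f"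
  and zero: "P \<zero>\<^bsub>XV {1..m}\<^esub> (\<lambda>_. \<zero>)"
  and add: "\<And>z w f g. [|z \<in> carrier (XV {1..m}); w \<in> carrier (XV {1..m}); P z f; P w g|] ==>
   P (z \<oplus>\<^bsub>XV {1..m}\<^esub> w) (\<lambda>F. f F \<oplus> g F)"
  and smult: "\<And>c z f. [|c \<in> carrier R; z \<in> carrier (XV {1..m}); P z f|] ==>
   P (c \<odot>\<^bsub>XV {1..m}\<^esub> z) (\<lambda>F. c \<otimes> f F)"
  and act: "\<And>\<sigma> z f. [|\<sigma> permutes {1..m}; z \<in> carrier (XV {1..m}); P z f|] ==>
   P (sp_map X {1..m} \<sigma> z) (\<lambda>F. f (unperm \<sigma> F))"
 shows "\<exists>\<beta>\<in>carrier (Coch n).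
  (\<forall>z\<in>carrier (XV {1..m}). P z (\<beta> {1..m} z)) \<and>
  (\<forall>I z F. finite I \<and> card I \<noteq> m \<and> z \<in> carrier (XV I) --> \<beta> I z F = \<zero>)"
proof -
 let ?M = "XV {1..m}" and ?t = "\<lambda>\<sigma>. unperm \<sigma>"
 have M: "module R ?M" by (rule val_module) simp
 have proj: "projective_rep R m ?M (sp_map X {1..m})"
  using wp unfolding weakly_projective_def by blast
 have t: "?t (\<sigma> \<circ> \<tau>) F = ?t \<tau> (?t \<sigma> F)" if "\<sigma> permutes {1..m}" "\<tau> permutes {1..m}"
  for \<sigma> \<tau> :: "nat => nat" and F
 proof -
  have "inv_into UNIV (\<sigma> \<circ> \<tau>) ` A = inv_into UNIV \<tau> ` inv_into UNIV \<sigma> ` A" for A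
   unfolding o_inv_distrib[OF permutes_bij[OF that(1)] permutes_bij[OF that(2)]] image_comp ..
  then have "image (inv_into UNIV (\<sigma> \<circ> \<tau>)) = image (inv_into UNIV \<tau>) \<circ> image (inv_into UNIV \<sigma>)"
   by (intro ext) (simp only: comp_apply)
  then show ?thesis by (simp only: list.map_comp)
 qed
 have range: "range f \<subseteq> carrier R" if "P z f" for z f
  by (rule free_module_range[OF closed[OF that]])
 have "\<exists>g. (\<forall>x\<in>carrier ?M. P x (g x)) \<and>
  (\<forall>x\<in>carrier ?M. \<forall>y\<in>carrier ?M. g (x \<oplus>\<^bsub>?M\<^esub> y) = (\<lambda>w. g x w \<oplus> g y w)) \<and>
  (\<forall>c\<in>carrier R. \<forall>x\<in>carrier ?M. g (c \<odot>\<^bsub>?M\<^esub> x) = (\<lambda>w. c \<otimes> g x w)) \<and>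
  (\<forall>\<sigma>. \<sigma> permutes {1..m} --> (\<forall>x\<in>carrier ?M. g (sp_map X {1..m} \<sigma> x) = (\<lambda>w. g x (?t \<sigma> w))))"
  by (rule projective_lifting[where P = P and t = ?t, OF proj M]) (fact total range zero add smult act t)+
 then obtain g where "\<forall>x\<in>carrier ?M. P x (g x)"
  "\<forall>x\<in>carrier ?M. \<forall>y\<in>carrier ?M. g (x \<oplus>\<^bsub>?M\<^esub> y) = (\<lambda>w. g x w \<oplus> g y w)"
  "\<forall>c\<in>carrier R. \<forall>x\<in>carrier ?M. g (c \<odot>\<^bsub>?M\<^esub> x) = (\<lambda>w. c \<otimes> g x w)"
  "\<forall>\<sigma>. \<sigma> permutes {1..m} --> (\<forall>x\<in>carrier ?M. g (sp_map X {1..m} \<sigma> x) = (\<lambda>w. g x (?t \<sigma> w)))"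
  by (elim exE conjE) (rule that)
 note g = this[rule_format]
 obtain \<beta> where \<beta>: "\<beta> \<in> carrier (Coch n)" "\<forall>z\<in>carrier ?M. \<beta> {1..m} z = g z"
  "\<forall>I z F. finite I \<and> card I \<noteq> m \<and> z \<in> carrier (XV I) --> \<beta> I z F = \<zero>"
  using cochain_extension[OF closed[OF g(1)] g(2-4)] by blast
 show ?thesis using \<beta> g(1) by (intro bexI[of _ \<beta>]) auto
qed

text \<open>Representatives of classes in \<open>E\<^sup>!\<close> can be chosen linearly and equivariantly, because the
 projection from \<open>\<Omega>(E)\<close> is a surjection of representations.\<close>

lemma class_lift:
 assumes wp: "weakly_projective R X"
  and closed: "\<And>z. z \<in> carrier (XV {1..p}) ==> k z \<in> carrier (Ed {1..p})"
  and add: "\<And>z w. [|z \<in> carrier (XV {1..p}); w \<in> carrier (XV {1..p})|] ==>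
   k (z \<oplus>\<^bsub>XV {1..p}\<^esub> w) = k z \<oplus>\<^bsub>Ed {1..p}\<^esub> k w"
  and smult: "\<And>c z. [|c \<in> carrier R; z \<in> carrier (XV {1..p})|] ==>
   k (c \<odot>\<^bsub>XV {1..p}\<^esub> z) = c \<odot>\<^bsub>Ed {1..p}\<^esub> k z"
  and act: "\<And>\<sigma> z. [|\<sigma> permutes {1..p}; z \<in> carrier (XV {1..p})|] ==>
   k (sp_map X {1..p} \<sigma> z) = sp_map (exp_dual R) {1..p} \<sigma> (k z)"
 shows "\<exists>\<alpha>\<in>carrier (Coch p). \<forall>z\<in>carrier (XV {1..p}). top_class p \<alpha> {1..p} z = k z"
proof -
 let ?N = "{1..p}"
 let ?M = "XV ?N"
 have N: "finite ?N" by simp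
 interpret M: module R ?M by (rule val_module[OF N])
 interpret W: module R "omega R ?N 0" by (rule omega_module)
 define P where "P z f \<longleftrightarrow> f \<in> carrier (omega R ?N 0) \<and> dcl ?N f = k z" for z f
 have "\<exists>\<beta>\<in>carrier (Coch p).
  (\<forall>z\<in>carrier ?M. P z (\<beta> ?N z)) \<and>
  (\<forall>I z F. finite I \<and> card I \<noteq> p \<and> z \<in> carrier (XV I) --> \<beta> I z F = \<zero>)"
 proof (rule lifted_cochain[OF wp])
  show "f \<in> carrier (fmod (decomps p ?N))" if "P z f" for z f
  proof -
   have f: "f \<in> carrier (omega R ?N 0)" using that by (simp add: P_def)
   have "f F = \<zero>" if "F \<notin> decomps p ?N" for F
    using omegaD(2)[OF N f, of F] omegaD(3)[OF N f, of F] that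
    by (cases "length F = p") (auto simp: composition_decomps)
   then show ?thesis unfolding free_module_carrier[OF finite_decomps[OF N]] using omegaD(1)[OF N f] by blast
  qed
  show "\<exists>f. P z f" if "z \<in> carrier ?M" for z
   using closed[OF that] unfolding exp_dual_simps(1)[OF N] P_def by auto
  show "P \<zero>\<^bsub>?M\<^esub> (\<lambda>_. \<zero>)"
  proof -
   have "k \<zero>\<^bsub>?M\<^esub> = \<zero>\<^bsub>Ed ?N\<^esub>"
    by (rule additive_map_zero[OF M.abelian_group_axioms _ closed add])
     (rule module.axioms(2)[OF exp_dual_simps(5)[OF N]])
   then show ?thesis using W.M.zero_closed by (simp add: P_def exp_dual_simps(2)[OF N] omega_simps)
  qed
  show "P (z \<oplus>\<^bsub>?M\<^esub> w) (\<lambda>F. f F \<oplus> g F)"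
   if "z \<in> carrier ?M" "w \<in> carrier ?M" "P z f" "P w g" for z w f g
   using that add[OF that(1,2)] exp_dual_simps(3)[OF N, of f g] W.M.a_closed[of f g]
   by (simp add: P_def omega_simps)
  show "P (c \<odot>\<^bsub>?M\<^esub> z) (\<lambda>F. c \<otimes> f F)" if "c \<in> carrier R" "z \<in> carrier ?M" "P z f" for c z f
   using that smult[OF that(1,2)] exp_dual_simps(4)[OF N, of f c] W.smult_closed[of c f]
   by (simp add: P_def omega_simps)
  show "P (sp_map X ?N \<sigma> z) (\<lambda>F. f (unperm \<sigma> F))"
   if \<sigma>: "\<sigma> permutes ?N" and z: "z \<in> carrier ?M" and f: "P z f" for \<sigma> z f
  proof -
   have f': "f \<in> carrier (omega R ?N 0)" and c: "dcl ?N f = k z" using f by (simp_all add: P_def)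
   have inj: "inj_on \<sigma> ?N" by (rule permutes_inj_on[OF \<sigma>])
   show ?thesis
    using relabel_closed[OF N inj f'] exp_dual_map[OF N inj f'] act[OF \<sigma> z] c permutes_image[OF \<sigma>]
    unfolding relabel_permutation[OF N \<sigma> f'] by (simp add: P_def)
  qed
 qed
 then obtain \<beta> where \<beta>: "\<beta> \<in> carrier (Coch p)" and P: "\<And>z. z \<in> carrier ?M ==> P z (\<beta> ?N z)" by blast
 have "top_class p \<beta> ?N z = k z" if z: "z \<in> carrier ?M" for z
 proof -
  have f: "\<beta> ?N z \<in> carrier (omega R ?N 0)" using P[OF z] by (simp add: P_def)
  have "top_part p ?N (\<beta> ?N z) = \<beta> ?N z"
  proof
   show "top_part p ?N (\<beta> ?N z) F = \<beta> ?N z F" for F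
    using omegaD(2,3)[OF N f, of F] by (auto simp: top_part_def)
  qed
  then show ?thesis using P[OF z] by (simp add: top_class_apply[OF N z] P_def)
 qed
 then show ?thesis using \<beta> by blast
qed

lemma top_class_surjective:
 assumes wp: "weakly_projective R X" and \<phi>: "\<phi> \<in> carrier (Kos p)"
 shows "\<exists>\<alpha>\<in>carrier (Coch p). top_class p \<alpha> = \<phi>"
proof -
 have \<phi>h: "\<phi> \<in> carrier (HomEd)" using \<phi> by (simp add: koszul_carrier)
 have N: "finite {1..p}" by simp
 note D = species_homD[OF \<phi>h N]
 have "\<phi> {1..p} (sp_map X {1..p} \<sigma> z) = sp_map (exp_dual R) {1..p} \<sigma> (\<phi> {1..p} z)"
  if "\<sigma> permutes {1..p}" "z \<in> carrier (XV {1..p})" for \<sigma> z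
  using D(4)[OF permutes_inj_on[OF that(1)] that(2)] permutes_image[OF that(1)] by simp
 then obtain \<alpha> where \<alpha>: "\<alpha> \<in> carrier (Coch p)"
  "\<forall>z\<in>carrier (XV {1..p}). top_class p \<alpha> {1..p} z = \<phi> {1..p} z"
  using class_lift[OF wp, of p "\<phi> {1..p}"] D(1-3) by blast
 have t: "top_class p \<alpha> \<in> carrier (Kos p)" by (rule top_class_in[OF \<alpha>(1)])
 have "top_class p \<alpha> = \<phi>"
 proof (rule koszul_ext[OF t \<phi>])
  fix I z assume I: "finite I" "card I = p" "z \<in> carrier (XV I)"
  have th: "top_class p \<alpha> \<in> carrier (HomEd)" using t by (simp add: koszul_carrier)
  show "top_class p \<alpha> I z = \<phi> I z"
   by (rule species_hom_agree[OF th \<phi>h _ I]) (use \<alpha>(2) in blast)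
 qed
 then show ?thesis using \<alpha>(1) by blast
qed

end

section \<open>Acyclicity of the kernel\<close>

context exp_bicomodule
begin

lemma cochain_diff_agree:
 assumes \<alpha>: "\<alpha> \<in> carrier (Coch n)" and \<beta>: "\<beta> \<in> carrier (Coch n)"
  and I: "finite I" "z \<in> carrier (XV I)"
  and agree: "\<And>J w F. [|J \<subseteq> I; w \<in> carrier (XV J)|] ==> \<alpha> J w F = \<beta> J w F"
 shows "cdiff n \<alpha> I z F = cdiff n \<beta> I z F"
proof (cases "F \<in> decomps (Suc n) I")
 case True
 let ?p = "position_of F"
 have p: "?p \<in> positions (Suc n) I" and F: "blocks (Suc n) ?p = F"
  using position_of_in_positions[OF True] blocks_position_of[OF True] by auto
 have "eval_cochain n \<alpha> (face n i (z, ?p)) = eval_cochain n \<beta> (face n i (z, ?p))" for i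
  using agree[OF _ face_elt_closed[OF p I, of i]] face_pos_subset[of n i ?p] support_positions[OF p]
  by (simp add: eval_cochain_def face_def)
 then show ?thesis
  using cochain_diff_blocks[OF \<alpha> p I] cochain_diff_blocks[OF \<beta> p I] by (simp add: F)
next
 case False
 then show ?thesis
  using cochainD(3)[OF cochain_diff_closed[OF \<alpha>] I] cochainD(3)[OF cochain_diff_closed[OF \<beta>] I] by simp
qed

lemma eval_face_local:
 assumes \<gamma>: "\<gamma> \<in> carrier (Coch n)" and p: "p \<in> positions (Suc n) I" and i: "i \<le> Suc n"
  and I: "finite I" "z \<in> carrier (XV I)"
  and vanish: "\<And>J w F. [|J \<subset> I; w \<in> carrier (XV J)|] ==> \<gamma> J w F = \<zero>"
 shows "eval_cochain n \<gamma> (face n i (z, p)) = positional n I (\<gamma> I z) (merge_pos i \<circ> p)"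
proof (cases "0 < i \<and> i \<le> n")
 case True
 then show ?thesis
  using face_pos_inner[OF p, of i] merge_pos_positions[OF p, of i]
  by (simp add: eval_cochain_def face_def face_elt_def positional_def)
next
 case outer: False
 let ?q = "face_pos n i p"
 let ?J = "support ?q"
 have sub: "?J \<subseteq> I" using face_pos_subset[of n i p] support_positions[OF p] by simp
 have zero: "p x = 0" if "x \<notin> I" for x using positionsD(3)[OF p that] .
 show ?thesis
 proof (cases "?J = I")
  case True
  have "?q x = (merge_pos i \<circ> p) x" for x
  proof (cases "x \<in> I")
   case xI: True
   then have "?q x \<noteq> 0" using True by (auto simp: support_def)
   then show ?thesis by (auto simp: face_pos_def Let_def split: if_splits)
  next
   case False
   then show ?thesis using zero[OF False] by (simp add: face_pos_def merge_pos_def Let_def)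
  qed
  then have q: "?q = merge_pos i \<circ> p" by auto
  have "face_elt n i z p = z"
   using outer i lam_counit[OF I] rho_counit[OF I] by (auto simp: face_elt_def True Let_def support_positions[OF p])
  moreover have "?q \<in> positions n I" using face_pos_in_positions[of n i p] True by simp
  ultimately show ?thesis using True by (simp add: eval_cochain_def face_def positional_def q)
 next
  case False
  then have "?J \<subset> I" using sub by auto
  then obtain x where x: "x \<in> I" "?q x = 0" by (auto simp: support_def)
  have "merge_pos i \<circ> p \<notin> positions n I"
   by (rule positions_failureI(1)[OF x(1)]) (use x(2) in \<open>auto simp: face_pos_def Let_def split: if_splits\<close>)
  then show ?thesis
   using vanish[OF \<open>?J \<subset> I\<close> face_elt_closed[OF p I, of i]]
   by (simp add: eval_cochain_def face_def positional_def)
 qed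
qed

text \<open>On a set all of whose proper subsets carry the value zero, the coactions act by zero except in
 the degenerate faces, where they act as the identity: the differential is that of the local complex.\<close>

lemma cochain_diff_local:
 assumes \<gamma>: "\<gamma> \<in> carrier (Coch n)"
  and I: "finite I" "z \<in> carrier (XV I)"
  and vanish: "\<And>J w F. [|J \<subset> I; w \<in> carrier (XV J)|] ==> \<gamma> J w F = \<zero>"
 shows "positional (Suc n) I (cdiff n \<gamma> I z) = local_diff I n (positional n I (\<gamma> I z))"
proof
 fix p
 have \<gamma>R: "range (\<gamma> I z) \<subseteq> carrier R" using cochainD(2)[OF \<gamma> I] by auto
 note loc = positional_in[OF \<gamma>R, of n I]
 show "positional (Suc n) I (cdiff n \<gamma> I z) p = local_diff I n (positional n I (\<gamma> I z)) p"
 proof (cases "p \<in> positions (Suc n) I")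
  case True
  have "cdiff n \<gamma> I z (blocks (Suc n) p) =
    alt_sum R {0..Suc n} (\<lambda>i. positional n I (\<gamma> I z) (merge_pos i \<circ> p))"
   unfolding cochain_diff_blocks[OF \<gamma> True I]
  proof (rule alt_sum_cong)
   fix i assume i: "i \<in> {0..Suc n}"
   show "eval_cochain n \<gamma> (face n i (z, p)) = positional n I (\<gamma> I z) (merge_pos i \<circ> p)"
    by (rule eval_face_local[OF \<gamma> True _ I vanish]) (use i in auto)
  next
   show "positional n I (\<gamma> I z) (merge_pos i \<circ> p) \<in> carrier R" for i
    by (rule local_cochains_closed[OF loc])
  qed
  moreover have "\<forall>x. x \<notin> I --> p x = 0" using positionsD(3)[OF True] by blast
  ultimately show ?thesis using True by (simp add: positional_def[of "Suc n"] local_diff_def)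
 next
  case False
  then show ?thesis using local_cochains_outside[OF local_diff_in[OF loc] False] by (simp add: positional_def[of "Suc n"])
 qed
qed

lemma cochain_diff_zero: "cdiff n \<zero>\<^bsub>Coch n\<^esub> = \<zero>\<^bsub>Coch (Suc n)\<^esub>"
proof -
 interpret C: module R "Coch n" by (rule cochains_module)
 interpret D: module R "Coch (Suc n)" by (rule cochains_module)
 show ?thesis
  by (rule additive_map_zero[OF C.abelian_group_axioms D.abelian_group_axioms])
   (use cochain_diff_closed cochain_diff_linear(1) in auto)
qed

lemma top_class_zero: "top_class n \<zero>\<^bsub>Coch n\<^esub> = \<zero>\<^bsub>Kos n\<^esub>"
proof -
 interpret C: module R "Coch n" by (rule cochains_module)
 interpret K: module R "Kos n" by (rule koszul_module)
 show ?thesis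
  by (rule additive_map_zero[OF C.abelian_group_axioms K.abelian_group_axioms])
   (use top_class_in top_class_linear(1) in auto)
qed

lemma koszul_diff_zero: "kdiff n \<zero>\<^bsub>Kos n\<^esub> = \<zero>\<^bsub>Kos (Suc n)\<^esub>"
proof -
 interpret C: module R "Coch n" by (rule cochains_module)
 show ?thesis
  using koszul_diff_top_class[OF C.zero_closed] by (simp add: top_class_zero cochain_diff_zero)
qed

lemma top_class_zeroI:
 assumes \<alpha>: "\<alpha> \<in> carrier (Coch n)"
  and "\<And>z. z \<in> carrier (XV {1..n}) ==> top_part n {1..n} (\<alpha> {1..n} z) \<in> cobd {1..n} 0"
 shows "top_class n \<alpha> = \<zero>\<^bsub>Kos n\<^esub>"
proof -
 interpret K: module R "Kos n" by (rule koszul_module)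
 note t = top_class_in[OF \<alpha>]
 have th: "top_class n \<alpha> \<in> carrier (HomEd)"
  "\<zero>\<^bsub>Kos n\<^esub> \<in> carrier (HomEd)"
  using t K.zero_closed by (simp_all add: koszul_carrier)
 have N: "finite {1..n}" by simp
 show ?thesis
 proof (rule koszul_ext[OF t K.zero_closed])
  fix I z assume I: "finite I" "card I = n" "z \<in> carrier (XV I)"
  show "top_class n \<alpha> I z = (\<zero>\<^bsub>Kos n\<^esub>) I z"
  proof (rule species_hom_agree[OF th _ I])
   fix w assume w: "w \<in> carrier (XV {1..n})"
   show "top_class n \<alpha> {1..n} w = (\<zero>\<^bsub>Kos n\<^esub>) {1..n} w"
    using assms(2)[OF w] dual_class_zero[OF N top_part_cochain[OF \<alpha> N w]]
    by (simp add: koszul_ops(1) species_hom_ops(1)[OF N w] top_class_apply[OF N w])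
  qed
 qed
qed

lemma top_class_zeroD:
 assumes \<alpha>: "\<alpha> \<in> carrier (Coch n)" and zero: "top_class n \<alpha> = \<zero>\<^bsub>Kos n\<^esub>"
  and I: "finite I" "z \<in> carrier (XV I)"
 shows "top_part n I (\<alpha> I z) \<in> cobd I 0"
 using fun_cong[OF fun_cong[OF zero], of I z] dual_class_zero[OF I(1) top_part_cochain[OF \<alpha> I, of n]]
 by (simp add: koszul_ops(1) species_hom_ops(1)[OF I] top_class_apply[OF I])

text \<open>The step of the induction on the cardinality. The primitive has to stay in the kernel of the
 comparison map, hence the condition on its top part in the relation that is lifted.\<close>

lemma primitive_on_cardinality:
 assumes wp: "weakly_projective R X" and \<gamma>: "\<gamma> \<in> carrier (Coch (Suc n))"
  and cocycle: "cdiff (Suc n) \<gamma> = \<zero>\<^bsub>Coch (Suc (Suc n))\<^esub>"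
  and top: "top_class (Suc n) \<gamma> = \<zero>\<^bsub>Kos (Suc n)\<^esub>"
  and vanish: "\<And>J w F. [|finite J; card J < m; w \<in> carrier (XV J)|] ==> \<gamma> J w F = \<zero>"
 shows "\<exists>\<beta>\<in>carrier (Coch n). top_class n \<beta> = \<zero>\<^bsub>Kos n\<^esub> \<and>
  (\<forall>I z F. finite I \<and> card I \<noteq> m \<and> z \<in> carrier (XV I) --> \<beta> I z F = \<zero>) \<and>
  (\<forall>I z F. finite I \<and> card I = m \<and> z \<in> carrier (XV I) -->
   cdiff n \<beta> I z F = \<gamma> I z F)"
proof -
 let ?N = "{1..m}"
 let ?M = "XV ?N"
 have N: "finite ?N" by simp
 interpret M: module R ?M by (rule val_module[OF N])
 interpret F: module R "fmod (decomps n ?N)" by (rule free_module_module)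
 interpret Q: quotient_module R "omega R ?N 0" "cobd ?N 0" by (rule omega_quotient[OF N])
 have proper: "finite J" "card J < m" if "J \<subset> ?N" for J
  using that psubset_card_mono[OF N that] finite_subset[OF _ N] by auto
 have \<gamma>_zero: "\<gamma> ?N \<zero>\<^bsub>?M\<^esub> F = \<zero>" for F
 proof -
  have "\<zero> \<odot>\<^bsub>?M\<^esub> \<zero>\<^bsub>?M\<^esub> = \<zero>\<^bsub>?M\<^esub>" by simp
  then show ?thesis
   using cochainD(5)[OF \<gamma> N M.zero_closed R.zero_closed, of F] cochainD(2)[OF \<gamma> N M.zero_closed, of F] by simp
 qed
 define P where "P z b \<longleftrightarrow> z \<in> carrier ?M \<and> b \<in> carrier (fmod (decomps n ?N)) \<and>
  local_diff ?N n (positional n ?N b) = positional (Suc n) ?N (\<gamma> ?N z) \<and>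
  top_part n ?N b \<in> cobd ?N 0" for z b
 have pR: "range (positional n ?N b) \<subseteq> carrier R" if "range b \<subseteq> carrier R" for b
  by (rule local_cochains_range[OF positional_in[OF that]])
 have "\<exists>\<beta>\<in>carrier (Coch n).
  (\<forall>z\<in>carrier ?M. P z (\<beta> ?N z)) \<and>
  (\<forall>I z F. finite I \<and> card I \<noteq> m \<and> z \<in> carrier (XV I) --> \<beta> I z F = \<zero>)"
 proof (rule lifted_cochain[OF wp])
  show "f \<in> carrier (fmod (decomps n ?N))" if "P z f" for z f using that by (simp add: P_def)
  show "\<exists>f. P z f" if z: "z \<in> carrier ?M" for z
  proof -
   have "\<exists>b\<in>carrier (fmod (decomps n ?N)).
     local_diff ?N n (positional n ?N b) = positional (Suc n) ?N (\<gamma> ?N z) \<and>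
     top_part n ?N b \<in> cobd ?N 0"
   proof (rule local_primitive_exists[OF N cochainD(1)[OF \<gamma> N z]])
    have "positional (Suc (Suc n)) ?N (cdiff (Suc n) \<gamma> ?N z) =
      local_diff ?N (Suc n) (positional (Suc n) ?N (\<gamma> ?N z))"
     by (rule cochain_diff_local[OF \<gamma> N z]) (rule vanish[OF proper])
    then have "local_diff ?N (Suc n) (positional (Suc n) ?N (\<gamma> ?N z)) p =
      positional (Suc (Suc n)) ?N (cdiff (Suc n) \<gamma> ?N z) p" for p by simp
    then show "local_diff ?N (Suc n) (positional (Suc n) ?N (\<gamma> ?N z)) p = \<zero>" for p
     unfolding cocycle by (simp add: positional_def cochain_ops(1)[OF N z])
    show "top_part (Suc n) ?N (\<gamma> ?N z) \<in> cobd ?N 0"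
     by (rule top_class_zeroD[OF \<gamma> top N z])
   qed
   then show ?thesis using z by (auto simp: P_def)
  qed
  show "P \<zero>\<^bsub>?M\<^esub> (\<lambda>_. \<zero>)"
  proof -
   have "local_diff ?N n (positional n ?N (\<lambda>_. \<zero>)) = positional (Suc n) ?N (\<gamma> ?N \<zero>\<^bsub>?M\<^esub>)"
    by (simp add: positional_def[abs_def] \<gamma>_zero local_diff_zero fun_eq_iff cong: if_cong)
   moreover have "top_part n ?N (\<lambda>_. \<zero>) = (\<lambda>_. \<zero>)" by (simp add: top_part_def[abs_def])
   ultimately show ?thesis
    using F.M.zero_closed Q.H_zero by (simp add: P_def free_module_simps omega_simps)
  qed
  show "P (z \<oplus>\<^bsub>?M\<^esub> w) (\<lambda>F. f F \<oplus> g F)"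
   if z: "z \<in> carrier ?M" and w: "w \<in> carrier ?M" and Pf: "P z f" and Pg: "P w g" for z w f g
  proof -
   have f: "f \<in> carrier (fmod (decomps n ?N))" and g: "g \<in> carrier (fmod (decomps n ?N))"
    using Pf Pg by (simp_all add: P_def)
   note fR = free_module_range[OF f] and gR = free_module_range[OF g]
   have "local_diff ?N n (positional n ?N (\<lambda>F. f F \<oplus> g F)) p =
     positional (Suc n) ?N (\<gamma> ?N (z \<oplus>\<^bsub>?M\<^esub> w)) p" for p
    unfolding positional_linear(1)[OF fR] local_diff_add[OF pR[OF fR] pR[OF gR]]
    using Pf Pg by (simp add: P_def positional_def cochainD(4)[OF \<gamma> N z w])
   moreover have "top_part n ?N (\<lambda>F. f F \<oplus> g F) = (\<lambda>F. top_part n ?N f F \<oplus> top_part n ?N g F)"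
    by (auto simp: top_part_def)
   then have "top_part n ?N (\<lambda>F. f F \<oplus> g F) \<in> cobd ?N 0"
    using Q.H_add[of "top_part n ?N f" "top_part n ?N g"] Pf Pg by (simp add: P_def omega_simps)
   moreover have "(\<lambda>F. f F \<oplus> g F) \<in> carrier (fmod (decomps n ?N))"
    using F.M.a_closed[OF f g] by (simp add: free_module_simps)
   ultimately show ?thesis using M.M.a_closed[OF z w] by (simp add: P_def fun_eq_iff)
  qed
  show "P (c \<odot>\<^bsub>?M\<^esub> z) (\<lambda>F. c \<otimes> f F)" if c: "c \<in> carrier R" and z: "z \<in> carrier ?M" and Pf: "P z f" for c z f
  proof -
   have f: "f \<in> carrier (fmod (decomps n ?N))" using Pf by (simp add: P_def)
   note fR = free_module_range[OF f]
   have "local_diff ?N n (positional n ?N (\<lambda>F. c \<otimes> f F)) p =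
     positional (Suc n) ?N (\<gamma> ?N (c \<odot>\<^bsub>?M\<^esub> z)) p" for p
    unfolding positional_linear(2)[OF fR c] local_diff_smult[OF pR[OF fR] c]
    using Pf c by (simp add: P_def positional_def cochainD(5)[OF \<gamma> N z c])
   moreover have "top_part n ?N (\<lambda>F. c \<otimes> f F) = (\<lambda>F. c \<otimes> top_part n ?N f F)"
    using c by (auto simp: top_part_def)
   then have "top_part n ?N (\<lambda>F. c \<otimes> f F) \<in> cobd ?N 0"
    using Q.H_smult[OF c, of "top_part n ?N f"] Pf by (simp add: P_def omega_simps)
   moreover have "(\<lambda>F. c \<otimes> f F) \<in> carrier (fmod (decomps n ?N))"
    using F.smult_closed[OF c f] by (simp add: free_module_simps)
   ultimately show ?thesis using M.smult_closed[OF c z] by (simp add: P_def fun_eq_iff)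
  qed
  show "P (sp_map X ?N \<sigma> z) (\<lambda>F. f (unperm \<sigma> F))"
   if \<sigma>: "\<sigma> permutes ?N" and z: "z \<in> carrier ?M" and Pf: "P z f" for \<sigma> z f
  proof -
   have inj: "inj_on \<sigma> ?N" and im: "\<sigma> ` ?N = ?N" using permutes_inj_on[OF \<sigma>] permutes_image[OF \<sigma>] by auto
   have f: "f \<in> carrier (fmod (decomps n ?N))" using Pf by (simp add: P_def)
   have z': "sp_map X ?N \<sigma> z \<in> carrier ?M" using carrier_map[OF N inj z] im by simp
   have \<gamma>': "\<gamma> ?N (sp_map X ?N \<sigma> z) F = \<gamma> ?N z (unperm \<sigma> F)" for F
   proof (cases "F \<in> decomps (Suc n) ?N")
    case True
    then show ?thesis
     using cochainD(6)[OF \<gamma> N z inj, of "unperm \<sigma> F"] permuted_decomps(1)[OF \<sigma>]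
      permuted_inverse(1)[OF \<sigma>, of F] im by simp
   next
    case False
    then show ?thesis
     using cochainD(3)[OF \<gamma> N z] cochainD(3)[OF \<gamma> N z'] permuted_decomps(1)[OF \<sigma>] by simp
   qed
   have "positional (Suc n) ?N (\<gamma> ?N (sp_map X ?N \<sigma> z)) p = positional (Suc n) ?N (\<gamma> ?N z) (p \<circ> \<sigma>)" for p
    using positional_permutation(1)[OF \<sigma>, of "Suc n" "\<gamma> ?N z" p] by (simp add: \<gamma>'[abs_def])
   then have "local_diff ?N n (positional n ?N (\<lambda>F. f (unperm \<sigma> F))) p =
     positional (Suc n) ?N (\<gamma> ?N (sp_map X ?N \<sigma> z)) p" for p
    using Pf unfolding positional_permutation(2)[OF \<sigma>] by (simp add: P_def)
   moreover have "(\<lambda>F. f (unperm \<sigma> F)) \<in> carrier (fmod (decomps n ?N))"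
    using f unfolding free_module_carrier[OF finite_decomps[OF N]] by (simp add: permuted_decomps(1)[OF \<sigma>])
   ultimately show ?thesis
    using Pf z' top_part_permutation[OF N \<sigma> free_module_range[OF f]] by (simp add: P_def fun_eq_iff)
  qed
 qed
 then obtain \<beta> where \<beta>: "\<beta> \<in> carrier (Coch n)" and P: "\<And>z. z \<in> carrier ?M ==> P z (\<beta> ?N z)"
  and off: "\<forall>I z F. finite I \<and> card I \<noteq> m \<and> z \<in> carrier (XV I) --> \<beta> I z F = \<zero>" by blast
 have diff: "cdiff n \<beta> ?N z = \<gamma> ?N z" if z: "z \<in> carrier ?M" for z
 proof (rule positional_cancel)
  show "cdiff n \<beta> ?N z \<in> carrier (fmod (decomps (Suc n) ?N))"
   "\<gamma> ?N z \<in> carrier (fmod (decomps (Suc n) ?N))"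
   using cochainD(1)[OF cochain_diff_closed[OF \<beta>] N z] cochainD(1)[OF \<gamma> N z] by auto
  have "positional (Suc n) ?N (cdiff n \<beta> ?N z) = local_diff ?N n (positional n ?N (\<beta> ?N z))"
  proof (rule cochain_diff_local[OF \<beta> N z])
   fix J w F assume J: "J \<subset> ?N" "w \<in> carrier (XV J)"
   show "\<beta> J w F = \<zero>" using off proper[OF J(1)] J(2) by simp
  qed
  then show "positional (Suc n) ?N (cdiff n \<beta> ?N z) = positional (Suc n) ?N (\<gamma> ?N z)"
   using P[OF z] by (simp add: P_def)
 qed
 have "cdiff n \<beta> I z = \<gamma> I z" if "finite I" "card I = m" "z \<in> carrier (XV I)" for I z
  by (rule species_hom_agree[OF cochain_diff_closed[OF \<beta>, unfolded cochains_def] \<gamma>[unfolded cochains_def] diff that])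
 moreover have "top_class n \<beta> = \<zero>\<^bsub>Kos n\<^esub>"
 proof (rule top_class_zeroI[OF \<beta>])
  fix z assume z: "z \<in> carrier (XV {1..n})"
  show "top_part n {1..n} (\<beta> {1..n} z) \<in> cobd {1..n} 0"
  proof (cases "n = m")
   case True
   then show ?thesis using P z by (simp add: P_def)
  next
   case False
   have "top_part n {1..n} (\<beta> {1..n} z) = (\<lambda>_. \<zero>)"
    using off z False by (auto simp: top_part_def fun_eq_iff)
   then show ?thesis
    using quotient_module.H_zero[OF omega_quotient[of "{1..n}"]] by (simp add: omega_simps)
  qed
 qed
 ultimately show ?thesis using \<beta> off by (intro bexI[of _ \<beta>]) auto
qed

text \<open>The partial primitives \<open>B m\<close> solve the equation on sets with fewer than \<open>m\<close> elements, and \<open>B (m + 1)\<close>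
 differs from \<open>B m\<close> only on sets with exactly \<open>m\<close> elements. Therefore they stabilise on every finite set, and the
 limit is a primitive.\<close>

lemma kernel_acyclic:
 assumes wp: "weakly_projective R X" and \<alpha>: "\<alpha> \<in> carrier (Coch (Suc n))"
  and cocycle: "cdiff (Suc n) \<alpha> = \<zero>\<^bsub>Coch (Suc (Suc n))\<^esub>"
  and top: "top_class (Suc n) \<alpha> = \<zero>\<^bsub>Kos (Suc n)\<^esub>"
 shows "\<exists>\<beta>\<in>carrier (Coch n). cdiff n \<beta> = \<alpha> \<and> top_class n \<beta> = \<zero>\<^bsub>Kos n\<^esub>"
proof -
 let ?\<delta> = "cdiff"
 interpret C: module R "Coch n" by (rule cochains_module)
 interpret C1: module R "Coch (Suc n)" by (rule cochains_module)
 interpret C2: module R "Coch (Suc (Suc n))" by (rule cochains_module)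
 interpret K: module R "Kos n" by (rule koszul_module)
 interpret K1: module R "Kos (Suc n)" by (rule koszul_module)
 define P where "P m b \<longleftrightarrow> b \<in> carrier (Coch n) \<and> top_class n b = \<zero>\<^bsub>Kos n\<^esub> \<and>
  (\<forall>I z F. finite I \<and> card I < m \<and> z \<in> carrier (XV I) --> ?\<delta> n b I z F = \<alpha> I z F)" for m b
 define Q where "Q m b b' \<longleftrightarrow> (\<forall>I z F. finite I \<and> card I \<noteq> m \<and> z \<in> carrier (XV I) --> b' I z F = b I z F)"
  for m and b b' :: "nat set => 'm => nat set list => 'k"
 have start: "P 0 \<zero>\<^bsub>Coch n\<^esub>" by (simp add: P_def top_class_zero)
 have step: "\<exists>b'. P (Suc m) b' \<and> Q m b b'" if Pb: "P m b" for m b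
 proof -
  have b: "b \<in> carrier (Coch n)" and tb: "top_class n b = \<zero>\<^bsub>Kos n\<^esub>" using Pb by (simp_all add: P_def)
  note \<delta>b = cochain_diff_closed[OF b]
  have m1: "\<ominus> \<one> \<in> carrier R" by simp
  \<comment> \<open>the error of the partial primitive \<open>b\<close>, which vanishes below the cardinality \<open>m\<close>\<close>
  define \<gamma> where "\<gamma> = \<alpha> \<oplus>\<^bsub>Coch (Suc n)\<^esub> \<ominus> \<one> \<odot>\<^bsub>Coch (Suc n)\<^esub> ?\<delta> n b"
  have \<delta>b': "\<ominus> \<one> \<odot>\<^bsub>Coch (Suc n)\<^esub> ?\<delta> n b \<in> carrier (Coch (Suc n))" by (rule C1.smult_closed[OF m1 \<delta>b])
  have \<gamma>: "\<gamma> \<in> carrier (Coch (Suc n))" unfolding \<gamma>_def by (rule C1.M.a_closed[OF \<alpha> \<delta>b'])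
  have \<gamma>_apply: "\<gamma> I z F = \<alpha> I z F \<ominus> ?\<delta> n b I z F" if I: "finite I" "z \<in> carrier (XV I)" for I z F
   using cochainD(2)[OF \<delta>b I, of F] by (simp add: \<gamma>_def cochain_ops[OF I] a_minus_def l_minus)
  have "?\<delta> (Suc n) \<gamma> = \<zero>\<^bsub>Coch (Suc (Suc n))\<^esub>"
   unfolding \<gamma>_def cochain_diff_linear(1)[OF \<alpha> \<delta>b'] cochain_diff_linear(2)[OF \<delta>b m1] cocycle cochain_diff_square[OF b]
   using m1 by simp
  moreover have "top_class (Suc n) \<gamma> = \<zero>\<^bsub>Kos (Suc n)\<^esub>"
   unfolding \<gamma>_def top_class_linear(1)[OF \<alpha> \<delta>b'] top_class_linear(2)[OF \<delta>b m1] top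
    koszul_diff_top_class[OF b, symmetric] tb koszul_diff_zero
   using m1 by simp
  moreover have "\<gamma> J w F = \<zero>" if "finite J" "card J < m" "w \<in> carrier (XV J)" for J w F
   using Pb that cochainD(2)[OF \<alpha> that(1,3), of F] by (simp add: \<gamma>_apply P_def a_minus_def r_neg)
  ultimately obtain \<beta> where \<beta>: "\<beta> \<in> carrier (Coch n)" "top_class n \<beta> = \<zero>\<^bsub>Kos n\<^esub>"
   and off: "\<forall>I z F. finite I \<and> card I \<noteq> m \<and> z \<in> carrier (XV I) --> \<beta> I z F = \<zero>"
   and at: "\<forall>I z F. finite I \<and> card I = m \<and> z \<in> carrier (XV I) --> ?\<delta> n \<beta> I z F = \<gamma> I z F"
   using primitive_on_cardinality[OF wp \<gamma>, of m] by blast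
  let ?b' = "b \<oplus>\<^bsub>Coch n\<^esub> \<beta>"
  have b': "?b' \<in> carrier (Coch n)" by (rule C.M.a_closed[OF b \<beta>(1)])
  have "top_class n ?b' = \<zero>\<^bsub>Kos n\<^esub>" unfolding top_class_linear(1)[OF b \<beta>(1)] tb \<beta>(2) by simp
  moreover have "?\<delta> n ?b' I z F = \<alpha> I z F" if I: "finite I" "card I < Suc m" "z \<in> carrier (XV I)" for I z F
  proof -
   have sum: "?\<delta> n ?b' I z F = ?\<delta> n b I z F \<oplus> ?\<delta> n \<beta> I z F"
    unfolding cochain_diff_linear(1)[OF b \<beta>(1)] by (rule cochain_ops(2)[OF I(1,3)])
   note R = cochainD(2)[OF \<delta>b I(1,3), of F] cochainD(2)[OF \<alpha> I(1,3), of F]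
   show ?thesis
   proof (cases "card I = m")
    case True
    then have "?\<delta> n \<beta> I z F = \<alpha> I z F \<ominus> ?\<delta> n b I z F" using at I \<gamma>_apply by simp
    then show ?thesis unfolding sum using R by (simp add: a_minus_def a_lcomm r_neg)
   next
    case False
    have "?\<delta> n \<beta> I z F = ?\<delta> n \<zero>\<^bsub>Coch n\<^esub> I z F"
    proof (rule cochain_diff_agree[OF \<beta>(1) C.zero_closed I(1,3)])
     fix J w F assume J: "J \<subseteq> I" "w \<in> carrier (XV J)"
     have "finite J" "card J < m" using J(1) I False card_mono[OF I(1) J(1)] finite_subset by auto
     then show "\<beta> J w F = (\<zero>\<^bsub>Coch n\<^esub>) J w F" using off J(2) by (simp add: cochain_ops(1))
    qed
    then have "?\<delta> n \<beta> I z F = \<zero>" by (simp add: cochain_diff_zero cochain_ops(1)[OF I(1,3)])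
    then show ?thesis unfolding sum using Pb I False R by (simp add: P_def)
   qed
  qed
  moreover have "?b' I z F = b I z F" if I: "finite I" "card I \<noteq> m" "z \<in> carrier (XV I)" for I z F
   using off that cochainD(2)[OF b I(1,3), of F] by (simp add: cochain_ops(2)[OF I(1,3)])
  ultimately show ?thesis using b' by (intro exI[of _ ?b']) (auto simp: P_def Q_def)
 qed
 obtain B where P: "P m (B m)" and Q: "Q m (B m) (B (Suc m))" for m
  using dependent_nat_choice[of P Q] start step by metis
 have B: "B m \<in> carrier (Coch n)" for m using P by (simp add: P_def)
 have stable: "B (card I + Suc k) I z F = B (Suc (card I)) I z F" if "finite I" "z \<in> carrier (XV I)" for I z F k
 proof (induction k)
  case (Suc k)
  then show ?case using Q[of "card I + Suc k"] that by (simp add: Q_def)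
 qed simp
 have stable': "B m I z F = B (Suc (card I)) I z F" if "finite I" "z \<in> carrier (XV I)" "card I < m" for I z F m
  using stable[OF that(1,2), of "m - Suc (card I)" F] that(3) by simp
 let ?\<beta> = "\<lambda>I\<in>{I. finite I}. \<lambda>z\<in>carrier (XV I). B (Suc (card I)) I z"
 have \<beta>: "?\<beta> \<in> carrier (Coch n)"
 proof (rule cochainI)
  fix I z F assume I: "finite I" "z \<in> carrier (XV I)"
  let ?b = "B (Suc (card I))"
  note D = cochainD[OF B I]
  show "?b I z F \<in> carrier R" by (rule D(2))
  show "?b I z F = \<zero>" if "F \<notin> decomps n I" by (rule D(3)[OF that])
  show "?b I (z \<oplus>\<^bsub>XV I\<^esub> w) F = ?b I z F \<oplus> ?b I w F" if "w \<in> carrier (XV I)" for w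
   by (rule D(4)[OF that])
  show "?b I (c \<odot>\<^bsub>XV I\<^esub> z) F = c \<otimes> ?b I z F" if "c \<in> carrier R" for c by (rule D(5)[OF that])
  show "B (Suc (card (\<sigma> ` I))) (\<sigma> ` I) (sp_map X I \<sigma> z) (map (image \<sigma>) F) = ?b I z F"
   if "inj_on \<sigma> I" "F \<in> decomps n I" for \<sigma>
   using D(6)[OF that] card_image[OF that(1)] by simp
 qed
 have agree: "?\<beta> J w F = B m J w F" if "finite J" "w \<in> carrier (XV J)" "card J < m" for J w F m
  using stable'[OF that] that by simp
 have "?\<delta> n ?\<beta> = \<alpha>"
 proof (rule cochain_ext[OF cochain_diff_closed[OF \<beta>] \<alpha>])
  fix I z p assume I: "finite I" "z \<in> carrier (XV I)"
  have "?\<delta> n ?\<beta> I z (blocks (Suc n) p) = ?\<delta> n (B (Suc (card I))) I z (blocks (Suc n) p)"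
  proof (rule cochain_diff_agree[OF \<beta> B I])
   fix J w F assume J: "J \<subseteq> I" "w \<in> carrier (XV J)"
   show "?\<beta> J w F = B (Suc (card I)) J w F"
    using agree[OF finite_subset[OF J(1) I(1)] J(2), of "Suc (card I)"] card_mono[OF I(1) J(1)] by simp
  qed
  then show "?\<delta> n ?\<beta> I z (blocks (Suc n) p) = \<alpha> I z (blocks (Suc n) p)"
   using P[of "Suc (card I)"] I by (simp add: P_def)
 qed
 moreover have "top_class n ?\<beta> = \<zero>\<^bsub>Kos n\<^esub>"
 proof (rule top_class_zeroI[OF \<beta>])
  fix z assume z: "z \<in> carrier (XV {1..n})"
  have "?\<beta> {1..n} z = B (Suc n) {1..n} z" using z by simp
  then show "top_part n {1..n} (?\<beta> {1..n} z) \<in> cobd {1..n} 0"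
   using top_class_zeroD[OF B, of "Suc n" "{1..n}" z] P[of "Suc n"] z by (simp add: P_def)
 qed
 ultimately show ?thesis using \<beta> by blast
qed

text \<open>The empty list is the only decomposition into no blocks, and it is also the linear order of the
 empty set.\<close>

lemma kernel_degree_zero:
 assumes \<alpha>: "\<alpha> \<in> carrier (Coch 0)" and top: "top_class 0 \<alpha> = \<zero>\<^bsub>Kos 0\<^esub>"
 shows "\<alpha> = \<zero>\<^bsub>Coch 0\<^esub>"
proof -
 interpret C: module R "Coch 0" by (rule cochains_module)
 show ?thesis
 proof (rule cochain_ext[OF \<alpha> C.zero_closed])
  fix I z p assume I: "finite I" "z \<in> carrier (XV I)" and p: "p \<in> positions 0 I"
  have "I = {}" using positionsD(1,2)[OF p] by fastforce
  have z: "z \<in> carrier (XV {})" using I(2) \<open>I = {}\<close> by simp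
  have "top_part 0 {} (\<alpha> {} z) \<in> cobd {} 0" by (rule top_class_zeroD[OF \<alpha> top _ z]) simp
  then have "top_value [] (positional (card {}) {} (top_part 0 {} (\<alpha> {} z))) = \<zero>"
   using coboundary_iff_top_value[of "[]" "{}" "top_part 0 {} (\<alpha> {} z)"] top_part_cochain[OF \<alpha> _ z] by simp
  moreover have "(\<lambda>_. 0) \<in> positions 0 {}" "[] \<in> compositions {}"
   by (simp_all add: positions_def compositions_iff)
  ultimately have "\<alpha> {} z [] = \<zero>" by (simp add: positional_def top_part_def blocks_def)
  then show "\<alpha> I z (blocks 0 p) = (\<zero>\<^bsub>Coch 0\<^esub>) I z (blocks 0 p)"
   by (simp add: cochain_ops(1)[OF I] blocks_def) (simp add: \<open>I = {}\<close>)
 qed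
qed

end

section \<open>Comparison of complexes, linear orders and signs\<close>

lemma cochain_complexD:
 assumes "cochain_complex R C d"
 shows "module R (C n)" "d n \<in> lin_hom R (C n) (C (Suc n))"
  and "x \<in> carrier (C n) ==> d (Suc n) (d n x) = \<zero>\<^bsub>C (Suc (Suc n))\<^esub>"
 using assms by (simp_all add: cochain_complex_def)

lemma coboundaries_cocycles:
 assumes C: "cochain_complex R C d"
 shows "quotient_module R ((C n)\<lparr>carrier := {x \<in> carrier (C n). d n x = \<zero>\<^bsub>C (Suc n)\<^esub>}\<rparr>) (coboundaries C d n)"
  (is "quotient_module R ?Z _")
proof -
 note D = cochain_complexD[OF C]
 interpret M: module R "C n" by (rule D(1))
 interpret M1: module R "C (Suc n)" by (rule D(1))
 note dn = lin_homD[OF D(2)] lin_hom_zero[OF D(1) D(1) D(2)]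
 interpret Z: module R ?Z
  by (rule restricted_module[OF D(1)]) (use dn in auto)
 show ?thesis
 proof (cases n)
  case 0
  have B: "coboundaries C d n = {\<zero>\<^bsub>C n\<^esub>}" by (simp add: coboundaries_def 0)
  show ?thesis
  proof unfold_locales
   show "coboundaries C d n \<subseteq> carrier ?Z" unfolding B using dn(5) M.M.zero_closed by simp
   show "\<zero>\<^bsub>?Z\<^esub> \<in> coboundaries C d n" by (simp add: B)
   show "x \<oplus>\<^bsub>?Z\<^esub> y \<in> coboundaries C d n" if "x \<in> coboundaries C d n" "y \<in> coboundaries C d n" for x y
    using that by (simp add: B)
   show "c \<odot>\<^bsub>?Z\<^esub> x \<in> coboundaries C d n" if "c \<in> carrier R" "x \<in> coboundaries C d n" for c x
    using that by (simp add: B)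
  qed
 next
  case (Suc m)
  interpret L: module R "C m" by (rule D(1))
  note dm = lin_homD[OF D(2)[of m]] lin_hom_zero[OF D(1) D(1) D(2)[of m]]
  show ?thesis
  proof unfold_locales
   show "coboundaries C d n \<subseteq> carrier ?Z" using dm(1) D(3) by (auto simp: coboundaries_def Suc)
   show "\<zero>\<^bsub>?Z\<^esub> \<in> coboundaries C d n"
    using dm(5) L.M.zero_closed by (auto simp: coboundaries_def Suc intro: image_eqI[of _ _ "\<zero>\<^bsub>C m\<^esub>"])
   show "x \<oplus>\<^bsub>?Z\<^esub> y \<in> coboundaries C d n" if x: "x \<in> coboundaries C d n" and y: "y \<in> coboundaries C d n" for x y
   proof -
    obtain x' y' where xy: "x' \<in> carrier (C m)" "x = d m x'" "y' \<in> carrier (C m)" "y = d m y'"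
     using x y by (auto simp: coboundaries_def Suc)
    then show ?thesis
     using dm(2)[of x' y'] L.M.a_closed[of x' y'] by (auto simp: coboundaries_def Suc intro!: image_eqI[of _ _ "x' \<oplus>\<^bsub>C m\<^esub> y'"])
   qed
   show "c \<odot>\<^bsub>?Z\<^esub> x \<in> coboundaries C d n" if c: "c \<in> carrier R" and x: "x \<in> coboundaries C d n" for c x
   proof -
    obtain x' where "x' \<in> carrier (C m)" "x = d m x'"
     using x by (auto simp: coboundaries_def Suc)
    then show ?thesis
     using dm(3)[of c x'] c L.smult_closed[of c x']
     by (auto simp: coboundaries_def Suc intro!: image_eqI[of _ _ "c \<odot>\<^bsub>C m\<^esub> x'"])
   qed
  qed
 qed
qed

text \<open>A surjective chain map with acyclic kernel is a quasi-isomorphism: the acyclicity corrects a lift of a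
 cocycle to a cocycle, and a lift of a primitive to a primitive.\<close>

lemma cohomology_iso:
 assumes C: "cochain_complex R C d" and D: "cochain_complex R D d'"
  and closed: "\<And>n x. x \<in> carrier (C n) ==> f n x \<in> carrier (D n)"
  and add: "\<And>n x y. [|x \<in> carrier (C n); y \<in> carrier (C n)|] ==> f n (x \<oplus>\<^bsub>C n\<^esub> y) = f n x \<oplus>\<^bsub>D n\<^esub> f n y"
  and smult: "\<And>n c x. [|c \<in> carrier R; x \<in> carrier (C n)|] ==> f n (c \<odot>\<^bsub>C n\<^esub> x) = c \<odot>\<^bsub>D n\<^esub> f n x"
  and chain: "\<And>n x. x \<in> carrier (C n) ==> f (Suc n) (d n x) = d' n (f n x)"
  and surj: "\<And>n y. y \<in> carrier (D n) ==> \<exists>x\<in>carrier (C n). f n x = y"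
  and kernel_zero: "\<And>x. [|x \<in> carrier (C 0); f 0 x = \<zero>\<^bsub>D 0\<^esub>|] ==> x = \<zero>\<^bsub>C 0\<^esub>"
  and kernel_Suc: "\<And>n x. [|x \<in> carrier (C (Suc n)); d (Suc n) x = \<zero>\<^bsub>C (Suc (Suc n))\<^esub>; f (Suc n) x = \<zero>\<^bsub>D (Suc n)\<^esub>|] ==>
   \<exists>y\<in>carrier (C n). d n y = x \<and> f n y = \<zero>\<^bsub>D n\<^esub>"
 shows "\<exists>h. h \<in> lin_iso R (cohomology D d' n) (cohomology C d n)"
 unfolding cohomology_def subquotient_def
proof (rule quot_module_iso[where f = "f n", OF coboundaries_cocycles[OF D] coboundaries_cocycles[OF C]])
 let ?ZD = "(D n)\<lparr>carrier := {x \<in> carrier (D n). d' n x = \<zero>\<^bsub>D (Suc n)\<^esub>}\<rparr>"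
 let ?ZC = "(C n)\<lparr>carrier := {x \<in> carrier (C n). d n x = \<zero>\<^bsub>C (Suc n)\<^esub>}\<rparr>"
 have mC: "module R (C k)" and mD: "module R (D k)" for k
  using cochain_complexD(1)[OF C] cochain_complexD(1)[OF D] by auto
 have gC: "abelian_group (C k)" and gD: "abelian_group (D k)" for k
  using mC mD by (auto simp: module_def)
 have lC: "d k \<in> lin_hom R (C k) (C (Suc k))" and lD: "d' k \<in> lin_hom R (D k) (D (Suc k))" for k
  using cochain_complexD(2)[OF C] cochain_complexD(2)[OF D] by auto
 have f_zero: "f k \<zero>\<^bsub>C k\<^esub> = \<zero>\<^bsub>D k\<^esub>" for k
  by (rule additive_map_zero[OF gC gD closed add])
 have f_minus: "f k (\<ominus>\<^bsub>C k\<^esub> x) = \<ominus>\<^bsub>D k\<^esub> f k x" if "x \<in> carrier (C k)" for k x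
  by (rule additive_map_minus[OF gC gD closed add that])
 have d_minus: "d k (\<ominus>\<^bsub>C k\<^esub> x) = \<ominus>\<^bsub>C (Suc k)\<^esub> d k x" if "x \<in> carrier (C k)" for k x
  by (rule additive_map_minus[OF gC gC lin_homD(1)[OF lC] lin_homD(2)[OF lC] that])
 show fZ: "f n a \<in> carrier ?ZD" if "a \<in> carrier ?ZC" for a
  using that closed chain[of a n] f_zero[of "Suc n"] by simp
 show "f n (a \<oplus>\<^bsub>?ZC\<^esub> b) = f n a \<oplus>\<^bsub>?ZD\<^esub> f n b" if "a \<in> carrier ?ZC" "b \<in> carrier ?ZC" for a b
  using that add by simp
 show "f n (c \<odot>\<^bsub>?ZC\<^esub> a) = c \<odot>\<^bsub>?ZD\<^esub> f n a" if "c \<in> carrier R" "a \<in> carrier ?ZC" for c a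
  using that smult by simp
 show "f n a \<in> coboundaries D d' n \<longleftrightarrow> a \<in> coboundaries C d n" if a: "a \<in> carrier ?ZC" for a
 proof (cases n)
  case 0
  then show ?thesis using a kernel_zero[of a] f_zero[of 0] by (auto simp: coboundaries_def)
 next
  case (Suc m)
  interpret L: module R "C m" by (rule mC)
  interpret M: module R "C n" by (rule mC)
  interpret N: module R "C (Suc n)" by (rule mC)
  interpret L': module R "D m" by (rule mD)
  interpret M': module R "D n" by (rule mD)
  have a': "a \<in> carrier (C n)" "d n a = \<zero>\<^bsub>C (Suc n)\<^esub>" using a by auto
  show ?thesis
  proof
   assume "f n a \<in> coboundaries D d' n"
   then obtain w where w: "w \<in> carrier (D m)" "f n a = d' m w" by (auto simp: coboundaries_def Suc)
   obtain y where y: "y \<in> carrier (C m)" "f m y = w" using surj[OF w(1)] by blast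
   have dy: "d m y \<in> carrier (C n)" using lin_homD(1)[OF lC y(1)] by (simp add: Suc)
   let ?x = "a \<oplus>\<^bsub>C n\<^esub> \<ominus>\<^bsub>C n\<^esub> d m y"
   have x: "?x \<in> carrier (C n)" using a'(1) dy by simp
   have "d n (d m y) = \<zero>\<^bsub>C (Suc n)\<^esub>" using cochain_complexD(3)[OF C y(1)] by (simp add: Suc)
   then have "d n ?x = \<zero>\<^bsub>C (Suc n)\<^esub>"
    using lin_homD(2)[OF lC a'(1) M.M.a_inv_closed[OF dy]] d_minus[OF dy] a'(2) by simp
   moreover have "f n ?x = \<zero>\<^bsub>D n\<^esub>"
   proof -
    have "f n (d m y) = f n a" using chain[OF y(1)] y(2) w(2) by (simp add: Suc)
    then show ?thesis
     using add[OF a'(1) M.M.a_inv_closed[OF dy]] f_minus[OF dy] closed[OF a'(1)] by (simp add: M'.M.r_neg)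
   qed
   ultimately obtain y' where y': "y' \<in> carrier (C m)" "d m y' = ?x"
    using kernel_Suc[of ?x m] x by (auto simp: Suc)
   have "d m (y' \<oplus>\<^bsub>C m\<^esub> y) = ?x \<oplus>\<^bsub>C n\<^esub> d m y"
    using lin_homD(2)[OF lC y'(1) y(1)] y'(2) by (simp add: Suc)
   also have "\<dots> = a" using a'(1) dy by (simp add: M.M.a_assoc M.M.l_neg)
   finally have "a = d m (y' \<oplus>\<^bsub>C m\<^esub> y)" by simp
   then show "a \<in> coboundaries C d n"
    using L.M.a_closed[OF y'(1) y(1)] by (auto simp: coboundaries_def Suc)
  next
   assume "a \<in> coboundaries C d n"
   then obtain y where y: "y \<in> carrier (C m)" "a = d m y" by (auto simp: coboundaries_def Suc)
   then show "f n a \<in> coboundaries D d' n"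
    using chain[OF y(1)] closed[OF y(1)] by (auto simp: coboundaries_def Suc)
  qed
 qed
 show "\<exists>a\<in>carrier ?ZC. z \<ominus>\<^bsub>?ZD\<^esub> f n a \<in> coboundaries D d' n" if z: "z \<in> carrier ?ZD" for z
 proof -
  interpret M: module R "C n" by (rule mC)
  interpret N: module R "C (Suc n)" by (rule mC)
  interpret M': module R "D n" by (rule mD)
  interpret Q: quotient_module R ?ZD "coboundaries D d' n" by (rule coboundaries_cocycles[OF D])
  have z': "z \<in> carrier (D n)" "d' n z = \<zero>\<^bsub>D (Suc n)\<^esub>" using z by auto
  obtain x where x: "x \<in> carrier (C n)" "f n x = z" using surj[OF z'(1)] by blast
  have dx: "d n x \<in> carrier (C (Suc n))" by (rule lin_homD(1)[OF lC x(1)])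
  have "d (Suc n) (d n x) = \<zero>\<^bsub>C (Suc (Suc n))\<^esub>" by (rule cochain_complexD(3)[OF C x(1)])
  moreover have "f (Suc n) (d n x) = \<zero>\<^bsub>D (Suc n)\<^esub>" using chain[OF x(1)] x(2) z'(2) by simp
  ultimately obtain y where y: "y \<in> carrier (C n)" "d n y = d n x" "f n y = \<zero>\<^bsub>D n\<^esub>"
   using kernel_Suc[OF dx] by blast
  let ?a = "x \<oplus>\<^bsub>C n\<^esub> \<ominus>\<^bsub>C n\<^esub> y"
  have a: "?a \<in> carrier (C n)" using x y by simp
  have "d n ?a = \<zero>\<^bsub>C (Suc n)\<^esub>"
   using lin_homD(2)[OF lC x(1) M.M.a_inv_closed[OF y(1)]] d_minus[OF y(1)] y(2) dx by (simp add: N.M.r_neg)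
  moreover have "f n ?a = z"
   using add[OF x(1) M.M.a_inv_closed[OF y(1)]] f_minus[OF y(1)] y(3) x(2) z'(1) by simp
  moreover have "z \<ominus>\<^bsub>?ZD\<^esub> z = \<zero>\<^bsub>?ZD\<^esub>" using Q.M.r_neg[OF z] by (simp only: a_minus_def)
  ultimately show ?thesis using a Q.H_zero by (intro bexI[of _ ?a]) auto
 qed
qed

lemma singletons_composition: "distinct w ==> map (\<lambda>i. {i}) w \<in> compositions (set w)"
 by (induction w) (auto simp: compositions_iff)

context cring
begin

text \<open>The position function of a list encodes the composition into the singletons of its entries.\<close>

lemma blocks_order_pos:
 assumes "distinct xs"
 shows "blocks (length xs) (order_pos xs) = map (\<lambda>i. {i}) xs"
 using assms
proof (induction xs)
 case (Cons x xs)
 have out: "y \<notin> set ys ==> order_pos ys y = 0" for y ys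
  by (induction ys) (auto simp: gap_pos_def)
 have first: "{y. order_pos (x # xs) y = Suc 0} = {x}" by (auto simp: gap_pos_def split: if_splits)
 have rest: "{y. order_pos (x # xs) y = Suc (Suc k)} = {y. order_pos xs y = Suc k}" for k
  using out[of x xs] Cons.prems by (auto simp: gap_pos_def split: if_splits)
 have "[0..<length (x # xs)] = 0 # map Suc [0..<length xs]" by (simp add: upt_conv_Cons map_Suc_upt del: upt_Suc)
 then have "blocks (length (x # xs)) (order_pos (x # xs)) = {x} # blocks (length xs) (order_pos xs)"
  using first rest by (simp add: blocks_def comp_def del: order_pos.simps)
 then show ?case using Cons by (simp del: order_pos.simps)
qed (simp add: blocks_def)

lemma lin_order_class_standard: "distinct xs ==> loc xs = dcl (set xs) (standard_vec xs)"
 by (simp add: lin_order_class_def standard_vec_def blocks_order_pos)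

lemma lin_order_class_in: "distinct xs ==> loc xs \<in> carrier (Ed (set xs))"
 using dual_class_in[OF _ standard_vec(1)[of xs]] by (simp add: lin_order_class_standard)

lemma lin_order_class_basis:
 assumes xs: "distinct xs" "set xs = I" and \<xi>: "\<xi> \<in> carrier (Ed I)"
 shows "\<exists>!c. c \<in> carrier R \<and> \<xi> = c \<odot>\<^bsub>Ed I\<^esub> loc xs"
proof -
 have fin: "finite I" using xs by auto
 note e = standard_vec[OF xs]
 have eR: "range (standard_vec xs) \<subseteq> carrier R" using omegaD(1)[OF fin e(1)] by auto
 note pe = local_cochains_range[OF positional_in[OF eR, of "card I" I]]
 have L: "c \<odot>\<^bsub>Ed I\<^esub> loc xs = dcl I (\<lambda>F. c \<otimes> standard_vec xs F)"
  if "c \<in> carrier R" for c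
  using exp_dual_simps(4)[OF fin e(1) that] xs by (simp add: lin_order_class_standard)
 interpret W: module R "omega R I 0" by (rule omega_module)
 have in_omega: "(\<lambda>F. c \<otimes> standard_vec xs F) \<in> carrier (omega R I 0)" if "c \<in> carrier R" for c
  using W.smult_closed[OF that e(1)] by (simp add: omega_simps)
 obtain f where f: "f \<in> carrier (omega R I 0)" "\<xi> = dcl I f"
  using \<xi> unfolding exp_dual_simps(1)[OF fin] by blast
 have fR: "range f \<subseteq> carrier R" using omegaD(1)[OF fin f(1)] by auto
 let ?c = "top_value xs (positional (card I) I f)"
 have c: "?c \<in> carrier R" by (rule top_value_closed[OF local_cochains_range[OF positional_in[OF fR]]])
 show ?thesis
 proof (rule ex1I[of _ ?c])
  show "?c \<in> carrier R \<and> \<xi> = ?c \<odot>\<^bsub>Ed I\<^esub> loc xs"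
   using c dual_class_standard[OF xs f(1)] f(2) by (simp add: L)
 next
  fix b assume b: "b \<in> carrier R \<and> \<xi> = b \<odot>\<^bsub>Ed I\<^esub> loc xs"
  then have bR: "b \<in> carrier R" by simp
  have "dcl I (\<lambda>F. b \<otimes> standard_vec xs F) = dcl I (\<lambda>F. ?c \<otimes> standard_vec xs F)"
   using b L[OF bR] f(2) dual_class_standard[OF xs f(1)] by simp
  then have "(\<lambda>F. b \<otimes> standard_vec xs F \<ominus> ?c \<otimes> standard_vec xs F) \<in> cobd I 0"
   using dual_class_eq[OF fin in_omega[OF bR] in_omega[OF c]] by simp
  moreover have "(\<lambda>F. b \<otimes> standard_vec xs F \<ominus> ?c \<otimes> standard_vec xs F) = (\<lambda>F. (b \<ominus> ?c) \<otimes> standard_vec xs F)"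
   using bR c omegaD(1)[OF fin e(1)] by (simp add: a_minus_def l_distr l_minus)
  moreover have d: "b \<ominus> ?c \<in> carrier R" using bR c by simp
  ultimately have "top_value xs (positional (card I) I (\<lambda>F. (b \<ominus> ?c) \<otimes> standard_vec xs F)) = \<zero>"
   using coboundary_iff_top_value[OF xs in_omega[OF d]] by simp
  then have "b \<ominus> ?c = \<zero>"
   unfolding positional_linear(2)[OF eR d] top_value_smult[OF pe d] using e(2) d by simp
  moreover have "b = (b \<ominus> ?c) \<oplus> ?c" using bR c by (simp add: a_minus_def a_assoc l_neg)
  ultimately show "b = ?c" using c by simp
 qed
qed

lemma split_doubleton:
 assumes "A \<union> B = {a, b}" "A \<noteq> {}" "B \<noteq> {}" "A \<inter> B = {}" "a \<noteq> b"
 shows "A = {a} \<and> B = {b} \<or> A = {b} \<and> B = {a}"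
proof -
 have "A = {x} \<and> B = {y}" if x: "x \<in> A" and xy: "{a, b} = {x, y}" for x y
 proof -
  have "B \<subseteq> {y}" using assms(1,4) x unfolding xy by auto
  then have B: "B = {y}" using assms(3) by auto
  then have "A \<subseteq> {x}" using assms(1,4) unfolding xy by auto
  then show ?thesis using x B by auto
 qed
 moreover have "a \<in> A \<or> b \<in> A" using assms(1,2) by auto
 moreover have "{a, b} = {b, a}" by auto
 ultimately show ?thesis by blast
qed

text \<open>The composition with the one block \<open>{a, b}\<close> arises by merging in two ways only, from the two
 orders of \<open>a\<close> and \<open>b\<close>; so its differential is, up to sign, the sum of these two linear orders.\<close>

lemma merge_to_doubleton:
 assumes G: "G \<in> compositions I" and i: "1 \<le> i" "i < length G" and ab: "a \<noteq> b"
 shows "merge_blocks i G = map (\<lambda>i. {i}) u @ [{a, b}] @ map (\<lambda>i. {i}) v \<longleftrightarrow> i = Suc (length u) \<and>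
  (G = map (\<lambda>i. {i}) (u @ [a, b] @ v) \<or> G = map (\<lambda>i. {i}) (u @ [b, a] @ v))"
  (is "_ = ?H \<longleftrightarrow> _")
proof
 let ?A = "G ! (i - 1)" and ?B = "G ! i"
 have s: "G = take (i - 1) G @ [?A, ?B] @ drop (i + 1) G" using split_blocks[of i G] i by simp
 have ne: "?A \<noteq> {}" "?B \<noteq> {}" using G i by (auto simp: compositions_iff) (metis less_imp_diff_less nth_mem)+
 have dis: "?A \<inter> ?B = {}"
  using G i sorted_wrt_nth_less[of "\<lambda>A B. A \<inter> B = {}" G "i - 1" i] by (auto simp: compositions_iff)
 assume eq: "merge_blocks i G = ?H"
 then have eq': "take (i - 1) G @ [?A \<union> ?B] @ drop (i + 1) G = ?H" by (simp add: merge_blocks_def)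
 have len: "length (take (i - 1) G) = i - 1" using i by simp
 have lenH: "i - 1 < length ?H" using arg_cong[OF eq', of length] i by simp
 have nth: "?H ! (i - 1) = ?A \<union> ?B" unfolding eq'[symmetric]
  using nth_append_length[of "take (i - 1) G" "?A \<union> ?B" "drop (i + 1) G", unfolded len] by (simp only: append_Cons append_Nil)
 have k: "i - 1 = length u"
 proof (rule ccontr)
  assume ni: "i - 1 \<noteq> length u"
  have "\<exists>c. ?H ! (i - 1) = {c}"
  proof (cases "i - 1 < length u")
   case True
   then show ?thesis by (simp add: nth_append)
  next
   case False
   then obtain j where j: "i - 1 = length u + Suc j" using ni by (metis add_Suc_right less_imp_Suc_add linorder_neqE_nat)
   then have "j < length v" using lenH by simp
   then show ?thesis unfolding j by (simp add: nth_append)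
  qed
  then obtain c where "?A \<union> ?B = {c}" using nth by auto
  then show False using ne dis by (auto simp: Un_singleton_iff)
 qed
 have T: "take (i - 1) G = map (\<lambda>i. {i}) u" and tl: "[?A \<union> ?B] @ drop (i + 1) G = [{a, b}] @ map (\<lambda>i. {i}) v"
  using eq' len k by (simp_all add: append_eq_append_conv)
 have AB: "?A \<union> ?B = {a, b}" and D: "drop (i + 1) G = map (\<lambda>i. {i}) v" using tl by simp_all
 have "?A = {a} \<and> ?B = {b} \<or> ?A = {b} \<and> ?B = {a}" by (rule split_doubleton[OF AB ne dis ab])
 then have "G = map (\<lambda>i. {i}) u @ [{a}, {b}] @ map (\<lambda>i. {i}) v \<or> G = map (\<lambda>i. {i}) u @ [{b}, {a}] @ map (\<lambda>i. {i}) v"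
  using s unfolding T D by auto
 moreover have "i = Suc (length u)" using k i(1) by simp
 ultimately show "i = Suc (length u) \<and>
   (G = map (\<lambda>i. {i}) (u @ [a, b] @ v) \<or> G = map (\<lambda>i. {i}) (u @ [b, a] @ v))" by simp
next
 assume R: "i = Suc (length u) \<and>
  (G = map (\<lambda>i. {i}) (u @ [a, b] @ v) \<or> G = map (\<lambda>i. {i}) (u @ [b, a] @ v))"
 have "{b, a} = {a, b}" by auto
 then show "merge_blocks i G = ?H"
  using R merge_blocks_append[of "map (\<lambda>i. {i}) u" "{a}" "{b}" "map (\<lambda>i. {i}) v"]
   merge_blocks_append[of "map (\<lambda>i. {i}) u" "{b}" "{a}" "map (\<lambda>i. {i}) v"] by auto
qed

lemma lin_order_class_adjacent:
 assumes w: "distinct (u @ [a, b] @ v)"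
 shows "loc (u @ [a, b] @ v) =
  \<ominus>\<^bsub>Ed (set (u @ [a, b] @ v))\<^esub> loc (u @ [b, a] @ v)"
proof -
 define I where "I = set (u @ [a, b] @ v)"
 let ?S = "map (\<lambda>i. {i})"
 let ?G1 = "?S (u @ [a, b] @ v)" and ?G2 = "?S (u @ [b, a] @ v)" and ?H = "?S u @ [{a, b}] @ ?S v"
 let ?k = "Suc (length u)"
 have I: "finite I" by (simp add: I_def)
 have I2: "set (u @ [b, a] @ v) = I" and w2: "distinct (u @ [b, a] @ v)" using w by (auto simp: I_def)
 have ab: "a \<noteq> b" using w by simp
 have G: "?G1 \<in> compositions I" "?G2 \<in> compositions I"
  using singletons_composition[OF w] singletons_composition[OF w2] I2 by (simp_all add: I_def)
 have card: "card I = length (u @ [a, b] @ v)" unfolding I_def by (rule distinct_card[OF w])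
 have H: "?H \<in> compositions I"
  using merge_blocks_composition[of ?k ?G1 I] G(1) merge_blocks_append[of "?S u" "{a}" "{b}" "?S v"]
  by (simp add: insert_is_Un[of a "{b}"] del: insert_is_Un)
 have h: "bas ?H \<in> carrier (omega R I (0 - 1))"
  by (rule omegaI[OF I]) (use H card in \<open>auto simp: basis_vec_def\<close>)
 define e where "e = [((-1 :: int) ^ ?k)] \<cdot> \<one>"
 have "e = (if even ?k then \<one> else \<ominus> \<one>)" unfolding e_def by (rule signed_multiple) simp
 then have "e = \<one> \<or> e = \<ominus> \<one>" by presburger
 then have ee: "e \<in> carrier R" "e \<otimes> e = \<one>" by (auto simp: l_minus)
 have diff: "omega_diff R I (bas ?H) F = (if F = ?G1 \<or> F = ?G2 then e else \<zero>)" for F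
 proof (cases "F \<in> compositions I")
  case True
  have "omega_diff R I (bas ?H) F =
    alt_sum R {1..<length F} (\<lambda>i. bas ?H (merge_blocks i F))"
   using omega_diff_apply[OF I h] True by simp
  also have "\<dots> = alt_sum R {1..<length F} (\<lambda>i. if i = ?k \<and> (F = ?G1 \<or> F = ?G2) then \<one> else \<zero>)"
  proof (rule alt_sum_cong)
   fix i assume "i \<in> {1..<length F}"
   then show "bas ?H (merge_blocks i F) = (if i = ?k \<and> (F = ?G1 \<or> F = ?G2) then \<one> else \<zero>)"
    using merge_to_doubleton[OF True _ _ ab, of i u v] by (simp add: basis_vec_def)
  qed simp
  also have "\<dots> = (if F = ?G1 \<or> F = ?G2 then e else \<zero>)"
  proof (cases "F = ?G1 \<or> F = ?G2")
   case G12: True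
   then have "?k \<in> {1..<length F}" by auto
   then have "alt_sum R {1..<length F} (\<lambda>i. if i = ?k \<and> (F = ?G1 \<or> F = ?G2) then \<one> else \<zero>) =
     [((-1 :: int) ^ ?k)] \<cdot> (if ?k = ?k \<and> (F = ?G1 \<or> F = ?G2) then \<one> else \<zero>)"
    by (rule alt_sum_single) auto
   then show ?thesis using G12 by (simp only: e_def if_True simp_thms)
  next
   case False
   then show ?thesis by (simp only: False simp_thms if_False) (rule alt_sum_zero, rule refl)
  qed
  finally show ?thesis .
 next
  case False
  then show ?thesis using omega_diff_apply[OF I h, of F] G by auto
 qed
 interpret Q: quotient_module R "omega R I 0" "cobd I 0" by (rule omega_quotient[OF I])
 have "omega_diff R I (bas ?H) \<in> cobd I 0"
  using h by (auto simp: omega_coboundaries_def)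
 from Q.H_smult[OF ee(1) this]
 have "(\<lambda>F. e \<otimes> omega_diff R I (bas ?H) F) \<in> cobd I 0" by (simp add: omega_simps)
 moreover have "(\<lambda>F. e \<otimes> omega_diff R I (bas ?H) F) = (\<lambda>F. bas ?G1 F \<oplus> bas ?G2 F)"
  using ee ab unfolding diff by (auto simp: basis_vec_def fun_eq_iff)
 ultimately have co: "(\<lambda>F. bas ?G1 F \<oplus> bas ?G2 F) \<in> cobd I 0" by simp
 have b1: "bas ?G1 \<in> carrier (omega R I 0)" and b2: "bas ?G2 \<in> carrier (omega R I 0)"
  using G card by (auto intro!: omegaI[OF I] simp: basis_vec_def)
 have b12: "(\<lambda>F. bas ?G1 F \<oplus> bas ?G2 F) \<in> carrier (omega R I 0)" by (rule Q.H_closed[OF co])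
 interpret E: module R "Ed I" by (rule exp_dual_simps(5)[OF I])
 have L: "loc (u @ [a, b] @ v) = dcl I (bas ?G1)"
  "loc (u @ [b, a] @ v) = dcl I (bas ?G2)"
  unfolding lin_order_class_def I2 by (simp_all only: I_def)
 have "loc (u @ [a, b] @ v) \<oplus>\<^bsub>Ed I\<^esub> loc (u @ [b, a] @ v) =
   \<zero>\<^bsub>Ed I\<^esub>"
  unfolding L exp_dual_simps(3)[OF I b1 b2] using dual_class_zero[OF I b12] co by simp
 moreover have "loc (u @ [a, b] @ v) \<in> carrier (Ed I)"
  "loc (u @ [b, a] @ v) \<in> carrier (Ed I)"
  unfolding L using dual_class_in[OF I b1] dual_class_in[OF I b2] by auto
 ultimately show ?thesis unfolding I_def[symmetric] using E.M.minus_equality by simp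
qed

text \<open>Three neighbouring exchanges move the element \<open>x\<close> out of the way and back again, which leaves the
 sign \<open>- 1\<close>.\<close>

lemma lin_order_class_exchange:
 assumes "distinct (u @ [a] @ m @ [b] @ v)"
 shows "loc (u @ [a] @ m @ [b] @ v) =
  \<ominus>\<^bsub>Ed (set (u @ [a] @ m @ [b] @ v))\<^esub> loc (u @ [b] @ m @ [a] @ v)"
 using assms
proof (induction m arbitrary: u)
 case Nil
 then show ?case using lin_order_class_adjacent[of u a b v] by simp
next
 case (Cons x m)
 let ?I = "set (u @ [a] @ (x # m) @ [b] @ v)"
 interpret E: module R "Ed ?I" by (rule exp_dual_simps(5)) simp
 have "loc (u @ [a, x] @ m @ [b] @ v) =
   \<ominus>\<^bsub>Ed ?I\<^esub> loc ((u @ [x]) @ [a] @ m @ [b] @ v)"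
  using lin_order_class_adjacent[of u a x "m @ [b] @ v"] Cons.prems by (simp add: insert_commute)
 also have "loc ((u @ [x]) @ [a] @ m @ [b] @ v) =
   \<ominus>\<^bsub>Ed ?I\<^esub> loc (u @ [x, b] @ m @ [a] @ v)"
  using Cons.IH[of "u @ [x]"] Cons.prems by (simp add: insert_commute)
 also have "loc (u @ [x, b] @ m @ [a] @ v) =
   \<ominus>\<^bsub>Ed ?I\<^esub> loc (u @ [b, x] @ m @ [a] @ v)"
 proof -
  have "set (u @ [x, b] @ m @ [a] @ v) = ?I" by auto
  then show ?thesis using lin_order_class_adjacent[of u x b "m @ [a] @ v"] Cons.prems by auto
 qed
 also have "\<ominus>\<^bsub>Ed ?I\<^esub> (\<ominus>\<^bsub>Ed ?I\<^esub> (\<ominus>\<^bsub>Ed ?I\<^esub>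
   loc (u @ [b, x] @ m @ [a] @ v))) =
   \<ominus>\<^bsub>Ed ?I\<^esub> loc (u @ [b, x] @ m @ [a] @ v)"
 proof -
  have "set (u @ [b, x] @ m @ [a] @ v) = ?I" "distinct (u @ [b, x] @ m @ [a] @ v)" using Cons.prems by auto
  then have "loc (u @ [b, x] @ m @ [a] @ v) \<in> carrier (Ed ?I)"
   using lin_order_class_in by metis
  then show ?thesis by (rule E.M.minus_minus[OF E.M.a_inv_closed])
 qed
 finally show ?case by simp
qed

lemma lin_order_class_transpose:
 assumes w: "distinct w" "a \<in> set w" "b \<in> set w" "a \<noteq> b"
 shows "loc (map (Transposition.transpose a b) w) = \<ominus>\<^bsub>Ed (set w)\<^esub> loc w"
proof -
 interpret E: module R "Ed (set w)" by (rule exp_dual_simps(5)) simp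
 have main: "loc (map (Transposition.transpose a b) w) = \<ominus>\<^bsub>Ed (set w)\<^esub> loc w"
  if ww: "w = u @ [x] @ m @ [y] @ v" and xy: "x = a \<and> y = b \<or> x = b \<and> y = a" for u m v x y
 proof -
  have id: "map (Transposition.transpose a b) t = t" if "set t \<subseteq> set u \<union> set m \<union> set v" for t
  proof (rule map_idI)
   fix c assume "c \<in> set t"
   then have "c \<noteq> a" "c \<noteq> b" using that w(1) ww xy by auto
   then show "Transposition.transpose a b c = c" by (simp add: transpose_apply_other)
  qed
  have "map (Transposition.transpose a b) w = u @ [y] @ m @ [x] @ v"
   using xy id[of u] id[of m] id[of v] ww by auto
  moreover have L: "loc (u @ [y] @ m @ [x] @ v) \<in> carrier (Ed (set w))"
  proof -
   have "distinct (u @ [y] @ m @ [x] @ v)" "set (u @ [y] @ m @ [x] @ v) = set w" using w(1) ww by auto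
   then show ?thesis using lin_order_class_in by metis
  qed
  moreover have "loc w =
    \<ominus>\<^bsub>Ed (set w)\<^esub> loc (u @ [y] @ m @ [x] @ v)"
   unfolding ww by (rule lin_order_class_exchange) (use w(1) ww in simp)
  ultimately show ?thesis by (simp only: E.M.minus_minus[OF L])
 qed
 obtain u v where uv: "w = u @ a # v" "a \<notin> set u" using split_list_first[OF w(2)] by blast
 show ?thesis
 proof (cases "b \<in> set u")
  case True
  then obtain u1 u2 where "u = u1 @ b # u2" by (meson split_list)
  then show ?thesis using main[of u1 b u2 a v] uv(1) by simp
 next
  case False
  then have "b \<in> set v" using w(3,4) uv(1) by auto
  then obtain v1 v2 where "v = v1 @ b # v2" by (meson split_list)
  then show ?thesis using main[of u a v1 b v2] uv(1) by simp
 qed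
qed

lemma lin_order_class_permuted:
 assumes \<sigma>: "\<sigma> permutes I" and w: "distinct w" "set w = I"
 shows "loc (map \<sigma> w) = ([sign \<sigma>] \<cdot> \<one>) \<odot>\<^bsub>Ed I\<^esub> loc w"
proof -
 have I: "finite I" using w by auto
 interpret E: module R "Ed I" by (rule exp_dual_simps(5)[OF I])
 have L: "loc w \<in> carrier (Ed I)" using lin_order_class_in[OF w(1)] w(2) by simp
 show ?thesis using \<sigma> I
 proof (induction rule: permutes_induct)
  case id
  then show ?case using L by simp
 next
  case (swap a b \<sigma>)
  have w': "distinct (map \<sigma> w)" "set (map \<sigma> w) = I"
   using w permutes_inj_on[OF swap(4)] permutes_image[OF swap(4)] by (auto simp: distinct_map)
  have "sign (Transposition.transpose a b \<circ> \<sigma>) = - sign \<sigma>"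
   using sign_compose[OF permutation_swap_id permutation_permutes[THEN iffD2], of \<sigma> a b] swap(3,4) I
   by (auto simp: sign_swap_id)
  then have s: "[sign (Transposition.transpose a b \<circ> \<sigma>)] \<cdot> \<one> = \<ominus> ([sign \<sigma>] \<cdot> \<one>)"
   by (simp add: sign_def add_pow_int_lt)
  have "loc (map (Transposition.transpose a b \<circ> \<sigma>) w) =
    \<ominus>\<^bsub>Ed I\<^esub> loc (map \<sigma> w)"
   using lin_order_class_transpose[OF w'(1), of a b] swap(1-3) w'(2) by simp
  also have "\<dots> = (\<ominus> ([sign \<sigma>] \<cdot> \<one>)) \<odot>\<^bsub>Ed I\<^esub> loc w"
   using L by (simp add: swap(5) E.smult_l_minus)
  finally show ?case by (simp only: s)
 qed
qed

lemma exp_dual_map_order: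
 assumes I: "finite I" and \<sigma>: "\<sigma> permutes I" and w: "distinct w" "set w = I"
 shows "sp_map (exp_dual R) I \<sigma> (loc w) =
  ([sign \<sigma>] \<cdot> \<one>) \<odot>\<^bsub>Ed I\<^esub> loc w"
proof -
 let ?S = "map (\<lambda>i. {i})"
 have inj: "inj_on \<sigma> I" and im: "\<sigma> ` I = I" using permutes_inj_on[OF \<sigma>] permutes_image[OF \<sigma>] by auto
 have b: "bas (?S w) \<in> carrier (omega R I 0)"
  using standard_vec(1)[OF w] blocks_order_pos[OF w(1)] by (simp add: standard_vec_def)
 have "relabel \<sigma> I (bas (?S w)) = bas (?S (map \<sigma> w))"
 proof
  fix F
  have "unperm \<sigma> F = ?S w \<longleftrightarrow> F = map (image \<sigma>) (?S w)"
   using permuted_inverse[OF \<sigma>] by metis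
  then show "relabel \<sigma> I (bas (?S w)) F = bas (?S (map \<sigma> w)) F"
   unfolding relabel_permutation[OF I \<sigma> b] by (simp add: basis_vec_def comp_def)
 qed
 then have "sp_map (exp_dual R) I \<sigma> (loc w) = loc (map \<sigma> w)"
  using exp_dual_map[OF I inj b] im w(2) by (simp add: lin_order_class_def)
 then show ?thesis using lin_order_class_permuted[OF \<sigma> w] by simp
qed

end

section \<open>The Koszul complex\<close>

context exp_bicomodule
begin

lemma cochains_complex: "cochain_complex R (Coch) (cdiff)"
 unfolding cochain_complex_def
proof (intro conjI allI ballI)
 show "module R (Coch n)" for n by (rule cochains_module)
 show "cdiff n \<in> lin_hom R (Coch n) (Coch (Suc n))" for n
  by (rule lin_homI)
   (use cochain_diff_closed cochain_diff_linear in \<open>auto simp: cochain_diff_def\<close>)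
 show "cdiff (Suc n) (cdiff n x) = \<zero>\<^bsub>Coch (Suc (Suc n))\<^esub>"
  if "x \<in> carrier (Coch n)" for n x
  by (rule cochain_diff_square[OF that])
qed

text \<open>All properties are inherited from the cochains along the surjective comparison map.\<close>

lemma koszul_complex:
 assumes wp: "weakly_projective R X"
 shows "cochain_complex R (Kos) (kdiff)"
 unfolding cochain_complex_def
proof (intro conjI allI ballI)
 let ?d = "kdiff"
 show "module R (Kos n)" for n by (rule koszul_module)
 show "?d n \<in> lin_hom R (Kos n) (Kos (Suc n))" for n
 proof (rule lin_homI)
  interpret C: module R "Coch n" by (rule cochains_module)
  fix \<phi> assume \<phi>: "\<phi> \<in> carrier (Kos n)"
  obtain \<alpha> where \<alpha>: "\<alpha> \<in> carrier (Coch n)" "top_class n \<alpha> = \<phi>"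
   using top_class_surjective[OF wp \<phi>] by blast
  note \<delta>\<alpha> = cochain_diff_closed[OF \<alpha>(1)]
  note d\<phi> = koszul_diff_top_class[OF \<alpha>(1), unfolded \<alpha>(2)]
  show "?d n \<phi> \<in> carrier (Kos (Suc n))" unfolding d\<phi> by (rule top_class_in[OF \<delta>\<alpha>])
  show "?d n (\<phi> \<oplus>\<^bsub>Kos n\<^esub> \<psi>) = ?d n \<phi> \<oplus>\<^bsub>Kos (Suc n)\<^esub> ?d n \<psi>"
   if \<psi>: "\<psi> \<in> carrier (Kos n)" for \<psi>
  proof -
   obtain \<beta> where \<beta>: "\<beta> \<in> carrier (Coch n)" "top_class n \<beta> = \<psi>"
    using top_class_surjective[OF wp \<psi>] by blast
   show ?thesis
    unfolding d\<phi> koszul_diff_top_class[OF \<beta>(1), unfolded \<beta>(2)]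
    using koszul_diff_top_class[OF C.M.a_closed[OF \<alpha>(1) \<beta>(1)]] top_class_linear(1)[OF \<alpha>(1) \<beta>(1)]
     cochain_diff_linear(1)[OF \<alpha>(1) \<beta>(1)] top_class_linear(1)[OF \<delta>\<alpha> cochain_diff_closed[OF \<beta>(1)]] \<alpha>(2) \<beta>(2)
    by simp
  qed
  show "?d n (c \<odot>\<^bsub>Kos n\<^esub> \<phi>) = c \<odot>\<^bsub>Kos (Suc n)\<^esub> ?d n \<phi>" if c: "c \<in> carrier R" for c
   unfolding d\<phi>
   using koszul_diff_top_class[OF C.smult_closed[OF c \<alpha>(1)]] top_class_linear(2)[OF \<alpha>(1) c]
    cochain_diff_linear(2)[OF \<alpha>(1) c] top_class_linear(2)[OF \<delta>\<alpha> c] \<alpha>(2) by simp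
 next
  show "?d n \<phi> = undefined" if "\<phi> \<notin> carrier (Kos n)" for \<phi>
   using that by (simp add: koszul_diff_def)
 qed
 show "?d (Suc n) (?d n \<phi>) = \<zero>\<^bsub>Kos (Suc (Suc n))\<^esub>" if \<phi>: "\<phi> \<in> carrier (Kos n)" for n \<phi>
 proof -
  obtain \<alpha> where \<alpha>: "\<alpha> \<in> carrier (Coch n)" "top_class n \<alpha> = \<phi>"
   using top_class_surjective[OF wp \<phi>] by blast
  show ?thesis
   unfolding \<alpha>(2)[symmetric] koszul_diff_top_class[OF \<alpha>(1)]
    koszul_diff_top_class[OF cochain_diff_closed[OF \<alpha>(1)]] cochain_diff_square[OF \<alpha>(1)]
   by (rule top_class_zero)
 qed
qed

lemma koszul_cohomology:
 assumes wp: "weakly_projective R X"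
 shows "\<exists>h. h \<in> lin_iso R (cohomology (Kos) (kdiff) p)
  (cohomology (Coch) (cdiff) p)"
proof (rule cohomology_iso[where f = top_class, OF cochains_complex koszul_complex[OF wp]])
 show "top_class (Suc n) (cdiff n x) = kdiff n (top_class n x)"
  if "x \<in> carrier (Coch n)" for n x
  by (rule koszul_diff_top_class[OF that, symmetric])
 show "\<exists>x\<in>carrier (Coch n). top_class n x = y" if "y \<in> carrier (Kos n)" for n y
  by (rule top_class_surjective[OF wp that])
 show "\<exists>y\<in>carrier (Coch n). cdiff n y = x \<and> top_class n y = \<zero>\<^bsub>Kos n\<^esub>"
  if "x \<in> carrier (Coch (Suc n))"
   "cdiff (Suc n) x = \<zero>\<^bsub>Coch (Suc (Suc n))\<^esub>"
   "top_class (Suc n) x = \<zero>\<^bsub>Kos (Suc n)\<^esub>" for n x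
  by (rule kernel_acyclic[OF wp that])
 show "top_class n (c \<odot>\<^bsub>Coch n\<^esub> x) = c \<odot>\<^bsub>Kos n\<^esub> top_class n x"
  if "c \<in> carrier R" "x \<in> carrier (Coch n)" for n c x
  by (rule top_class_linear(2)[OF that(2,1)])
qed (fact top_class_in top_class_linear(1) kernel_degree_zero)+

definition order_coeff :: "nat => (nat set list => 'k) set => 'k" where
 "order_coeff p \<xi> =
   (THE c. c \<in> carrier R \<and> \<xi> = c \<odot>\<^bsub>Ed {1..p}\<^esub> loc [1..<Suc p])"

lemma standard_order: "distinct [1..<Suc p]" "set [1..<Suc p] = {1..p}"
 by (auto simp del: upt_Suc)

lemma order_coeff:
 assumes "\<xi> \<in> carrier (Ed {1..p})"
 shows "order_coeff p \<xi> \<in> carrier R"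
  and "\<xi> = order_coeff p \<xi> \<odot>\<^bsub>Ed {1..p}\<^esub> loc [1..<Suc p]"
 using theI'[OF lin_order_class_basis[OF standard_order assms]] by (simp_all only: order_coeff_def)

lemma order_coeff_eqI:
 assumes c: "c \<in> carrier R" and \<xi>: "\<xi> = c \<odot>\<^bsub>Ed {1..p}\<^esub> loc [1..<Suc p]"
 shows "order_coeff p \<xi> = c"
proof -
 have N: "finite {1..p}" by simp
 interpret E: module R "Ed {1..p}" by (rule exp_dual_simps(5)[OF N])
 have "loc [1..<Suc p] \<in> carrier (Ed {1..p})"
  using lin_order_class_in[OF standard_order(1)] by (simp only: standard_order(2))
 then have \<xi>_in: "\<xi> \<in> carrier (Ed {1..p})" using c \<xi> by simp
 show ?thesis
  using lin_order_class_basis[OF standard_order \<xi>_in] order_coeff[OF \<xi>_in] c \<xi> by blast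
qed

text \<open>A morphism in \<open>K\<^sup>p(X)\<close> is determined by its component at \<open>{1..p}\<close>, and \<open>E\<^sup>![p]\<close> is the sign
 representation with the class of \<open>1 < \<dots> < p\<close> as its generator. Surjectivity uses that an equivariant map on
 \<open>X[p]\<close> extends to a morphism of species, here as the top class of a lifted cochain.\<close>

theorem koszul_sign_representation:
 assumes wp: "weakly_projective R X"
 shows "\<exists>\<Psi> \<in> lin_iso R (Kos p)
   (rep_hom R p (XV {1..p}) (sp_map X {1..p}) (regular_module R) (sgn_act R)).
  \<forall>\<phi>\<in>carrier (Kos p). \<forall>z\<in>carrier (XV {1..p}).
   \<phi> {1..p} z = \<Psi> \<phi> z \<odot>\<^bsub>Ed {1..p}\<^esub> loc [1..<Suc p]"
proof -
 let ?N = "{1..p}"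
 let ?M = "XV ?N" and ?E = "Ed ?N" and ?L = "loc [1..<Suc p]"
 let ?H = "rep_hom R p ?M (sp_map X ?N) (regular_module R) (sgn_act R)"
 have N: "finite ?N" by simp
 interpret M: module R ?M by (rule val_module[OF N])
 interpret E: module R ?E by (rule exp_dual_simps(5)[OF N])
 have L: "?L \<in> carrier ?E"
  using lin_order_class_in[OF standard_order(1)] by (simp only: standard_order(2))
 have reg: "carrier (regular_module R) = carrier R" "x \<oplus>\<^bsub>regular_module R\<^esub> y = x \<oplus> y"
  "c \<odot>\<^bsub>regular_module R\<^esub> x = c \<otimes> x" for x y c by (simp_all add: regular_module_def)
 have rep: "carrier ?H = {f \<in> lin_hom R ?M (regular_module R).
   \<forall>\<sigma>. \<sigma> permutes ?N --> (\<forall>x\<in>carrier ?M. f (sp_map X ?N \<sigma> x) = sgn_act R \<sigma> (f x))}"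
  "f \<oplus>\<^bsub>?H\<^esub> g = (\<lambda>x\<in>carrier ?M. f x \<oplus> g x)" "c \<odot>\<^bsub>?H\<^esub> f = (\<lambda>x\<in>carrier ?M. c \<otimes> f x)" for f g c
  by (simp_all add: rep_hom_def hom_module_def reg)
 have sgn: "sgn_act R \<sigma> c = c \<otimes> ([sign \<sigma>] \<cdot> \<one>)" if "c \<in> carrier R" for \<sigma> c
  using that by (simp add: sgn_act_def sign_def add_pow_int_lt r_minus)
 have act: "sp_map (exp_dual R) ?N \<sigma> (c \<odot>\<^bsub>?E\<^esub> ?L) = sgn_act R \<sigma> c \<odot>\<^bsub>?E\<^esub> ?L"
  if \<sigma>: "\<sigma> permutes ?N" and c: "c \<in> carrier R" for \<sigma> c
 proof -
  have hom: "sp_map (exp_dual R) ?N \<sigma> \<in> lin_hom R ?E (Ed (\<sigma> ` ?N))"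
   by (rule linear_relabellingD(3)[OF linear_relabelling_exp_dual N permutes_inj_on[OF \<sigma>]])
  have s: "[sign \<sigma>] \<cdot> \<one> \<in> carrier R" by simp
  have "sp_map (exp_dual R) ?N \<sigma> (c \<odot>\<^bsub>?E\<^esub> ?L) = c \<odot>\<^bsub>?E\<^esub> sp_map (exp_dual R) ?N \<sigma> ?L"
   using lin_homD(3)[OF hom c L] permutes_image[OF \<sigma>] by simp
  also have "\<dots> = c \<odot>\<^bsub>?E\<^esub> (([sign \<sigma>] \<cdot> \<one>) \<odot>\<^bsub>?E\<^esub> ?L)"
   by (simp only: exp_dual_map_order[OF N \<sigma> standard_order])
  also have "\<dots> = sgn_act R \<sigma> c \<odot>\<^bsub>?E\<^esub> ?L" unfolding sgn[OF c] by (rule E.smult_assoc1[OF c s L, symmetric])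
  finally show ?thesis .
 qed
 have kos: "\<phi> \<in> carrier (HomEd)" if "\<phi> \<in> carrier (Kos p)" for \<phi>
  using that by (simp add: koszul_carrier)
 note val = species_homD(1)[OF kos N]
 define \<Psi> where "\<Psi> = (\<lambda>\<phi>\<in>carrier (Kos p). \<lambda>z\<in>carrier ?M. order_coeff p (\<phi> ?N z))"
 have \<Psi>: "\<Psi> \<phi> z \<in> carrier R" "\<phi> ?N z = \<Psi> \<phi> z \<odot>\<^bsub>?E\<^esub> ?L"
  if "\<phi> \<in> carrier (Kos p)" "z \<in> carrier ?M" for \<phi> z
  using order_coeff[OF val[OF that]] that by (simp_all add: \<Psi>_def del: upt_Suc)
 have \<Psi>_eqI: "\<Psi> \<phi> z = c"
  if "\<phi> \<in> carrier (Kos p)" "z \<in> carrier ?M" "c \<in> carrier R" "\<phi> ?N z = c \<odot>\<^bsub>?E\<^esub> ?L" for \<phi> z c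
  using order_coeff_eqI[OF that(3,4)] that(1,2) by (simp add: \<Psi>_def)
 have \<Psi>_in: "\<Psi> \<phi> \<in> carrier ?H" if \<phi>: "\<phi> \<in> carrier (Kos p)" for \<phi>
  unfolding rep(1)
 proof (intro CollectI conjI allI impI ballI)
  note D = species_homD[OF kos[OF \<phi>] N]
  show "\<Psi> \<phi> \<in> lin_hom R ?M (regular_module R)"
  proof (rule lin_homI, unfold reg)
   fix z assume z: "z \<in> carrier ?M"
   show "\<Psi> \<phi> z \<in> carrier R" by (rule \<Psi>(1)[OF \<phi> z])
   show "\<Psi> \<phi> (z \<oplus>\<^bsub>?M\<^esub> w) = \<Psi> \<phi> z \<oplus> \<Psi> \<phi> w" if w: "w \<in> carrier ?M" for w
   proof (rule \<Psi>_eqI[OF \<phi> M.M.a_closed[OF z w]])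
    show "\<Psi> \<phi> z \<oplus> \<Psi> \<phi> w \<in> carrier R" using \<Psi>(1)[OF \<phi> z] \<Psi>(1)[OF \<phi> w] by simp
    have "\<phi> ?N (z \<oplus>\<^bsub>?M\<^esub> w) = \<phi> ?N z \<oplus>\<^bsub>?E\<^esub> \<phi> ?N w" by (rule D(2)[OF z w])
    also have "\<dots> = \<Psi> \<phi> z \<odot>\<^bsub>?E\<^esub> ?L \<oplus>\<^bsub>?E\<^esub> \<Psi> \<phi> w \<odot>\<^bsub>?E\<^esub> ?L"
     using \<Psi>(2)[OF \<phi> z] \<Psi>(2)[OF \<phi> w] by simp
    finally show "\<phi> ?N (z \<oplus>\<^bsub>?M\<^esub> w) = (\<Psi> \<phi> z \<oplus> \<Psi> \<phi> w) \<odot>\<^bsub>?E\<^esub> ?L"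
     using E.smult_l_distr[OF \<Psi>(1)[OF \<phi> z] \<Psi>(1)[OF \<phi> w] L] by simp
   qed
   show "\<Psi> \<phi> (c \<odot>\<^bsub>?M\<^esub> z) = c \<otimes> \<Psi> \<phi> z" if c: "c \<in> carrier R" for c
   proof (rule \<Psi>_eqI[OF \<phi> M.smult_closed[OF c z]])
    show "c \<otimes> \<Psi> \<phi> z \<in> carrier R" using c \<Psi>(1)[OF \<phi> z] by simp
    have "\<phi> ?N (c \<odot>\<^bsub>?M\<^esub> z) = c \<odot>\<^bsub>?E\<^esub> \<phi> ?N z" by (rule D(3)[OF c z])
    also have "\<dots> = c \<odot>\<^bsub>?E\<^esub> (\<Psi> \<phi> z \<odot>\<^bsub>?E\<^esub> ?L)" using \<Psi>(2)[OF \<phi> z] by simp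
    finally show "\<phi> ?N (c \<odot>\<^bsub>?M\<^esub> z) = (c \<otimes> \<Psi> \<phi> z) \<odot>\<^bsub>?E\<^esub> ?L"
     using E.smult_assoc1[OF c \<Psi>(1)[OF \<phi> z] L] by simp
   qed
  next
   show "\<Psi> \<phi> z = undefined" if "z \<notin> carrier ?M" for z using \<phi> that by (simp add: \<Psi>_def)
  qed
  fix \<sigma> z assume \<sigma>: "\<sigma> permutes ?N" and z: "z \<in> carrier ?M"
  have inj: "inj_on \<sigma> ?N" and im: "\<sigma> ` ?N = ?N" using permutes_inj_on[OF \<sigma>] permutes_image[OF \<sigma>] by auto
  show "\<Psi> \<phi> (sp_map X ?N \<sigma> z) = sgn_act R \<sigma> (\<Psi> \<phi> z)"
  proof (rule \<Psi>_eqI[OF \<phi>])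
   show "sp_map X ?N \<sigma> z \<in> carrier ?M" using carrier_map[OF N inj z] by (simp only: im)
   show "sgn_act R \<sigma> (\<Psi> \<phi> z) \<in> carrier R" using \<Psi>(1)[OF \<phi> z] by (simp add: sgn)
   have "\<phi> ?N (sp_map X ?N \<sigma> z) = sp_map (exp_dual R) ?N \<sigma> (\<phi> ?N z)" using D(4)[OF inj z] by (simp only: im)
   also have "\<dots> = sp_map (exp_dual R) ?N \<sigma> (\<Psi> \<phi> z \<odot>\<^bsub>?E\<^esub> ?L)" using \<Psi>(2)[OF \<phi> z] by simp
   finally show "\<phi> ?N (sp_map X ?N \<sigma> z) = sgn_act R \<sigma> (\<Psi> \<phi> z) \<odot>\<^bsub>?E\<^esub> ?L"
    by (simp only: act[OF \<sigma> \<Psi>(1)[OF \<phi> z]])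
  qed
 qed
 interpret K: module R "Kos p" by (rule koszul_module)
 have ext: "\<Psi> \<phi> = (\<lambda>z\<in>carrier ?M. c z)"
  if \<phi>: "\<phi> \<in> carrier (Kos p)" and c: "\<And>z. z \<in> carrier ?M ==> \<Psi> \<phi> z = c z" for \<phi> c
 proof
  show "\<Psi> \<phi> z = (\<lambda>z\<in>carrier ?M. c z) z" for z
   using c[of z] \<phi> by (cases "z \<in> carrier ?M") (simp_all add: \<Psi>_def)
 qed
 have "\<Psi> \<in> lin_hom R (Kos p) ?H"
 proof (rule lin_homI)
  fix \<phi> assume \<phi>: "\<phi> \<in> carrier (Kos p)"
  show "\<Psi> \<phi> \<in> carrier ?H" by (rule \<Psi>_in[OF \<phi>])
  show "\<Psi> (\<phi> \<oplus>\<^bsub>Kos p\<^esub> \<psi>) = \<Psi> \<phi> \<oplus>\<^bsub>?H\<^esub> \<Psi> \<psi>" if \<psi>: "\<psi> \<in> carrier (Kos p)" for \<psi>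
   unfolding rep(2)
  proof (rule ext[OF K.M.a_closed[OF \<phi> \<psi>]], rule \<Psi>_eqI[OF K.M.a_closed[OF \<phi> \<psi>]])
   fix z assume z: "z \<in> carrier ?M"
   show "z \<in> carrier ?M" by (rule z)
   show "\<Psi> \<phi> z \<oplus> \<Psi> \<psi> z \<in> carrier R" using \<Psi>(1)[OF \<phi> z] \<Psi>(1)[OF \<psi> z] by simp
   have "(\<phi> \<oplus>\<^bsub>Kos p\<^esub> \<psi>) ?N z = \<phi> ?N z \<oplus>\<^bsub>?E\<^esub> \<psi> ?N z"
    unfolding koszul_ops by (rule species_hom_ops(2)[OF N z])
   then show "(\<phi> \<oplus>\<^bsub>Kos p\<^esub> \<psi>) ?N z = (\<Psi> \<phi> z \<oplus> \<Psi> \<psi> z) \<odot>\<^bsub>?E\<^esub> ?L"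
    using E.smult_l_distr[OF \<Psi>(1)[OF \<phi> z] \<Psi>(1)[OF \<psi> z] L] \<Psi>(2)[OF \<phi> z] \<Psi>(2)[OF \<psi> z] by simp
  qed
  show "\<Psi> (c \<odot>\<^bsub>Kos p\<^esub> \<phi>) = c \<odot>\<^bsub>?H\<^esub> \<Psi> \<phi>" if c: "c \<in> carrier R" for c
   unfolding rep(3)
  proof (rule ext[OF K.smult_closed[OF c \<phi>]], rule \<Psi>_eqI[OF K.smult_closed[OF c \<phi>]])
   fix z assume z: "z \<in> carrier ?M"
   show "z \<in> carrier ?M" by (rule z)
   show "c \<otimes> \<Psi> \<phi> z \<in> carrier R" using c \<Psi>(1)[OF \<phi> z] by simp
   have "(c \<odot>\<^bsub>Kos p\<^esub> \<phi>) ?N z = c \<odot>\<^bsub>?E\<^esub> \<phi> ?N z"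
    unfolding koszul_ops by (rule species_hom_ops(3)[OF N z])
   then show "(c \<odot>\<^bsub>Kos p\<^esub> \<phi>) ?N z = (c \<otimes> \<Psi> \<phi> z) \<odot>\<^bsub>?E\<^esub> ?L"
    using E.smult_assoc1[OF c \<Psi>(1)[OF \<phi> z] L] \<Psi>(2)[OF \<phi> z] by simp
  qed
 next
  show "\<Psi> \<phi> = undefined" if "\<phi> \<notin> carrier (Kos p)" for \<phi> using that by (simp add: \<Psi>_def)
 qed
 moreover have "bij_betw \<Psi> (carrier (Kos p)) (carrier ?H)"
  unfolding bij_betw_def
 proof (intro conjI equalityI subsetI)
  show "inj_on \<Psi> (carrier (Kos p))"
  proof (rule inj_onI)
   fix \<phi> \<psi> assume \<phi>: "\<phi> \<in> carrier (Kos p)" and \<psi>: "\<psi> \<in> carrier (Kos p)" and eq: "\<Psi> \<phi> = \<Psi> \<psi>"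
   have agree: "\<phi> ?N z = \<psi> ?N z" if "z \<in> carrier ?M" for z
    using \<Psi>(2)[OF \<phi> that] \<Psi>(2)[OF \<psi> that] eq by simp
   show "\<phi> = \<psi>"
    by (rule koszul_ext[OF \<phi> \<psi>], rule species_hom_agree[OF kos[OF \<phi>] kos[OF \<psi>] agree])
  qed
  show "f \<in> carrier ?H" if f: "f \<in> \<Psi> ` carrier (Kos p)" for f using f \<Psi>_in by auto
  show "g \<in> \<Psi> ` carrier (Kos p)" if g: "g \<in> carrier ?H" for g
  proof -
   have gh: "g \<in> lin_hom R ?M (regular_module R)"
    and g\<sigma>: "g (sp_map X ?N \<sigma> z) = sgn_act R \<sigma> (g z)" if "\<sigma> permutes ?N" "z \<in> carrier ?M" for \<sigma> z
    using g that unfolding rep(1) by auto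
   have gh: "g \<in> lin_hom R ?M (regular_module R)" using g unfolding rep(1) by simp
   note G = lin_homD[OF gh, unfolded reg]
   have "\<exists>\<alpha>\<in>carrier (Coch p). \<forall>z\<in>carrier ?M. top_class p \<alpha> ?N z = g z \<odot>\<^bsub>?E\<^esub> ?L"
   proof (rule class_lift[OF wp])
    fix z assume z: "z \<in> carrier ?M"
    show "g z \<odot>\<^bsub>?E\<^esub> ?L \<in> carrier ?E" by (rule E.smult_closed[OF G(1)[OF z] L])
    show "g (z \<oplus>\<^bsub>?M\<^esub> w) \<odot>\<^bsub>?E\<^esub> ?L = g z \<odot>\<^bsub>?E\<^esub> ?L \<oplus>\<^bsub>?E\<^esub> g w \<odot>\<^bsub>?E\<^esub> ?L" if w: "w \<in> carrier ?M" for w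
     unfolding G(2)[OF z w] by (rule E.smult_l_distr[OF G(1)[OF z] G(1)[OF w] L])
    show "g (c \<odot>\<^bsub>?M\<^esub> z) \<odot>\<^bsub>?E\<^esub> ?L = c \<odot>\<^bsub>?E\<^esub> (g z \<odot>\<^bsub>?E\<^esub> ?L)" if c: "c \<in> carrier R" for c
     unfolding G(3)[OF c z] by (rule E.smult_assoc1[OF c G(1)[OF z] L])
    show "g (sp_map X ?N \<sigma> z) \<odot>\<^bsub>?E\<^esub> ?L = sp_map (exp_dual R) ?N \<sigma> (g z \<odot>\<^bsub>?E\<^esub> ?L)"
     if \<sigma>: "\<sigma> permutes ?N" for \<sigma>
     unfolding g\<sigma>[OF \<sigma> z] by (rule act[OF \<sigma> G(1)[OF z], symmetric])
   qed
   then obtain \<alpha> where \<alpha>: "\<alpha> \<in> carrier (Coch p)"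
    and t: "\<And>z. z \<in> carrier ?M ==> top_class p \<alpha> ?N z = g z \<odot>\<^bsub>?E\<^esub> ?L" by blast
   note \<phi> = top_class_in[OF \<alpha>]
   have "\<Psi> (top_class p \<alpha>) = (\<lambda>z\<in>carrier ?M. g z)"
    by (rule ext[OF \<phi>], rule \<Psi>_eqI[OF \<phi> _ G(1) t])
   also have "\<dots> = g" using G(4) by (auto simp: fun_eq_iff)
   finally show ?thesis using \<phi> by (metis image_eqI)
  qed
 qed
 ultimately show ?thesis using \<Psi>(2) by (intro bexI[of _ \<Psi>]) (auto simp: lin_iso_def simp del: upt_Suc)
qed

end

theorem theorem3p2:
  fixes R :: "('k, 'r) ring_scheme"
    and X :: "('k, 'm) species"
    and lam rho :: "nat set \<Rightarrow> 'm \<Rightarrow> nat set \<times> nat set \<Rightarrow> 'm"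
  assumes "cring R"
    and "exp_bicomodule R X lam rho"
    and "weakly_projective R X"
  shows "cochain_complex R (koszul R X) (koszul_diff R X lam rho) \<and>
    (\<forall>p. \<exists>h. h \<in> lin_iso R (cohomology (koszul R X) (koszul_diff R X lam rho) p)
                            (cohomology (cochains R X) (cochain_diff R X lam rho) p)) \<and>
    (\<forall>p. \<exists>\<Psi> \<in> lin_iso R (koszul R X p)
                  (rep_hom R p (sp_val X {1..p}) (sp_map X {1..p}) (regular_module R) (sgn_act R)).
         \<forall>\<phi>\<in>carrier (koszul R X p). \<forall>z\<in>carrier (sp_val X {1..p}).
           \<phi> {1..p} z = \<Psi> \<phi> z \<odot>\<^bsub>sp_val (exp_dual R) {1..p}\<^esub> lin_order_class R [1..<Suc p])"
proof -
  interpret exp_bicomodule R X lam rho by (rule assms(2))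
  show ?thesis
    using koszul_complex[OF assms(3)] koszul_cohomology[OF assms(3)] koszul_sign_representation[OF assms(3)]
    by blast
qed

end
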